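(* For $m \in \mathbb{N}$ and $Q > 1$, let $\mathrm{Sal}_m^{sq}(Q)$ be the set of Salem numbers of degree $2m$ that are square-rootable over $\mathbb{Q}$ and lie in the interval $(1, Q]$. For integers $m \ge 0$ let $$w_m = \frac{2^{m(m+1)}}{m+1} \prod_{k=0}^{m-1} \frac{(k!)^2}{(2k+1)!},$$ and let $\zeta$ be the Riemann zeta function. Then for fixed $m \ge 3$ and $Q \to \infty$ (implicit constants may depend on $m$): (1) if $m = 3$, then $$\# \mathrm{Sal}_m^{sq}(Q) = w_{m-1} \frac{6}{\pi^2} Q^{m/2} \log(Q) + O(Q^{m/2});$$ (2) if $m = 4$, then $$\# \mathrm{Sal}_m^{sq}(Q) \ge \frac{1}{2^{2m}} \cdot w_{m-1} \frac{6}{\pi^2} Q^{m/2} \log(Q) + O(Q^{m/2}),$$ $$\# \mathrm{Sal}_m^{sq}(Q) \le w_{m-1} \frac{6}{\pi^2} Q^{m/2} \log(Q) + O(Q^{m/2});$$ (3) if $m \ge 5$ and $m$ is odd, then $$\# \mathrm{Sal}_m^{sq}(Q) = w_{m-1} \frac{\zeta(\frac{m+1}{4})}{\zeta(\frac{m+1}{2})} Q^{m/2} + O(Q^{(m-1)/2} \log Q);$$ (4) if $m \ge 5$ and $m$ is even, then $$\# \mathrm{Sal}_m^{sq}(Q) \ge \frac{1}{2^{2m}} \cdot w_{m-1} \frac{\zeta(\frac{m}{4})}{\zeta(\frac{m}{2})} Q^{m/2} + O(Q^{(m-1)/2} \log Q),$$ $$\# \mathrm{Sal}_m^{sq}(Q)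 \le w_{m-1} \frac{\zeta(\frac{m}{4})}{\zeta(\frac{m}{2})} Q^{m/2} + O(Q^{(m-1)/2} \log Q).$$
   Context: A Salem number is a real algebraic integer $\lambda > 1$ that is conjugate (over $\mathbb{Q}$) to $\lambda^{-1}$ and all of whose remaining conjugates lie on the unit circle; Salem numbers of degree $2$ are allowed. A polynomial $p$ is palindromic if $p(x) = x^{\deg p} p(x^{-1})$. A Salem number $\lambda$ is square-rootable over $\mathbb{Q}$ if there exist a positive $\alpha \in \mathbb{Q}$ and a monic palindromic polynomial $q$ whose even degree coefficients lie in $\mathbb{Q}$ and whose odd degree coefficients lie in $\sqrt{\alpha}\,\mathbb{Q}$, such that $q(x) q(-x) = p(x^2)$, where $p$ is the minimal polynomial of $\lambda$ over $\mathbb{Q}$. $\log$ is the natural logarithm and $\#X$ is the cardinality of $X$. An inequality of the form $A(Q) \ge B(Q) + O(g(Q))$ (respectively $\le$) means that $A(Q) \ge B(Q) + h(Q)$ (respectively $\le$) for some function $h$ with $h(Q) = O(g(Q))$ as $Q \to \infty$. *)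

theory Defs
  imports
    Complex_Main
    "HOL-Computational_Algebra.Computational_Algebra"
    "HOL-Library.Landau_Symbols"
begin

text \<open>
  Minimal polynomial over \<open>\<rat>\<close>; meaningful only for algebraic arguments, for which it exists
  uniquely (lemma \<open>min_poly_rat_ex1\<close> below).
\<close>

definition min_poly_rat :: "'a::field_char_0 \<Rightarrow> rat poly" where
  "min_poly_rat x =
     (THE p. lead_coeff p = 1 \<and> irreducible p \<and> poly (map_poly of_rat p) x = 0)"

lemma map_poly_of_rat_mult:
  "map_poly of_rat (p * q) =
     (map_poly of_rat p * map_poly of_rat q :: 'a::field_char_0 poly)"
  by (rule poly_eqI) (simp add: coeff_map_poly coeff_mult of_rat_sum of_rat_mult)

lemma map_poly_of_rat_add:
  "map_poly of_rat (p + q) =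
     (map_poly of_rat p + map_poly of_rat q :: 'a::field_char_0 poly)"
  by (rule poly_eqI) (simp add: coeff_map_poly of_rat_add)

lemma min_poly_rat_ex1:
  fixes x :: "'a::field_char_0"
  assumes "algebraic x"
  shows "\<exists>!p. lead_coeff p = 1 \<and> irreducible p \<and> poly (map_poly of_rat p) x = 0"
proof -
  define R where "R = (\<lambda>p :: rat poly. p \<noteq> 0 \<and> poly (map_poly of_rat p) x = 0)"
  obtain p0 where p0: "\<And>i. coeff p0 i \<in> \<int>" "p0 \<noteq> 0" "poly p0 x = 0"
    using assms by (auto simp: algebraic_def)
  have "\<forall>i. \<exists>r::int. coeff p0 i = of_int r"
    using p0(1) by (auto elim!: Ints_cases)
  then obtain f :: "nat \<Rightarrow> int" where f: "\<And>i. coeff p0 i = of_int (f i)" by metis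
  define r0 where "r0 = Abs_poly (\<lambda>i. of_int (f i) :: rat)"
  have cr0: "coeff r0 = (\<lambda>i. of_int (f i) :: rat)"
    unfolding r0_def
  proof (rule Abs_poly_inverse, simp)
    have "{i. f i \<noteq> 0} = {i. coeff p0 i \<noteq> 0}" by (simp add: f)
    then show "\<forall>\<^sub>\<infinity>n. f n = 0"
      using MOST_coeff_eq_0[of p0] by (simp add: f)
  qed
  have r0: "map_poly of_rat r0 = p0"
    by (rule poly_eqI) (simp add: coeff_map_poly cr0 f)
  have "R r0" using p0 r0 by (auto simp: R_def)
  then obtain p where p: "R p" and pmin: "\<And>q. R q \<Longrightarrow> degree p \<le> degree q"
    using ex_has_least_nat[of R r0 degree] by blast
  have irr: "irreducible p"
  proof (rule irreducibleI)
    show "p \<noteq> 0" using p by (simp add: R_def)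
    show "\<not> p dvd 1"
    proof
      assume "p dvd 1"
      then obtain c where "p = [:c:]" "c \<noteq> 0"
        using p by (auto simp: is_unit_poly_iff R_def)
      then show False using p by (simp add: R_def map_poly_pCons)
    qed
  next
    fix a b assume ab: "p = a * b"
    have nz: "a \<noteq> 0" "b \<noteq> 0" using p ab by (auto simp: R_def)
    have "R a \<or> R b" using p nz by (auto simp: R_def ab map_poly_of_rat_mult)
    then have "degree b = 0 \<or> degree a = 0"
      using pmin[of a] pmin[of b] nz by (auto simp: ab degree_mult_eq)
    then show "a dvd 1 \<or> b dvd 1" using nz by (auto simp: is_unit_iff_degree)
  qed
  define q where "q = smult (inverse (lead_coeff p)) p"
  have nz: "p \<noteq> 0" using p by (simp add: R_def)
  have unit: "[:inverse (lead_coeff p):] dvd 1" using nz by (simp add: is_unit_iff_degree)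
  have q_eq: "q = [:inverse (lead_coeff p):] * p" by (simp add: q_def)
  have "lead_coeff q = 1" using nz by (simp add: q_def)
  moreover have "irreducible q"
    unfolding q_eq using irr unit by (simp only: irreducible_mult_unit_left)
  moreover have "poly (map_poly of_rat q) x = 0"
    using p unfolding q_eq by (simp only: map_poly_of_rat_mult R_def poly_mult mult_zero_right)
  moreover have "a = q"
    if a: "lead_coeff a = 1" "irreducible a" "poly (map_poly of_rat a) x = 0" for a
  proof -
    have "poly (map_poly of_rat ((a div p) * p + a mod p)) x = (0::'a)"
      using a(3) by simp
    then have "poly (map_poly of_rat (a mod p)) x = (0::'a)"
      using p by (simp only: map_poly_of_rat_mult map_poly_of_rat_add R_def poly_mult poly_add) simp
    then have "a mod p = 0"
      using pmin[of "a mod p"] degree_mod_less[OF nz, of a] unfolding R_def by (metis not_le)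
    then obtain c where c: "a = p * c" by (auto simp: mod_eq_0_iff_dvd dvd_def)
    have "c dvd 1" using a(2) c irr by (auto simp: irreducible_def)
    then obtain d where d: "c = [:d:]" by (auto simp: is_unit_poly_iff)
    have "lead_coeff p * d = 1" using a(1) by (simp only: c d lead_coeff_mult) simp
    then have "d = inverse (lead_coeff p)"
      by (metis inverse_unique)
    then show "a = q" by (simp add: c d q_def)
  qed
  ultimately show ?thesis by (intro ex1I[of _ q]) blast+
qed

definition conjugates :: "real \<Rightarrow> complex set" where
  "conjugates x = {z. poly (map_poly of_rat (min_poly_rat x)) z = 0}"

definition salem_number :: "real \<Rightarrow> bool" where
  "salem_number x \<longleftrightarrow>
     algebraic_int x \<and> x > 1 \<and>
     complex_of_real (inverse x) \<in> conjugates x \<and>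
     (\<forall>z \<in> conjugates x - {complex_of_real x, complex_of_real (inverse x)}. norm z = 1)"

text \<open>\<open>reflect_poly p\<close> is the polynomial \<open>x ^ degree p * p(1/x)\<close>, see \<open>poly_reflect_poly_nz\<close>.\<close>

definition palindromic :: "'a::zero poly \<Rightarrow> bool" where
  "palindromic p \<longleftrightarrow> p = reflect_poly p"

definition square_rootable :: "real \<Rightarrow> bool" where
  "square_rootable x \<longleftrightarrow>
     (\<exists>(\<alpha>::rat) (q::real poly).
        \<alpha> > 0 \<and> lead_coeff q = 1 \<and> palindromic q \<and>
        (\<forall>i. even i \<longrightarrow> coeff q i \<in> \<rat>) \<and>
        (\<forall>i. odd i \<longrightarrow> (\<exists>r\<in>\<rat>. coeff q i = sqrt (of_rat \<alpha>) * r)) \<and>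
        q * pcompose q [:0, -1:] = pcompose (map_poly of_rat (min_poly_rat x)) [:0, 0, 1:])"

definition Sal_sq :: "nat \<Rightarrow> real \<Rightarrow> real set" where
  "Sal_sq m Q =
     {x. salem_number x \<and> degree (min_poly_rat x) = 2 * m \<and> square_rootable x \<and> 1 < x \<and> x \<le> Q}"

definition w_const :: "nat \<Rightarrow> real" where
  "w_const m = 2 ^ (m * (m + 1)) / (real m + 1) * (\<Prod>k<m. (fact k)\<^sup>2 / fact (2 * k + 1))"

text \<open>
  The Riemann zeta function, given by its Dirichlet series; meaningful only for real \<open>s > 1\<close>.
\<close>

definition zeta :: "real \<Rightarrow> real" where
  "zeta s = (\<Sum>n. 1 / real (Suc n) powr s)"

end

theory Submission
  imports Defs "HOL-Analysis.Analysis"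
begin

text \<open>
  If \<open>q(x)q(-x) = p(x\<^sup>2)\<close> for a palindromic \<open>q\<close> of degree \<open>2m\<close>, then
  \<open>q(x) = x\<^sup>m F(x + 1/x)\<close> with \<open>F\<close> monic of degree \<open>m\<close>, and \<open>p\<close> is the minimal polynomial
  of a Salem number \<open>\<lambda> = v\<^sup>2\<close> exactly when \<open>p\<close> is irreducible and the roots of \<open>F\<close> are
  \<open>v + 1/v > 2\<close> and \<open>m - 1\<close> points of \<open>[-2, 2]\<close>. Integrality of \<open>p\<close> means that the
  coefficients of \<open>F\<close> lie alternately in \<open>\<int>\<close> and \<open>\<surd>d \<int>\<close> for a squarefree \<open>d\<close>. Thus one
  counts, for each \<open>d\<close>, points of a grid in the region of coefficient vectors of such \<open>F\<close>
  with \<open>v + 1/v \<le> \<surd>Q + 1/\<surd>Q\<close>. The volume of the region comes from a Selberg integral, the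
  points with reducible \<open>p\<close> lie on finitely many hyperplanes, because the complementary factor of \<open>p\<close>
  has all its roots on the unit circle, and summation over \<open>d\<close> gives the logarithm or the zeta quotient. For odd
  \<open>m\<close> the number \<open>\<lambda>\<close> determines \<open>q\<close> since \<open>p(-1) = F(0)\<^sup>2\<close> determines \<open>d\<close>;
  for even \<open>m\<close> at most \<open>2\<^bsup>2m\<^esup>\<close> polynomials \<open>F\<close> belong to the same \<open>\<lambda>\<close>, because their roots are
  up to sign those of one of them.
\<close>

text \<open>The grid for d has step sqrt d in part of the coordinates, and this step may be as large
  as a constant times X, the bound for the largest root. The counting error must therefore be
  uniform in d. It is obtained by rounding one coordinate at a time: membership changes at boundedly
  many places along a line parallel to an axis, so rounding coordinate i costs a constant times its
  step times the volume of a box in the other coordinates. As only one root is unbounded, every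
  coefficient is O(X), and one d contributes an error O(X^(m-1) / sqrt d^(r-1)), where r coordinates
  have step sqrt d. The cases of the theorem reflect r: for m = 3, 4 it is 2 and the main terms form
  a harmonic sum; for m \<ge> 5 it is at least 3 and they converge.

  Volumes are computed by splitting off the largest root, with the value of the quotient at that
  root as Jacobian; only substitutions in one real variable occur. The Selberg integral contains the
  Vandermonde product to the first power and is found by Aomoto's method: a divergence with a free
  parameter u integrates to zero, which gives a two-term recursion.\<close>

section \<open>Lebesgue measure on vectors of varying length\<close>

text \<open>Lebesgue measure on R^n, carried by the functions that vanish from index n on. One type
  for all dimensions permits induction on n.\<close>

primrec coord_measure :: "nat \<Rightarrow> (nat \<Rightarrow> real) measure" where
  "coord_measure 0 = distr (count_space {()}) borel (\<lambda>_ _. 0)"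
| "coord_measure (Suc n) =
     distr (lborel \<Otimes>\<^sub>M coord_measure n) borel (\<lambda>(y, c). c(n := y))"

lemma sets_coord_measure [simp, measurable_cong]: "sets (coord_measure n) = sets borel"
  by (cases n) auto

lemma space_coord_measure [simp]: "space (coord_measure n) = UNIV"
  by (cases n) auto

lemma measurable_fun_upd_borel [measurable (raw)]:
  fixes f :: "'a \<Rightarrow> nat \<Rightarrow> real"
  assumes "f \<in> borel_measurable M" "g \<in> borel_measurable M"
  shows "(\<lambda>x. (f x)(n := g x)) \<in> borel_measurable M"
proof (rule measurable_coordinatewise_then_product)
  fix i
  have "(\<lambda>x. f x i) \<in> borel_measurable M"
    using measurable_product_then_coordinatewise[OF assms(1)] .
  then show "(\<lambda>x. ((f x)(n := g x)) i) \<in> borel_measurable M"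
    using assms(2) by (cases "i = n") auto
qed

lemma measurable_app_borel [measurable (raw)]:
  fixes f :: "'a \<Rightarrow> nat \<Rightarrow> real"
  assumes "f \<in> borel_measurable M"
  shows "(\<lambda>x. f x i) \<in> borel_measurable M"
  using measurable_product_then_coordinatewise[OF assms] .

lemma measurable_fun_upd_pair [measurable]:
  "(\<lambda>(y, c). c(n := y)) \<in> borel_measurable (lborel \<Otimes>\<^sub>M coord_measure k)"
  by (simp add: split_beta)

lemma sets_coord_box [measurable]: "{c::nat \<Rightarrow> real. \<forall>i<n. \<bar>c i\<bar> \<le> r} \<in> sets borel"
proof -
  have "Measurable.pred borel (\<lambda>c::nat \<Rightarrow> real. \<forall>i\<in>{..<n}. \<bar>c i\<bar> \<le> r)" by measurable
  then show ?thesis by (simp add: pred_def Ball_def)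
qed

text \<open>The two claims are proved together: the product measure in dimension n + 1 needs
  sigma-finiteness in dimension n, and the sets that exhaust dimension n + 1 are boxes.\<close>

lemma coord_measure_finite_box:
  "sigma_finite_measure (coord_measure n) \<and> emeasure (coord_measure n) {c. \<forall>i<n. \<bar>c i\<bar> \<le> r} < \<infinity>"
proof (induction n arbitrary: r)
  case 0
  have "finite_measure (coord_measure 0)"
    by (auto intro!: finite_measure.finite_measure_distr finite_measure_count_space)
  then interpret finite_measure "coord_measure 0" .
  show ?case
    by (simp add: sigma_finite_measure_axioms emeasure_finite less_top[symmetric] del: coord_measure.simps)
next
  case (Suc n)
  interpret N: sigma_finite_measure "coord_measure n" using Suc by auto
  have fin: "emeasure (coord_measure (Suc n)) {c. \<forall>i<Suc n. \<bar>c i\<bar> \<le> r} < \<infinity>" for r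
  proof -
    have "emeasure (coord_measure (Suc n)) {c. \<forall>i<Suc n. \<bar>c i\<bar> \<le> r} =
        emeasure (lborel \<Otimes>\<^sub>M coord_measure n) ({-r..r} \<times> {c. \<forall>i<n. \<bar>c i\<bar> \<le> r})"
      unfolding coord_measure.simps
      by (subst emeasure_distr)
        (auto intro!: arg_cong2[where f = emeasure] simp: space_pair_measure less_Suc_eq abs_le_iff)
    also have "\<dots> = emeasure lborel {-r..r} * emeasure (coord_measure n) {c. \<forall>i<n. \<bar>c i\<bar> \<le> r}"
      by (rule N.emeasure_pair_measure_Times) auto
    also have "\<dots> < \<infinity>"
      using Suc[of r] by (cases "r \<ge> 0") (auto simp: ennreal_mult_less_top)
    finally show ?thesis .
  qed
  have "sigma_finite_measure (coord_measure (Suc n))"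
  proof
    show "\<exists>A. countable A \<and> A \<subseteq> sets (coord_measure (Suc n)) \<and> \<Union>A = space (coord_measure (Suc n)) \<and>
        (\<forall>a\<in>A. emeasure (coord_measure (Suc n)) a \<noteq> \<infinity>)"
    proof (intro exI[of _ "range (\<lambda>k::nat. {c. \<forall>i<Suc n. \<bar>c i\<bar> \<le> real k})"] conjI ballI)
      have "\<exists>k::nat. \<forall>i<Suc n. \<bar>c i\<bar> \<le> real k" for c :: "nat \<Rightarrow> real"
      proof -
        obtain k :: nat where k: "(\<Sum>i<Suc n. \<bar>c i\<bar>) \<le> k" using real_arch_simple by blast
        have "\<bar>c i\<bar> \<le> (\<Sum>i<Suc n. \<bar>c i\<bar>)" if "i < Suc n" for i
          using that by (intro member_le_sum) auto
        then show ?thesis using k by (intro exI[of _ k]) force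
      qed
      then show "\<Union>(range (\<lambda>k::nat. {c. \<forall>i<Suc n. \<bar>c i\<bar> \<le> real k})) = space (coord_measure (Suc n))"
        by auto
    qed (use fin in \<open>auto simp del: coord_measure.simps simp: less_top\<close>)
  qed
  then show ?case using fin by auto
qed

lemma sigma_finite_coord_measure: "sigma_finite_measure (coord_measure n)"
  using coord_measure_finite_box by blast

lemma coord_pair_sigma_finite: "pair_sigma_finite lborel (coord_measure n)"
  unfolding pair_sigma_finite_def using sigma_finite_coord_measure by (auto intro: sigma_finite_lborel)

lemma nn_integral_coord_0:
  assumes [measurable]: "f \<in> borel_measurable borel"
  shows "(\<integral>\<^sup>+c. f c \<partial>coord_measure 0) = f (\<lambda>_. 0)"
  by (simp add: nn_integral_distr nn_integral_count_space_finite)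

lemma nn_integral_coord_Suc:
  fixes f :: "(nat \<Rightarrow> real) \<Rightarrow> ennreal"
  assumes [measurable]: "f \<in> borel_measurable borel"
  shows "(\<integral>\<^sup>+c. f c \<partial>coord_measure (Suc n)) = (\<integral>\<^sup>+y. \<integral>\<^sup>+c. f (c(n := y)) \<partial>coord_measure n \<partial>lborel)"
proof -
  interpret pair_sigma_finite lborel "coord_measure n" by (rule coord_pair_sigma_finite)
  have "(\<integral>\<^sup>+c. f c \<partial>coord_measure (Suc n)) =
      (\<integral>\<^sup>+p. f (case p of (y, c) \<Rightarrow> c(n := y)) \<partial>(lborel \<Otimes>\<^sub>M coord_measure n))"
    by (simp add: nn_integral_distr)
  also have "\<dots> = (\<integral>\<^sup>+y. \<integral>\<^sup>+c. f (c(n := y)) \<partial>coord_measure n \<partial>lborel)"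
    by (subst M2.nn_integral_fst [symmetric]) (simp_all add: split_beta)
  finally show ?thesis .
qed

lemma nn_integral_coord_Fubini:
  fixes f :: "real \<Rightarrow> (nat \<Rightarrow> real) \<Rightarrow> ennreal"
  assumes "(\<lambda>p. f (fst p) (snd p)) \<in> borel_measurable (borel \<Otimes>\<^sub>M borel)"
  shows "(\<integral>\<^sup>+y. \<integral>\<^sup>+c. f y c \<partial>coord_measure n \<partial>lborel) = (\<integral>\<^sup>+c. \<integral>\<^sup>+y. f y c \<partial>lborel \<partial>coord_measure n)"
proof -
  interpret pair_sigma_finite lborel "coord_measure n" by (rule coord_pair_sigma_finite)
  have "sets (lborel \<Otimes>\<^sub>M coord_measure n) = sets (borel \<Otimes>\<^sub>M borel)"
    by (intro sets_pair_measure_cong) auto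
  then have "(\<lambda>(y, c). f y c) \<in> borel_measurable (lborel \<Otimes>\<^sub>M coord_measure n)"
    using assms by (simp add: split_beta cong: measurable_cong_sets)
  then show ?thesis by (rule Fubini'[symmetric])
qed

lemma nn_integral_coord_Suc':
  fixes f :: "(nat \<Rightarrow> real) \<Rightarrow> ennreal"
  assumes [measurable]: "f \<in> borel_measurable borel"
  shows "(\<integral>\<^sup>+c. f c \<partial>coord_measure (Suc n)) = (\<integral>\<^sup>+c. \<integral>\<^sup>+y. f (c(n := y)) \<partial>lborel \<partial>coord_measure n)"
  by (subst nn_integral_coord_Suc[OF assms], rule nn_integral_coord_Fubini) measurable

text \<open>Selects the vectors of length n among all sequences; on these a vector is determined by
  its monic polynomial.\<close>

definition supp_below :: "nat \<Rightarrow> (nat \<Rightarrow> 'a::zero) \<Rightarrow> bool" where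
  "supp_below n c \<longleftrightarrow> (\<forall>i\<ge>n. c i = 0)"

lemma supp_below_Suc_upd [simp]: "supp_below n c \<Longrightarrow> supp_below (Suc n) (c(n := y))"
  by (auto simp: supp_below_def)

lemma measurable_supp_below [measurable]: "Measurable.pred borel (supp_below n :: (nat \<Rightarrow> real) \<Rightarrow> bool)"
  unfolding supp_below_def[abs_def] by measurable

lemma AE_coord_measure: "AE c in coord_measure n. supp_below n c"
proof (induction n)
  case 0
  have "AE c in coord_measure 0. supp_below 0 c"
    unfolding coord_measure.simps
    by (subst AE_distr_iff) (auto simp: AE_count_space supp_below_def)
  then show ?case .
next
  case (Suc n)
  have "(\<integral>\<^sup>+c. indicator {c. \<not> supp_below (Suc n) c} c \<partial>coord_measure (Suc n)) =
      (\<integral>\<^sup>+y. \<integral>\<^sup>+c. indicator {c. \<not> supp_below (Suc n) c} (c(n := y)) \<partial>coord_measure n \<partial>lborel)"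
    by (rule nn_integral_coord_Suc) measurable
  also have "\<dots> = (\<integral>\<^sup>+y. 0 \<partial>(lborel::real measure))"
  proof (intro nn_integral_cong)
    fix y :: real
    have "(\<integral>\<^sup>+c. indicator {c. \<not> supp_below (Suc n) c} (c(n := y)) \<partial>coord_measure n) = (\<integral>\<^sup>+c. 0 \<partial>coord_measure n)"
      by (intro nn_integral_cong_AE) (use Suc in \<open>auto simp: indicator_def\<close>)
    then show "(\<integral>\<^sup>+c. indicator {c. \<not> supp_below (Suc n) c} (c(n := y)) \<partial>coord_measure n) = (0::ennreal)" by simp
  qed
  finally have "emeasure (coord_measure (Suc n)) {c. \<not> supp_below (Suc n) c} = 0"
    by (subst (asm) nn_integral_indicator) auto
  then show ?case by (subst AE_iff_measurable[OF _ refl]) (auto simp: pred_def)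
qed

lemma nn_integral_coord_cong:
  assumes "\<And>c. supp_below n c \<Longrightarrow> f c = g c"
  shows "(\<integral>\<^sup>+c. f c \<partial>coord_measure n) = (\<integral>\<^sup>+c. g c \<partial>coord_measure n)"
  using AE_coord_measure[of n] by (intro nn_integral_cong_AE) (auto elim!: eventually_mono intro: assms)

lemma nn_integral_coord_mono:
  assumes "\<And>c. supp_below n c \<Longrightarrow> f c \<le> g c"
  shows "(\<integral>\<^sup>+c. f c \<partial>coord_measure n) \<le> (\<integral>\<^sup>+c. g c \<partial>coord_measure n)"
  using AE_coord_measure[of n] by (intro nn_integral_mono_AE) (auto elim!: eventually_mono intro: assms)

text \<open>Outer coordinates are peeled off until j is the last one, which Fubini then moves
  innermost. Both integration by parts and rounding to the grid proceed along one axis in this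
  way.\<close>

lemma nn_integral_coord_fibre_mono:
  fixes f g :: "(nat \<Rightarrow> real) \<Rightarrow> ennreal"
  assumes "f \<in> borel_measurable borel" "g \<in> borel_measurable borel" "j < n"
    and "\<And>c. supp_below n c \<Longrightarrow> (\<integral>\<^sup>+y. f (c(j := y)) \<partial>lborel) \<le> (\<integral>\<^sup>+y. g (c(j := y)) \<partial>lborel)"
  shows "(\<integral>\<^sup>+c. f c \<partial>coord_measure n) \<le> (\<integral>\<^sup>+c. g c \<partial>coord_measure n)"
  using assms
proof (induction n arbitrary: f g)
  case (Suc n)
  note [measurable] = Suc.prems(1,2)
  show ?case
  proof (cases "j = n")
    case True
    show ?thesis
      unfolding nn_integral_coord_Suc'[OF Suc.prems(1)] nn_integral_coord_Suc'[OF Suc.prems(2)]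
      by (intro nn_integral_coord_mono, unfold True[symmetric], rule Suc.prems(4)) (simp add: supp_below_def True)
  next
    case False
    show ?thesis
      unfolding nn_integral_coord_Suc[OF Suc.prems(1)] nn_integral_coord_Suc[OF Suc.prems(2)]
    proof (rule nn_integral_mono)
      fix y :: real
      show "(\<integral>\<^sup>+c. f (c(n := y)) \<partial>coord_measure n) \<le> (\<integral>\<^sup>+c. g (c(n := y)) \<partial>coord_measure n)"
      proof (rule Suc.IH)
        fix c assume "supp_below n (c::nat \<Rightarrow> real)"
        then show "(\<integral>\<^sup>+z. f ((c(j := z))(n := y)) \<partial>lborel) \<le> (\<integral>\<^sup>+z. g ((c(j := z))(n := y)) \<partial>lborel)"
          using Suc.prems(4)[of "c(n := y)"] fun_upd_twist[OF False, of c _ y]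
          by (simp del: fun_upd_apply)
      next
        show "(\<lambda>c. f (c(n := y))) \<in> borel_measurable borel"
          "(\<lambda>c. g (c(n := y))) \<in> borel_measurable borel" by measurable
        show "j < n" using Suc.prems(3) False by simp
      qed
    qed
  qed
qed simp

lemma nn_integral_coord_fibre_eq:
  fixes f g :: "(nat \<Rightarrow> real) \<Rightarrow> ennreal"
  assumes "f \<in> borel_measurable borel" "g \<in> borel_measurable borel" "j < n"
    and "\<And>c. supp_below n c \<Longrightarrow> (\<integral>\<^sup>+y. f (c(j := y)) \<partial>lborel) = (\<integral>\<^sup>+y. g (c(j := y)) \<partial>lborel)"
  shows "(\<integral>\<^sup>+c. f c \<partial>coord_measure n) = (\<integral>\<^sup>+c. g c \<partial>coord_measure n)"
  using assms by (intro antisym nn_integral_coord_fibre_mono[of _ _ j]) auto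

lemma measurable_coord_if [measurable]:
  fixes h :: "nat \<Rightarrow> (nat \<Rightarrow> real) \<Rightarrow> real"
  assumes "\<And>i. i < n \<Longrightarrow> h i \<in> borel_measurable borel"
  shows "(\<lambda>c i. if i < n then h i c else 0) \<in> borel_measurable borel"
proof (rule measurable_coordinatewise_then_product)
  show "(\<lambda>c. if i < n then h i c else 0) \<in> borel_measurable borel" for i
    using assms by (cases "i < n") auto
qed

lemma nn_integral_coord_affine:
  fixes f :: "(nat \<Rightarrow> real) \<Rightarrow> ennreal"
  assumes "f \<in> borel_measurable borel" "k > 0"
  shows "(\<integral>\<^sup>+c. f c \<partial>coord_measure n) =
    ennreal (k ^ n) * (\<integral>\<^sup>+c. f (\<lambda>i. if i < n then a + k * c i else 0) \<partial>coord_measure n)"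
  using assms(1)
proof (induction n arbitrary: f)
  case 0
  then show ?case
    by (subst (1 2) nn_integral_coord_0) (simp_all add: measurable_compose[OF borel_measurable_const])
next
  case (Suc n)
  note [measurable] = Suc.prems
  have *: "(\<lambda>i. if i < Suc n then a + k * (c(n := y)) i else 0) =
      (\<lambda>i. if i < n then a + k * c i else 0)(n := a + k * y)" for c y
    by (auto simp: fun_eq_iff less_Suc_eq)
  have "(\<integral>\<^sup>+c. f c \<partial>coord_measure (Suc n)) = (\<integral>\<^sup>+y. \<integral>\<^sup>+c. f (c(n := y)) \<partial>coord_measure n \<partial>lborel)"
    by (rule nn_integral_coord_Suc[OF Suc.prems])
  also have "\<dots> = (\<integral>\<^sup>+y. ennreal (k ^ n) * (\<integral>\<^sup>+c. f ((\<lambda>i. if i < n then a + k * c i else 0)(n := y)) \<partial>coord_measure n) \<partial>lborel)"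
    by (intro nn_integral_cong Suc.IH) measurable
  also have "\<dots> = ennreal (k ^ n) * (\<integral>\<^sup>+y. (\<integral>\<^sup>+c. f ((\<lambda>i. if i < n then a + k * c i else 0)(n := y)) \<partial>coord_measure n) \<partial>lborel)"
    using sigma_finite_coord_measure[of n]
    by (intro nn_integral_cmult) (auto intro!: sigma_finite_measure.borel_measurable_nn_integral)
  also have "(\<integral>\<^sup>+y. (\<integral>\<^sup>+c. f ((\<lambda>i. if i < n then a + k * c i else 0)(n := y)) \<partial>coord_measure n) \<partial>lborel)
     = ennreal k * (\<integral>\<^sup>+y. (\<integral>\<^sup>+c. f ((\<lambda>i. if i < n then a + k * c i else 0)(n := a + k * y)) \<partial>coord_measure n) \<partial>lborel)"
    using \<open>k > 0\<close> sigma_finite_coord_measure[of n]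
    by (subst nn_integral_real_affine[where c = k and t = a])
      (auto intro!: sigma_finite_measure.borel_measurable_nn_integral)
  also have "(\<integral>\<^sup>+y. (\<integral>\<^sup>+c. f ((\<lambda>i. if i < n then a + k * c i else 0)(n := a + k * y)) \<partial>coord_measure n) \<partial>lborel)
     = (\<integral>\<^sup>+c. f (\<lambda>i. if i < Suc n then a + k * c i else 0) \<partial>coord_measure (Suc n))"
    by (subst nn_integral_coord_Suc) (simp_all only: *, measurable)
  finally show ?case
    using \<open>k > 0\<close> by (simp add: ennreal_mult ac_simps del: coord_measure.simps)
qed

text \<open>Coefficients of (t - x) S(t) without the constant one, where S has coefficients s. The
  linear part is triangular with ones on the diagonal, so the map preserves Lebesgue
  measure.\<close>

definition shear :: "real \<Rightarrow> nat \<Rightarrow> (nat \<Rightarrow> real) \<Rightarrow> nat \<Rightarrow> real" where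
  "shear x n s = (\<lambda>i. if i < n then s i - x * (if i = 0 then 1 else s (i - 1)) else 0)"

lemma measurable_shear [measurable]: "shear x n \<in> borel_measurable borel"
  unfolding shear_def[abs_def] by measurable

lemma nn_integral_coord_shear:
  fixes f :: "(nat \<Rightarrow> real) \<Rightarrow> ennreal"
  assumes "f \<in> borel_measurable borel"
  shows "(\<integral>\<^sup>+c. f c \<partial>coord_measure n) = (\<integral>\<^sup>+s. f (shear x n s) \<partial>coord_measure n)"
  using assms
proof (induction n arbitrary: f)
  case 0
  note [measurable] = this
  show ?case
    by (subst (1 2) nn_integral_coord_0) (simp_all add: shear_def)
next
  case (Suc n)
  note [measurable] = Suc.prems
  define t where "t = (\<lambda>s. x * (if n = 0 then 1 else s (n - 1)) :: real)"
  have *: "shear x (Suc n) (s(n := y)) = (shear x n s)(n := y - t s)" for s y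
    by (auto simp: fun_eq_iff less_Suc_eq shear_def t_def)
  have "(\<integral>\<^sup>+c. f c \<partial>coord_measure (Suc n)) = (\<integral>\<^sup>+c. \<integral>\<^sup>+y. f (c(n := y)) \<partial>lborel \<partial>coord_measure n)"
    by (rule nn_integral_coord_Suc'[OF Suc.prems])
  also have "\<dots> = (\<integral>\<^sup>+s. \<integral>\<^sup>+y. f ((shear x n s)(n := y)) \<partial>lborel \<partial>coord_measure n)"
    by (intro Suc.IH) measurable
  also have "\<dots> = (\<integral>\<^sup>+s. \<integral>\<^sup>+y. f ((shear x n s)(n := y - t s)) \<partial>lborel \<partial>coord_measure n)"
  proof (rule nn_integral_cong)
    fix s
    show "(\<integral>\<^sup>+y. f ((shear x n s)(n := y)) \<partial>lborel) = (\<integral>\<^sup>+y. f ((shear x n s)(n := y - t s)) \<partial>lborel)"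
      by (subst nn_integral_real_affine[where c = 1 and t = "- t s"]) simp_all
  qed
  also have "\<dots> = (\<integral>\<^sup>+s. f (shear x (Suc n) s) \<partial>coord_measure (Suc n))"
    by (subst nn_integral_coord_Suc') (simp_all only: *, measurable)
  finally show ?case .
qed

section \<open>Monic polynomials and splitting off a root\<close>

text \<open>Coefficients are listed from the top, the constant one last. A prefix of c then yields a
  partial polynomial of the Horner scheme, and raising the degree leaves the earlier entries in
  place.\<close>

primrec monic_poly :: "nat \<Rightarrow> (nat \<Rightarrow> 'a::comm_ring_1) \<Rightarrow> 'a poly" where
  "monic_poly 0 c = 1"
| "monic_poly (Suc n) c = pCons (c n) (monic_poly n c)"

lemma degree_monic_poly [simp]: "degree (monic_poly n (c :: nat \<Rightarrow> 'a::comm_ring_1)) = n"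
  and lead_coeff_monic_poly: "coeff (monic_poly n c) n = (1 :: 'a)"
proof -
  have "monic_poly n c \<noteq> 0 \<and> degree (monic_poly n c) = n \<and> coeff (monic_poly n c) n = (1 :: 'a)"
    by (induction n) auto
  then show "degree (monic_poly n (c :: nat \<Rightarrow> 'a)) = n" "coeff (monic_poly n c) n = (1 :: 'a)" by auto
qed

lemma monic_poly_nonzero [simp]: "monic_poly n (c :: nat \<Rightarrow> 'a::comm_ring_1) \<noteq> 0"
  using lead_coeff_monic_poly[of n c] by (metis coeff_0 zero_neq_one)

lemma monic_poly_cong: "(\<And>i. i < n \<Longrightarrow> c i = d i) \<Longrightarrow> monic_poly n c = monic_poly n d"
  by (induction n) auto

lemma coeff_monic_poly: "i < n \<Longrightarrow> coeff (monic_poly n c) i = c (n - 1 - i)"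
  by (induction n arbitrary: i) (auto simp: coeff_pCons lead_coeff_monic_poly split: nat.splits)

lemma monic_poly_inject:
  assumes "monic_poly n c = monic_poly n d" "i < n"
  shows "c i = d i"
proof -
  have "coeff (monic_poly n c) (n - 1 - i) = coeff (monic_poly n d) (n - 1 - i)" using assms by simp
  then show ?thesis using assms(2) by (simp add: coeff_monic_poly)
qed

lemma monic_poly_inject_supp:
  assumes "monic_poly n c = monic_poly n d" "supp_below n c" "supp_below n d"
  shows "c = d"
proof
  fix i show "c i = d i"
    using assms monic_poly_inject[OF assms(1), of i] by (cases "i < n") (auto simp: supp_below_def)
qed

definition attach_root :: "'a::comm_ring_1 \<Rightarrow> (nat \<Rightarrow> 'a) \<Rightarrow> nat \<Rightarrow> 'a" where
  "attach_root x s = (\<lambda>i. s i - x * (if i = 0 then 1 else s (i - 1)))"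

lemma supp_attach_root: "supp_below n s \<Longrightarrow> supp_below (Suc n) (attach_root x s)"
  by (auto simp: supp_below_def attach_root_def)

text \<open>Cutting s off at k leaves the remainder \<open>s k\<close>; keeping it in the statement
  makes the induction work.\<close>

lemma monic_poly_attach_root':
  "monic_poly (Suc k) (attach_root x s) = [:-x, 1:] * monic_poly k s + [:s k:]"
proof (induction k)
  case (Suc k)
  have "monic_poly (Suc (Suc k)) (attach_root x s) =
      pCons (s (Suc k) - x * s k) ([:-x, 1:] * monic_poly k s + [:s k:])"
    using Suc by (simp add: attach_root_def)
  also have "\<dots> = [:-x, 1:] * pCons (s k) (monic_poly k s) + [:s (Suc k):]"
    by (simp add: algebra_simps)
  finally show ?case by simp
qed (simp add: attach_root_def)

lemma monic_poly_attach_root: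
  assumes "supp_below n s"
  shows "monic_poly (Suc n) (attach_root x s) = [:-x, 1:] * monic_poly n s"
  using assms monic_poly_attach_root'[of n x s] by (simp add: supp_below_def)

text \<open>Synthetic division: the partial Horner values at x are the coefficients of the quotient
  by t - x. For a dividend of degree n + 1 the constant coefficient affects only the remainder, so
  the first n entries suffice.\<close>

definition quot_root :: "nat \<Rightarrow> real \<Rightarrow> (nat \<Rightarrow> real) \<Rightarrow> nat \<Rightarrow> real" where
  "quot_root n x c = (\<lambda>i. if i < n then poly (monic_poly (Suc i) c) x else 0)"

lemma supp_quot_root [simp]: "supp_below n (quot_root n x c)"
  by (auto simp: supp_below_def quot_root_def)

lemma supp_shear [simp]: "supp_below n (shear x n c)"
  by (auto simp: supp_below_def shear_def)

lemma shear_quot_root: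
  assumes "supp_below n c"
  shows "shear x n (quot_root n x c) = c"
proof
  fix i
  show "shear x n (quot_root n x c) i = c i"
    using assms by (cases i) (auto simp: shear_def quot_root_def supp_below_def)
qed

lemma poly_monic_poly_shear:
  "k \<le> n \<Longrightarrow> poly (monic_poly k (shear x n s)) x = (if k = 0 then 1 else s (k - 1))"
  by (induction k) (auto simp: shear_def)

lemma quot_root_shear:
  assumes "supp_below n s"
  shows "quot_root n x (shear x n s) = s"
proof
  fix i
  show "quot_root n x (shear x n s) i = s i"
    using assms poly_monic_poly_shear[of "Suc i" n x s]
    by (auto simp: quot_root_def supp_below_def simp del: monic_poly.simps)
qed

lemma attach_root_eq_shear_upd:
  assumes "supp_below n s"
  shows "attach_root x s = (shear x n s)(n := - (x * poly (monic_poly n (shear x n s)) x))"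
  using assms poly_monic_poly_shear[of n n x s]
  by (auto simp: fun_eq_iff attach_root_def shear_def supp_below_def)

lemma attach_quot_root:
  assumes "supp_below n c"
  shows "attach_root x (quot_root n x c) = c(n := - (x * poly (monic_poly n c) x))"
  using attach_root_eq_shear_upd[OF supp_quot_root, of x n x c] shear_quot_root[OF assms] by simp

text \<open>With the upper coefficients fixed, t P(t) + y(x) = (t - x) S(t) makes the constant
  coefficient y(x) = - x P(x) a function of the root x. Differentiating in t at t = x shows that (t
  P)' has the value S(x) there. So the Jacobian of splitting off a root is, up to sign, the quotient
  evaluated at that root.\<close>

lemma has_derivative_quot_root:
  assumes "supp_below n c"
  shows "((\<lambda>x. - (x * poly (monic_poly n c) x)) has_real_derivative
            - poly (monic_poly n (quot_root n x c)) x) (at x)"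
proof -
  let ?s = "quot_root n x c"
  let ?y = "- (x * poly (monic_poly n c) x)"
  have "monic_poly (Suc n) (c(n := ?y)) = [:-x, 1:] * monic_poly n ?s"
    using monic_poly_attach_root[of n ?s x] attach_quot_root[OF assms] by simp
  moreover have "monic_poly (Suc n) (c(n := ?y)) = pCons 0 (monic_poly n c) + [:?y:]"
    using monic_poly_cong[of n "c(n := ?y)" c] by simp
  ultimately have "pCons 0 (monic_poly n c) + [:?y:] = [:-x, 1:] * monic_poly n ?s" by simp
  then have "pderiv (pCons 0 (monic_poly n c) + [:?y:]) = pderiv ([:-x, 1:] * monic_poly n ?s)" by simp
  then have "poly (pderiv (pCons 0 (monic_poly n c))) x = poly (monic_poly n ?s) x"
    by (simp only: pderiv_add pderiv_mult) (simp add: pderiv_pCons)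
  moreover have "((\<lambda>x. - poly (pCons 0 (monic_poly n c)) x) has_real_derivative
      - poly (pderiv (pCons 0 (monic_poly n c))) x) (at x)"
    by (intro derivative_intros poly_DERIV)
  ultimately show ?thesis by simp
qed

section \<open>Change of variables on the line\<close>

text \<open>The underlying change of variables is a statement about absolutely integrable functions,
  so an image of infinite measure is treated separately, by contradiction.\<close>

lemma emeasure_image_inj_on:
  fixes g :: "real \<Rightarrow> real"
  assumes S [measurable]: "S \<in> sets borel" and g' [measurable]: "g' \<in> borel_measurable borel"
    and der: "\<And>x. x \<in> S \<Longrightarrow> (g has_real_derivative g' x) (at x)" and inj: "inj_on g S"
    and img: "g ` S \<in> sets borel"
  shows "emeasure lborel (g ` S) = (\<integral>\<^sup>+x. indicator S x * ennreal \<bar>g' x\<bar> \<partial>lborel)"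
proof -
  have Sl: "S \<in> sets lebesgue" by (simp add: S)
  have der': "(g has_field_derivative g' x) (at x within S)" if "x \<in> S" for x
    using der[OF that] by (rule has_field_derivative_at_within)
  note cv = has_absolute_integral_change_of_variables_1'[OF Sl der' inj, where f = "\<lambda>_. 1"]
  show ?thesis
  proof (cases "emeasure lborel (g ` S) < \<infinity>")
    case True
    then have lm: "g ` S \<in> lmeasurable"
      using img by (auto simp: fmeasurable_def)
    then have "(\<lambda>_. 1::real) absolutely_integrable_on g ` S \<and> integral (g ` S) (\<lambda>_. 1::real) = measure lebesgue (g ` S)"
      by (simp add: lmeasure_integral absolutely_integrable_on_iff_nonneg integrable_on_const)
    then have *: "(\<lambda>x. \<bar>g' x\<bar> * 1) absolutely_integrable_on S" 
        "integral S (\<lambda>x. \<bar>g' x\<bar> * 1) = measure lebesgue (g ` S)"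
      using cv[of "measure lebesgue (g ` S)"] by auto
    have "(\<lambda>x. \<bar>g' x\<bar>) absolutely_integrable_on S"
      using *(1) by simp
    then have i1: "set_integrable lborel S (\<lambda>x. \<bar>g' x\<bar>)" by (simp add: set_integrable_def integrable_completion)
    have "(\<integral>\<^sup>+x. indicator S x * ennreal \<bar>g' x\<bar> \<partial>lborel) = (\<integral>\<^sup>+x. ennreal (indicator S x *\<^sub>R \<bar>g' x\<bar>) \<partial>lborel)"
      by (intro nn_integral_cong) (auto simp: indicator_def)
    also have "\<dots> = ennreal (LINT x:S|lborel. \<bar>g' x\<bar>)"
      unfolding set_lebesgue_integral_def
      by (rule nn_integral_eq_integral) (use i1 in \<open>auto simp: set_integrable_def\<close>)
    also have "(LINT x:S|lborel. \<bar>g' x\<bar>) = integral S (\<lambda>x. \<bar>g' x\<bar>)"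
      using i1 by (rule set_borel_integral_eq_integral)
    also have "\<dots> = measure lebesgue (g ` S)" using *(2) by simp
    also have "ennreal \<dots> = emeasure lborel (g ` S)"
      using True img by (simp add: measure_completion emeasure_eq_ennreal_measure)
    finally show ?thesis ..
  next
    case False
    have "(\<integral>\<^sup>+x. indicator S x * ennreal \<bar>g' x\<bar> \<partial>lborel) = \<infinity>"
    proof (rule ccontr)
      assume "(\<integral>\<^sup>+x. indicator S x * ennreal \<bar>g' x\<bar> \<partial>lborel) \<noteq> \<infinity>"
      moreover have "(\<integral>\<^sup>+x. indicator S x * ennreal \<bar>g' x\<bar> \<partial>lborel) =
          (\<integral>\<^sup>+x. ennreal (norm (indicator S x *\<^sub>R \<bar>g' x\<bar>)) \<partial>lborel)"
        by (intro nn_integral_cong) (auto simp: indicator_def)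
      ultimately have "integrable lborel (\<lambda>x. indicator S x *\<^sub>R \<bar>g' x\<bar>)"
        by (intro integrableI_bounded) (auto simp: less_top[symmetric])
      then have "(\<lambda>x. \<bar>g' x\<bar> * 1) absolutely_integrable_on S"
        by (simp add: set_integrable_def integrable_completion)
      then have "(\<lambda>_. 1::real) absolutely_integrable_on g ` S" using cv by blast
      then have "integrable lebesgue (indicat_real (g ` S))"
        by (simp add: set_integrable_def)
      then have "emeasure lebesgue (g ` S) < \<infinity>"
        using img by (subst (asm) integrable_indicator_iff) auto
      then show False using False img by simp
    qed
    then show ?thesis using False by (simp add: less_top[symmetric])
  qed
qed

text \<open>Lebesgue measure restricted to the image and the push-forward of the density |g'| on S
  are the same measure. On a Borel set A this is the previous lemma for the part of S that g maps
  into A; equality of measures then covers every integrand.\<close>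

lemma nn_integral_image_inj_on:
  fixes g :: "real \<Rightarrow> real" and f :: "real \<Rightarrow> ennreal"
  assumes S [measurable]: "S \<in> sets borel" and g' [measurable]: "g' \<in> borel_measurable borel"
    and g [measurable]: "g \<in> borel_measurable borel"
    and der: "\<And>x. x \<in> S \<Longrightarrow> (g has_real_derivative g' x) (at x)" and inj: "inj_on g S"
    and img [measurable]: "g ` S \<in> sets borel" and f [measurable]: "f \<in> borel_measurable borel"
  shows "(\<integral>\<^sup>+y. indicator (g ` S) y * f y \<partial>lborel) =
         (\<integral>\<^sup>+x. indicator S x * (ennreal \<bar>g' x\<bar> * f (g x)) \<partial>lborel)"
proof -
  have eq: "density lborel (indicator (g ` S)) = distr (density lborel (\<lambda>x. indicator S x * ennreal \<bar>g' x\<bar>)) borel g"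
    (is "?M = ?N")
  proof (rule measure_eqI)
    show "sets ?M = sets ?N" by simp
  next
    fix A assume "A \<in> sets ?M"
    then have A [measurable]: "A \<in> sets borel" by simp
    have i: "g ` (S \<inter> g -` A) = g ` S \<inter> A" by auto
    have "emeasure ?M A = emeasure lborel (g ` S \<inter> A)"
      by (subst emeasure_density) (auto simp: nn_integral_indicator[symmetric] indicator_inter_arith simp del: nn_integral_indicator)
    also have "\<dots> = (\<integral>\<^sup>+x. indicator (S \<inter> g -` A) x * ennreal \<bar>g' x\<bar> \<partial>lborel)"
      unfolding i[symmetric]
    proof (rule emeasure_image_inj_on)
      have "g -` A \<in> sets borel" using measurable_sets[OF g A] by simp
      then show "S \<inter> g -` A \<in> sets borel" by simp
      show "g ` (S \<inter> g -` A) \<in> sets borel" unfolding i by simp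
      show "inj_on g (S \<inter> g -` A)" using inj by (rule inj_on_subset) auto
    qed (use der in auto)
    also have "\<dots> = emeasure ?N A"
      by (subst emeasure_distr, simp, simp, subst emeasure_density)
        (auto intro!: nn_integral_cong simp: indicator_def measurable_sets[OF g A, simplified])
    finally show "emeasure ?M A = emeasure ?N A" .
  qed
  have "(\<integral>\<^sup>+y. indicator (g ` S) y * f y \<partial>lborel) = (\<integral>\<^sup>+y. f y \<partial>?M)"
    by (subst nn_integral_density) auto
  also have "\<dots> = (\<integral>\<^sup>+x. indicator S x * (ennreal \<bar>g' x\<bar> * f (g x)) \<partial>lborel)"
    unfolding eq by (subst nn_integral_distr) (auto simp: nn_integral_density ac_simps)
  finally show ?thesis .
qed

lemma measurable_poly_monic_poly [measurable (raw)]: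
  fixes c :: "'a \<Rightarrow> nat \<Rightarrow> real"
  assumes [measurable]: "c \<in> borel_measurable M" "x \<in> borel_measurable M"
  shows "(\<lambda>p. poly (monic_poly k (c p)) (x p)) \<in> borel_measurable M"
  by (induction k) simp_all

lemma measurable_quot_root [measurable (raw)]:
  assumes [measurable]: "c \<in> borel_measurable M" "x \<in> borel_measurable M"
  shows "(\<lambda>p. quot_root n (x p) (c p)) \<in> borel_measurable M"
proof (rule measurable_coordinatewise_then_product)
  show "(\<lambda>p. quot_root n (x p) (c p) i) \<in> borel_measurable M" for i
    unfolding quot_root_def by (cases "i < n") (simp_all del: monic_poly.simps)
qed

lemma measurable_attach_root [measurable (raw)]:
  assumes [measurable]: "s \<in> borel_measurable M" "(x :: _ \<Rightarrow> real) \<in> borel_measurable M"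
  shows "(\<lambda>p. attach_root (x p) (s p)) \<in> borel_measurable M"
proof (rule measurable_coordinatewise_then_product)
  show "(\<lambda>p. attach_root (x p) (s p) i) \<in> borel_measurable M" for i
    unfolding attach_root_def by (cases "i = 0") simp_all
qed

text \<open>On a line with fixed upper coefficients the constant coefficient is a function of the
  root x, so a substitution in one variable suffices. After exchanging the integrals x is fixed, and
  \<open>shear\<close> replaces the upper coefficients by those of the quotient without changing the
  measure. The assumption \<open>inj\<close> makes D select one root of each polynomial.\<close>

lemma nn_integral_coord_attach_root:
  fixes f :: "(nat \<Rightarrow> real) \<Rightarrow> ennreal" and D :: "(real \<times> (nat \<Rightarrow> real)) set" and n :: nat
  defines "G \<equiv> {c. \<exists>x s. supp_below n s \<and> (x, s) \<in> D \<and> c = attach_root x s}"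
  assumes D [measurable]: "D \<in> sets (borel \<Otimes>\<^sub>M borel)" and G [measurable]: "G \<in> sets borel"
    and f [measurable]: "f \<in> borel_measurable borel"
    and inj: "\<And>x s x' s'. supp_below n s \<Longrightarrow> supp_below n s' \<Longrightarrow> (x, s) \<in> D \<Longrightarrow> (x', s') \<in> D \<Longrightarrow>
      attach_root x s = attach_root x' s' \<Longrightarrow> x = x'"
  shows "(\<integral>\<^sup>+c. indicator G c * f c \<partial>coord_measure (Suc n)) =
    (\<integral>\<^sup>+x. \<integral>\<^sup>+s. indicator D (x, s) * (ennreal \<bar>poly (monic_poly n s) x\<bar> * f (attach_root x s)) \<partial>coord_measure n \<partial>lborel)"
proof -
  define h where "h = (\<lambda>x s. indicator D (x, s) * (ennreal \<bar>poly (monic_poly n s) x\<bar> * f (attach_root x s)))"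
  have [measurable]: "(\<lambda>p. h (x p) (s p)) \<in> borel_measurable M"
    if [measurable]: "x \<in> borel_measurable M" "s \<in> borel_measurable M" for M x s
    unfolding h_def by measurable
  have fibre: "(\<integral>\<^sup>+y. indicator G (c(n := y)) * f (c(n := y)) \<partial>lborel) = (\<integral>\<^sup>+x. h x (quot_root n x c) \<partial>lborel)"
    if c: "supp_below n c" for c
  proof -
    define S where "S = {x. (x, quot_root n x c) \<in> D}"
    define g where "g = (\<lambda>x. - (x * poly (monic_poly n c) x))"
    have upd: "attach_root x (quot_root n x c) = c(n := g x)" for x
      using attach_quot_root[OF c] by (simp add: g_def)
    have img: "g ` S = {y. c(n := y) \<in> G}"
    proof safe
      fix x assume "x \<in> S"
      then show "c(n := g x) \<in> G"
        unfolding G_def S_def by (auto intro!: exI[of _ x] exI[of _ "quot_root n x c"] simp: upd)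
    next
      fix y assume "c(n := y) \<in> G"
      then obtain x s where xs: "supp_below n s" "(x, s) \<in> D" "c(n := y) = attach_root x s"
        by (auto simp: G_def)
      have "shear x n s = c"
      proof
        fix i show "shear x n s i = c i"
          using c xs(3)[unfolded attach_root_eq_shear_upd[OF xs(1)], THEN fun_cong, of i]
          by (cases "i = n") (auto simp: shear_def supp_below_def)
      qed
      then have s: "s = quot_root n x c" using quot_root_shear[OF xs(1)] by metis
      then have "c(n := y) = c(n := g x)" using xs(3) upd by simp
      then have "y = g x" by (metis fun_upd_same)
      then show "y \<in> g ` S" using xs(2) s by (auto simp: S_def)
    qed
    have [measurable]: "S \<in> sets borel" unfolding S_def by measurable
    have [measurable]: "g \<in> borel_measurable borel" unfolding g_def by measurable
    have [measurable]: "g ` S \<in> sets borel" unfolding img by measurable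
    have "(\<integral>\<^sup>+y. indicator G (c(n := y)) * f (c(n := y)) \<partial>lborel) =
        (\<integral>\<^sup>+y. indicator (g ` S) y * f (c(n := y)) \<partial>lborel)"
      by (intro nn_integral_cong) (auto simp: img indicator_def)
    also have "\<dots> = (\<integral>\<^sup>+x. indicator S x * (ennreal \<bar>- poly (monic_poly n (quot_root n x c)) x\<bar> * f (c(n := g x))) \<partial>lborel)"
    proof (rule nn_integral_image_inj_on)
      show "(g has_real_derivative - poly (monic_poly n (quot_root n x c)) x) (at x)" for x
        unfolding g_def by (rule has_derivative_quot_root[OF c])
      show "inj_on g S"
      proof (rule inj_onI)
        fix x x' assume "x \<in> S" "x' \<in> S" "g x = g x'"
        then show "x = x'"
          by (intro inj[of "quot_root n x c" "quot_root n x' c"]) (auto simp: S_def upd)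
      qed
    qed measurable
    also have "\<dots> = (\<integral>\<^sup>+x. h x (quot_root n x c) \<partial>lborel)"
      by (intro nn_integral_cong) (auto simp: h_def S_def upd indicator_def)
    finally show ?thesis .
  qed
  have "(\<integral>\<^sup>+c. indicator G c * f c \<partial>coord_measure (Suc n)) =
      (\<integral>\<^sup>+c. \<integral>\<^sup>+y. indicator G (c(n := y)) * f (c(n := y)) \<partial>lborel \<partial>coord_measure n)"
    by (rule nn_integral_coord_Suc') measurable
  also have "\<dots> = (\<integral>\<^sup>+c. \<integral>\<^sup>+x. h x (quot_root n x c) \<partial>lborel \<partial>coord_measure n)"
    by (intro nn_integral_coord_cong fibre)
  also have "\<dots> = (\<integral>\<^sup>+x. \<integral>\<^sup>+c. h x (quot_root n x c) \<partial>coord_measure n \<partial>lborel)"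
    by (rule nn_integral_coord_Fubini[symmetric]) measurable
  also have "\<dots> = (\<integral>\<^sup>+x. \<integral>\<^sup>+s. h x s \<partial>coord_measure n \<partial>lborel)"
  proof (rule nn_integral_cong)
    fix x :: real
    have "(\<integral>\<^sup>+c. h x (quot_root n x c) \<partial>coord_measure n) = (\<integral>\<^sup>+s. h x (quot_root n x (shear x n s)) \<partial>coord_measure n)"
      by (rule nn_integral_coord_shear) measurable
    also have "\<dots> = (\<integral>\<^sup>+s. h x s \<partial>coord_measure n)"
      by (intro nn_integral_coord_cong) (simp add: quot_root_shear)
    finally show "(\<integral>\<^sup>+c. h x (quot_root n x c) \<partial>coord_measure n) = (\<integral>\<^sup>+s. h x s \<partial>coord_measure n)" .
  qed
  finally show ?thesis unfolding h_def .
qed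

section \<open>Ordered roots as coordinates\<close>

primrec root_coeffs :: "nat \<Rightarrow> (nat \<Rightarrow> real) \<Rightarrow> nat \<Rightarrow> real" where
  "root_coeffs 0 z = (\<lambda>_. 0)"
| "root_coeffs (Suc n) z = attach_root (z n) (root_coeffs n z)"

lemma supp_root_coeffs [simp]: "supp_below n (root_coeffs n z)"
  by (induction n) (auto simp: supp_attach_root, simp add: supp_below_def)

lemma monic_poly_root_coeffs: "monic_poly n (root_coeffs n z) = (\<Prod>i<n. [:- z i, 1:])"
proof (induction n)
  case (Suc n)
  have "monic_poly (Suc n) (root_coeffs (Suc n) z) = [:- z n, 1:] * monic_poly n (root_coeffs n z)"
    unfolding root_coeffs.simps by (rule monic_poly_attach_root) simp
  then show ?case using Suc by (simp only: prod.lessThan_Suc mult.commute)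
qed simp

lemma poly_root_coeffs: "poly (monic_poly n (root_coeffs n z)) x = (\<Prod>i<n. x - z i)"
  by (simp add: monic_poly_root_coeffs poly_prod)

lemma root_coeffs_cong: "(\<And>i. i < n \<Longrightarrow> z i = w i) \<Longrightarrow> root_coeffs n z = root_coeffs n w"
  by (induction n) auto

lemma root_coeffs_upd [simp]: "root_coeffs n (z(n := x)) = root_coeffs n z"
  by (rule root_coeffs_cong) auto

lemma continuous_attach_root:
  assumes "continuous_on S x" "continuous_on S (s :: _ \<Rightarrow> nat \<Rightarrow> real)"
  shows "continuous_on S (\<lambda>p. attach_root (x p) (s p))"
  unfolding attach_root_def
proof (rule continuous_on_coordinatewise_then_product)
  fix i
  have "continuous_on S (\<lambda>p. s p i)" for i
    using continuous_on_product_then_coordinatewise[OF assms(2)] .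
  then show "continuous_on S (\<lambda>p. s p i - x p * (if i = 0 then 1 else s p (i - 1)))"
    using assms(1) by (cases "i = 0") (auto intro!: continuous_intros)
qed

lemma continuous_root_coeffs: "continuous_on S (root_coeffs n)"
  by (induction n) (auto intro!: continuous_attach_root continuous_on_subset[OF continuous_on_product_coordinates])

lemma measurable_root_coeffs [measurable]: "root_coeffs n \<in> borel_measurable borel"
  by (intro borel_measurable_continuous_onI continuous_root_coeffs)

text \<open>Weak inequalities make the set closed, so that the region of coefficients is compact and
  hence Borel. Tuples with equal entries contribute nothing to the integrals because
  \<open>vdm\<close> vanishes there.\<close>

definition ordered_tuple :: "nat \<Rightarrow> real \<Rightarrow> real \<Rightarrow> (nat \<Rightarrow> real) \<Rightarrow> bool" where
  "ordered_tuple n a b z \<longleftrightarrow> (\<forall>i<n. a \<le> z i \<and> z i \<le> b) \<and> (\<forall>i j. i < j \<and> j < n \<longrightarrow> z i \<le> z j)"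

lemma closed_ordered_tuple: "closed {z. ordered_tuple n a b z}"
proof -
  have "continuous_on UNIV (\<lambda>z :: nat \<Rightarrow> real. z i)" for i by simp
  then have "closed {z :: nat \<Rightarrow> real. a \<le> z i \<and> z i \<le> b}" "closed {z :: nat \<Rightarrow> real. z i \<le> z j}" for i j
    by (auto intro!: closed_Collect_conj closed_Collect_le continuous_on_const)
  then have "closed ((\<Inter>i\<in>{..<n}. {z. a \<le> z i \<and> z i \<le> b}) \<inter> (\<Inter>p\<in>{(i, j). i < j \<and> j < n}. {z :: nat \<Rightarrow> real. z (fst p) \<le> z (snd p)}))"
    by (intro closed_Int closed_INT ballI) auto
  also have "\<dots> = {z. ordered_tuple n a b z}"
    by (auto simp: ordered_tuple_def)
  finally show ?thesis .
qed

lemma measurable_ordered_tuple [measurable]: "Measurable.pred borel (ordered_tuple n a b)"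
  using borel_closed[OF closed_ordered_tuple] by (simp add: pred_def)

lemma closed_supp_below: "closed {z :: nat \<Rightarrow> real. supp_below n z}"
proof -
  have "closed (\<Inter>i\<in>{n..}. {z :: nat \<Rightarrow> real. z i = 0})"
    by (intro closed_INT ballI closed_Collect_eq) auto
  also have "\<dots> = {z. supp_below n z}" by (auto simp: supp_below_def)
  finally show ?thesis .
qed

lemma ordered_tuple_Suc:
  "ordered_tuple (Suc n) a b z \<longleftrightarrow> a \<le> z n \<and> z n \<le> b \<and> ordered_tuple n a (z n) z"
proof
  assume "ordered_tuple (Suc n) a b z"
  then show "a \<le> z n \<and> z n \<le> b \<and> ordered_tuple n a (z n) z"
    by (auto simp: ordered_tuple_def)
next
  assume z: "a \<le> z n \<and> z n \<le> b \<and> ordered_tuple n a (z n) z"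
  then show "ordered_tuple (Suc n) a b z"
    unfolding ordered_tuple_def less_Suc_eq by (force intro: order_trans)
qed

lemma ordered_tuple_cong: "(\<And>i. i < n \<Longrightarrow> z i = w i) \<Longrightarrow> ordered_tuple n a b z = ordered_tuple n a b w"
  unfolding ordered_tuple_def by (metis order.strict_trans)

lemma compact_ordered_tuple: "compact {z. supp_below n z \<and> ordered_tuple n a b z}"
proof -
  let ?B = "PiE UNIV (\<lambda>i. if i < n then {a..b} else {0 :: real})"
  have "compactin (product_topology (\<lambda>_. euclidean) UNIV) ?B"
    unfolding compactin_PiE by (auto simp: compactin_euclidean_iff)
  then have B: "compact ?B"
    by (simp add: euclidean_product_topology)
  have cl: "closed {z. supp_below n z \<and> ordered_tuple n a b z}"
    by (intro closed_Collect_conj closed_supp_below closed_ordered_tuple)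
  have "{z. supp_below n z \<and> ordered_tuple n a b z} \<subseteq> ?B"
  proof
    fix z assume "z \<in> {z. supp_below n z \<and> ordered_tuple n a b z}"
    then have "\<forall>i<n. a \<le> z i \<and> z i \<le> b" "\<forall>i\<ge>n. z i = 0"
      by (simp_all add: supp_below_def ordered_tuple_def)
    then show "z \<in> ?B" by (simp add: PiE_iff)
  qed
  then have "{z. supp_below n z \<and> ordered_tuple n a b z} = ?B \<inter> {z. supp_below n z \<and> ordered_tuple n a b z}"
    by (rule inf_absorb2[symmetric])
  then show ?thesis using compact_Int_closed[OF B cl] by simp
qed

definition root_region :: "nat \<Rightarrow> real \<Rightarrow> real \<Rightarrow> (nat \<Rightarrow> real) set" where
  "root_region n a b = {root_coeffs n z | z. ordered_tuple n a b z}"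

lemma root_region_altdef:
  "root_region n a b = root_coeffs n ` {z. supp_below n z \<and> ordered_tuple n a b z}"
proof -
  have "\<exists>w. root_coeffs n z = root_coeffs n w \<and> supp_below n w \<and> ordered_tuple n a b w"
    if "ordered_tuple n a b z" for z
    by (intro exI[of _ "\<lambda>i. if i < n then z i else 0"] conjI)
      (use that in \<open>auto simp: supp_below_def cong: root_coeffs_cong ordered_tuple_cong\<close>)
  then show ?thesis unfolding root_region_def by auto
qed

lemma compact_root_region: "compact (root_region n a b)"
  unfolding root_region_altdef by (intro compact_continuous_image continuous_root_coeffs compact_ordered_tuple)

lemma borel_root_region [measurable]: "root_region n a b \<in> sets borel"
  by (intro borel_compact compact_root_region)

text \<open>Compactness serves measurability: the induction for the Jacobian integrates over these
  pairs, which must form a Borel set in the product.\<close>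

lemma compact_root_region_pairs: "compact {(x, s). a \<le> x \<and> x \<le> b \<and> s \<in> root_region n a x}"
proof -
  have "{(x, s). a \<le> x \<and> x \<le> b \<and> s \<in> root_region n a x} =
      (\<lambda>z. (z n, root_coeffs n z)) ` {z. supp_below (Suc n) z \<and> ordered_tuple (Suc n) a b z}"
  proof safe
    fix x s assume xs: "a \<le> x" "x \<le> b" "s \<in> root_region n a x"
    then obtain z where z: "supp_below n z" "ordered_tuple n a x z" "s = root_coeffs n z"
      by (auto simp: root_region_altdef)
    have "ordered_tuple (Suc n) a b (z(n := x))"
      using xs z(2) ordered_tuple_cong[of n z "z(n := x)"] by (simp add: ordered_tuple_Suc)
    then show "(x, s) \<in> (\<lambda>z. (z n, root_coeffs n z)) ` {z. supp_below (Suc n) z \<and> ordered_tuple (Suc n) a b z}"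
      using z by (intro image_eqI[of _ _ "z(n := x)"]) (simp_all del: fun_upd_apply, simp)
  next
    fix z :: "nat \<Rightarrow> real" assume "ordered_tuple (Suc n) a b z"
    then show "a \<le> z n" "z n \<le> b" "root_coeffs n z \<in> root_region n a (z n)"
      by (auto simp: ordered_tuple_Suc root_region_def)
  qed
  moreover have "compact \<dots>"
    by (intro compact_continuous_image compact_ordered_tuple continuous_on_Pair continuous_root_coeffs
        continuous_on_subset[OF continuous_on_product_coordinates]) auto
  ultimately show ?thesis by simp
qed

lemma root_region_Suc:
  "root_region (Suc n) a b = {attach_root x s | x s. a \<le> x \<and> x \<le> b \<and> s \<in> root_region n a x}"
proof safe
  fix c assume "c \<in> root_region (Suc n) a b"
  then show "\<exists>x s. c = attach_root x s \<and> a \<le> x \<and> x \<le> b \<and> s \<in> root_region n a x"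
    by (auto simp: root_region_def ordered_tuple_Suc)
next
  fix x s assume xs: "a \<le> x" "x \<le> b" "s \<in> root_region n a x"
  then obtain z where z: "ordered_tuple n a x z" "s = root_coeffs n z"
    by (auto simp: root_region_def)
  have "ordered_tuple (Suc n) a b (z(n := x))"
    using xs z(1) ordered_tuple_cong[of n z "z(n := x)"] by (simp add: ordered_tuple_Suc)
  moreover have "attach_root x s = root_coeffs (Suc n) (z(n := x))" using z by simp
  ultimately show "attach_root x s \<in> root_region (Suc n) a b" unfolding root_region_def by blast
qed

lemma supp_root_region: "c \<in> root_region n a b \<Longrightarrow> supp_below n c"
  by (auto simp: root_region_def)

text \<open>Both sides describe the same polynomial, and each of x and x' is a root of it that
  bounds all its roots from above.\<close>

lemma attach_root_inj_largest:
  assumes s: "s \<in> root_region n a b" "b \<le> x" and s': "s' \<in> root_region n a' b'" "b' \<le> (x' :: real)"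
    and eq: "attach_root x s = attach_root x' s'"
  shows "x = x'"
proof -
  obtain z where z: "ordered_tuple n a b z" "s = root_coeffs n z" using s by (auto simp: root_region_def)
  obtain z' where z': "ordered_tuple n a' b' z'" "s' = root_coeffs n z'" using s' by (auto simp: root_region_def)
  have "(t - x) * (\<Prod>i<n. t - z i) = (t - x') * (\<Prod>i<n. t - z' i)" for t
    using arg_cong[OF eq, of "\<lambda>c. poly (monic_poly (Suc n) c) t"]
    unfolding monic_poly_attach_root[OF supp_root_region[OF s(1)]] monic_poly_attach_root[OF supp_root_region[OF s'(1)]]
    by (simp add: z z' poly_root_coeffs algebra_simps del: monic_poly.simps)
  from this[of x] this[of x'] have "x = x' \<or> (\<exists>i<n. x = z' i)" "x = x' \<or> (\<exists>i<n. x' = z i)"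
    by (auto simp: eq_commute[of 0])
  then show ?thesis
    using z(1) z'(1) \<open>b \<le> x\<close> \<open>b' \<le> x'\<close> unfolding ordered_tuple_def by (smt (verit, best))
qed

definition vdm :: "nat \<Rightarrow> (nat \<Rightarrow> real) \<Rightarrow> real" where
  "vdm n z = (\<Prod>j<n. \<Prod>i<j. z j - z i)"

lemma vdm_Suc: "vdm (Suc n) z = vdm n z * (\<Prod>i<n. z n - z i)"
  by (simp add: vdm_def)

lemma vdm_upd [simp]: "vdm n (z(n := x)) = vdm n z"
  unfolding vdm_def by (intro prod.cong) auto

lemma measurable_vdm [measurable]: "vdm n \<in> borel_measurable borel"
  unfolding vdm_def[abs_def] by measurable

lemma vdm_nonneg: "ordered_tuple n a b z \<Longrightarrow> vdm n z \<ge> 0"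
  unfolding vdm_def ordered_tuple_def by (intro prod_nonneg) auto

text \<open>The Jacobian from ordered roots to coefficients is the Vandermonde product: attaching
  the largest root x multiplies it by the value at x of the polynomial formed so far, that is by the
  new factors x - z i, all nonnegative because of the order.\<close>

lemma nn_integral_root_region:
  fixes f :: "(nat \<Rightarrow> real) \<Rightarrow> ennreal"
  assumes "f \<in> borel_measurable borel"
  shows "(\<integral>\<^sup>+c. indicator (root_region n a b) c * f c \<partial>coord_measure n) =
    (\<integral>\<^sup>+z. indicator {z. ordered_tuple n a b z} z * (ennreal (vdm n z) * f (root_coeffs n z)) \<partial>coord_measure n)"
  using assms
proof (induction n arbitrary: f b)
  case 0
  note [measurable] = this
  have "root_region 0 a b = {\<lambda>_. 0}" by (auto simp: root_region_def ordered_tuple_def)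
  then show ?case
    by (subst (1 2) nn_integral_coord_0) (auto simp: ordered_tuple_def vdm_def)
next
  case (Suc n)
  note [measurable] = Suc.prems
  define D where "D = {(x, s). a \<le> x \<and> x \<le> b \<and> s \<in> root_region n a x}"
  have D [measurable]: "D \<in> sets (borel \<Otimes>\<^sub>M borel)"
    unfolding borel_prod D_def by (intro borel_compact compact_root_region_pairs)
  have G: "root_region (Suc n) a b = {c. \<exists>x s. supp_below n s \<and> (x, s) \<in> D \<and> c = attach_root x s}"
    unfolding root_region_Suc D_def using supp_root_region by fast
  have "(\<integral>\<^sup>+c. indicator (root_region (Suc n) a b) c * f c \<partial>coord_measure (Suc n)) =
     (\<integral>\<^sup>+x. \<integral>\<^sup>+s. indicator D (x, s) * (ennreal \<bar>poly (monic_poly n s) x\<bar> * f (attach_root x s)) \<partial>coord_measure n \<partial>lborel)"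
    unfolding G
  proof (rule nn_integral_coord_attach_root)
    show "{c. \<exists>x s. supp_below n s \<and> (x, s) \<in> D \<and> c = attach_root x s} \<in> sets borel"
      unfolding G[symmetric] by measurable
    show "x = x'" if "(x, s) \<in> D" "(x', s') \<in> D" "attach_root x s = attach_root x' s'" for x s x' s'
      using that by (auto simp: D_def intro: attach_root_inj_largest[OF _ order_refl _ order_refl])
  qed (use Suc.prems in auto)
  also have "\<dots> = (\<integral>\<^sup>+x. \<integral>\<^sup>+z. indicator {z. ordered_tuple (Suc n) a b z} (z(n := x)) *
      (ennreal (vdm (Suc n) (z(n := x))) * f (root_coeffs (Suc n) (z(n := x)))) \<partial>coord_measure n \<partial>lborel)"
  proof (rule nn_integral_cong)
    fix x :: real
    have oc: "ordered_tuple (Suc n) a b (z(n := x)) \<longleftrightarrow> a \<le> x \<and> x \<le> b \<and> ordered_tuple n a x z" for z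
      using ordered_tuple_cong[of n z "z(n := x)" a x] by (simp add: ordered_tuple_Suc)
    show "(\<integral>\<^sup>+s. indicator D (x, s) * (ennreal \<bar>poly (monic_poly n s) x\<bar> * f (attach_root x s)) \<partial>coord_measure n) =
      (\<integral>\<^sup>+z. indicator {z. ordered_tuple (Suc n) a b z} (z(n := x)) *
      (ennreal (vdm (Suc n) (z(n := x))) * f (root_coeffs (Suc n) (z(n := x)))) \<partial>coord_measure n)"
    proof (cases "a \<le> x \<and> x \<le> b")
      case True
      have "(\<integral>\<^sup>+s. indicator D (x, s) * (ennreal \<bar>poly (monic_poly n s) x\<bar> * f (attach_root x s)) \<partial>coord_measure n) =
        (\<integral>\<^sup>+s. indicator (root_region n a x) s * (ennreal \<bar>poly (monic_poly n s) x\<bar> * f (attach_root x s)) \<partial>coord_measure n)"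
        using True by (intro nn_integral_cong) (auto simp: D_def indicator_def)
      also have "\<dots> = (\<integral>\<^sup>+z. indicator {z. ordered_tuple n a x z} z * (ennreal (vdm n z) *
          (ennreal \<bar>poly (monic_poly n (root_coeffs n z)) x\<bar> * f (attach_root x (root_coeffs n z)))) \<partial>coord_measure n)"
        by (rule Suc.IH) measurable
      also have "\<dots> = (\<integral>\<^sup>+z. indicator {z. ordered_tuple (Suc n) a b z} (z(n := x)) *
        (ennreal (vdm (Suc n) (z(n := x))) * f (root_coeffs (Suc n) (z(n := x)))) \<partial>coord_measure n)"
      proof (intro nn_integral_cong)
        fix z
        show "indicator {z. ordered_tuple n a x z} z * (ennreal (vdm n z) *
          (ennreal \<bar>poly (monic_poly n (root_coeffs n z)) x\<bar> * f (attach_root x (root_coeffs n z)))) =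
          indicator {z. ordered_tuple (Suc n) a b z} (z(n := x)) *
        (ennreal (vdm (Suc n) (z(n := x))) * f (root_coeffs (Suc n) (z(n := x))))"
        proof (cases "ordered_tuple n a x z")
          case o: True
          then have "(\<Prod>i<n. x - z i) \<ge> 0" by (intro prod_nonneg) (auto simp: ordered_tuple_def)
          moreover have "(\<Prod>i<n. (z(n := x)) n - (z(n := x)) i) = (\<Prod>i<n. x - z i)" by (intro prod.cong) auto
          ultimately show ?thesis
            using o True vdm_nonneg[OF o]
            by (simp add: oc vdm_Suc poly_root_coeffs ennreal_mult mult.assoc del: fun_upd_apply) simp
        qed (simp add: oc del: fun_upd_apply)
      qed
      finally show ?thesis .
    next
      case False
      then show ?thesis by (auto simp: D_def oc simp del: fun_upd_apply)
    qed
  qed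
  also have "\<dots> = (\<integral>\<^sup>+z. indicator {z. ordered_tuple (Suc n) a b z} z *
      (ennreal (vdm (Suc n) z) * f (root_coeffs (Suc n) z)) \<partial>coord_measure (Suc n))"
    by (rule nn_integral_coord_Suc[symmetric]) measurable
  finally show ?case .
qed

section \<open>The Selberg integral by Aomoto's method\<close>

definition index_pairs :: "nat \<Rightarrow> (nat \<times> nat) set" where
  "index_pairs n = Sigma {..<n} (\<lambda>j. {..<j})"

lemma finite_index_pairs [simp]: "finite (index_pairs n)"
  by (simp add: index_pairs_def)

lemma card_index_pairs: "2 * real (card (index_pairs n)) = real n * (real n - 1)"
proof -
  have "card (index_pairs n) = (\<Sum>j<n. j)" by (simp add: index_pairs_def)
  moreover have "2 * real (\<Sum>j<n. j) = real n * (real n - 1)"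
    by (induction n) (auto simp: algebra_simps)
  ultimately show ?thesis by simp
qed

lemma vdm_pairs: "vdm n z = (\<Prod>p\<in>index_pairs n. z (fst p) - z (snd p))"
  by (simp add: vdm_def index_pairs_def prod.Sigma split_beta)

lemma vdm_scale: "vdm n (\<lambda>i. if i < n then a + k * z i else 0) = k ^ card (index_pairs n) * vdm n z"
proof -
  have "vdm n (\<lambda>i. if i < n then a + k * z i else 0) = (\<Prod>p\<in>index_pairs n. k * (z (fst p) - z (snd p)))"
    unfolding vdm_pairs by (intro prod.cong) (auto simp: index_pairs_def algebra_simps)
  then show ?thesis by (simp add: prod.distrib vdm_pairs)
qed

lemma continuous_on_coord [continuous_intros]: "continuous_on S (\<lambda>z :: nat \<Rightarrow> real. z i)"
  by (rule continuous_on_subset[OF continuous_on_product_coordinates]) auto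

lemma emeasure_ordered_tuple_finite:
  "emeasure (coord_measure n) {z. ordered_tuple n a b z} < \<infinity>"
proof -
  have "\<bar>x\<bar> \<le> \<bar>a\<bar> + \<bar>b\<bar>" if "a \<le> x \<and> x \<le> b" for x using that by linarith
  then have "{z. ordered_tuple n a b z} \<subseteq> {c. \<forall>i<n. \<bar>c i\<bar> \<le> \<bar>a\<bar> + \<bar>b\<bar>}"
    unfolding ordered_tuple_def by blast
  then have "emeasure (coord_measure n) {z. ordered_tuple n a b z} \<le>
      emeasure (coord_measure n) {c. \<forall>i<n. \<bar>c i\<bar> \<le> \<bar>a\<bar> + \<bar>b\<bar>}"
    by (rule emeasure_mono) simp
  also have "\<dots> < \<infinity>" using coord_measure_finite_box by blast
  finally show ?thesis .
qed

lemma integrable_ordered_tuple: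
  assumes f: "continuous_on UNIV (f :: (nat \<Rightarrow> real) \<Rightarrow> real)"
  shows "integrable (coord_measure n) (\<lambda>z. indicator {z. ordered_tuple n a b z} z * f z)"
proof -
  have "compact (f ` {z. supp_below n z \<and> ordered_tuple n a b z})"
    by (intro compact_continuous_image compact_ordered_tuple continuous_on_subset[OF f]) auto
  then obtain B where B: "\<And>z. supp_below n z \<Longrightarrow> ordered_tuple n a b z \<Longrightarrow> \<bar>f z\<bar> \<le> B"
    by (fastforce dest!: compact_imp_bounded simp: bounded_iff)
  have "integrable (coord_measure n) (\<lambda>z. indicator {z. ordered_tuple n a b z} z *\<^sub>R f z)"
  proof (rule integrableI_bounded_set_indicator)
    show "f \<in> borel_measurable (coord_measure n)"
      using borel_measurable_continuous_onI[OF f] by measurable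
    show "AE z in coord_measure n. z \<in> {z. ordered_tuple n a b z} \<longrightarrow> norm (f z) \<le> B"
      using AE_coord_measure[of n] by (auto elim!: eventually_mono intro: B)
  qed (use emeasure_ordered_tuple_finite in auto)
  then show ?thesis by simp
qed

text \<open>That the integral vanishes is phrased as equality of the integrals of positive and
  negative part. In this form it can be integrated over the remaining coordinates by
  \<open>nn_integral_coord_fibre_eq\<close>, with nonnegative integrands throughout.\<close>

lemma nn_integral_FTC_zero:
  fixes F f :: "real \<Rightarrow> real"
  assumes der: "\<And>x. (F has_real_derivative f x) (at x)" and cont: "continuous_on UNIV f"
    and eq: "a \<le> b \<Longrightarrow> F a = F b"
  shows "(\<integral>\<^sup>+x. ennreal (indicator {a..b} x * f x) \<partial>lborel) =
    (\<integral>\<^sup>+x. ennreal (- (indicator {a..b} x * f x)) \<partial>lborel)"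
proof (cases "a \<le> b")
  case True
  have "has_bochner_integral lborel (\<lambda>x. f x * indicator {a .. b} x) (F b - F a)"
    using True der cont by (intro has_bochner_integral_FTC_Icc_real) (auto simp: continuous_on_eq_continuous_at)
  then have i: "integrable lborel (\<lambda>x. indicator {a .. b} x * f x)" "(LINT x|lborel. indicator {a .. b} x * f x) = 0"
    using eq[OF True] by (auto simp: has_bochner_integral_iff mult.commute)
  have enn: "x = y" if "x \<noteq> \<infinity>" "y \<noteq> \<infinity>" "enn2real x = enn2real y" for x y
    using that by (cases x; cases y) auto
  from i(1) have "(\<integral>\<^sup>+x. ennreal (indicator {a..b} x * f x) \<partial>lborel) \<noteq> \<infinity>"
     "(\<integral>\<^sup>+x. ennreal (- (indicator {a..b} x * f x)) \<partial>lborel) \<noteq> \<infinity>"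
    by (auto simp: real_integrable_def)
  moreover have "enn2real (\<integral>\<^sup>+x. ennreal (indicator {a..b} x * f x) \<partial>lborel) =
     enn2real (\<integral>\<^sup>+x. ennreal (- (indicator {a..b} x * f x)) \<partial>lborel)"
    using i(2) unfolding real_lebesgue_integral_def[OF i(1)] by simp
  ultimately show ?thesis by (rule enn)
qed simp

text \<open>Summed over the omitted indices, the products lacking one factor give the first
  derivative in u of the full product, and those lacking two give half of the second. This turns the
  divergence below into a differential operator in u.\<close>

definition rest_prod :: "real \<Rightarrow> nat \<Rightarrow> nat set \<Rightarrow> (nat \<Rightarrow> real) \<Rightarrow> real" where
  "rest_prod u n A z = (\<Prod>j\<in>{..<n} - A. u + 1 - z j)"

definition vdm_deriv :: "nat \<Rightarrow> nat \<Rightarrow> (nat \<Rightarrow> real) \<Rightarrow> real" where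
  "vdm_deriv n i z = (\<Sum>p\<in>index_pairs n. ((if fst p = i then 1 else 0) - (if snd p = i then 1 else 0)) *
     (\<Prod>q\<in>index_pairs n - {p}. z (fst q) - z (snd q)))"

text \<open>Component i of a vector field that has no flux through the boundary of the ordered
  simplex: z i (1 - z i) vanishes at 0 and 1, and the Vandermonde product where two neighbours meet.
  Because u is free, a single divergence identity yields one equation for each power of u.\<close>

definition aomoto_field :: "real \<Rightarrow> nat \<Rightarrow> nat \<Rightarrow> (nat \<Rightarrow> real) \<Rightarrow> real" where
  "aomoto_field u n i z = z i * (1 - z i) * rest_prod u n {i} z * vdm n z"

definition aomoto_deriv :: "real \<Rightarrow> nat \<Rightarrow> nat \<Rightarrow> (nat \<Rightarrow> real) \<Rightarrow> real" where
  "aomoto_deriv u n i z = (1 - 2 * z i) * rest_prod u n {i} z * vdm n z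
     + z i * (1 - z i) * rest_prod u n {i} z * vdm_deriv n i z"

lemma rest_prod_upd: "i \<in> A \<Longrightarrow> rest_prod u n A (z(i := y)) = rest_prod u n A z"
  unfolding rest_prod_def by (intro prod.cong) auto

lemma has_derivative_vdm:
  "((\<lambda>y. vdm n (z(i := y))) has_real_derivative vdm_deriv n i (z(i := y))) (at y)"
  unfolding vdm_pairs vdm_deriv_def
proof (rule has_field_derivative_prod)
  fix p assume "p \<in> index_pairs n"
  then have "fst p \<noteq> snd p" by (auto simp: index_pairs_def)
  then show "((\<lambda>y. (z(i := y)) (fst p) - (z(i := y)) (snd p)) has_real_derivative
      (if fst p = i then 1 else 0) - (if snd p = i then 1 else 0)) (at y)"
    by (auto intro!: derivative_eq_intros)
qed

lemma has_derivative_aomoto_field: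
  "((\<lambda>y. aomoto_field u n i (z(i := y))) has_real_derivative aomoto_deriv u n i (z(i := y))) (at y)"
  unfolding aomoto_field_def aomoto_deriv_def
  by (auto intro!: derivative_eq_intros has_derivative_vdm simp: rest_prod_upd algebra_simps simp del: vdm_upd)

lemma continuous_on_fun_upd: "continuous_on S (\<lambda>y :: real. z(i := y))"
proof (rule continuous_on_coordinatewise_then_product)
  show "continuous_on S (\<lambda>y. (z(i := y)) j)" for j
    by (cases "j = i") (auto intro!: continuous_intros)
qed

lemma continuous_aomoto_deriv: "continuous_on S (aomoto_deriv u n i)"
  unfolding aomoto_deriv_def[abs_def] rest_prod_def vdm_pairs vdm_deriv_def
  by (intro continuous_intros)

lemma vdm_eq_0: "i < j \<Longrightarrow> j < n \<Longrightarrow> z i = z j \<Longrightarrow> vdm n z = 0"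
  unfolding vdm_pairs by (intro prod_zero finite_index_pairs bexI[of _ "(j, i)"]) (simp_all add: index_pairs_def)

lemma ordered_tuple_upd:
  assumes "i < n"
  shows "ordered_tuple n a b (z(i := y)) \<longleftrightarrow>
    ((\<forall>j<n. j \<noteq> i \<longrightarrow> a \<le> z j \<and> z j \<le> b) \<and> (\<forall>j k. j < k \<and> k < n \<and> j \<noteq> i \<and> k \<noteq> i \<longrightarrow> z j \<le> z k)) \<and>
    (a \<le> y \<and> (\<forall>j<i. z j \<le> y)) \<and> (y \<le> b \<and> (\<forall>j. i < j \<and> j < n \<longrightarrow> y \<le> z j))" (is "?L \<longleftrightarrow> ?O \<and> ?A \<and> ?B")
proof
  assume ?L
  then have 1: "a \<le> (z(i := y)) j \<and> (z(i := y)) j \<le> b" if "j < n" for j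
    using that unfolding ordered_tuple_def by blast
  have 2: "(z(i := y)) j \<le> (z(i := y)) k" if "j < k" "k < n" for j k
    using \<open>?L\<close> that unfolding ordered_tuple_def by blast
  have ?O
  proof (intro conjI allI impI)
    fix j assume "j < n" "j \<noteq> i"
    then show "a \<le> z j" "z j \<le> b" using 1[of j] by simp_all
  next
    fix j k assume "j < k \<and> k < n \<and> j \<noteq> i \<and> k \<noteq> i"
    then show "z j \<le> z k" using 2[of j k] by simp
  qed
  moreover have ?A using 1[OF assms] 2[OF _ assms] by simp
  moreover have ?B using 1[OF assms] 2[of i] by auto
  ultimately show "?O \<and> ?A \<and> ?B" by blast
next
  assume r: "?O \<and> ?A \<and> ?B"
  show ?L
    unfolding ordered_tuple_def
  proof (intro conjI allI impI)
    fix j assume "j < n"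
    then show "a \<le> (z(i := y)) j" "(z(i := y)) j \<le> b" using r by (cases "j = i"; simp)+
  next
    fix j k assume "j < k \<and> k < n"
    then show "(z(i := y)) j \<le> (z(i := y)) k"
      using r by (cases "j = i"; cases "k = i") simp_all
  qed
qed

text \<open>The lower end is 0 or the largest earlier entry, the upper end is 1 or the smallest
  later one; on each such face the field vanishes. If the other entries violate the order or the
  bounds, the fibre is empty and represented by the interval from 1 to 0.\<close>

lemma ordered_tuple_fibre:
  assumes "i < n"
  obtains lo hi where "\<And>y. ordered_tuple n 0 1 (z(i := y)) \<longleftrightarrow> y \<in> {lo..hi}"
    "lo \<le> hi \<Longrightarrow> aomoto_field u n i (z(i := lo)) = 0" "lo \<le> hi \<Longrightarrow> aomoto_field u n i (z(i := hi)) = 0"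
proof (cases "(\<forall>j<n. j \<noteq> i \<longrightarrow> 0 \<le> z j \<and> z j \<le> 1) \<and> (\<forall>j k. j < k \<and> k < n \<and> j \<noteq> i \<and> k \<noteq> i \<longrightarrow> z j \<le> z k)")
  case False
  then have "\<not> ordered_tuple n 0 1 (z(i := y))" for y
    using ordered_tuple_upd[OF assms] by blast
  then show ?thesis by (intro that[of 1 0]) simp_all
next
  case True
  define lo where "lo = Max (insert 0 (z ` {..<i}))"
  define hi where "hi = Min (insert 1 (z ` {i<..<n}))"
  have lo: "lo \<le> y \<longleftrightarrow> 0 \<le> y \<and> (\<forall>j<i. z j \<le> y)" for y unfolding lo_def by auto
  have hi: "y \<le> hi \<longleftrightarrow> y \<le> 1 \<and> (\<forall>j. i < j \<and> j < n \<longrightarrow> y \<le> z j)" for y unfolding hi_def by auto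
  show ?thesis
  proof (rule that[of lo hi])
    fix y
    show "ordered_tuple n 0 1 (z(i := y)) \<longleftrightarrow> y \<in> {lo..hi}"
      unfolding ordered_tuple_upd[OF assms] atLeastAtMost_iff lo hi using True by blast
  next
    have "lo \<in> insert 0 (z ` {..<i})" unfolding lo_def by (rule Max_in) auto
    then show "aomoto_field u n i (z(i := lo)) = 0"
    proof
      assume "lo \<in> z ` {..<i}"
      then obtain j where "j < i" "lo = z j" by auto
      then have "vdm n (z(i := lo)) = 0" using \<open>i < n\<close> by (intro vdm_eq_0[of j i]) auto
      then show ?thesis by (simp add: aomoto_field_def)
    qed (simp add: aomoto_field_def)
  next
    have "hi \<in> insert 1 (z ` {i<..<n})" unfolding hi_def by (rule Min_in) auto
    then show "aomoto_field u n i (z(i := hi)) = 0"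
    proof
      assume "hi \<in> z ` {i<..<n}"
      then obtain j where "i < j" "j < n" "hi = z j" by auto
      then have "vdm n (z(i := hi)) = 0" by (intro vdm_eq_0[of i j]) auto
      then show ?thesis by (simp add: aomoto_field_def)
    qed (simp add: aomoto_field_def)
  qed
qed

lemma integral_aomoto_deriv:
  assumes "i < n"
  shows "(LINT z|coord_measure n. indicator {z. ordered_tuple n 0 1 z} z * aomoto_deriv u n i z) = 0"
proof -
  have [measurable]: "aomoto_deriv u n i \<in> borel_measurable borel"
    by (intro borel_measurable_continuous_onI continuous_aomoto_deriv)
  have "(\<integral>\<^sup>+z. ennreal (indicator {z. ordered_tuple n 0 1 z} z * aomoto_deriv u n i z) \<partial>coord_measure n) =
    (\<integral>\<^sup>+z. ennreal (- (indicator {z. ordered_tuple n 0 1 z} z * aomoto_deriv u n i z)) \<partial>coord_measure n)"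
  proof (rule nn_integral_coord_fibre_eq[OF _ _ assms])
    fix z :: "nat \<Rightarrow> real"
    obtain lo hi where lh: "\<And>y. ordered_tuple n 0 1 (z(i := y)) \<longleftrightarrow> y \<in> {lo..hi}"
    "lo \<le> hi \<Longrightarrow> aomoto_field u n i (z(i := lo)) = 0" "lo \<le> hi \<Longrightarrow> aomoto_field u n i (z(i := hi)) = 0"
      using ordered_tuple_fibre[OF assms] by metis
    have ind: "indicator {z. ordered_tuple n 0 1 z} (z(i := y)) = (indicator {lo..hi} y :: real)" for y
      using lh(1)[of y] by (simp add: indicator_def)
    show "(\<integral>\<^sup>+y. ennreal (indicator {z. ordered_tuple n 0 1 z} (z(i := y)) * aomoto_deriv u n i (z(i := y))) \<partial>lborel) =
      (\<integral>\<^sup>+y. ennreal (- (indicator {z. ordered_tuple n 0 1 z} (z(i := y)) * aomoto_deriv u n i (z(i := y)))) \<partial>lborel)"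
      unfolding ind
    proof (rule nn_integral_FTC_zero[OF has_derivative_aomoto_field])
      show "continuous_on UNIV (\<lambda>y. aomoto_deriv u n i (z(i := y)))"
        by (intro continuous_on_compose2[OF continuous_aomoto_deriv continuous_on_fun_upd]) auto
    qed (use lh in auto)
  qed measurable
  then show ?thesis
    by (subst real_lebesgue_integral_def) (auto intro!: integrable_ordered_tuple continuous_aomoto_deriv)
qed

lemma rest_prod_split:
  "j < n \<Longrightarrow> j \<notin> A \<Longrightarrow> rest_prod u n A z = (u + 1 - z j) * rest_prod u n (insert j A) z"
  unfolding rest_prod_def by (subst prod.remove[of _ j]) (auto simp: insert_Diff_if Diff_insert[symmetric])

text \<open>For a pair (j, k) the difference of the two weights is divisible by z j - z k. This
  restores the full Vandermonde product, and the quotient is again a combination of products lacking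
  no or two factors. For the full product P in u the result is n(n+3)/2 P - (1 + 2u) P' - u(1+u)/2
  P'' times \<open>vdm n z\<close>: up to a constant factor, the Jacobi operator with both
  parameters 1, moved to the interval from -1 to 0.\<close>

lemma sum_aomoto_deriv:
  "(\<Sum>i<n. aomoto_deriv u n i z) = vdm n z * (real n * (real n + 3) / 2 * rest_prod u n {} z
      - (1 + 2 * u) * (\<Sum>i<n. rest_prod u n {i} z)
      - u * (1 + u) * (\<Sum>p\<in>index_pairs n. rest_prod u n {fst p, snd p} z))"
proof -
  define \<phi> where "\<phi> = (\<lambda>i. z i * (1 - z i) * rest_prod u n {i} z)"
  define V where "V = (\<lambda>p. \<Prod>q\<in>index_pairs n - {p}. z (fst q) - z (snd q))"
  define e where "e = (\<lambda>(p :: nat \<times> nat) (i :: nat). (if fst p = i then 1 else 0) - (if snd p = i then 1 else 0) :: real)"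
  have V: "vdm n z = (z (fst p) - z (snd p)) * V p" if "p \<in> index_pairs n" for p
    unfolding vdm_pairs V_def using that by (subst prod.remove[of _ p]) auto
  have "(\<Sum>i<n. \<phi> i * vdm_deriv n i z) = (\<Sum>i<n. \<Sum>p\<in>index_pairs n. V p * (e p i * \<phi> i))"
    unfolding vdm_deriv_def V_def e_def by (simp add: sum_distrib_left mult_ac)
  also have "\<dots> = (\<Sum>p\<in>index_pairs n. V p * (\<Sum>i<n. e p i * \<phi> i))"
    by (subst sum.swap) (simp add: sum_distrib_left)
  also have "\<dots> = (\<Sum>p\<in>index_pairs n. vdm n z * (rest_prod u n {} z - u * (1 + u) * rest_prod u n {fst p, snd p} z))"
  proof (rule sum.cong[OF refl])
    fix p assume p: "p \<in> index_pairs n"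
    obtain j k where jk: "p = (j, k)" by force
    have jk': "k < j" "j < n" "k < n" using p jk by (auto simp: index_pairs_def)
    have "(\<Sum>i<n. e p i * \<phi> i) = (\<Sum>i<n. (if j = i then \<phi> i else 0) - (if k = i then \<phi> i else 0))"
      by (intro sum.cong) (auto simp: e_def jk)
    also have "\<dots> = \<phi> j - \<phi> k"
      using jk' by (simp add: sum_subtractf)
    finally have s: "(\<Sum>i<n. e p i * \<phi> i) = \<phi> j - \<phi> k" .
    define R where "R = rest_prod u n {j, k} z"
    have R1: "rest_prod u n {j} z = (u + 1 - z k) * R" "rest_prod u n {k} z = (u + 1 - z j) * R"
      using jk' rest_prod_split[of k n "{j}" u z] rest_prod_split[of j n "{k}" u z]
      by (auto simp: R_def insert_commute)
    have R2: "rest_prod u n {} z = (u + 1 - z j) * (u + 1 - z k) * R"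
      using jk' rest_prod_split[of j n "{}" u z] R1 by simp
    have "\<phi> j - \<phi> k = (z j - z k) * (rest_prod u n {} z - u * (1 + u) * R)"
      unfolding \<phi>_def R1 R2 by (simp add: algebra_simps)
    then show "V p * (\<Sum>i<n. e p i * \<phi> i) = vdm n z * (rest_prod u n {} z - u * (1 + u) * rest_prod u n {fst p, snd p} z)"
      using V[OF p] s by (simp add: jk R_def)
  qed
  finally have A: "(\<Sum>i<n. \<phi> i * vdm_deriv n i z) = vdm n z * (real (card (index_pairs n)) * rest_prod u n {} z
      - u * (1 + u) * (\<Sum>p\<in>index_pairs n. rest_prod u n {fst p, snd p} z))"
    by (simp add: sum_distrib_left[symmetric] sum_subtractf)
  have "(1 - 2 * z i) * rest_prod u n {i} z = 2 * rest_prod u n {} z - (1 + 2 * u) * rest_prod u n {i} z" if "i < n" for i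
    using that rest_prod_split[of i n "{}" u z] by (simp add: algebra_simps)
  then have B: "(\<Sum>i<n. (1 - 2 * z i) * rest_prod u n {i} z) =
      2 * real n * rest_prod u n {} z - (1 + 2 * u) * (\<Sum>i<n. rest_prod u n {i} z)"
    by (simp add: sum_subtractf sum_distrib_left)
  have c: "real (card (index_pairs n)) = real n * (real n - 1) / 2"
    using card_index_pairs[of n] by simp
  have "(\<Sum>i<n. aomoto_deriv u n i z) =
      vdm n z * (\<Sum>i<n. (1 - 2 * z i) * rest_prod u n {i} z) + (\<Sum>i<n. \<phi> i * vdm_deriv n i z)"
    by (simp add: aomoto_deriv_def sum.distrib sum_distrib_left \<phi>_def mult_ac)
  then show ?thesis
    unfolding A B c by (simp add: algebra_simps) (simp add: field_simps)?
qed

text \<open>The polynomial with roots z i, expanded at the point 1. This point is a singularity of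
  the differential operator, which makes the recursion of the coefficients two-term, and the
  constant coefficient is the product of the 1 - z i.\<close>

definition refl_poly :: "nat \<Rightarrow> (nat \<Rightarrow> real) \<Rightarrow> real poly" where
  "refl_poly n z = (\<Prod>i<n. [:1 - z i, 1:])"

lemma poly_refl_poly: "poly (refl_poly n z) u = rest_prod u n {} z"
  by (simp add: refl_poly_def rest_prod_def poly_prod algebra_simps)

lemma poly_pderiv_refl_poly: "poly (pderiv (refl_poly n z)) u = (\<Sum>i<n. rest_prod u n {i} z)"
  by (simp add: refl_poly_def rest_prod_def poly_prod pderiv_prod poly_sum pderiv_pCons algebra_simps)

lemma sum_symmetric_index_pairs:
  fixes F :: "nat \<Rightarrow> nat \<Rightarrow> real"
  assumes "\<And>i j. F i j = F j i"
  shows "(\<Sum>i<n. \<Sum>j\<in>{..<n} - {i}. F i j) = 2 * (\<Sum>p\<in>index_pairs n. F (fst p) (snd p))"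
proof -
  have "(\<Sum>i<n. \<Sum>j\<in>{..<n} - {i}. F i j) = (\<Sum>i<n. (\<Sum>j<i. F i j) + (\<Sum>j\<in>{i<..<n}. F i j))"
  proof (intro sum.cong refl)
    fix i assume "i \<in> {..<n}"
    then have eq: "{..<n} - {i} = {..<i} \<union> {i<..<n}" by auto
    show "(\<Sum>j\<in>{..<n} - {i}. F i j) = (\<Sum>j<i. F i j) + (\<Sum>j\<in>{i<..<n}. F i j)"
      unfolding eq by (rule sum.union_disjoint) auto
  qed
  also have "\<dots> = (\<Sum>i<n. \<Sum>j<i. F i j) + (\<Sum>i<n. \<Sum>j\<in>{i<..<n}. F i j)" by (simp add: sum.distrib)
  also have "(\<Sum>i<n. \<Sum>j\<in>{i<..<n}. F i j) = (\<Sum>j<n. \<Sum>i<j. F i j)"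
  proof -
    have "(\<Sum>i<n. \<Sum>j\<in>{i<..<n}. F i j) = (\<Sum>i<n. \<Sum>j | j \<in> {..<n} \<and> i < j. F i j)"
      by (intro sum.cong) auto
    also have "\<dots> = (\<Sum>j<n. \<Sum>i | i \<in> {..<n} \<and> i < j. F i j)" by (rule sum.swap_restrict) auto
    also have "\<dots> = (\<Sum>j<n. \<Sum>i<j. F i j)" by (intro sum.cong) auto
    finally show ?thesis .
  qed
  also have "(\<Sum>j<n. \<Sum>i<j. F i j) = (\<Sum>j<n. \<Sum>i<j. F j i)" using assms by simp
  finally show ?thesis by (simp add: index_pairs_def sum.Sigma split_beta)
qed

lemma poly_pderiv2_refl_poly:
  "poly (pderiv (pderiv (refl_poly n z))) u = 2 * (\<Sum>p\<in>index_pairs n. rest_prod u n {fst p, snd p} z)"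
proof -
  have d: "pderiv (\<Prod>j\<in>A. [:1 - z j, 1:]) = (\<Sum>i\<in>A. \<Prod>j\<in>A - {i}. [:1 - z j, 1:])" for A
    by (simp add: pderiv_prod pderiv_pCons)
  have ds: "pderiv (sum f A) = (\<Sum>a\<in>A. pderiv (f a))" for f :: "nat \<Rightarrow> real poly" and A
    by (induction A rule: infinite_finite_induct) (auto simp: pderiv_add)
  have "pderiv (pderiv (refl_poly n z)) = (\<Sum>i<n. \<Sum>j\<in>{..<n} - {i}. \<Prod>k\<in>{..<n} - {i} - {j}. [:1 - z k, 1:])"
    by (simp add: refl_poly_def d ds)
  then have "poly (pderiv (pderiv (refl_poly n z))) u = (\<Sum>i<n. \<Sum>j\<in>{..<n} - {i}. rest_prod u n {i, j} z)"
    by (simp add: poly_sum poly_prod rest_prod_def Diff_insert[symmetric] insert_commute algebra_simps)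
  also have "\<dots> = 2 * (\<Sum>p\<in>index_pairs n. rest_prod u n {fst p, snd p} z)"
    by (rule sum_symmetric_index_pairs) (simp add: insert_commute)
  finally show ?thesis .
qed

lemma refl_poly_Suc: "refl_poly (Suc n) z = [:1 - z n, 1:] * refl_poly n z"
  by (simp add: refl_poly_def mult.commute)

lemma coeff_refl_poly_top: "coeff (refl_poly n z) n = 1"
  and degree_refl_poly: "degree (refl_poly n z) = n"
proof -
  have "refl_poly n z \<noteq> 0 \<and> degree (refl_poly n z) = n \<and> lead_coeff (refl_poly n z) = 1"
  proof (induction n)
    case (Suc n)
    then show ?case unfolding refl_poly_Suc
      by (subst degree_mult_eq) (auto simp: lead_coeff_mult simp del: mult_pCons_left)
  qed (simp add: refl_poly_def)
  then show "coeff (refl_poly n z) n = 1" "degree (refl_poly n z) = n" by auto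
qed

lemma continuous_coeff_refl_poly: "continuous_on S (\<lambda>z. coeff (refl_poly n z) k)"
proof (induction n arbitrary: k)
  case 0
  then show ?case by (simp add: refl_poly_def)
next
  case (Suc n)
  have "coeff (refl_poly (Suc n) z) k = (1 - z n) * coeff (refl_poly n z) k + (if k = 0 then 0 else coeff (refl_poly n z) (k - 1))" for z
    by (cases k) (simp_all add: refl_poly_Suc)
  moreover have "continuous_on S (\<lambda>z. (1 - z n) * coeff (refl_poly n z) k + (if k = 0 then 0 else coeff (refl_poly n z) (k - 1)))"
    using Suc by (cases k) (auto intro!: continuous_intros)
  ultimately show ?case by simp
qed

lemma continuous_vdm: "continuous_on S (vdm n)"
  unfolding vdm_pairs[abs_def] by (intro continuous_intros)

text \<open>Two values matter: k = n gives the integral of the Vandermonde product itself, and k = 0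
  is what this integral in dimension n + 1 leaves once the largest variable has been scaled to 1.
  The recursion in k links the two.\<close>

definition aomoto_coeff :: "nat \<Rightarrow> nat \<Rightarrow> real" where
  "aomoto_coeff n k = (LINT z|coord_measure n. indicator {z. ordered_tuple n 0 1 z} z * (vdm n z * coeff (refl_poly n z) k))"

lemma aomoto_recursion:
  "(real n * (real n + 3) - real k * (real k + 3)) * aomoto_coeff n k = (real k + 1) * (real k + 2) * aomoto_coeff n (Suc k)"
proof -
  define Om where "Om = {z. ordered_tuple n 0 1 z}"
  \<comment> \<open>The operator found for the divergence. By \<open>Lc\<close> it couples only the
    coefficients k and k + 1.\<close>
  define L where "L = (\<lambda>z. smult (real n * (real n + 3) / 2) (refl_poly n z) - [:1, 2:] * pderiv (refl_poly n z)
      - smult (1/2) ([:0, 1, 1:] * pderiv (pderiv (refl_poly n z))))"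
  have Lc: "coeff (L z) k = ((real n * (real n + 3) - real k * (real k + 3)) / 2) * coeff (refl_poly n z) k
      - (real k + 1) * (real k + 2) / 2 * coeff (refl_poly n z) (Suc k)" for z k
  proof -
    have "coeff (L z) k = real n * (real n + 3) / 2 * coeff (refl_poly n z) k
      - ((real k + 1) * coeff (refl_poly n z) (Suc k) + 2 * (real k * coeff (refl_poly n z) k))
      - (1/2) * ((real k + 1) * real k * coeff (refl_poly n z) (Suc k) + real k * (real k - 1) * coeff (refl_poly n z) k)"
    proof -
      consider "k = 0" | "k = 1" | j where "k = Suc (Suc j)" by (metis One_nat_def not0_implies_Suc)
      then show ?thesis
        by cases (simp_all add: L_def coeff_pderiv algebra_simps)
    qed
    also have "\<dots> = ((real n * (real n + 3) - real k * (real k + 3)) / 2) * coeff (refl_poly n z) k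
      - (real k + 1) * (real k + 2) / 2 * coeff (refl_poly n z) (Suc k)"
      by (simp add: field_simps)
    finally show ?thesis .
  qed
  have cL: "continuous_on UNIV (\<lambda>z. vdm n z * coeff (L z) k)" for k
    unfolding Lc by (intro continuous_intros continuous_vdm continuous_coeff_refl_poly)
  define c where "c = (\<lambda>k. LINT z|coord_measure n. indicator Om z * (vdm n z * coeff (L z) k))"
  have dL: "degree (L z) \<le> n" for z
    by (rule degree_le) (auto simp: Lc coeff_eq_0 degree_refl_poly)
  \<comment> \<open>At every u this value is the integral of a divergence and hence zero, so all
    coefficients \<open>c k\<close> vanish.\<close>
  have "poly (\<Sum>k\<le>n. monom (c k) k) u = 0" for u
  proof -
    have "poly (L z) u * vdm n z = (\<Sum>i<n. aomoto_deriv u n i z)" for z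
      unfolding sum_aomoto_deriv L_def
      by (simp add: poly_refl_poly poly_pderiv_refl_poly poly_pderiv2_refl_poly algebra_simps)
    then have "(LINT z|coord_measure n. indicator Om z * (vdm n z * poly (L z) u)) =
        (LINT z|coord_measure n. (\<Sum>i<n. indicator Om z * aomoto_deriv u n i z))"
      by (intro Bochner_Integration.integral_cong) (auto simp: sum_distrib_left[symmetric] mult.commute)
    also have "\<dots> = (\<Sum>i<n. LINT z|coord_measure n. indicator Om z * aomoto_deriv u n i z)"
      unfolding Om_def by (intro Bochner_Integration.integral_sum integrable_ordered_tuple continuous_aomoto_deriv)
    also have "\<dots> = 0" unfolding Om_def by (simp add: integral_aomoto_deriv)
    finally have "(LINT z|coord_measure n. indicator Om z * (vdm n z * poly (L z) u)) = 0" .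
    moreover have "indicator Om z * (vdm n z * poly (L z) u) =
        (\<Sum>k\<le>n. (indicator Om z * (vdm n z * coeff (L z) k)) * u ^ k)" for z
    proof -
      have "poly (L z) u = (\<Sum>k\<le>n. coeff (L z) k * u ^ k)"
        unfolding poly_altdef by (rule sum.mono_neutral_left) (use dL[of z] in \<open>auto simp: coeff_eq_0\<close>)
      then show ?thesis by (simp add: sum_distrib_left mult_ac)
    qed
    moreover have "(LINT z|coord_measure n. (\<Sum>k\<le>n. (indicator Om z * (vdm n z * coeff (L z) k)) * u ^ k)) = (\<Sum>k\<le>n. c k * u ^ k)"
      unfolding c_def Om_def
      by (subst Bochner_Integration.integral_sum)
        (auto intro!: integrable_mult_left integrable_ordered_tuple cL)
    ultimately have "(\<Sum>k\<le>n. c k * u ^ k) = 0" by simp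
    then show ?thesis by (simp add: poly_sum poly_monom)
  qed
  then have "(\<Sum>k\<le>n. monom (c k) k) = 0" using poly_all_0_iff_0 by blast
  then have coeff0: "coeff (\<Sum>k\<le>n. monom (c k) k) k = 0" for k by simp
  have c0: "c k = 0" if "k \<le> n" for k
    using coeff0[of k] that by (simp add: coeff_sum)
  show ?thesis
  proof (cases "k \<le> n")
    case True
    have "c k = ((real n * (real n + 3) - real k * (real k + 3)) / 2) * aomoto_coeff n k - (real k + 1) * (real k + 2) / 2 * aomoto_coeff n (Suc k)"
    proof -
      have "c k = (LINT z|coord_measure n. ((real n * (real n + 3) - real k * (real k + 3)) / 2) * (indicator Om z * (vdm n z * coeff (refl_poly n z) k))
          - (real k + 1) * (real k + 2) / 2 * (indicator Om z * (vdm n z * coeff (refl_poly n z) (Suc k))))"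
        unfolding c_def Lc by (intro Bochner_Integration.integral_cong) (auto simp: algebra_simps)
      also have "\<dots> = ((real n * (real n + 3) - real k * (real k + 3)) / 2) * aomoto_coeff n k - (real k + 1) * (real k + 2) / 2 * aomoto_coeff n (Suc k)"
        unfolding aomoto_coeff_def Om_def
        by (subst Bochner_Integration.integral_diff)
          (auto intro!: integrable_mult_right integrable_ordered_tuple continuous_intros continuous_vdm continuous_coeff_refl_poly)
      finally show ?thesis .
    qed
    then show ?thesis using c0[OF True] by (simp add: field_simps)
  next
    case False
    then have "coeff (refl_poly n z) k = 0" "coeff (refl_poly n z) (Suc k) = 0" for z
      by (auto intro!: coeff_eq_0 simp: degree_refl_poly)
    then show ?thesis by (simp add: aomoto_coeff_def)
  qed
qed

text \<open>The recursion is solved downwards from k = n, using n(n+3) - k(k+3) = (n-k)(n+k+3),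
  which is nonzero for k < n.\<close>

lemma aomoto_coeff_closed:
  assumes "k \<le> n"
  shows "aomoto_coeff n k = (fact n * fact (n + 1) * fact (n + k + 2)) /
    (fact k * fact (k + 1) * fact (n - k) * fact (2 * n + 2)) * aomoto_coeff n n"
  using assms
proof (induction k rule: inc_induct)
  case base
  have e: "n + n + 2 = 2 * n + 2" by simp
  have gen: "x = A * B * C / (A * B * fact 0 * C) * x" if "A \<noteq> 0" "B \<noteq> 0" "C \<noteq> 0" for A B C x :: real
    using that by simp
  show ?case unfolding e diff_self_eq_0 by (rule gen) (rule fact_nonzero)+
next
  case (step k)
  have nz: "real n * (real n + 3) - real k * (real k + 3) = (real n - real k) * (real n + real k + 3)"
    by (simp add: algebra_simps)
  have pos: "real n - real k > 0" using step by simp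
  obtain d where d: "n = Suc (k + d)" using step(2) less_imp_Suc_add by blast
  have "(real n - real k) * (real n + real k + 3) * aomoto_coeff n k = (real k + 1) * (real k + 2) * aomoto_coeff n (Suc k)"
    using aomoto_recursion[of n k] by (simp only: nz)
  then have "aomoto_coeff n k = (real k + 1) * (real k + 2) / ((real n - real k) * (real n + real k + 3)) * aomoto_coeff n (Suc k)"
  proof -
    have "a = c / b * e" if "b * a = c * e" "b \<noteq> 0" for a b c e :: real using that by (simp add: field_simps)
    moreover have "(real n - real k) * (real n + real k + 3) \<noteq> 0" using pos by simp
    ultimately show ?thesis using \<open>(real n - real k) * (real n + real k + 3) * aomoto_coeff n k = _\<close> by blast
  qed
  also have "\<dots> = (real k + 1) * (real k + 2) / ((real n - real k) * (real n + real k + 3)) *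
     ((fact n * fact (n + 1) * fact (n + Suc k + 2)) / (fact (Suc k) * fact (Suc k + 1) * fact (n - Suc k) * fact (2 * n + 2)) * aomoto_coeff n n)"
    using step.IH by simp
  also have "\<dots> = (fact n * fact (n + 1) * fact (n + k + 2)) /
    (fact k * fact (k + 1) * fact (n - k) * fact (2 * n + 2)) * aomoto_coeff n n"
  proof -
    have "n + Suc k + 2 = Suc (n + k + 2)" "Suc k + 1 = Suc (k + 1)" by simp_all
    then have f1: "(fact (n + Suc k + 2) :: real) = (real n + real k + 3) * fact (n + k + 2)"
      and f2: "(fact (Suc k) :: real) = (real k + 1) * fact k" "(fact (Suc k + 1) :: real) = (real k + 2) * fact (k + 1)"
      by (simp_all only: fact_Suc) simp_all
    have "n - k = Suc (n - Suc k)" using d by simp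
    then have f3: "(fact (n - k) :: real) = (real n - real k) * fact (n - Suc k)"
      using d by (simp only: fact_Suc) simp
    have gen: "r1 * r2 / (r3 * r4) * (A * B * (r4 * C) / (r1 * D * (r2 * E) * F * G) * x) =
        A * B * C / (D * E * (r3 * F) * G) * x"
      if "r1 \<noteq> 0" "r2 \<noteq> 0" "r3 \<noteq> 0" "r4 \<noteq> 0" for r1 r2 r3 r4 A B C D E F G x :: real
      using that by (simp add: mult_ac)
    have "real k + 1 \<noteq> 0" "real k + 2 \<noteq> 0" "real n + real k + 3 \<noteq> 0" by linarith+
    then show ?thesis
      unfolding f1 f2 f3 using pos by (intro gen) simp_all
  qed
  finally show ?case .
qed

text \<open>Selberg's integral of the absolute value of the Vandermonde product over the unit cube,
  divided by n! as only ordered tuples are counted.\<close>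

definition ordered_vol :: "nat \<Rightarrow> real" where
  "ordered_vol n = (\<Prod>k<n. (fact k)\<^sup>2 / fact (2 * k + 1))"

lemma ordered_vol_pos: "ordered_vol n > 0"
  unfolding ordered_vol_def by (intro prod_pos) auto

lemma nn_integral_ordered_real:
  assumes f: "continuous_on UNIV f" and pos: "\<And>z. ordered_tuple n a b z \<Longrightarrow> f z \<ge> 0"
  shows "(\<integral>\<^sup>+z. indicator {z. ordered_tuple n a b z} z * ennreal (f z) \<partial>coord_measure n) =
    ennreal (LINT z|coord_measure n. indicator {z. ordered_tuple n a b z} z * f z)"
proof -
  have "(\<integral>\<^sup>+z. indicator {z. ordered_tuple n a b z} z * ennreal (f z) \<partial>coord_measure n) =
    (\<integral>\<^sup>+z. ennreal (indicator {z. ordered_tuple n a b z} z * f z) \<partial>coord_measure n)"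
    by (intro nn_integral_cong) (auto simp: indicator_def)
  also have "\<dots> = ennreal (LINT z|coord_measure n. indicator {z. ordered_tuple n a b z} z * f z)"
  proof (rule nn_integral_eq_integral)
    show "integrable (coord_measure n) (\<lambda>z. indicator {z. ordered_tuple n a b z} z * f z)"
      by (rule integrable_ordered_tuple[OF f])
  qed (use pos in \<open>simp add: indicator_def\<close>)
  finally show ?thesis .
qed

lemma aomoto_coeff_top:
  "ennreal (aomoto_coeff n n) = (\<integral>\<^sup>+z. indicator {z. ordered_tuple n 0 1 z} z * ennreal (vdm n z) \<partial>coord_measure n)"
  unfolding aomoto_coeff_def coeff_refl_poly_top
  by (subst nn_integral_ordered_real) (auto intro: continuous_vdm vdm_nonneg)

lemma coeff_refl_poly_0: "coeff (refl_poly n z) 0 = (\<Prod>i<n. 1 - z i)"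
  by (simp add: refl_poly_def poly_0_coeff_0[symmetric] poly_prod)

lemma prod_reflect_nonneg: "ordered_tuple n a b z \<Longrightarrow> b \<le> x \<Longrightarrow> (\<Prod>i<n. x - z i) \<ge> 0"
  by (intro prod_nonneg) (force simp: ordered_tuple_def)

lemma aomoto_coeff_bot:
  "ennreal (aomoto_coeff n 0) =
    (\<integral>\<^sup>+z. indicator {z. ordered_tuple n 0 1 z} z * ennreal (vdm n z * (\<Prod>i<n. 1 - z i)) \<partial>coord_measure n)"
proof -
  have "continuous_on UNIV (\<lambda>z. vdm n z * (\<Prod>i<n. 1 - z i))"
    using continuous_vdm by (intro continuous_intros)
  then show ?thesis
    unfolding aomoto_coeff_def coeff_refl_poly_0
    by (subst nn_integral_ordered_real) (auto intro!: mult_nonneg_nonneg vdm_nonneg prod_reflect_nonneg)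
qed

lemma aomoto_coeff_nonneg: "aomoto_coeff n 0 \<ge> 0" "aomoto_coeff n n \<ge> 0"
proof -
  have "0 \<le> indicator {z. ordered_tuple n 0 1 z} z * (vdm n z * (\<Prod>i<n. 1 - z i))"
    "0 \<le> indicator {z. ordered_tuple n 0 1 z} z * (vdm n z * 1)" for z
    using vdm_nonneg[of n 0 1 z] prod_reflect_nonneg[of n 0 1 z 1]
    by (cases "ordered_tuple n 0 1 z"; simp)+
  then show "aomoto_coeff n 0 \<ge> 0" "aomoto_coeff n n \<ge> 0"
    unfolding aomoto_coeff_def coeff_refl_poly_0 coeff_refl_poly_top
    by (auto intro!: integral_nonneg_AE AE_I2)
qed

lemma ordered_tuple_scale:
  assumes "k > 0"
  shows "ordered_tuple n (a + k * l) (a + k * h) (\<lambda>i. if i < n then a + k * z i else 0) \<longleftrightarrow> ordered_tuple n l h z"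
proof -
  have "(i < j \<and> j < n \<longrightarrow> (if i < n then a + k * z i else 0) \<le> (if j < n then a + k * z j else 0)) \<longleftrightarrow>
      (i < j \<and> j < n \<longrightarrow> z i \<le> z j)" for i j
    using assms by auto
  moreover have "(i < n \<longrightarrow> a + k * l \<le> (if i < n then a + k * z i else 0) \<and> (if i < n then a + k * z i else 0) \<le> a + k * h) \<longleftrightarrow>
      (i < n \<longrightarrow> l \<le> z i \<and> z i \<le> h)" for i
    using assms by auto
  ultimately show ?thesis unfolding ordered_tuple_def by presburger
qed

lemma ordered_vdm_scale:
  assumes "k > 0"
  shows "(\<integral>\<^sup>+z. indicator {z. ordered_tuple n (a + k * l) (a + k * h) z} z * ennreal (vdm n z) \<partial>coord_measure n) =
    ennreal (k ^ (n + card (index_pairs n))) *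
      (\<integral>\<^sup>+z. indicator {z. ordered_tuple n l h z} z * ennreal (vdm n z) \<partial>coord_measure n)"
proof -
  have "(\<integral>\<^sup>+z. indicator {z. ordered_tuple n (a + k * l) (a + k * h) z} z * ennreal (vdm n z) \<partial>coord_measure n) =
    ennreal (k ^ n) * (\<integral>\<^sup>+z. indicator {z. ordered_tuple n (a + k * l) (a + k * h) z} (\<lambda>i. if i < n then a + k * z i else 0) *
      ennreal (vdm n (\<lambda>i. if i < n then a + k * z i else 0)) \<partial>coord_measure n)"
    by (rule nn_integral_coord_affine[OF _ assms]) measurable
  also have "(\<integral>\<^sup>+z. indicator {z. ordered_tuple n (a + k * l) (a + k * h) z} (\<lambda>i. if i < n then a + k * z i else 0) *
      ennreal (vdm n (\<lambda>i. if i < n then a + k * z i else 0)) \<partial>coord_measure n) =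
      (\<integral>\<^sup>+z. ennreal (k ^ card (index_pairs n)) * (indicator {z. ordered_tuple n l h z} z * ennreal (vdm n z)) \<partial>coord_measure n)"
  proof (rule nn_integral_cong)
    fix z
    have "ennreal (k ^ card (index_pairs n) * vdm n z) = ennreal (k ^ card (index_pairs n)) * ennreal (vdm n z)"
      using assms by (intro ennreal_mult') simp
    then show "indicator {z. ordered_tuple n (a + k * l) (a + k * h) z} (\<lambda>i. if i < n then a + k * z i else 0) *
      ennreal (vdm n (\<lambda>i. if i < n then a + k * z i else 0)) =
      ennreal (k ^ card (index_pairs n)) * (indicator {z. ordered_tuple n l h z} z * ennreal (vdm n z))"
      unfolding vdm_scale using ordered_tuple_scale[OF assms, of n a l h z]
      by (simp add: indicator_def)
  qed
  also have "\<dots> = ennreal (k ^ card (index_pairs n)) *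
      (\<integral>\<^sup>+z. indicator {z. ordered_tuple n l h z} z * ennreal (vdm n z) \<partial>coord_measure n)"
    by (rule nn_integral_cmult) measurable
  finally show ?thesis using assms by (simp add: power_add ennreal_mult mult.assoc)
qed

text \<open>Scaling the variables by x gives x^n from the measure, x^n from the product and
  x^(n(n-1)/2) from the Vandermonde product.\<close>

lemma ordered_vdm_prod_scale:
  assumes "x > 0"
  shows "(\<integral>\<^sup>+z. indicator {z. ordered_tuple n 0 x z} z * ennreal (vdm n z * (\<Prod>i<n. x - z i)) \<partial>coord_measure n) =
    ennreal (x ^ (2 * n + card (index_pairs n)) * aomoto_coeff n 0)"
proof -
  let ?f = "\<lambda>z i. if i < n then 0 + x * z i else (0 :: real)"
  have "(\<integral>\<^sup>+z. indicator {z. ordered_tuple n 0 x z} z * ennreal (vdm n z * (\<Prod>i<n. x - z i)) \<partial>coord_measure n) =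
    ennreal (x ^ n) * (\<integral>\<^sup>+z. indicator {z. ordered_tuple n 0 x z} (?f z) *
      ennreal (vdm n (?f z) * (\<Prod>i<n. x - ?f z i)) \<partial>coord_measure n)"
    by (rule nn_integral_coord_affine[OF _ assms]) measurable
  also have "(\<integral>\<^sup>+z. indicator {z. ordered_tuple n 0 x z} (?f z) *
      ennreal (vdm n (?f z) * (\<Prod>i<n. x - ?f z i)) \<partial>coord_measure n) =
      (\<integral>\<^sup>+z. ennreal (x ^ (n + card (index_pairs n))) *
        (indicator {z. ordered_tuple n 0 1 z} z * ennreal (vdm n z * (\<Prod>i<n. 1 - z i))) \<partial>coord_measure n)"
  proof (intro nn_integral_cong)
    fix z
    have i: "indicator {z. ordered_tuple n 0 x z} (?f z) = (indicator {z. ordered_tuple n 0 1 z} z :: ennreal)"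
      using ordered_tuple_scale[OF assms, of n 0 0 1 z] by (simp add: indicator_def)
    have "(\<Prod>i<n. x - ?f z i) = (\<Prod>i<n. x * (1 - z i))"
      by (intro prod.cong) (auto simp: algebra_simps)
    then have p: "(\<Prod>i<n. x - ?f z i) = x ^ n * (\<Prod>i<n. 1 - z i)"
      by (simp add: prod.distrib)
    have "vdm n (?f z) * (\<Prod>i<n. x - ?f z i) = x ^ (n + card (index_pairs n)) * (vdm n z * (\<Prod>i<n. 1 - z i))"
      unfolding vdm_scale p by (simp add: power_add)
    moreover have "ennreal (x ^ (n + card (index_pairs n)) * (vdm n z * (\<Prod>i<n. 1 - z i))) =
        ennreal (x ^ (n + card (index_pairs n))) * ennreal (vdm n z * (\<Prod>i<n. 1 - z i))"
      using assms by (intro ennreal_mult') simp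
    ultimately show "indicator {z. ordered_tuple n 0 x z} (?f z) * ennreal (vdm n (?f z) * (\<Prod>i<n. x - ?f z i)) =
      ennreal (x ^ (n + card (index_pairs n))) *
        (indicator {z. ordered_tuple n 0 1 z} z * ennreal (vdm n z * (\<Prod>i<n. 1 - z i)))"
      unfolding i by (simp add: indicator_def)
  qed
  also have "\<dots> = ennreal (x ^ (n + card (index_pairs n))) * ennreal (aomoto_coeff n 0)"
    unfolding aomoto_coeff_bot by (rule nn_integral_cmult) measurable
  moreover have e: "2 * n + card (index_pairs n) = n + (n + card (index_pairs n))" by simp
  ultimately show ?thesis
    unfolding e power_add[of x n] using assms aomoto_coeff_nonneg[of n]
    by (simp add: ennreal_mult'[symmetric] mult.assoc)
qed

lemma nn_integral_power_Icc:
  assumes "a \<ge> 0" "c \<ge> 0" "a \<le> b"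
  shows "(\<integral>\<^sup>+x. indicator {a..b} x * ennreal (c * x ^ k) \<partial>lborel) = ennreal (c * (b ^ Suc k - a ^ Suc k) / real (Suc k))"
proof -
  have "(\<integral>\<^sup>+x. indicator {a..b} x * ennreal (c * x ^ k) \<partial>lborel) = (\<integral>\<^sup>+x. ennreal (c * x ^ k) * indicator {a..b} x \<partial>lborel)"
    by (simp add: mult.commute)
  also have "\<dots> = ennreal (c * b ^ Suc k / real (Suc k) - c * a ^ Suc k / real (Suc k))"
  proof (rule nn_integral_FTC_Icc)
    fix x assume "x \<in> {a..b}"
    then show "0 \<le> c * x ^ k" using assms by auto
    show "((\<lambda>x. c * x ^ Suc k / real (Suc k)) has_real_derivative c * x ^ k) (at x)"
      by (auto intro!: derivative_eq_intros simp del: power_Suc)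
  qed (use assms in auto)
  finally show ?thesis by (simp add: diff_divide_distrib right_diff_distrib)
qed

text \<open>With the largest variable x fixed, scaling the others leaves x^e times
  \<open>aomoto_coeff n 0\<close>. The integral of x^e over the unit interval is 1/(e+1) =
  2/((n+1)(n+2)).\<close>

lemma aomoto_coeff_Suc:
  "aomoto_coeff (Suc n) (Suc n) = 2 / ((real n + 1) * (real n + 2)) * aomoto_coeff n 0"
proof -
  define e where "e = 2 * n + card (index_pairs n)"
  have "real (Suc e) = (real n + 1) * (real n + 2) / 2"
    using card_index_pairs[of n] by (simp add: e_def algebra_simps)
  have "ennreal (aomoto_coeff (Suc n) (Suc n)) =
    (\<integral>\<^sup>+x. \<integral>\<^sup>+z. indicator {z. ordered_tuple (Suc n) 0 1 z} (z(n := x)) * ennreal (vdm (Suc n) (z(n := x))) \<partial>coord_measure n \<partial>lborel)"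
    unfolding aomoto_coeff_top by (rule nn_integral_coord_Suc) measurable
  also have "\<dots> = (\<integral>\<^sup>+x. indicator {0..1} x * ennreal (aomoto_coeff n 0 * x ^ e) \<partial>lborel)"
  proof (rule nn_integral_cong_AE)
    \<comment> \<open>The scaling requires x > 0.\<close>
    have "AE x in lborel. x \<noteq> (0::real)" by (rule AE_lborel_singleton)
    then show "AE x in lborel. (\<integral>\<^sup>+z. indicator {z. ordered_tuple (Suc n) 0 1 z} (z(n := x)) * ennreal (vdm (Suc n) (z(n := x))) \<partial>coord_measure n) =
      indicator {0..1} x * ennreal (aomoto_coeff n 0 * x ^ e)"
    proof (rule eventually_mono)
      fix x :: real assume "x \<noteq> 0"
      have oc: "ordered_tuple (Suc n) 0 1 (z(n := x)) \<longleftrightarrow> 0 \<le> x \<and> x \<le> 1 \<and> ordered_tuple n 0 x z" for z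
        using ordered_tuple_cong[of n z "z(n := x)" 0 x] by (simp add: ordered_tuple_Suc)
      show "(\<integral>\<^sup>+z. indicator {z. ordered_tuple (Suc n) 0 1 z} (z(n := x)) * ennreal (vdm (Suc n) (z(n := x))) \<partial>coord_measure n) =
        indicator {0..1} x * ennreal (aomoto_coeff n 0 * x ^ e)"
      proof (cases "0 \<le> x \<and> x \<le> 1")
        case True
        with \<open>x \<noteq> 0\<close> have "x > 0" by simp
        have "vdm (Suc n) (z(n := x)) = vdm n z * (\<Prod>i<n. x - z i)" for z
        proof -
          have "(\<Prod>i<n. (z(n := x)) n - (z(n := x)) i) = (\<Prod>i<n. x - z i)" by (intro prod.cong) auto
          then show ?thesis by (simp only: vdm_Suc vdm_upd)
        qed
        then have "(\<integral>\<^sup>+z. indicator {z. ordered_tuple (Suc n) 0 1 z} (z(n := x)) * ennreal (vdm (Suc n) (z(n := x))) \<partial>coord_measure n) =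
          (\<integral>\<^sup>+z. indicator {z. ordered_tuple n 0 x z} z * ennreal (vdm n z * (\<Prod>i<n. x - z i)) \<partial>coord_measure n)"
          using True by (intro nn_integral_cong) (simp add: indicator_def oc del: fun_upd_apply)
        then show ?thesis
          using ordered_vdm_prod_scale[OF \<open>x > 0\<close>, of n] True by (simp add: e_def mult.commute)
      qed (auto simp: oc indicator_def simp del: fun_upd_apply)
    qed
  qed
  also have "\<dots> = ennreal (aomoto_coeff n 0 * (1 ^ Suc e - 0 ^ Suc e) / real (Suc e))"
    using aomoto_coeff_nonneg[of n] by (intro nn_integral_power_Icc) auto
  finally have "aomoto_coeff (Suc n) (Suc n) = aomoto_coeff n 0 / real (Suc e)"
    using aomoto_coeff_nonneg[of n] aomoto_coeff_nonneg[of "Suc n"] by (subst (asm) ennreal_inj) auto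
  also have "\<dots> = aomoto_coeff n 0 / ((real n + 1) * (real n + 2) / 2)"
    by (simp only: \<open>real (Suc e) = _\<close>)
  finally show ?thesis by simp
qed

text \<open>The closed form at k = 0 followed by the step to dimension n + 1 multiplies the value by
  (n!)^2 / (2n+1)!.\<close>

lemma aomoto_coeff_eq_ordered_vol: "aomoto_coeff n n = ordered_vol n"
proof (induction n)
  case 0
  have "ennreal (aomoto_coeff 0 0) = 1"
    unfolding aomoto_coeff_top by (subst nn_integral_coord_0) (auto simp: ordered_tuple_def vdm_def)
  then show ?case by (simp add: ordered_vol_def)
next
  case (Suc n)
  have "2 * n + 2 = Suc (2 * n + 1)" "n + 1 = Suc n" "n + 2 = Suc (Suc n)" by simp_all
  then have f: "(fact (2 * n + 2) :: real) = 2 * (real n + 1) * fact (2 * n + 1)"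
      "(fact (n + 1) :: real) = (real n + 1) * fact n" "(fact (n + 2) :: real) = (real n + 2) * ((real n + 1) * fact n)"
    by (simp_all only: fact_Suc) (simp_all add: add.commute)
  have "real n + 1 \<noteq> 0" "real n + 2 \<noteq> 0" by linarith+
  moreover have "2 / (N * M) * ((A * (N * A) * (M * (N * A))) / (A * (2 * N * B)) * x) = A\<^sup>2 / B * x"
    if "A \<noteq> 0" "N \<noteq> 0" "M \<noteq> 0" for A B N M x :: real
    using that by (simp add: power2_eq_square mult_ac)
  ultimately have gen: "2 / ((real n + 1) * (real n + 2)) * ((A * ((real n + 1) * A) * ((real n + 2) * ((real n + 1) * A))) /
      (A * (2 * (real n + 1) * B)) * x) = A\<^sup>2 / B * x" if "A \<noteq> 0" for A B x :: real
    using that by blast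
  have "aomoto_coeff n 0 = (fact n * fact (n + 1) * fact (n + 2)) / (fact n * fact (2 * n + 2)) * aomoto_coeff n n"
    using aomoto_coeff_closed[of 0 n] by (simp only: fact_0 fact_1 diff_zero add_0_left mult_1_left add_0_right le0)
  then have "aomoto_coeff (Suc n) (Suc n) = 2 / ((real n + 1) * (real n + 2)) *
      ((fact n * fact (n + 1) * fact (n + 2)) / (fact n * fact (2 * n + 2)) * aomoto_coeff n n)"
    by (simp only: aomoto_coeff_Suc)
  also have "\<dots> = (fact n)\<^sup>2 / fact (2 * n + 1) * aomoto_coeff n n"
    unfolding f by (rule gen) (rule fact_nonzero)
  finally show ?case using Suc by (simp add: ordered_vol_def mult.commute)
qed

section \<open>Volume of the region of trace polynomials\<close>

text \<open>The length 4 of the interval [-2, 2] enters with exponent n + n(n-1)/2, whence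
  2^(n(n+1)).\<close>

definition disc_vol :: "nat \<Rightarrow> real" where
  "disc_vol n = 2 ^ (n * (n + 1)) * ordered_vol n"

lemma emeasure_root_region: "emeasure (coord_measure n) (root_region n (-2) 2) = ennreal (disc_vol n)"
proof -
  have "2 * (n + card (index_pairs n)) = n * (n + 1)"
  proof -
    have "real (2 * (n + card (index_pairs n))) = real (n * (n + 1))"
      using card_index_pairs[of n] by (simp add: algebra_simps)
    then show ?thesis by (simp only: of_nat_eq_iff)
  qed
  then have p: "(4::real) ^ (n + card (index_pairs n)) = 2 ^ (n * (n + 1))"
    by (metis num_double numeral_times_numeral power2_eq_square power_mult)
  have "emeasure (coord_measure n) (root_region n (-2) 2) = (\<integral>\<^sup>+c. indicator (root_region n (-2) 2) c * 1 \<partial>coord_measure n)"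
    by simp
  also have "\<dots> = (\<integral>\<^sup>+z. indicator {z. ordered_tuple n (-2) 2 z} z * (ennreal (vdm n z) * 1) \<partial>coord_measure n)"
    by (rule nn_integral_root_region) measurable
  also have "\<dots> = (\<integral>\<^sup>+z. indicator {z. ordered_tuple n (-2 + 4 * 0) (-2 + 4 * 1) z} z * ennreal (vdm n z) \<partial>coord_measure n)"
    by simp
  also have "\<dots> = ennreal (4 ^ (n + card (index_pairs n))) * ennreal (aomoto_coeff n n)"
    unfolding aomoto_coeff_top by (rule ordered_vdm_scale) simp
  finally show ?thesis
    using ordered_vol_pos[of n] by (simp add: p aomoto_coeff_eq_ordered_vol disc_vol_def ennreal_mult')
qed

definition salem_region :: "nat \<Rightarrow> real \<Rightarrow> (nat \<Rightarrow> real) set" where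
  "salem_region n X = {attach_root x s | x s. 2 \<le> x \<and> x \<le> X \<and> s \<in> root_region n (-2) 2}"

lemma compact_salem_region: "compact (salem_region n X)"
proof -
  have "salem_region n X = (\<lambda>p. attach_root (fst p) (snd p)) ` ({2..X} \<times> root_region n (-2) 2)"
    by (force simp: salem_region_def)
  moreover have "compact \<dots>"
    by (intro compact_continuous_image continuous_attach_root compact_Times compact_root_region
        continuous_on_fst continuous_on_snd continuous_on_id compact_Icc)
  ultimately show ?thesis by simp
qed

lemma borel_salem_region [measurable]: "salem_region n X \<in> sets borel"
  by (intro borel_compact compact_salem_region)

lemma emeasure_salem_region:
  "emeasure (coord_measure (Suc n)) (salem_region n X) =
    (\<integral>\<^sup>+x. indicator {2..X} x * (\<integral>\<^sup>+s. indicator (root_region n (-2) 2) s * ennreal \<bar>poly (monic_poly n s) x\<bar> \<partial>coord_measure n) \<partial>lborel)"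
proof -
  define D where "D = {2..X} \<times> root_region n (-2) 2"
  have D [measurable]: "D \<in> sets (borel \<Otimes>\<^sub>M borel)"
    unfolding D_def by measurable
  have G: "salem_region n X = {c. \<exists>x s. supp_below n s \<and> (x, s) \<in> D \<and> c = attach_root x s}"
    unfolding salem_region_def D_def using supp_root_region by fastforce
  have "emeasure (coord_measure (Suc n)) (salem_region n X) =
      (\<integral>\<^sup>+c. indicator (salem_region n X) c * 1 \<partial>coord_measure (Suc n))"
    by (simp del: coord_measure.simps)
  also have "\<dots> = (\<integral>\<^sup>+x. \<integral>\<^sup>+s. indicator D (x, s) * (ennreal \<bar>poly (monic_poly n s) x\<bar> * 1) \<partial>coord_measure n \<partial>lborel)"
    unfolding G
  proof (rule nn_integral_coord_attach_root)
    show "{c. \<exists>x s. supp_below n s \<and> (x, s) \<in> D \<and> c = attach_root x s} \<in> sets borel"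
      unfolding G[symmetric] by measurable
    show "x = x'" if "(x, s) \<in> D" "(x', s') \<in> D" "attach_root x s = attach_root x' s'" for x s x' s'
      using that by (auto simp: D_def intro: attach_root_inj_largest[of s n "-2" 2 _ s' "-2" 2])
  qed measurable
  also have "\<dots> = (\<integral>\<^sup>+x. indicator {2..X} x * (\<integral>\<^sup>+s. indicator (root_region n (-2) 2) s * ennreal \<bar>poly (monic_poly n s) x\<bar> \<partial>coord_measure n) \<partial>lborel)"
  proof (rule nn_integral_cong)
    fix x :: real
    have "indicator D (x, s) = indicator {2..X} x * (indicator (root_region n (-2) 2) s :: ennreal)" for s
      by (simp add: D_def indicator_def)
    then show "(\<integral>\<^sup>+s. indicator D (x, s) * (ennreal \<bar>poly (monic_poly n s) x\<bar> * 1) \<partial>coord_measure n) =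
        indicator {2..X} x * (\<integral>\<^sup>+s. indicator (root_region n (-2) 2) s * ennreal \<bar>poly (monic_poly n s) x\<bar> \<partial>coord_measure n)"
      by (subst nn_integral_cmult[symmetric]) (auto simp: mult.assoc)
  qed
  finally show ?thesis .
qed

text \<open>Only the leading power of X is wanted. For x \<ge> 2 each factor x - z i lies between x
  - 2 and x + 2, so the inner integral is estimated by \<open>disc_vol n\<close> times a power of x
  - 2 or x + 2.\<close>

lemma salem_region_volume:
  assumes "X \<ge> 2"
  shows "emeasure (coord_measure (Suc n)) (salem_region n X) \<le> ennreal (disc_vol n * (X + 2) ^ Suc n / real (Suc n))"
    and "emeasure (coord_measure (Suc n)) (salem_region n X) \<ge> ennreal (disc_vol n * (X - 2) ^ Suc n / real (Suc n))"
proof -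
  have v: "disc_vol n \<ge> 0" using ordered_vol_pos[of n] by (simp add: disc_vol_def)
  have bnd: "(x - 2) ^ n \<le> \<bar>poly (monic_poly n s) x\<bar> \<and> \<bar>poly (monic_poly n s) x\<bar> \<le> (x + 2) ^ n"
    if "x \<ge> 2" "s \<in> root_region n (-2) 2" for x s
  proof -
    obtain z where z: "ordered_tuple n (-2) 2 z" "s = root_coeffs n z"
      using \<open>s \<in> _\<close> by (auto simp: root_region_def)
    have zi: "- 2 \<le> z i \<and> z i \<le> 2" if "i < n" for i using z(1) that by (simp add: ordered_tuple_def)
    have "\<bar>poly (monic_poly n s) x\<bar> = (\<Prod>i<n. x - z i)"
      unfolding z(2) poly_root_coeffs abs_prod using zi \<open>x \<ge> 2\<close> by (intro prod.cong) force+
    moreover have "(\<Prod>i<n. x - 2) \<le> (\<Prod>i<n. x - z i)"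
      using zi \<open>x \<ge> 2\<close> by (intro prod_mono) force
    moreover have "(\<Prod>i<n. x - z i) \<le> (\<Prod>i<n. x + 2)"
      using zi \<open>x \<ge> 2\<close> by (intro prod_mono) force
    ultimately show ?thesis by simp
  qed
  have inner: "(\<integral>\<^sup>+s. indicator (root_region n (-2) 2) s * ennreal y \<partial>coord_measure n) = ennreal (disc_vol n * y)"
    if "y \<ge> 0" for y
    using that v by (subst nn_integral_multc) (auto simp: emeasure_root_region ennreal_mult')
  have sub: "(\<integral>\<^sup>+x. indicator {a..b} x * ennreal (disc_vol n * (x + d) ^ n) \<partial>lborel) =
      ennreal (disc_vol n * ((b + d) ^ Suc n - (a + d) ^ Suc n) / real (Suc n))" if "a + d \<ge> 0" "a \<le> b" for a b d :: real
  proof -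
    have "(\<integral>\<^sup>+x. indicator {a+d..b+d} x * ennreal (disc_vol n * x ^ n) \<partial>lborel) =
      (\<integral>\<^sup>+x. indicator {a+d..b+d} (d + 1 * x) * ennreal (disc_vol n * (d + 1 * x) ^ n) \<partial>lborel)"
      by (subst nn_integral_real_affine[where c = 1 and t = d]) simp_all
    also have "\<dots> = (\<integral>\<^sup>+x. indicator {a..b} x * ennreal (disc_vol n * (x + d) ^ n) \<partial>lborel)"
      by (intro nn_integral_cong) (auto simp: indicator_def add.commute)
    finally show ?thesis using nn_integral_power_Icc[of "a + d" "disc_vol n" "b + d" n] that v by simp
  qed
  have "emeasure (coord_measure (Suc n)) (salem_region n X) \<le>
      (\<integral>\<^sup>+x. indicator {2..X} x * ennreal (disc_vol n * (x + 2) ^ n) \<partial>lborel)"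
    unfolding emeasure_salem_region
  proof (rule nn_integral_mono)
    fix x :: real
    show "indicator {2..X} x * (\<integral>\<^sup>+s. indicator (root_region n (-2) 2) s * ennreal \<bar>poly (monic_poly n s) x\<bar> \<partial>coord_measure n)
      \<le> indicator {2..X} x * ennreal (disc_vol n * (x + 2) ^ n)"
    proof (cases "2 \<le> x \<and> x \<le> X")
      case True
      have "(\<integral>\<^sup>+s. indicator (root_region n (-2) 2) s * ennreal \<bar>poly (monic_poly n s) x\<bar> \<partial>coord_measure n) \<le>
          (\<integral>\<^sup>+s. indicator (root_region n (-2) 2) s * ennreal ((x + 2) ^ n) \<partial>coord_measure n)"
        using True bnd[of x] by (intro nn_integral_mono) (auto simp: indicator_def intro!: ennreal_leI)
      then show ?thesis using True inner[of "(x + 2) ^ n"] by simp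
    qed simp
  qed
  also have "\<dots> = ennreal (disc_vol n * ((X + 2) ^ Suc n - (2 + 2) ^ Suc n) / real (Suc n))"
    using assms by (intro sub) auto
  also have "\<dots> \<le> ennreal (disc_vol n * (X + 2) ^ Suc n / real (Suc n))"
    using v by (intro ennreal_leI divide_right_mono mult_left_mono) auto
  finally show "emeasure (coord_measure (Suc n)) (salem_region n X) \<le> ennreal (disc_vol n * (X + 2) ^ Suc n / real (Suc n))" .
  have "ennreal (disc_vol n * (X - 2) ^ Suc n / real (Suc n)) =
      (\<integral>\<^sup>+x. indicator {2..X} x * ennreal (disc_vol n * (x + (- 2)) ^ n) \<partial>lborel)"
    using assms by (subst sub) auto
  also have "\<dots> \<le> emeasure (coord_measure (Suc n)) (salem_region n X)"
    unfolding emeasure_salem_region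
  proof (rule nn_integral_mono)
    fix x :: real
    show "indicator {2..X} x * ennreal (disc_vol n * (x + (- 2)) ^ n) \<le>
       indicator {2..X} x * (\<integral>\<^sup>+s. indicator (root_region n (-2) 2) s * ennreal \<bar>poly (monic_poly n s) x\<bar> \<partial>coord_measure n)"
    proof (cases "2 \<le> x \<and> x \<le> X")
      case True
      have "(\<integral>\<^sup>+s. indicator (root_region n (-2) 2) s * ennreal ((x - 2) ^ n) \<partial>coord_measure n) \<le>
         (\<integral>\<^sup>+s. indicator (root_region n (-2) 2) s * ennreal \<bar>poly (monic_poly n s) x\<bar> \<partial>coord_measure n)"
        using True bnd[of x] by (intro nn_integral_mono) (auto simp: indicator_def intro!: ennreal_leI)
      then show ?thesis using True inner[of "(x - 2) ^ n"] by simp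
    qed simp
  qed
  finally show "emeasure (coord_measure (Suc n)) (salem_region n X) \<ge> ennreal (disc_vol n * (X - 2) ^ Suc n / real (Suc n))" .
qed

section \<open>Fibres of the region along an axis\<close>

lemma monic_poly_eqI:
  fixes c d :: "nat \<Rightarrow> real"
  assumes "inj_on r {..<N}" "\<And>i. i < N \<Longrightarrow> poly (monic_poly N c) (r i) = 0"
    "\<And>i. i < N \<Longrightarrow> poly (monic_poly N d) (r i) = 0"
  shows "monic_poly N c = monic_poly N d"
proof (rule ccontr)
  define P where "P = monic_poly N c - monic_poly N d"
  assume "monic_poly N c \<noteq> monic_poly N d"
  then have P: "P \<noteq> 0" by (simp add: P_def)
  have "degree P \<le> N" unfolding P_def by (intro degree_diff_le) auto
  moreover have "coeff P N = 0" by (simp add: P_def lead_coeff_monic_poly)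
  ultimately have "degree P < N" using P by (metis le_neq_implies_less leading_coeff_0_iff)
  have "N = card (r ` {..<N})" using assms(1) by (simp add: card_image)
  also have "\<dots> \<le> card {x. poly P x = 0}"
    using assms(2,3) by (intro card_mono poly_roots_finite P) (auto simp: P_def)
  also have "\<dots> \<le> degree P" using P by (rule card_poly_roots_bound)
  finally show False using \<open>degree P < N\<close> by simp
qed

lemma eq_root_coeffsI:
  assumes "inj_on r {..<N}" "\<And>i. i < N \<Longrightarrow> poly (monic_poly N c) (r i) = 0" "supp_below N c"
  shows "c = root_coeffs N r"
proof (rule monic_poly_inject_supp[OF monic_poly_eqI[OF assms(1,2)]])
  show "poly (monic_poly N (root_coeffs N r)) (r i) = 0" if "i < N" for i
    unfolding poly_root_coeffs using that by (intro prod_zero bexI[of _ i]) auto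
qed (use assms in auto)

lemma salem_region_altdef:
  "salem_region n X = {root_coeffs (Suc n) w | w. ordered_tuple n (-2) 2 w \<and> 2 \<le> w n \<and> w n \<le> X}"
proof safe
  fix c assume "c \<in> salem_region n X"
  then obtain x z where xz: "2 \<le> x" "x \<le> X" "ordered_tuple n (-2) 2 z" "c = attach_root x (root_coeffs n z)"
    by (auto simp: salem_region_def root_region_def)
  have "ordered_tuple n (-2) 2 (z(n := x))"
    using xz(3) ordered_tuple_cong[of n z "z(n := x)"] by simp
  moreover have "c = root_coeffs (Suc n) (z(n := x))" using xz by simp
  ultimately show "\<exists>w. c = root_coeffs (Suc n) w \<and> ordered_tuple n (-2) 2 w \<and> 2 \<le> w n \<and> w n \<le> X"
    using xz by (intro exI[of _ "z(n := x)"]) simp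
qed (auto simp: salem_region_def root_region_def)

text \<open>Strictly increasing roots determine the monic polynomial, so locating the n + 1 roots is
  enough for membership. Sign changes will supply them.\<close>

lemma salem_regionI:
  assumes "supp_below (Suc n) c" "\<And>i. i \<le> n \<Longrightarrow> poly (monic_poly (Suc n) c) (r i) = 0"
    "\<And>i. i < n \<Longrightarrow> -2 \<le> r i \<and> r i \<le> 2" "\<And>i j. i < j \<Longrightarrow> j \<le> n \<Longrightarrow> r i < r j" "2 \<le> r n" "r n \<le> X"
  shows "c \<in> salem_region n X"
proof -
  have "inj_on r {..<Suc n}"
  proof (rule linorder_inj_onI')
    show "r i \<noteq> r j" if "i < j" "i \<in> {..<Suc n}" "j \<in> {..<Suc n}" for i j
      using assms(4)[of i j] that by auto
  qed
  then have "c = root_coeffs (Suc n) r" using assms(1,2) by (intro eq_root_coeffsI) (auto simp: less_Suc_eq_le simp del: monic_poly.simps)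
  moreover have "ordered_tuple n (-2) 2 r"
    using assms(3,4) by (auto simp: ordered_tuple_def less_imp_le)
  ultimately show ?thesis unfolding salem_region_altdef using assms(5,6) by blast
qed

lemma poly_monic_poly_upd:
  assumes "j < N"
  shows "poly (monic_poly N (c(j := y))) t = poly (monic_poly N (c(j := 0))) t + y * t ^ (N - 1 - j)"
  using assms
proof (induction N)
  case (Suc N)
  show ?case
  proof (cases "j = N")
    case True
    then show ?thesis using monic_poly_cong[of N "c(N := y)" "c(N := 0)"] by (simp del: fun_upd_apply) simp
  next
    case False
    then have "Suc N - 1 - j = Suc (N - 1 - j)" using Suc.prems by simp
    moreover have "t ^ (N - j) = t * t ^ (N - 1 - j)"
      using False Suc.prems by (simp add: power_eq_if)
    ultimately show ?thesis using Suc False by (simp add: algebra_simps del: fun_upd_apply) (simp add: algebra_simps)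
  qed
qed simp

lemma monic_poly_upd:
  assumes "j < N"
  shows "monic_poly N (c(j := y :: real)) = monic_poly N (c(j := 0)) + monom y (N - 1 - j)"
  using poly_monic_poly_upd[OF assms, of c y] by (simp add: poly_eq_poly_eq_iff[symmetric] fun_eq_iff poly_monom)

lemma sign_change_roots:
  fixes F :: "real poly"
  assumes "\<And>i. i \<le> N \<Longrightarrow> (- 1) ^ (N - i) * poly F (q i) > 0" "\<And>i. i < N \<Longrightarrow> q i < q (Suc i)"
  obtains r where "\<And>i. i < N \<Longrightarrow> q i < r i \<and> r i < q (Suc i) \<and> poly F (r i) = 0"
proof -
  have "\<exists>x. q i < x \<and> x < q (Suc i) \<and> poly F x = 0" if "i < N" for i
  proof -
    have e: "N - i = Suc (N - Suc i)" using that by simp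
    have s: "(- 1) ^ (N - Suc i) = (1::real) \<or> (- 1) ^ (N - Suc i) = (-1::real)"
      by (cases "even (N - Suc i)") simp_all
    have "poly F (q i) * poly F (q (Suc i)) < 0"
      using assms(1)[of i] assms(1)[of "Suc i"] that s unfolding e
      by (auto simp: mult_pos_neg mult_neg_pos)
    then show ?thesis using poly_IVT[OF assms(2)[OF that], of F] by blast
  qed
  then show ?thesis using that by metis
qed

text \<open>Polynomials vanishing at 0 are left out: if a coefficient of t^2 or higher varies, a
  multiple root at 0 persists for all its values, and the parameters with colliding roots would no
  longer be finite in number. The omitted set is null, and it contains no trace polynomial of a
  Salem number counted here, as F(0) = 0 would make -1 a root of p.\<close>

definition salem_cell :: "nat \<Rightarrow> real \<Rightarrow> (nat \<Rightarrow> real) set" where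
  "salem_cell n X = {c \<in> salem_region n X. c n \<noteq> 0}"

lemma supp_salem_region: "c \<in> salem_region n X \<Longrightarrow> supp_below (Suc n) c"
  by (auto simp: salem_region_altdef simp del: root_coeffs.simps)

text \<open>
  A fibre of \<open>salem_cell\<close> can only change where a root crosses \<open>\<plusminus>2\<close> or \<open>X\<close> or two roots collide; elsewhere it
  is relatively closed (compactness) and relatively open (sign changes persist).
\<close>

lemma salem_cell_open_fibre:
  assumes "n > 0" "X > 2" "c \<in> salem_region n X"
    and ne: "poly (monic_poly (Suc n) c) 2 \<noteq> 0" "poly (monic_poly (Suc n) c) (-2) \<noteq> 0" "poly (monic_poly (Suc n) c) X \<noteq> 0"
    and sq: "\<And>t. poly (monic_poly (Suc n) c) t = 0 \<Longrightarrow> poly (pderiv (monic_poly (Suc n) c)) t \<noteq> 0"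
    and "j \<le> n"
  shows "\<forall>\<^sub>F y in nhds (c j). c(j := y) \<in> salem_region n X"
proof -
  define F where "F = monic_poly (Suc n) c"
  obtain w where w: "c = root_coeffs (Suc n) w" "ordered_tuple n (-2) 2 w" "2 \<le> w n" "w n \<le> X"
    using assms(3) unfolding salem_region_altdef by auto
  have Fw: "poly F t = (\<Prod>i<Suc n. t - w i)" for t
    unfolding F_def w(1) by (rule poly_root_coeffs)
  have root: "poly F (w i) = 0" if "i \<le> n" for i
    unfolding Fw using that by (intro prod_zero bexI[of _ i]) auto
  have wn: "2 < w n" "w n < X" using w(3,4) root[of n] ne unfolding F_def by (auto simp: less_le)
  have wi: "-2 < w i" "w i < 2" if "i < n" for i
    using w(2) that root[of i] ne unfolding F_def ordered_tuple_def by (auto simp: less_le)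
  have wlt: "w i < w k" if "i < k" "k \<le> n" for i k
  proof (cases "k = n")
    case True
    then show ?thesis using wi[of i] wn that by simp
  next
    case False
    have "w i \<noteq> w k"
    proof
      assume "w i = w k"
      have "F = [:- w i, 1:] * ([:- w k, 1:] * (\<Prod>l\<in>{..<Suc n} - {i} - {k}. [:- w l, 1:]))"
        unfolding F_def w(1) monic_poly_root_coeffs using that False
        by (subst prod.remove[of _ i], simp, simp, subst prod.remove[of _ k]) auto
      then have "poly (pderiv F) (w i) = 0"
        using \<open>w i = w k\<close> by (simp only: pderiv_mult poly_add poly_mult) simp
      then show False using sq[of "w i"] root[of i] that unfolding F_def by simp
    qed
    moreover have "w i \<le> w k" using w(2) that False by (simp add: ordered_tuple_def)
    ultimately show ?thesis by simp
  qed
  \<comment> \<open>Separators of the roots: midpoints, except for -2 at the bottom and 2 and X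
    around the largest root. A polynomial with the same signs at all \<open>q i\<close> has a root
    in every gap, so its roots stay in the prescribed intervals.\<close>
  define q where "q = (\<lambda>i. if i = 0 then -2 else if i < n then (w (i - 1) + w i) / 2 else if i = n then 2 else X)"
  have q1: "q i < w i" if "i \<le> n" for i
    using that wi[of i] wn wlt[of "i - 1" i] by (auto simp: q_def field_simps)
  have q2: "w i < q (Suc i)" if "i \<le> n" for i
    using that wi[of i] wn wlt[of i "Suc i"] by (cases "i = n") (auto simp: q_def field_simps)
  have lt: "q i < w k" if "i \<le> k" "k \<le> n" for i k
    using q1[of i] wlt[of i k] that by (cases "i = k") (auto intro: less_trans)
  have gt: "w k < q i" if "k < i" "i \<le> Suc n" for i k
  proof -
    obtain i' where i: "i = Suc i'" using \<open>k < i\<close> by (cases i) auto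
    show ?thesis
      using q2[of i'] wlt[of k i'] that unfolding i by (cases "k = i'") (auto intro: less_trans)
  qed
  have sign: "(-1) ^ (Suc n - i) * poly F (q i) > 0" if "i \<le> Suc n" for i
  proof -
    have eq: "{..<Suc n} = {..<i} \<union> {i..<Suc n}" using that by auto
    have "poly F (q i) = (\<Prod>k<i. q i - w k) * (\<Prod>k\<in>{i..<Suc n}. q i - w k)"
      unfolding Fw eq by (rule prod.union_disjoint) auto
    also have "(\<Prod>k\<in>{i..<Suc n}. q i - w k) = (\<Prod>k\<in>{i..<Suc n}. (-1) * (w k - q i))"
      by (intro prod.cong) auto
    also have "\<dots> = (-1) ^ (Suc n - i) * (\<Prod>k\<in>{i..<Suc n}. w k - q i)"
      by (simp only: prod.distrib prod_constant card_atLeastLessThan)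
    finally have "(-1) ^ (Suc n - i) * poly F (q i) =
        ((-1) ^ (Suc n - i) * (-1) ^ (Suc n - i)) * ((\<Prod>k<i. q i - w k) * (\<Prod>k\<in>{i..<Suc n}. w k - q i))"
      by (simp only: mult_ac)
    also have "((-1) ^ (Suc n - i) * (-1) ^ (Suc n - i)) = (1::real)"
      by (simp flip: power_mult_distrib)
    finally show ?thesis
      using lt[of i] gt[of _ i] that by (auto intro!: mult_pos_pos prod_pos)
  qed
  have "\<forall>\<^sub>F y in nhds (c j). \<forall>i\<in>{..Suc n}. (-1) ^ (Suc n - i) * poly (monic_poly (Suc n) (c(j := y))) (q i) > 0"
  proof (intro eventually_ball_finite ballI)
    fix i assume "i \<in> {..Suc n}"
    let ?f = "\<lambda>y. (-1) ^ (Suc n - i) * poly (monic_poly (Suc n) (c(j := y))) (q i)"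
    have f: "?f = (\<lambda>y. (-1) ^ (Suc n - i) * (poly (monic_poly (Suc n) (c(j := 0))) (q i) + y * q i ^ (Suc n - 1 - j)))"
      by (rule ext) (subst poly_monic_poly_upd[OF le_imp_less_Suc[OF \<open>j \<le> n\<close>]], rule refl)
    have "isCont ?f (c j)"
      unfolding f by (intro continuous_intros)
    then have "(?f \<longlongrightarrow> ?f (c j)) (nhds (c j))"
      using tendsto_at_iff_tendsto_nhds[of ?f "c j"] by (simp only: isCont_def)
    moreover have "?f (c j) > 0" using sign[of i] \<open>i \<in> _\<close> by (simp add: F_def fun_upd_triv del: monic_poly.simps)
    ultimately show "\<forall>\<^sub>F y in nhds (c j). ?f y > 0" by (rule order_tendstoD(1))
  qed simp
  then show ?thesis
  proof (rule eventually_mono)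
    fix y assume y: "\<forall>i\<in>{..Suc n}. (-1) ^ (Suc n - i) * poly (monic_poly (Suc n) (c(j := y))) (q i) > 0"
    have qlt: "q i < q (Suc i)" if "i < Suc n" for i
      using q1[of i] q2[of i] that by simp
    obtain r where r: "\<And>i. i < Suc n \<Longrightarrow> q i < r i \<and> r i < q (Suc i) \<and> poly (monic_poly (Suc n) (c(j := y))) (r i) = 0"
      using sign_change_roots[of "Suc n" "monic_poly (Suc n) (c(j := y))" q] y qlt by auto
    have qmono: "q i \<le> q k" if "i \<le> k" "k \<le> Suc n" for i k
      using that
    proof (induction k rule: dec_induct)
      case (step m)
      then show ?case using qlt[of m] by simp
    qed simp
    show "c(j := y) \<in> salem_region n X"
    proof (rule salem_regionI)
      show "supp_below (Suc n) (c(j := y))"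
        using supp_salem_region[OF assms(3)] \<open>j \<le> n\<close> by (auto simp: supp_below_def)
      show "poly (monic_poly (Suc n) (c(j := y))) (r i) = 0" if "i \<le> n" for i
        using r[of i] that by auto
      show "-2 \<le> r i \<and> r i \<le> 2" if "i < n" for i
        using r[of i] qmono[of 0 i] qmono[of "Suc i" n] that by (auto simp: q_def split: if_splits)
      show "r i < r k" if "i < k" "k \<le> n" for i k
        using r[of i] r[of k] qmono[of "Suc i" k] that by auto
      show "2 \<le> r n" "r n \<le> X"
        using r[of n] \<open>n > 0\<close> by (auto simp: q_def split: if_splits)
    qed
  qed
qed


text \<open>Write the polynomials of the fibre as F0 + y t^k. Exceptional y are those where 2, -2 or
  X becomes a root, those with a multiple root t \<noteq> 0, and 0, since for j = n the parameter y
  is itself the constant coefficient. A multiple root satisfies P(t) = 0 for a polynomial P of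
  degree at most n + 1 that does not involve y and whose coefficient n + 1 - k at the top is
  nonzero. This gives at most 4 + (n + 1) values.\<close>

lemma salem_cell_fibre:
  assumes "n > 0" "X > 2" "j \<le> n"
  obtains E where "finite E" "card E \<le> n + 5"
    "\<And>y1 y2. y1 \<le> y2 \<Longrightarrow> {y1..y2} \<inter> E = {} \<Longrightarrow> c(j := y1) \<in> salem_cell n X \<longleftrightarrow> c(j := y2) \<in> salem_cell n X"
proof -
  have jn: "j < Suc n" using assms(3) by simp
  define k where "k = n - j"
  define F0 where "F0 = monic_poly (Suc n) (c(j := 0))"
  define F where "F = (\<lambda>y. monic_poly (Suc n) (c(j := y)))"
  have F: "F y = F0 + monom y k" for y
    unfolding F_def F0_def k_def using monic_poly_upd[OF jn, of c y] by simp
  \<comment> \<open>For every F = F0 + y t^k the expression t F' - k F equals P, as y drops out. For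
    t \<noteq> 0 the value \<open>e t\<close> is the only y with root t.\<close>
  define P where "P = [:0, 1:] * pderiv F0 - smult (real k) F0"
  define e where "e = (\<lambda>t. - poly F0 t / t ^ k)"
  define E where "E = {0, e 2, e (-2), e X} \<union> e ` {t. poly P t = 0}"
  have "coeff P (Suc n) = real (Suc n) - real k"
    using lead_coeff_monic_poly[of "Suc n" "c(j := 0)"] by (simp add: P_def F0_def coeff_pderiv del: monic_poly.simps)
  then have "P \<noteq> 0" by (auto simp: k_def)
  have "degree (pderiv F0) \<le> n" by (simp add: F0_def degree_pderiv del: monic_poly.simps)
  then have "degree ([:0, 1:] * pderiv F0) \<le> Suc n"
    using degree_mult_le[of "[:0, 1:]" "pderiv F0"] by simp
  then have "degree P \<le> Suc n"
    unfolding P_def by (intro degree_diff_le) (auto simp: F0_def simp del: monic_poly.simps)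
  have fin: "finite {t. poly P t = 0}" using \<open>P \<noteq> 0\<close> by (rule poly_roots_finite)
  have "card (e ` {t. poly P t = 0}) \<le> Suc n"
    using card_image_le[OF fin, of e] card_poly_roots_bound[OF \<open>P \<noteq> 0\<close>] \<open>degree P \<le> Suc n\<close> by simp
  moreover have "card {0, e 2, e (-2), e X} \<le> 4" using card_length[of "[0, e 2, e (-2), e X]"] by simp
  ultimately have cardE: "card E \<le> n + 5"
    unfolding E_def using card_Un_le[of "{0, e 2, e (-2), e X}" "e ` {t. poly P t = 0}"] by simp
  have eI: "y = e t" if "poly (F y) t = 0" "t \<noteq> 0" for y t
    using that by (simp add: F poly_monom e_def field_simps add_eq_0_iff)
  have good: "poly (F y) 2 \<noteq> 0 \<and> poly (F y) (-2) \<noteq> 0 \<and> poly (F y) X \<noteq> 0" if "y \<notin> E" for y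
    using that eI[of y 2] eI[of y "-2"] eI[of y X] assms(2) unfolding E_def by auto
  have sq: "poly (pderiv (F y)) t \<noteq> 0" if "y \<notin> E" "poly (F y) t = 0" "t \<noteq> 0" for y t
  proof
    assume d: "poly (pderiv (F y)) t = 0"
    have K: "t * (real k * y * t ^ (k - 1)) = real k * (y * t ^ k)"
      by (subst (2) power_eq_if) auto
    have "poly (pderiv (F y)) t = poly (pderiv F0) t + real k * y * t ^ (k - 1)"
      by (simp add: F pderiv_add pderiv_monom poly_monom)
    moreover have "poly (F y) t = poly F0 t + y * t ^ k" by (simp add: F poly_monom)
    ultimately have "poly P t = t * poly (pderiv (F y)) t - real k * poly (F y) t"
      by (simp only: distrib_left K) (simp add: P_def)
    then have "poly P t = 0" using d that(2) by simp
    then show False using that(1) eI[OF that(2,3)] by (auto simp: E_def)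
  qed
  define S where "S = {y. c(j := y) \<in> salem_region n X}"
  have "closed S"
  proof -
    have "S = (\<lambda>y. c(j := y)) -` salem_region n X" by (auto simp: S_def)
    then show ?thesis
      by (metis closed_vimage compact_imp_closed compact_salem_region continuous_on_fun_upd)
  qed
  have key: "c(j := y1) \<in> salem_cell n X \<longleftrightarrow> c(j := y2) \<in> salem_cell n X"
    if y: "y1 \<le> y2" "{y1..y2} \<inter> E = {}" for y1 y2
  proof (cases "j \<noteq> n \<and> c n = 0")
    \<comment> \<open>The constant coefficient is then 0 on the whole fibre, which therefore misses
      \<open>salem_cell\<close>.\<close>
    case True
    then show ?thesis by (simp add: salem_cell_def)
  next
    case False
    have c0: "(c(j := y)) n \<noteq> 0" if "y \<in> {y1..y2}" for y
      using that y(2) False by (auto simp: E_def)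
    \<comment> \<open>S is closed; with this it is also relatively open in the interval, and
      connectedness leaves all or nothing.\<close>
    have op: "S \<inter> {y1..y2} \<subseteq> interior S"
    proof
      fix y assume "y \<in> S \<inter> {y1..y2}"
      then have yS: "c(j := y) \<in> salem_region n X" "y \<notin> E" "y \<in> {y1..y2}" using y by (auto simp: S_def)
      have "\<forall>\<^sub>F z in nhds ((c(j := y)) j). (c(j := y))(j := z) \<in> salem_region n X"
      proof (rule salem_cell_open_fibre[OF assms(1,2) yS(1)])
        fix t assume t: "poly (monic_poly (Suc n) (c(j := y))) t = 0"
        have "t \<noteq> 0" using t c0[OF yS(3)] by auto
        then show "poly (pderiv (monic_poly (Suc n) (c(j := y)))) t \<noteq> 0"
          using sq[OF yS(2), of t] t by (simp add: F_def del: monic_poly.simps)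
      qed (use good[OF yS(2)] assms(3) in \<open>auto simp: F_def simp del: monic_poly.simps\<close>)
      then have "\<forall>\<^sub>F z in nhds y. z \<in> S" by (simp add: S_def)
      then show "y \<in> interior S"
        by (metis eventually_nhds interiorI subsetI)
    qed
    have "interior S \<inter> {y1..y2} = {} \<or> (- S) \<inter> {y1..y2} = {}"
    proof (rule connectedD)
      show "open (- S)" using \<open>closed S\<close> by auto
      show "interior S \<inter> - S \<inter> {y1..y2} = {}" using interior_subset by blast
      show "{y1..y2} \<subseteq> interior S \<union> - S" using op by blast
    qed auto
    then have "y1 \<in> S \<longleftrightarrow> y2 \<in> S" using op y(1) by fastforce
    then show ?thesis using c0[of y1] c0[of y2] y(1) by (simp add: S_def salem_cell_def)
  qed
  show ?thesis
    by (rule that[of E]) (use cardE fin key in \<open>auto simp: E_def\<close>)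
qed

section \<open>Rounding to a grid\<close>

definition grid_floor :: "real \<Rightarrow> real \<Rightarrow> real" where
  "grid_floor \<delta> y = \<delta> * of_int \<lfloor>y / \<delta>\<rfloor>"

lemma grid_floor_bounds:
  assumes "\<delta> > 0"
  shows "grid_floor \<delta> y \<le> y" "y < grid_floor \<delta> y + \<delta>"
proof -
  have "of_int \<lfloor>y / \<delta>\<rfloor> * \<delta> \<le> y" "y < (of_int \<lfloor>y / \<delta>\<rfloor> + 1) * \<delta>"
    using pos_le_divide_eq[OF assms, of "of_int \<lfloor>y / \<delta>\<rfloor>" y] pos_divide_less_eq[OF assms, of y "of_int \<lfloor>y / \<delta>\<rfloor> + 1"]
    by linarith+
  then show "grid_floor \<delta> y \<le> y" "y < grid_floor \<delta> y + \<delta>"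
    by (simp_all add: grid_floor_def algebra_simps)
qed

lemma measurable_grid_floor [measurable]: "grid_floor \<delta> \<in> borel_measurable borel"
  unfolding grid_floor_def[abs_def] by measurable

text \<open>If membership in A differs at y and at its rounding, some e in E lies between the two,
  so y belongs to [e, e + \<delta>].\<close>

lemma grid_floor_difference:
  assumes "finite E" "\<delta> > 0"
    and "\<And>y1 y2. y1 \<le> y2 \<Longrightarrow> {y1..y2} \<inter> E = {} \<Longrightarrow> y1 \<in> A \<longleftrightarrow> y2 \<in> A"
  shows "(\<integral>\<^sup>+y. indicator {y. (grid_floor \<delta> y \<in> A) \<noteq> (y \<in> A)} y \<partial>lborel) \<le> ennreal (real (card E) * \<delta>)"
proof -
  have "(\<integral>\<^sup>+y. indicator {y. (grid_floor \<delta> y \<in> A) \<noteq> (y \<in> A)} y \<partial>lborel) \<le>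
      (\<integral>\<^sup>+y. (\<Sum>e\<in>E. indicator {e..e + \<delta>} y) \<partial>lborel)"
  proof (rule nn_integral_mono)
    fix y :: real
    show "indicator {y. (grid_floor \<delta> y \<in> A) \<noteq> (y \<in> A)} y \<le> (\<Sum>e\<in>E. indicator {e..e + \<delta>} y :: ennreal)"
    proof (cases "(grid_floor \<delta> y \<in> A) \<noteq> (y \<in> A)")
      case True
      then have "{grid_floor \<delta> y..y} \<inter> E \<noteq> {}"
        using assms(3)[OF grid_floor_bounds(1)[OF assms(2), of y]] by blast
      then obtain e where e: "e \<in> E" "grid_floor \<delta> y \<le> e" "e \<le> y" by auto
      then have "y \<in> {e..e + \<delta>}" using grid_floor_bounds(2)[OF assms(2), of y] by simp
      then have "(1::ennreal) = indicator {e..e + \<delta>} y" by simp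
      also have "\<dots> \<le> (\<Sum>e\<in>E. indicator {e..e + \<delta>} y)"
        by (rule member_le_sum[OF e(1)]) (use assms in auto)
      finally show ?thesis using True by simp
    qed simp
  qed
  also have "\<dots> = (\<Sum>e\<in>E. ennreal \<delta>)"
    using assms(2) by (subst nn_integral_sum) auto
  also have "\<dots> = ennreal (real (card E) * \<delta>)"
    using assms(2) by (simp add: ennreal_mult ennreal_of_nat_eq_real_of_nat)
  finally show ?thesis .
qed

section \<open>Grid points and volume\<close>

lemma emeasure_coord_box:
  assumes [measurable]: "\<And>i. A i \<in> sets borel"
  shows "emeasure (coord_measure N) {c. \<forall>i<N. c i \<in> A i} = (\<Prod>i<N. emeasure lborel (A i))"
proof (induction N)
  case 0
  have "emeasure (coord_measure 0) UNIV = (\<integral>\<^sup>+c. 1 \<partial>coord_measure 0)" by (simp del: coord_measure.simps)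
  also have "\<dots> = 1" by (rule nn_integral_coord_0) measurable
  finally show ?case by simp
next
  case (Suc N)
  have [measurable]: "{c :: nat \<Rightarrow> real. \<forall>i<N. c i \<in> A i} \<in> sets borel" for N
  proof -
    have "Measurable.pred borel (\<lambda>c :: nat \<Rightarrow> real. \<forall>i\<in>{..<N}. c i \<in> A i)" by measurable
    then show ?thesis by (simp add: pred_def Ball_def)
  qed
  have ind: "indicator {c. \<forall>i<Suc N. c i \<in> A i} (c(N := y)) =
      indicator (A N) y * (indicator {c. \<forall>i<N. c i \<in> A i} c :: ennreal)" for c y
    by (auto simp: indicator_def less_Suc_eq)
  have "emeasure (coord_measure (Suc N)) {c. \<forall>i<Suc N. c i \<in> A i} =
      (\<integral>\<^sup>+y. \<integral>\<^sup>+c. indicator (A N) y * indicator {c. \<forall>i<N. c i \<in> A i} c \<partial>coord_measure N \<partial>lborel)"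
    unfolding ind[symmetric]
    by (subst nn_integral_coord_Suc[symmetric]) (simp_all del: coord_measure.simps)
  also have "\<dots> = (\<integral>\<^sup>+y. indicator (A N) y * (\<Prod>i<N. emeasure lborel (A i)) \<partial>lborel)"
    by (subst nn_integral_cmult) (simp_all add: Suc)
  also have "\<dots> = (\<Prod>i<Suc N. emeasure lborel (A i))"
    by (subst nn_integral_multc) (simp_all add: mult.commute)
  finally show ?case .
qed

definition grid_points :: "nat \<Rightarrow> real \<Rightarrow> (nat \<Rightarrow> real) \<Rightarrow> (nat \<Rightarrow> real) set" where
  "grid_points n X \<delta> = {c \<in> salem_cell n X. \<forall>i\<le>n. \<exists>k::int. c i = \<delta> i * of_int k}"

lemma finite_grid_points:
  assumes "\<And>i. i \<le> n \<Longrightarrow> \<delta> i > 0"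
  shows "finite (grid_points n X \<delta>)"
proof -
  define h where "h = (\<lambda>c. restrict (\<lambda>i. \<lfloor>c i / \<delta> i\<rfloor>) {..n})"
  have ex: "\<exists>k. \<delta> i * real_of_int k = c i \<and> \<lfloor>c i / \<delta> i\<rfloor> = k" if "c \<in> grid_points n X \<delta>" "i \<le> n" for c i
    using that assms[OF that(2)] unfolding grid_points_def by fastforce
  have inj: "inj_on h (grid_points n X \<delta>)"
  proof (rule inj_onI)
    fix c d assume cd: "c \<in> grid_points n X \<delta>" "d \<in> grid_points n X \<delta>" "h c = h d"
    show "c = d"
    proof
      fix i show "c i = d i"
      proof (cases "i \<le> n")
        case True
        then have "\<lfloor>c i / \<delta> i\<rfloor> = \<lfloor>d i / \<delta> i\<rfloor>"
          using fun_cong[OF cd(3), of i] by (simp add: h_def)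
        then show ?thesis using ex[OF cd(1) True] ex[OF cd(2) True] by auto
      next
        case False
        have "supp_below (Suc n) c" "supp_below (Suc n) d"
          using cd(1,2) by (auto simp: grid_points_def salem_cell_def intro: supp_salem_region)
        then show ?thesis using False by (simp add: supp_below_def)
      qed
    qed
  qed
  have "compact ((\<lambda>c. c i) ` salem_region n X)" for i
    by (intro compact_continuous_image compact_salem_region continuous_on_coord)
  then have "\<exists>B. \<forall>c\<in>salem_region n X. \<bar>c i\<bar> \<le> B" for i
    by (fastforce dest!: compact_imp_bounded simp: bounded_iff)
  then obtain B where B: "\<And>i c. c \<in> salem_region n X \<Longrightarrow> \<bar>c i\<bar> \<le> B i" by metis
  have "h ` grid_points n X \<delta> \<subseteq> (\<Pi>\<^sub>E i\<in>{..n}. {\<lfloor>- B i / \<delta> i\<rfloor>..\<lfloor>B i / \<delta> i\<rfloor>})"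
  proof (rule image_subsetI)
    fix c assume c: "c \<in> grid_points n X \<delta>"
    have "- B i / \<delta> i \<le> c i / \<delta> i \<and> c i / \<delta> i \<le> B i / \<delta> i" if "i \<le> n" for i
    proof -
      have "- B i \<le> c i" "c i \<le> B i" using B[of c i] c by (auto simp: grid_points_def salem_cell_def)
      then show ?thesis using assms[OF that] by (intro conjI divide_right_mono) auto
    qed
    then show "h c \<in> (\<Pi>\<^sub>E i\<in>{..n}. {\<lfloor>- B i / \<delta> i\<rfloor>..\<lfloor>B i / \<delta> i\<rfloor>})"
      by (auto simp: h_def intro!: floor_mono)
  qed
  then have "finite (h ` grid_points n X \<delta>)" by (rule finite_subset) (auto intro!: finite_PiE)
  then show ?thesis using inj by (rule finite_imageD)
qed

lemma borel_salem_cell [measurable]: "salem_cell n X \<in> sets borel"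
proof -
  have "salem_cell n X = salem_region n X \<inter> {c. c n \<noteq> 0}" by (auto simp: salem_cell_def)
  moreover have "{c :: nat \<Rightarrow> real. c n \<noteq> 0} \<in> sets borel"
    by (intro borel_open open_Collect_neq continuous_on_coord continuous_on_const)
  ultimately show ?thesis by simp
qed

lemma emeasure_salem_cell: "emeasure (coord_measure (Suc n)) (salem_cell n X) = emeasure (coord_measure (Suc n)) (salem_region n X)"
proof -
  have "emeasure (coord_measure (Suc n)) {c. \<forall>i<Suc n. c i \<in> (if i = n then {0} else UNIV)} = 0"
    by (subst emeasure_coord_box) (auto simp del: coord_measure.simps intro!: prod_zero bexI[of _ n])
  then have "emeasure (coord_measure (Suc n)) {c. c n = 0} = 0"
    by (auto simp: less_Suc_eq simp del: coord_measure.simps cong: if_cong elim!: back_subst[of "\<lambda>A. emeasure _ A = 0"])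
  then have "AE c in coord_measure (Suc n). c n \<noteq> 0"
    by (subst AE_iff_measurable[OF _ refl]) (auto intro!: borel_closed closed_Collect_eq continuous_on_coord continuous_on_const simp del: coord_measure.simps)
  then show ?thesis
    by (intro emeasure_eq_AE) (auto simp: salem_cell_def simp del: coord_measure.simps elim!: eventually_mono)
qed

text \<open>Passing from the volume to the number of points by rounding the coordinates one after
  the other. Step k changes the integral only near exceptional points of the fibres in direction k,
  at most n + 5 on each, and only over a box that contains the region together with a margin for the
  rounding.\<close>

lemma grid_points_volume:
  assumes "n > 0" "X > 2" and \<delta>: "\<And>i. i \<le> n \<Longrightarrow> \<delta> i > 0"
    and B: "\<And>c i. c \<in> salem_region n X \<Longrightarrow> \<bar>c i\<bar> \<le> B" "B \<ge> 0"
  shows "\<bar>real (card (grid_points n X \<delta>)) * (\<Prod>i\<le>n. \<delta> i) - measure (coord_measure (Suc n)) (salem_region n X)\<bar> \<le>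
    (\<Sum>k\<le>n. (real n + 5) * \<delta> k * (\<Prod>i\<in>{..n} - {k}. 2 * (B + \<delta> i)))"
proof -
  \<comment> \<open>\<open>fl k\<close> rounds the first k coordinates. Thus \<open>a 0\<close> is
    the volume of the cell, while \<open>a (Suc n)\<close> is the number of grid points times the
    volume of a grid box.\<close>
  define fl where "fl = (\<lambda>k c i. if i < k then grid_floor (\<delta> i) (c i) else c i)"
  define a where "a = (\<lambda>k. \<integral>\<^sup>+c. indicator (salem_cell n X) (fl k c) \<partial>coord_measure (Suc n))"
  define \<epsilon> where "\<epsilon> = (\<lambda>k. (real n + 5) * \<delta> k * (\<Prod>i\<in>{..n} - {k}. 2 * (B + \<delta> i)))"
  have Bd: "0 \<le> B + \<delta> i" if "i \<le> n" for i
    using \<delta>[OF that] B(2) by simp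
  have \<epsilon>0: "\<epsilon> k \<ge> 0" if "k \<le> n" for k
    unfolding \<epsilon>_def using \<delta>[OF that] Bd by (intro mult_nonneg_nonneg prod_nonneg) auto
  have [measurable]: "fl k \<in> borel_measurable borel" for k
  proof (rule measurable_coordinatewise_then_product)
    show "(\<lambda>c. fl k c i) \<in> borel_measurable borel" for i
      unfolding fl_def by (cases "i < k") auto
  qed
  define D where "D = (\<lambda>k. indicator {c. (fl k c \<in> salem_cell n X) \<noteq> (fl (Suc k) c \<in> salem_cell n X)} :: (nat \<Rightarrow> real) \<Rightarrow> ennreal)"
  have [measurable]: "D k \<in> borel_measurable borel" for k
    unfolding D_def by measurable
  have D: "(\<integral>\<^sup>+c. D k c \<partial>coord_measure (Suc n)) \<le> ennreal (\<epsilon> k)" if k: "k \<le> n" for k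
  proof -
    \<comment> \<open>In direction k the box has length 1 merely as a placeholder: the constant on
      the right then integrates along that axis to the bound for the fibre.\<close>
    define I where "I = (\<lambda>i. if i = k then {0..1} else {- (B + \<delta> i)..B + \<delta> i})"
    have bI [measurable]: "I i \<in> sets borel" for i by (simp add: I_def)
    define box where "box = {c. \<forall>i<Suc n. c i \<in> I i}"
    have [measurable]: "box \<in> sets borel"
    proof -
      have "Measurable.pred borel (\<lambda>c :: nat \<Rightarrow> real. \<forall>i\<in>{..<Suc n}. c i \<in> I i)" by measurable
      then show ?thesis by (simp add: pred_def Ball_def box_def)
    qed
    have "(\<integral>\<^sup>+c. D k c \<partial>coord_measure (Suc n)) \<le> (\<integral>\<^sup>+c. ennreal ((real n + 5) * \<delta> k) * indicator box c \<partial>coord_measure (Suc n))"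
    proof (rule nn_integral_coord_fibre_mono[of _ _ k])
      fix c :: "nat \<Rightarrow> real" assume "supp_below (Suc n) c"
      have fk: "fl k (c(k := y)) = (fl k c)(k := y)" "fl (Suc k) (c(k := y)) = (fl k c)(k := grid_floor (\<delta> k) y)" for y
        by (auto simp: fl_def fun_eq_iff less_Suc_eq)
      show "(\<integral>\<^sup>+y. D k (c(k := y)) \<partial>lborel) \<le> (\<integral>\<^sup>+y. ennreal ((real n + 5) * \<delta> k) * indicator box (c(k := y)) \<partial>lborel)"
      proof (cases "\<forall>i<Suc n. i \<noteq> k \<longrightarrow> c i \<in> I i")
        case True
        obtain E where E: "finite E" "card E \<le> n + 5"
          "\<And>y1 y2. y1 \<le> y2 \<Longrightarrow> {y1..y2} \<inter> E = {} \<Longrightarrow> (fl k c)(k := y1) \<in> salem_cell n X \<longleftrightarrow> (fl k c)(k := y2) \<in> salem_cell n X"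
          using salem_cell_fibre[OF assms(1,2) k, of "fl k c"] by metis
        define A where "A = {y. (fl k c)(k := y) \<in> salem_cell n X}"
        have "D k (c(k := y)) = indicator {y. (grid_floor (\<delta> k) y \<in> A) \<noteq> (y \<in> A)} y" for y
          unfolding D_def by (auto simp: fk A_def indicator_def simp del: fun_upd_apply)
        then have "(\<integral>\<^sup>+y. D k (c(k := y)) \<partial>lborel) = (\<integral>\<^sup>+y. indicator {y. (grid_floor (\<delta> k) y \<in> A) \<noteq> (y \<in> A)} y \<partial>lborel)"
          by simp
        also have "\<dots> \<le> ennreal (real (card E) * \<delta> k)"
          by (rule grid_floor_difference[OF E(1) \<delta>[OF k]]) (use E(3) in \<open>simp add: A_def\<close>)
        also have "\<dots> \<le> ennreal ((real n + 5) * \<delta> k)"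
          using E(2) \<delta>[OF k] by (intro ennreal_leI mult_right_mono) auto
        also have "\<dots> = (\<integral>\<^sup>+y. ennreal ((real n + 5) * \<delta> k) * indicator {0..1::real} y \<partial>lborel)"
          by (subst nn_integral_cmult_indicator) auto
        also have "\<dots> = (\<integral>\<^sup>+y. ennreal ((real n + 5) * \<delta> k) * indicator box (c(k := y)) \<partial>lborel)"
          using True k by (intro nn_integral_cong) (auto simp: box_def I_def indicator_def)
        finally show ?thesis .
      next
        case False
        then obtain i where i: "i < Suc n" "i \<noteq> k" "c i \<notin> I i" by blast
        have "z \<notin> salem_cell n X" if "z i = fl k c i" for z
        proof
          assume "z \<in> salem_cell n X"
          then have "\<bar>fl k c i\<bar> \<le> B" using B(1)[of z i] that by (simp add: salem_cell_def)
          moreover have "\<delta> i > 0" using \<delta>[of i] i by simp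
          ultimately have "- (B + \<delta> i) \<le> c i \<and> c i \<le> B + \<delta> i"
            using grid_floor_bounds[of "\<delta> i" "c i"] by (auto simp: fl_def abs_le_iff split: if_splits)
          then show False using i by (simp add: I_def)
        qed
        then have "D k (c(k := y)) = 0" for y
          using i(2) by (simp add: D_def fk)
        then show ?thesis by simp
      qed
    qed (use k in auto)
    also have "\<dots> = ennreal ((real n + 5) * \<delta> k) * (\<Prod>i<Suc n. emeasure lborel (I i))"
    proof -
      have "emeasure (coord_measure (Suc n)) box = (\<Prod>i<Suc n. emeasure lborel (I i))"
        unfolding box_def by (rule emeasure_coord_box) measurable
      then show ?thesis
        by (subst nn_integral_cmult_indicator) (simp_all del: coord_measure.simps prod.lessThan_Suc)
    qed
    also have "(\<Prod>i<Suc n. emeasure lborel (I i)) = (\<Prod>i\<in>{..n} - {k}. ennreal (2 * (B + \<delta> i)))"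
    proof -
      have "(\<Prod>i<Suc n. emeasure lborel (I i)) = emeasure lborel (I k) * (\<Prod>i\<in>{..<Suc n} - {k}. emeasure lborel (I i))"
        using k by (intro prod.remove) auto
      also have "(\<Prod>i\<in>{..<Suc n} - {k}. emeasure lborel (I i)) = (\<Prod>i\<in>{..n} - {k}. ennreal (2 * (B + \<delta> i)))"
      proof (intro prod.cong)
        fix i assume "i \<in> {..n} - {k}"
        then have "\<delta> i > 0" "i \<noteq> k" using \<delta>[of i] by auto
        then show "emeasure lborel (I i) = ennreal (2 * (B + \<delta> i))" using B(2) by (simp add: I_def)
      qed auto
      finally show ?thesis by (simp add: I_def)
    qed
    also have "\<dots> = ennreal (\<Prod>i\<in>{..n} - {k}. 2 * (B + \<delta> i))"
      using Bd by (intro prod_ennreal mult_nonneg_nonneg) auto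
    also have "ennreal ((real n + 5) * \<delta> k) * \<dots> = ennreal (\<epsilon> k)"
      unfolding \<epsilon>_def using \<delta>[OF k] by (intro ennreal_mult'[symmetric]) auto
    finally show ?thesis .
  qed
  have step: "a k \<le> a (Suc k) + ennreal (\<epsilon> k)" "a (Suc k) \<le> a k + ennreal (\<epsilon> k)" if "k \<le> n" for k
  proof -
    have "a k \<le> (\<integral>\<^sup>+c. indicator (salem_cell n X) (fl (Suc k) c) + D k c \<partial>coord_measure (Suc n))"
      unfolding a_def by (intro nn_integral_mono) (auto simp: D_def indicator_def)
    also have "\<dots> = a (Suc k) + (\<integral>\<^sup>+c. D k c \<partial>coord_measure (Suc n))"
      unfolding a_def by (rule nn_integral_add) measurable
    finally show "a k \<le> a (Suc k) + ennreal (\<epsilon> k)" using D[OF that] by (meson add_left_mono order_trans)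
    have "a (Suc k) \<le> (\<integral>\<^sup>+c. indicator (salem_cell n X) (fl k c) + D k c \<partial>coord_measure (Suc n))"
      unfolding a_def by (intro nn_integral_mono) (auto simp: D_def indicator_def)
    also have "\<dots> = a k + (\<integral>\<^sup>+c. D k c \<partial>coord_measure (Suc n))"
      unfolding a_def by (rule nn_integral_add) measurable
    finally show "a (Suc k) \<le> a k + ennreal (\<epsilon> k)" using D[OF that] by (meson add_left_mono order_trans)
  qed
  have a0: "a 0 = emeasure (coord_measure (Suc n)) (salem_region n X)"
    by (simp add: a_def fl_def emeasure_salem_cell[symmetric] del: coord_measure.simps)
  have fin0: "a 0 \<noteq> \<infinity>"
    unfolding a0 using salem_region_volume(1)[of X n] assms(2) by (auto simp: top_unique simp del: coord_measure.simps)
  define r where "r = (\<lambda>k. enn2real (a k))"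
  have ar: "k \<le> Suc n \<Longrightarrow> a k \<noteq> \<infinity> \<and> \<bar>r k - r 0\<bar> \<le> (\<Sum>i<k. \<epsilon> i)" for k
  proof (induction k)
    case 0
    then show ?case using fin0 by simp
  next
    case (Suc k)
    then have IH: "a k \<noteq> \<infinity>" "\<bar>r k - r 0\<bar> \<le> (\<Sum>i<k. \<epsilon> i)" and k: "k \<le> n" by auto
    have fin: "a (Suc k) \<noteq> \<infinity>"
      using step(2)[OF k] IH(1) by (auto simp: top_unique)
    have e: "a k = ennreal (r k)" "a (Suc k) = ennreal (r (Suc k))" "r k \<ge> 0" "r (Suc k) \<ge> 0"
      using IH(1) fin by (auto simp: r_def less_top[symmetric])
    have "r k \<le> r (Suc k) + \<epsilon> k" "r (Suc k) \<le> r k + \<epsilon> k"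
      using step[OF k] e(3,4) \<epsilon>0[OF k] unfolding e(1,2) by (auto simp flip: ennreal_plus)
    then show ?case using IH(2) fin by auto
  qed
  have aN: "a (Suc n) = ennreal (real (card (grid_points n X \<delta>)) * (\<Prod>i\<le>n. \<delta> i))"
  proof -
    let ?L = "grid_points n X \<delta>"
    define cell where "cell = (\<lambda>l. {c. \<forall>i<Suc n. c i \<in> {l i..<l i + \<delta> i}})"
    have [measurable]: "cell l \<in> sets borel" for l
    proof -
      have "Measurable.pred borel (\<lambda>c :: nat \<Rightarrow> real. \<forall>i\<in>{..<Suc n}. c i \<in> {l i..<l i + \<delta> i})" by measurable
      then show ?thesis by (simp add: pred_def Ball_def cell_def)
    qed
    \<comment> \<open>The grid boxes are half open, so c lies in the box of at most one grid point,
      namely of its own rounding.\<close>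
    have "a (Suc n) = (\<integral>\<^sup>+c. (\<Sum>l\<in>?L. indicator (cell l) c) \<partial>coord_measure (Suc n))"
      unfolding a_def
    proof (rule nn_integral_coord_cong)
      fix c :: "nat \<Rightarrow> real" assume c: "supp_below (Suc n) c"
      have uniq: "l = fl (Suc n) c" if lL: "l \<in> ?L" and lc: "c \<in> cell l" for l
      proof
        fix i show "l i = fl (Suc n) c i"
        proof (cases "i \<le> n")
          case True
          then obtain k :: int where k: "l i = \<delta> i * of_int k" using lL by (auto simp: grid_points_def)
          have "\<delta> i * of_int k \<le> c i" "c i < \<delta> i * of_int k + \<delta> i"
            using lc True k by (auto simp: cell_def less_Suc_eq_le)
          then have "\<lfloor>c i / \<delta> i\<rfloor> = k"
            using \<delta>[OF True] by (intro floor_unique) (auto simp: field_simps)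
          then show ?thesis using True k by (simp add: fl_def grid_floor_def)
        next
          case False
          then show ?thesis
            using lL c supp_salem_region[of l n X] by (simp add: fl_def grid_points_def salem_cell_def supp_below_def)
        qed
      qed
      show "indicator (salem_cell n X) (fl (Suc n) c) = (\<Sum>l\<in>?L. indicator (cell l) c :: ennreal)"
      proof (cases "fl (Suc n) c \<in> salem_cell n X")
        case True
        have L: "fl (Suc n) c \<in> ?L"
          using True by (auto simp: grid_points_def fl_def grid_floor_def)
        have C: "c \<in> cell (fl (Suc n) c)"
          using \<delta> grid_floor_bounds by (auto simp: cell_def fl_def less_Suc_eq_le)
        have "(\<Sum>l\<in>?L. indicator (cell l) c :: ennreal) = (\<Sum>l\<in>{fl (Suc n) c}. indicator (cell l) c)"
          using uniq L by (intro sum.mono_neutral_right finite_grid_points \<delta>) (auto simp: indicator_def)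
        then show ?thesis using True C by simp
      next
        case False
        have "c \<notin> cell l" if "l \<in> ?L" for l
          using uniq[OF that] that False by (auto simp: grid_points_def)
        then have "(\<Sum>l\<in>?L. indicator (cell l) c :: ennreal) = 0" by (intro sum.neutral) auto
        then show ?thesis using False by simp
      qed
    qed
    also have "\<dots> = (\<Sum>l\<in>?L. emeasure (coord_measure (Suc n)) (cell l))"
      by (subst nn_integral_sum) (auto simp del: coord_measure.simps)
    also have "\<dots> = (\<Sum>l\<in>?L. ennreal (\<Prod>i\<le>n. \<delta> i))"
    proof (intro sum.cong refl)
      fix l
      have "emeasure (coord_measure (Suc n)) (cell l) = (\<Prod>i<Suc n. ennreal (\<delta> i))"
      proof -
        have "emeasure (coord_measure (Suc n)) (cell l) = (\<Prod>i<Suc n. emeasure lborel {l i..<l i + \<delta> i})"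
          unfolding cell_def by (rule emeasure_coord_box) simp
        also have "\<dots> = (\<Prod>i<Suc n. ennreal (\<delta> i))"
          using \<delta> by (intro prod.cong refl) (simp add: less_imp_le less_Suc_eq_le)
        finally show ?thesis .
      qed
      also have "\<dots> = ennreal (\<Prod>i<Suc n. \<delta> i)"
        using \<delta> by (intro prod_ennreal) (auto intro: less_imp_le simp: less_Suc_eq_le)
      finally show "emeasure (coord_measure (Suc n)) (cell l) = ennreal (\<Prod>i\<le>n. \<delta> i)"
        by (simp only: lessThan_Suc_atMost)
    qed
    also have "\<dots> = ennreal (real (card ?L) * (\<Prod>i\<le>n. \<delta> i))"
      by (simp add: ennreal_mult' ennreal_of_nat_eq_real_of_nat)
    finally show ?thesis .
  qed
  have "r (Suc n) = real (card (grid_points n X \<delta>)) * (\<Prod>i\<le>n. \<delta> i)"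
    unfolding r_def aN using \<delta> by (intro enn2real_ennreal mult_nonneg_nonneg prod_nonneg) (auto intro: less_imp_le)
  moreover have "r 0 = measure (coord_measure (Suc n)) (salem_region n X)"
    unfolding r_def a0 by (simp add: measure_def)
  ultimately show ?thesis
    using ar[of "Suc n"] by (simp add: \<epsilon>_def lessThan_Suc_atMost)
qed

text \<open>Only one root can exceed 2 in absolute value, so the coefficients grow linearly in X and
  not like X^(n+1). The size of the counting error rests on this.\<close>

lemma salem_region_bound:
  obtains M where "M \<ge> 1" "\<And>X c i. X \<ge> 2 \<Longrightarrow> c \<in> salem_region n X \<Longrightarrow> \<bar>c i\<bar> \<le> M * X"
proof -
  have "compact ((\<lambda>c. c i) ` root_region n (-2) 2)" for i
    by (intro compact_continuous_image compact_root_region continuous_on_coord)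
  then have "\<exists>B. \<forall>s\<in>root_region n (-2) 2. \<bar>s i\<bar> \<le> B" for i
    by (fastforce dest!: compact_imp_bounded simp: bounded_iff)
  then obtain B where B: "\<And>i s. s \<in> root_region n (-2) 2 \<Longrightarrow> \<bar>s i\<bar> \<le> B i" by metis
  define M0 where "M0 = 1 + (\<Sum>i<n. \<bar>B i\<bar>)"
  have M0: "M0 \<ge> 1" by (simp add: M0_def sum_nonneg)
  have s: "\<bar>s i\<bar> \<le> M0" if "s \<in> root_region n (-2) 2" for s i
  proof (cases "i < n")
    case True
    have "\<bar>B i\<bar> \<le> (\<Sum>i<n. \<bar>B i\<bar>)" using True by (intro member_le_sum) auto
    then show ?thesis using B[OF that, of i] by (simp add: M0_def)
  next
    case False
    then show ?thesis using supp_root_region[OF that] M0 by (simp add: supp_below_def)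
  qed
  show ?thesis
  proof (rule that[of "2 * M0"])
    fix X c i assume X: "X \<ge> (2::real)" and c: "c \<in> salem_region n X"
    then obtain x s where xs: "c = attach_root x s" "2 \<le> x" "x \<le> X" "s \<in> root_region n (-2) 2"
      by (auto simp: salem_region_def)
    have "\<bar>x * (if i = 0 then 1 else s (i - 1))\<bar> \<le> X * M0"
      unfolding abs_mult using xs M0 s[OF xs(4), of "i - 1"] by (intro mult_mono) auto
    moreover have "\<bar>s i\<bar> \<le> X * M0"
    proof -
      have "1 * M0 \<le> X * M0" using X M0 by (intro mult_right_mono) auto
      then show ?thesis using s[OF xs(4), of i] by linarith
    qed
    moreover have e: "2 * M0 * X = X * M0 + X * M0" by simp
    ultimately show "\<bar>c i\<bar> \<le> 2 * M0 * X"
      unfolding xs(1) attach_root_def e by linarith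
  qed (use M0 in simp)
qed

lemma power_Suc_diff_le:
  fixes a b :: real
  assumes "0 \<le> b" "b \<le> a"
  shows "a ^ Suc n - b ^ Suc n \<le> real (Suc n) * (a - b) * a ^ n"
proof -
  have "a ^ Suc n - b ^ Suc n = (a - b) * (\<Sum>p<Suc n. a ^ p * b ^ (n - p))"
  proof -
    have "(\<Sum>p<Suc n. b ^ (Suc n - Suc p) * a ^ p) = (\<Sum>p<Suc n. a ^ p * b ^ (n - p))"
      by (intro sum.cong) (simp_all add: mult.commute)
    then show ?thesis using power_diff_sumr2[of a "Suc n" b] by (simp only:)
  qed
  also have "\<dots> \<le> (a - b) * (\<Sum>p<Suc n. a ^ n)"
  proof (intro mult_left_mono sum_mono)
    fix p assume "p \<in> {..<Suc n}"
    then have "a ^ p * b ^ (n - p) \<le> a ^ p * a ^ (n - p)"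
      using assms by (intro mult_left_mono power_mono) auto
    then show "a ^ p * b ^ (n - p) \<le> a ^ n" using \<open>p \<in> _\<close> by (simp flip: power_add)
  qed (use assms in simp)
  also have "\<dots> = real (Suc n) * (a - b) * a ^ n" by (simp only: sum_constant card_lessThan mult_ac)
  finally show ?thesis .
qed

text \<open>Entry i is the coefficient of t^(n-i) in a polynomial of degree n + 1. Even i therefore
  mark the coefficients at odd distance from the top, the ones that carry sqrt d.\<close>

definition root_step :: "nat \<Rightarrow> nat \<Rightarrow> real" where
  "root_step d i = (if even i then sqrt (real d) else 1)"

text \<open>The number of even i \<le> n, so that a grid box has volume sqrt d to this
  power.\<close>

definition odd_codim :: "nat \<Rightarrow> nat" where
  "odd_codim n = n div 2 + 1"

lemma prod_root_step: "(\<Prod>i\<le>n. root_step d i) = sqrt (real d) ^ odd_codim n"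
  by (induction n) (auto simp: root_step_def odd_codim_def elim!: oddE)

lemma root_step_pos: "d \<ge> 1 \<Longrightarrow> root_step d i > 0"
  by (simp add: root_step_def)

lemma root_step_le: "d \<ge> 1 \<Longrightarrow> root_step d i \<le> sqrt (real d)"
  by (simp add: root_step_def)

lemma disc_vol_nonneg: "disc_vol n \<ge> 0"
  using ordered_vol_pos[of n] by (simp add: disc_vol_def)

lemma measure_salem_region:
  assumes "X \<ge> 3"
  shows "\<bar>measure (coord_measure (Suc n)) (salem_region n X) - disc_vol n * X ^ Suc n / real (Suc n)\<bar>
     \<le> disc_vol n * 2 * 3 ^ n * X ^ n"
proof -
  let ?V = "\<lambda>X. disc_vol n * X ^ Suc n / real (Suc n)"
  have v: "disc_vol n / real (Suc n) \<ge> 0" using disc_vol_nonneg[of n] by simp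
  have "?V (X - 2) \<ge> 0" using assms disc_vol_nonneg[of n] by simp
  moreover have "emeasure (coord_measure (Suc n)) (salem_region n X) \<noteq> \<infinity>"
    using salem_region_volume(1)[of X n] assms by (auto simp: top_unique simp del: coord_measure.simps)
  ultimately have "measure (coord_measure (Suc n)) (salem_region n X) \<le> ?V (X + 2)"
     "?V (X - 2) \<le> measure (coord_measure (Suc n)) (salem_region n X)"
    using salem_region_volume[of X n] assms disc_vol_nonneg[of n]
    by (auto simp: emeasure_eq_ennreal_measure less_top[symmetric] simp del: coord_measure.simps power_Suc of_nat_Suc)
  moreover have "?V (X + 2) - ?V X \<le> disc_vol n * 2 * 3 ^ n * X ^ n"
  proof -
    have "?V (X + 2) - ?V X = disc_vol n / real (Suc n) * ((X + 2) ^ Suc n - X ^ Suc n)"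
      by (simp add: diff_divide_distrib right_diff_distrib del: power_Suc of_nat_Suc)
    also have "\<dots> \<le> disc_vol n / real (Suc n) * (real (Suc n) * ((X + 2) - X) * (X + 2) ^ n)"
      using assms by (intro mult_left_mono power_Suc_diff_le v) auto
    also have "\<dots> = disc_vol n * 2 * (X + 2) ^ n" by (simp del: of_nat_Suc)
    also have "\<dots> \<le> disc_vol n * 2 * (3 * X) ^ n"
      using assms disc_vol_nonneg[of n] by (intro mult_left_mono power_mono) auto
    finally show ?thesis by (simp only: power_mult_distrib mult.assoc)
  qed
  moreover have "?V X - ?V (X - 2) \<le> disc_vol n * 2 * 3 ^ n * X ^ n"
  proof -
    have "?V X - ?V (X - 2) = disc_vol n / real (Suc n) * (X ^ Suc n - (X - 2) ^ Suc n)"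
      by (simp add: diff_divide_distrib right_diff_distrib del: power_Suc of_nat_Suc)
    also have "\<dots> \<le> disc_vol n / real (Suc n) * (real (Suc n) * (X - (X - 2)) * X ^ n)"
      using assms by (intro mult_left_mono power_Suc_diff_le v) auto
    also have "\<dots> = disc_vol n * 2 * X ^ n" by (simp del: of_nat_Suc)
    also have "\<dots> \<le> disc_vol n * 2 * (3 * X) ^ n"
      using assms disc_vol_nonneg[of n] by (intro mult_left_mono power_mono) auto
    finally show ?thesis by (simp only: power_mult_distrib mult.assoc)
  qed
  ultimately show ?thesis by (simp del: coord_measure.simps power_Suc of_nat_Suc)
qed

text \<open>Rounding a coordinate costs O(sqrt d X^n): its own step is at most sqrt d, and the other
  n sides are O(X) as long as sqrt d \<le> \<kappa> X. Dividing by the volume of a grid box cancels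
  one factor sqrt d. The constant does not depend on d, as the summation over d requires.\<close>

lemma card_grid_points:
  assumes "n > 0" "\<kappa> > 0"
  obtains C where "C \<ge> 0" "\<And>X d. X \<ge> 3 \<Longrightarrow> d \<ge> 1 \<Longrightarrow> sqrt (real d) \<le> \<kappa> * X \<Longrightarrow>
    \<bar>real (card (grid_points n X (root_step d))) - disc_vol n / real (Suc n) * X ^ Suc n / sqrt (real d) ^ odd_codim n\<bar>
      \<le> C * X ^ n / sqrt (real d) ^ (odd_codim n - 1)"
proof -
  obtain M where M: "M \<ge> 1" "\<And>X c i. X \<ge> 2 \<Longrightarrow> c \<in> salem_region n X \<Longrightarrow> \<bar>c i\<bar> \<le> M * X"
    using salem_region_bound[of n] by blast
  define C1 where "C1 = real (Suc n) * (real n + 5) * (2 * (M + \<kappa>)) ^ n"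
  define C2 where "C2 = disc_vol n * 2 * 3 ^ n"
  have C: "C1 \<ge> 0" "C2 \<ge> 0" using M(1) assms(2) disc_vol_nonneg[of n] by (auto simp: C1_def C2_def)
  show ?thesis
  proof (rule that[of "C1 + C2"])
    fix X d assume X: "X \<ge> (3::real)" and d: "d \<ge> (1::nat)" and dX: "sqrt (real d) \<le> \<kappa> * X"
    let ?N = "real (card (grid_points n X (root_step d)))" and ?r = "sqrt (real d)"
    let ?vol = "measure (coord_measure (Suc n)) (salem_region n X)"
    have r: "?r \<ge> 1" using d by simp
    have "\<bar>?N * (\<Prod>i\<le>n. root_step d i) - ?vol\<bar> \<le>
      (\<Sum>k\<le>n. (real n + 5) * root_step d k * (\<Prod>i\<in>{..n} - {k}. 2 * (M * X + root_step d i)))"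
      using X M root_step_pos[OF d] assms(1) by (intro grid_points_volume) auto
    also have "\<dots> \<le> (\<Sum>k\<le>n. (real n + 5) * ?r * (2 * (M + \<kappa>) * X) ^ n)"
    proof (intro sum_mono mult_mono mult_nonneg_nonneg)
      fix k assume k: "k \<in> {..n}"
      have st: "0 \<le> root_step d i \<and> root_step d i \<le> \<kappa> * X" for i
        using root_step_pos[OF d, of i] root_step_le[OF d, of i] dX by linarith
      show "(\<Prod>i\<in>{..n} - {k}. 2 * (M * X + root_step d i)) \<le> (2 * (M + \<kappa>) * X) ^ n"
      proof -
        have "(\<Prod>i\<in>{..n} - {k}. 2 * (M * X + root_step d i)) \<le> (\<Prod>i\<in>{..n} - {k}. 2 * (M + \<kappa>) * X)"
          using st M(1) X by (intro prod_mono) (auto simp: algebra_simps)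
        also have "\<dots> = (2 * (M + \<kappa>) * X) ^ n" using k by simp
        finally show ?thesis .
      qed
      show "(\<Prod>i\<in>{..n} - {k}. 2 * (M * X + root_step d i)) \<ge> 0"
        using st M(1) X by (intro prod_nonneg) auto
    qed (use root_step_le[OF d] root_step_pos[OF d] in \<open>auto simp: less_imp_le\<close>)
    also have "\<dots> = C1 * X ^ n * ?r" by (simp add: C1_def power_mult_distrib)
    finally have 1: "\<bar>?N * ?r ^ odd_codim n - ?vol\<bar> \<le> C1 * X ^ n * ?r"
      by (simp add: prod_root_step)
    have 2: "\<bar>?vol - disc_vol n * X ^ Suc n / real (Suc n)\<bar> \<le> C2 * X ^ n * ?r"
    proof -
      have "C2 * X ^ n * 1 \<le> C2 * X ^ n * ?r" using C X r by (intro mult_left_mono) auto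
      then show ?thesis using measure_salem_region[OF X, of n] unfolding C2_def by linarith
    qed
    have 3: "\<bar>?N * ?r ^ odd_codim n - disc_vol n / real (Suc n) * X ^ Suc n\<bar> \<le> (C1 + C2) * X ^ n * ?r"
      using 1 2 by (simp add: algebra_simps del: power_Suc of_nat_Suc)
    have "odd_codim n = Suc (odd_codim n - 1)" by (simp add: odd_codim_def)
    then have rp: "?r ^ odd_codim n = ?r * ?r ^ (odd_codim n - 1)" by (metis power_Suc)
    have "?N - disc_vol n / real (Suc n) * X ^ Suc n / ?r ^ odd_codim n =
        (?N * ?r ^ odd_codim n - disc_vol n / real (Suc n) * X ^ Suc n) / ?r ^ odd_codim n"
      using r d by (simp add: diff_divide_distrib del: power_Suc of_nat_Suc)
    then have "\<bar>?N - disc_vol n / real (Suc n) * X ^ Suc n / ?r ^ odd_codim n\<bar> =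
        \<bar>?N * ?r ^ odd_codim n - disc_vol n / real (Suc n) * X ^ Suc n\<bar> / ?r ^ odd_codim n"
      by (simp add: abs_divide del: power_Suc of_nat_Suc)
    also have "\<dots> \<le> ((C1 + C2) * X ^ n * ?r) / ?r ^ odd_codim n"
      using 3 by (intro divide_right_mono) auto
    also have "\<dots> = (C1 + C2) * X ^ n / ?r ^ (odd_codim n - 1)"
      unfolding rp using r d by simp
    finally show "\<bar>?N - disc_vol n / real (Suc n) * X ^ Suc n / ?r ^ odd_codim n\<bar> \<le>
      (C1 + C2) * X ^ n / ?r ^ (odd_codim n - 1)" .
  qed (use C in simp)
qed

text \<open>Dropping the constant coefficient loses at most one factor sqrt d, whatever the parity
  of n.\<close>

lemma prod_root_step_less: "d \<ge> 1 \<Longrightarrow> (\<Prod>i<n. root_step d i) \<ge> sqrt (real d) ^ (odd_codim n - 1)"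
proof -
  assume d: "d \<ge> 1"
  have "sqrt (real d) ^ odd_codim n = (\<Prod>i<n. root_step d i) * root_step d n"
    by (simp flip: prod_root_step lessThan_Suc_atMost)
  also have "\<dots> \<le> (\<Prod>i<n. root_step d i) * sqrt (real d)"
    using root_step_pos[OF d] root_step_le[OF d] by (intro mult_left_mono prod_nonneg) (auto simp: less_imp_le)
  finally show ?thesis using d by (simp add: odd_codim_def)
qed

lemma card_int_interval:
  assumes "\<delta> > 0" "b \<ge> 0"
  shows "finite {k::int. \<bar>\<delta> * of_int k\<bar> \<le> b}" "real (card {k::int. \<bar>\<delta> * of_int k\<bar> \<le> b}) \<le> 2 * b / \<delta> + 1"
proof -
  have eq: "{k::int. \<bar>\<delta> * of_int k\<bar> \<le> b} = {- \<lfloor>b / \<delta>\<rfloor>..\<lfloor>b / \<delta>\<rfloor>}"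
  proof -
    have "\<bar>\<delta> * of_int k\<bar> \<le> b \<longleftrightarrow> - \<lfloor>b / \<delta>\<rfloor> \<le> k \<and> k \<le> \<lfloor>b / \<delta>\<rfloor>" for k :: int
    proof -
      have "\<bar>\<delta> * of_int k\<bar> \<le> b \<longleftrightarrow> of_int \<bar>k\<bar> \<le> b / \<delta>"
        using assms by (simp add: abs_mult pos_le_divide_eq mult.commute)
      also have "\<dots> \<longleftrightarrow> \<bar>k\<bar> \<le> \<lfloor>b / \<delta>\<rfloor>" by (simp only: le_floor_iff)
      finally show ?thesis by auto
    qed
    then show ?thesis unfolding set_eq_iff mem_Collect_eq atLeastAtMost_iff by blast
  qed
  show "finite {k::int. \<bar>\<delta> * of_int k\<bar> \<le> b}" unfolding eq by simp
  have "\<lfloor>b / \<delta>\<rfloor> \<ge> 0" using assms by simp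
  then have "real (card {k::int. \<bar>\<delta> * of_int k\<bar> \<le> b}) = 2 * of_int \<lfloor>b / \<delta>\<rfloor> + 1" unfolding eq by simp
  also have "\<dots> \<le> 2 * (b / \<delta>) + 1" using of_int_floor_le[of "b / \<delta>"] by linarith
  finally show "real (card {k::int. \<bar>\<delta> * of_int k\<bar> \<le> b}) \<le> 2 * b / \<delta> + 1" by simp
qed

text \<open>A prescribed root \<open>\<beta>\<close> determines the constant coefficient, which saves one dimension.\<close>

lemma card_grid_points_root:
  assumes "\<kappa> > 0"
  obtains C where "C \<ge> 0" "\<And>X d \<beta>. X \<ge> 3 \<Longrightarrow> d \<ge> 1 \<Longrightarrow> sqrt (real d) \<le> \<kappa> * X \<Longrightarrow>
    real (card {c \<in> grid_points n X (root_step d). poly (monic_poly (Suc n) c) \<beta> = 0})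
      \<le> C * X ^ n / sqrt (real d) ^ (odd_codim n - 1)"
proof -
  obtain M where M: "M \<ge> 1" "\<And>X c i. X \<ge> 2 \<Longrightarrow> c \<in> salem_region n X \<Longrightarrow> \<bar>c i\<bar> \<le> M * X"
    using salem_region_bound[of n] by blast
  show ?thesis
  proof (rule that[of "(2 * M + \<kappa>) ^ n"])
    fix X d \<beta> assume X: "X \<ge> (3::real)" and d: "d \<ge> (1::nat)" and dX: "sqrt (real d) \<le> \<kappa> * X"
    let ?\<delta> = "root_step d"
    define A where "A = {c \<in> grid_points n X ?\<delta>. poly (monic_poly (Suc n) c) \<beta> = 0}"
    define h where "h = (\<lambda>c. restrict (\<lambda>i. \<lfloor>c i / ?\<delta> i\<rfloor>) {..<n})"
    have ex: "?\<delta> i * of_int \<lfloor>c i / ?\<delta> i\<rfloor> = c i" if cA: "c \<in> A" and i: "i \<le> n" for c i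
    proof -
      obtain k :: int where "c i = ?\<delta> i * of_int k" using cA i by (auto simp: A_def grid_points_def)
      then show ?thesis using root_step_pos[OF d, of i] by simp
    qed
    have reg: "c \<in> salem_region n X" if "c \<in> A" for c
      using that by (auto simp: A_def grid_points_def salem_cell_def)
    have inj: "inj_on h A"
    proof (rule inj_onI)
      fix c e assume ce: "c \<in> A" "e \<in> A" "h c = h e"
      have lt: "c i = e i" if "i < n" for i
      proof -
        have "\<lfloor>c i / ?\<delta> i\<rfloor> = \<lfloor>e i / ?\<delta> i\<rfloor>"
          using fun_cong[OF ce(3), of i] that by (simp add: h_def)
        then have "?\<delta> i * of_int \<lfloor>c i / ?\<delta> i\<rfloor> = ?\<delta> i * of_int \<lfloor>e i / ?\<delta> i\<rfloor>" by (simp only:)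
        then show ?thesis unfolding ex[OF ce(1) less_imp_le[OF that]] ex[OF ce(2) less_imp_le[OF that]] .
      qed
      then have "monic_poly n c = monic_poly n e" by (rule monic_poly_cong)
      then have "c n = e n" using ce(1,2) by (simp add: A_def)
      show "c = e"
      proof
        fix i show "c i = e i"
          using lt[of i] \<open>c n = e n\<close> supp_salem_region[OF reg[OF ce(1)]] supp_salem_region[OF reg[OF ce(2)]]
          by (cases i n rule: linorder_cases) (auto simp: supp_below_def)
      qed
    qed
    have MX: "M * X \<ge> 0" using M(1) X by simp
    define I where "I = (\<lambda>i. {k::int. \<bar>?\<delta> i * of_int k\<bar> \<le> M * X})"
    have finI: "finite (I i)" for i
      unfolding I_def by (rule card_int_interval(1)[OF root_step_pos[OF d] MX])
    have "h ` A \<subseteq> (\<Pi>\<^sub>E i\<in>{..<n}. I i)"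
    proof (rule image_subsetI)
      fix c assume c: "c \<in> A"
      have "\<bar>?\<delta> i * of_int \<lfloor>c i / ?\<delta> i\<rfloor>\<bar> \<le> M * X" if "i < n" for i
        using ex[OF c, of i] M(2)[OF _ reg[OF c], of i] that X by simp
      then show "h c \<in> (\<Pi>\<^sub>E i\<in>{..<n}. I i)" by (auto simp: h_def I_def)
    qed
    then have "card A \<le> card (\<Pi>\<^sub>E i\<in>{..<n}. I i)"
      using inj by (metis card_image card_mono finI finite_PiE finite_lessThan)
    also have "\<dots> = (\<Prod>i<n. card (I i))" by (simp add: card_PiE)
    finally have "real (card A) \<le> (\<Prod>i<n. real (card (I i)))" by (simp flip: of_nat_prod)
    also have "\<dots> \<le> (\<Prod>i<n. (2 * M + \<kappa>) * X / ?\<delta> i)"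
    proof (intro prod_mono conjI)
      fix i
      have "real (card (I i)) \<le> 2 * (M * X) / ?\<delta> i + 1"
        unfolding I_def by (rule card_int_interval(2)[OF root_step_pos[OF d] MX])
      also have "\<dots> \<le> (2 * M + \<kappa>) * X / ?\<delta> i"
      proof -
        have "?\<delta> i \<le> \<kappa> * X" using root_step_le[OF d, of i] dX by linarith
        then show ?thesis using root_step_pos[OF d, of i] by (simp add: field_simps)
      qed
      finally show "real (card (I i)) \<le> (2 * M + \<kappa>) * X / ?\<delta> i" .
    qed simp
    also have "\<dots> = ((2 * M + \<kappa>) * X) ^ n / (\<Prod>i<n. ?\<delta> i)" by (simp add: prod_dividef)
    also have "\<dots> \<le> ((2 * M + \<kappa>) * X) ^ n / sqrt (real d) ^ (odd_codim n - 1)"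
      using M(1) X assms d prod_root_step_less[OF d, of n] root_step_pos[OF d]
      by (intro divide_left_mono mult_pos_pos prod_pos) auto
    finally show "real (card {c \<in> grid_points n X (root_step d). poly (monic_poly (Suc n) c) \<beta> = 0})
      \<le> (2 * M + \<kappa>) ^ n * X ^ n / sqrt (real d) ^ (odd_codim n - 1)"
      by (simp add: A_def power_mult_distrib)
  qed (use M(1) assms in auto)
qed

text \<open>G will be the set of points with irreducible p. Since Z is finite and the same for all X
  and d, discarding the other points costs no more than the error already present.\<close>

lemma card_grid_points_generic:
  assumes "n > 0" "\<kappa> > 0" "finite Z"
  obtains C where "C \<ge> 0" "\<And>X d G. X \<ge> 3 \<Longrightarrow> d \<ge> 1 \<Longrightarrow> sqrt (real d) \<le> \<kappa> * X \<Longrightarrow>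
    G \<subseteq> grid_points n X (root_step d) \<Longrightarrow>
    (\<And>c. c \<in> grid_points n X (root_step d) - G \<Longrightarrow> \<exists>\<beta>\<in>Z. poly (monic_poly (Suc n) c) \<beta> = 0) \<Longrightarrow>
    \<bar>real (card G) - disc_vol n / real (Suc n) * X ^ Suc n / sqrt (real d) ^ odd_codim n\<bar>
      \<le> C * X ^ n / sqrt (real d) ^ (odd_codim n - 1)"
proof -
  obtain C1 where C1: "C1 \<ge> 0" "\<And>X d. X \<ge> 3 \<Longrightarrow> d \<ge> 1 \<Longrightarrow> sqrt (real d) \<le> \<kappa> * X \<Longrightarrow>
    \<bar>real (card (grid_points n X (root_step d))) - disc_vol n / real (Suc n) * X ^ Suc n / sqrt (real d) ^ odd_codim n\<bar>
      \<le> C1 * X ^ n / sqrt (real d) ^ (odd_codim n - 1)"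
    using card_grid_points[OF assms(1,2)] by blast
  obtain C2 where C2: "C2 \<ge> 0" "\<And>X d \<beta>. X \<ge> 3 \<Longrightarrow> d \<ge> 1 \<Longrightarrow> sqrt (real d) \<le> \<kappa> * X \<Longrightarrow>
    real (card {c \<in> grid_points n X (root_step d). poly (monic_poly (Suc n) c) \<beta> = 0})
      \<le> C2 * X ^ n / sqrt (real d) ^ (odd_codim n - 1)"
    using card_grid_points_root[OF assms(2), of n] by blast
  show ?thesis
  proof (rule that[of "C1 + real (card Z) * C2"])
    fix X d G assume X: "X \<ge> (3::real)" and d: "d \<ge> (1::nat)" and dX: "sqrt (real d) \<le> \<kappa> * X"
      and G: "G \<subseteq> grid_points n X (root_step d)"
      and bad: "\<And>c. c \<in> grid_points n X (root_step d) - G \<Longrightarrow> \<exists>\<beta>\<in>Z. poly (monic_poly (Suc n) c) \<beta> = 0"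
    let ?L = "grid_points n X (root_step d)" and ?e = "X ^ n / sqrt (real d) ^ (odd_codim n - 1)"
    have fin: "finite ?L" by (rule finite_grid_points) (rule root_step_pos[OF d])
    have "?L - G \<subseteq> (\<Union>\<beta>\<in>Z. {c \<in> ?L. poly (monic_poly (Suc n) c) \<beta> = 0})" using bad by blast
    then have "card (?L - G) \<le> card (\<Union>\<beta>\<in>Z. {c \<in> ?L. poly (monic_poly (Suc n) c) \<beta> = 0})"
      using fin assms(3) by (intro card_mono) auto
    also have "\<dots> \<le> (\<Sum>\<beta>\<in>Z. card {c \<in> ?L. poly (monic_poly (Suc n) c) \<beta> = 0})"
      by (rule card_UN_le[OF assms(3)])
    finally have "real (card (?L - G)) \<le> (\<Sum>\<beta>\<in>Z. real (card {c \<in> ?L. poly (monic_poly (Suc n) c) \<beta> = 0}))"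
      by (simp flip: of_nat_sum)
    also have "\<dots> \<le> (\<Sum>\<beta>\<in>Z. C2 * X ^ n / sqrt (real d) ^ (odd_codim n - 1))"
      by (intro sum_mono C2(2)[OF X d dX])
    finally have b: "real (card (?L - G)) \<le> real (card Z) * C2 * ?e" by simp
    have "real (card ?L) = real (card G) + real (card (?L - G))"
      using card_Diff_subset[OF finite_subset[OF G fin] G] card_mono[OF fin G] by simp
    then show "\<bar>real (card G) - disc_vol n / real (Suc n) * X ^ Suc n / sqrt (real d) ^ odd_codim n\<bar>
      \<le> (C1 + real (card Z) * C2) * X ^ n / sqrt (real d) ^ (odd_codim n - 1)"
      using C1(2)[OF X d dX] b by (simp add: distrib_right add_divide_distrib del: power_Suc of_nat_Suc)
  qed (use C1 C2 in auto)
qed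

lemma poly_monic_poly_minus:
  fixes c :: "nat \<Rightarrow> real"
  assumes "\<And>i. i < N \<Longrightarrow> even i \<Longrightarrow> c i = 0"
  shows "poly (monic_poly N c) (- t) = (-1) ^ N * poly (monic_poly N c) t"
  using assms
proof (induction N)
  case (Suc N)
  then have IH: "poly (monic_poly N c) (- t) = (-1) ^ N * poly (monic_poly N c) t" by simp
  show ?case
  proof (cases "even N")
    case True
    then show ?thesis using Suc.prems[of N] IH by simp
  qed (use IH in simp)
qed simp

text \<open>If all coefficients that carry sqrt d vanished, the polynomial would be even or odd and
  would have the root - x < -2, which no member of the region has. The nonzero coefficient found
  here later both determines d and bounds it.\<close>

lemma salem_region_even_coeff:
  assumes "poly (monic_poly (Suc n) c) x = 0" "x > 2" "c \<in> salem_region n X"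
  obtains i where "i \<le> n" "even i" "c i \<noteq> 0"
proof (rule ccontr)
  assume "\<not> thesis"
  then have "\<And>i. i < Suc n \<Longrightarrow> even i \<Longrightarrow> c i = 0" using that by (meson less_Suc_eq_le)
  then have "poly (monic_poly (Suc n) c) (- x) = 0"
    using poly_monic_poly_minus[of "Suc n" c x] assms(1) by (simp del: monic_poly.simps)
  moreover obtain w where w: "c = root_coeffs (Suc n) w" "ordered_tuple n (-2) 2 w" "2 \<le> w n"
    using assms(3) unfolding salem_region_altdef by auto
  ultimately have "(\<Prod>i<Suc n. - x - w i) = 0" by (simp only: w(1) poly_root_coeffs)
  then obtain i where "i < Suc n" "- x = w i" by (auto simp del: prod.lessThan_Suc)
  then have "w i < -2" using assms(2) by simp
  moreover have "w i \<ge> -2" if "i < n" using w(2) that by (simp add: ordered_tuple_def)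
  ultimately show False using w(3) \<open>i < Suc n\<close> by (cases "i = n") auto
qed

section \<open>Sums over squarefree numbers\<close>

text \<open>After division by the gcd of a and b there are coprime u, v with d u^2 = e v^2. Then u^2
  divides e and v^2 divides d, so u = v = 1.\<close>

lemma squarefree_mult_square_unique:
  fixes d e a b :: nat
  assumes "squarefree d" "squarefree e" "d * a\<^sup>2 = e * b\<^sup>2" "a > 0"
  shows "d = e \<and> a = b"
proof -
  have "d > 0" "e > 0" using assms(1,2) by (auto intro!: Nat.gr0I)
  then have "b > 0" using assms(3,4) by (auto intro!: Nat.gr0I)
  define g where "g = gcd a b"
  have "g > 0" using \<open>a > 0\<close> by (simp add: g_def)
  obtain u v where uv: "a = g * u" "b = g * v" "coprime u v"
    unfolding g_def using \<open>a > 0\<close> by (metis gcd_coprime_exists gcd_eq_0_iff mult.commute not_gr_zero)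
  have eq: "d * u\<^sup>2 = e * v\<^sup>2"
    using assms(3) \<open>g > 0\<close> unfolding uv(1,2) by (simp add: power_mult_distrib)
  have cop: "coprime (u\<^sup>2) (v\<^sup>2)" using uv(3) by simp
  have "u\<^sup>2 dvd e" using eq cop by (metis coprime_dvd_mult_left_iff dvd_triv_right)
  then have "u = 1" using assms(2) by (auto dest: squarefreeD)
  have "v\<^sup>2 dvd d" using eq cop by (metis coprime_commute coprime_dvd_mult_left_iff dvd_triv_right)
  then have "v = 1" using assms(1) by (auto dest: squarefreeD)
  show ?thesis using eq uv \<open>u = 1\<close> \<open>v = 1\<close> by simp
qed

lemma squarefree_decomposition_bij:
  "bij_betw (\<lambda>(a, d). d * a\<^sup>2) ({1..} \<times> {d :: nat. squarefree d}) {1..}"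
proof (rule bij_betwI')
  fix p q :: "nat \<times> nat" assume "p \<in> {1..} \<times> {d :: nat. squarefree d}" "q \<in> {1..} \<times> {d :: nat. squarefree d}"
  then obtain a d b e where pq: "p = (a, d)" "q = (b, e)" "a > 0" "squarefree d" "squarefree e"
    by (cases p; cases q) auto
  show "((case p of (a, d) \<Rightarrow> d * a\<^sup>2) = (case q of (a, d) \<Rightarrow> d * a\<^sup>2)) = (p = q)"
    using squarefree_mult_square_unique[OF pq(4,5) _ pq(3), of b] unfolding pq(1,2) by auto
next
  fix p :: "nat \<times> nat" assume "p \<in> {1..} \<times> {d :: nat. squarefree d}"
  then show "(case p of (a, d) \<Rightarrow> d * a\<^sup>2) \<in> {1..}"
    by (auto simp: Suc_le_eq intro!: Nat.gr0I)
next
  fix n :: nat assume n: "n \<in> {1..}"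
  have "square_part n \<noteq> 0" using n by simp
  then have "1 \<le> square_part n" by linarith
  then have "(square_part n, squarefree_part n) \<in> {1..} \<times> {d. squarefree d}" by auto
  moreover have "n = squarefree_part n * (square_part n)\<^sup>2" by (rule squarefree_decompose)
  ultimately show "\<exists>p\<in>{1..} \<times> {d. squarefree d}. n = (case p of (a, d) \<Rightarrow> d * a\<^sup>2)"
    by (intro bexI[of _ "(square_part n, squarefree_part n)"]) auto
qed

definition sqfree_upto :: "nat \<Rightarrow> nat set" where
  "sqfree_upto N = {d. squarefree d \<and> 1 \<le> d \<and> d \<le> N}"

lemma finite_sqfree_upto [simp]: "finite (sqfree_upto N)"
  by (rule finite_subset[of _ "{..N}"]) (auto simp: sqfree_upto_def)

lemma squarefree_nat_pos: "squarefree (d :: nat) \<Longrightarrow> d \<ge> 1"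
  by (cases d) auto

text \<open>The terms are grouped by the square part of n = d a^2. For a^2 > N the inner sum is
  empty, so a may simply run up to N.\<close>

lemma sum_sqfree_decompose:
  fixes f :: "nat \<Rightarrow> real"
  assumes "\<And>a d. f (d * a\<^sup>2) = g a * f d"
  shows "(\<Sum>n=1..N. f n) = (\<Sum>a=1..N. g a * (\<Sum>d\<in>sqfree_upto (N div a\<^sup>2). f d))"
proof -
  define P where "P = (SIGMA a:{1..N}. sqfree_upto (N div a\<^sup>2))"
  have "bij_betw (\<lambda>(a, d). d * a\<^sup>2) P {1..N}"
  proof (rule bij_betw_subset[OF squarefree_decomposition_bij])
    show "P \<subseteq> {1..} \<times> {d. squarefree d}" by (auto simp: P_def sqfree_upto_def)
    show "(\<lambda>(a, d). d * a\<^sup>2) ` P = {1..N}"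
    proof safe
      fix a d assume "(a, d) \<in> P"
      then have "1 \<le> a" "1 \<le> d" "d \<le> N div a\<^sup>2" by (auto simp: P_def sqfree_upto_def)
      then show "d * a\<^sup>2 \<in> {1..N}" by (auto simp: less_eq_div_iff_mult_less_eq Suc_le_eq)
    next
      fix n assume n: "n \<in> {1..N}"
      then have "n \<in> (\<lambda>(a, d). d * a\<^sup>2) ` ({1..} \<times> {d. squarefree d})"
        using squarefree_decomposition_bij by (auto simp: bij_betw_def)
      then obtain a d where ad: "a \<ge> 1" "squarefree d" "n = d * a\<^sup>2" by auto
      have d: "d \<ge> 1" using ad(2) by (rule squarefree_nat_pos)
      have "a \<le> a\<^sup>2" using ad(1) by (simp add: power2_eq_square)
      also have "\<dots> \<le> n" using d ad(3) by simp
      finally have "a \<le> N" using n by simp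
      moreover have "d \<le> N div a\<^sup>2" using n ad by (simp add: less_eq_div_iff_mult_less_eq)
      ultimately have "(a, d) \<in> P" using ad d by (auto simp: P_def sqfree_upto_def)
      then show "n \<in> (\<lambda>(a, d). d * a\<^sup>2) ` P" using ad(3) by (intro image_eqI[of _ _ "(a, d)"]) auto
    qed
  qed
  then have "(\<Sum>n=1..N. f n) = (\<Sum>p\<in>P. f (case p of (a, d) \<Rightarrow> d * a\<^sup>2))"
    by (rule sum.reindex_bij_betw[symmetric])
  also have "\<dots> = (\<Sum>(a, d)\<in>P. g a * f d)"
    by (intro sum.cong) (auto simp: assms)
  also have "\<dots> = (\<Sum>a=1..N. g a * (\<Sum>d\<in>sqfree_upto (N div a\<^sup>2). f d))"
    unfolding P_def by (subst sum.Sigma[symmetric]) (auto simp: sum_distrib_left)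
  finally show ?thesis .
qed

lemma harm_eq_sum: "harm n = (\<Sum>k=1..n. 1 / real k)"
  by (simp add: harm_def inverse_eq_divide)

lemma harm_le_ln: "n \<ge> 1 \<Longrightarrow> harm n \<le> ln (real n) + (1 :: real)"
proof (induction n rule: dec_induct)
  case (step n)
  have "ln (real n / real (Suc n)) \<le> real n / real (Suc n) - 1"
    using step by (intro ln_le_minus_one) auto
  moreover have "ln (real n / real (Suc n)) = ln (real n) - ln (real (Suc n))"
    using step by (intro ln_divide_pos) auto
  moreover have "real n / real (Suc n) - 1 = - (1 / real (Suc n))" by (simp add: field_simps)
  ultimately have "ln (real n) + 1 / real (Suc n) \<le> ln (real (Suc n))" by linarith
  then show ?case using step by (simp add: harm_Suc inverse_eq_divide)
qed (simp add: harm_expand)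

lemma sum_powr_le:
  assumes "s > 1" "M \<ge> 1"
  shows "(\<Sum>k\<in>{M<..N}. real k powr - s) \<le> real M powr (1 - s) / (s - 1)"
proof (cases "M \<le> N")
  case True
  have "(\<Sum>k\<in>{M<..N}. real k powr - s) \<le> (real M powr (1 - s) - real N powr (1 - s)) / (s - 1)"
    using True
  proof (induction N rule: dec_induct)
    case (step N)
    have N: "real N > 0" using step assms by simp
    have "\<exists>z. real N < z \<and> z < real (Suc N) \<and> real (Suc N) powr (1 - s) - real N powr (1 - s) =
        (real (Suc N) - real N) * ((1 - s) * z powr (1 - s - 1))"
    proof (intro MVT2)
      fix x assume "real N \<le> x" "x \<le> real (Suc N)"
      then show "((\<lambda>x. x powr (1 - s)) has_real_derivative (1 - s) * x powr (1 - s - 1)) (at x)"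
        using N by (intro has_real_derivative_powr) auto
    qed simp
    then obtain z where z: "real N < z" "z < real (Suc N)"
      "real (Suc N) powr (1 - s) - real N powr (1 - s) = (1 - s) * z powr (- s)" by auto
    have "real (Suc N) powr - s \<le> z powr - s" using z N assms by (intro powr_mono2') auto
    then have "(s - 1) * real (Suc N) powr - s \<le> (s - 1) * z powr - s" using assms by (intro mult_left_mono) auto
    also have "\<dots> = real N powr (1 - s) - real (Suc N) powr (1 - s)" using z(3) by (simp add: algebra_simps)
    finally have "real (Suc N) powr - s \<le> (real N powr (1 - s) - real (Suc N) powr (1 - s)) / (s - 1)"
      using assms by (simp add: field_simps)
    moreover have "{M<..Suc N} = insert (Suc N) {M<..N}" using step by auto
    ultimately show ?case using step.IH by (simp add: diff_divide_distrib)
  qed simp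
  also have "\<dots> \<le> real M powr (1 - s) / (s - 1)" using assms by (intro divide_right_mono) auto
  finally show ?thesis .
qed (use assms in simp)

lemma sum_inverse_sqrt_le: "(\<Sum>k=1..N. 1 / sqrt (real k)) \<le> 2 * sqrt (real N)"
proof (induction N)
  case (Suc N)
  have "1 / sqrt (real (Suc N)) \<le> 2 * (sqrt (real (Suc N)) - sqrt (real N))"
  proof -
    have p: "sqrt (real (Suc N)) > 0" by simp
    have "(sqrt (real (Suc N)) - sqrt (real N)) * (sqrt (real (Suc N)) + sqrt (real N)) = 1"
      by (simp add: algebra_simps flip: power2_eq_square)
    moreover have "(sqrt (real (Suc N)) - sqrt (real N)) * (sqrt (real (Suc N)) + sqrt (real N)) \<le>
       (sqrt (real (Suc N)) - sqrt (real N)) * (sqrt (real (Suc N)) + sqrt (real (Suc N)))"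
      by (intro mult_left_mono) auto
    ultimately have "1 \<le> (sqrt (real (Suc N)) - sqrt (real N)) * (2 * sqrt (real (Suc N)))" by simp
    moreover have "1 / r \<le> 2 * (r - t)" if "1 \<le> (r - t) * (2 * r)" "r > 0" for r t :: real
    proof -
      have "1 / r \<le> z \<longleftrightarrow> 1 \<le> z * r" for z using that(2) by (rule pos_divide_le_eq)
      then show ?thesis using that(1) by (simp add: mult_ac)
    qed
    ultimately show ?thesis using p by blast
  qed
  then show ?case using Suc by simp
qed simp

text \<open>With L the sum over squarefree numbers, the harmonic sum is the sum of L(N/a^2)/a^2. As
  L(N) - L(N/a^2) is at most 1 + 2 log a, replacing L(N/a^2) by L(N) throughout costs O(1). The sum
  of 1/a^2 up to N misses pi^2/6 by at most 1/N, and L(N) \<le> N.\<close>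

lemma sum_sqfree_inverse:
  obtains C where "C \<ge> 0" "\<And>N. N \<ge> 1 \<Longrightarrow> \<bar>(\<Sum>d\<in>sqfree_upto N. 1 / real d) - 6 / pi\<^sup>2 * ln (real N)\<bar> \<le> C"
proof -
  define L where "L = (\<lambda>N. \<Sum>d\<in>sqfree_upto N. 1 / real d)"
  \<comment> \<open>The factor 4 comes from 1 + 2 log a \<le> 4 sqrt a. In the sum of a^(-3/2) the
    term a = 1 gives 1 and the tail at most 1/(3/2 - 1) = 2.\<close>
  define K where "K = 4 * (1 + 2 :: real)"
  have Lle: "0 \<le> L N - L M \<and> L N - L M \<le> harm N - harm M" if "M \<le> N" for M N
  proof -
    have s: "sqfree_upto M \<subseteq> sqfree_upto N" "sqfree_upto N - sqfree_upto M \<subseteq> {M<..N}"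
      using that by (auto simp: sqfree_upto_def)
    have "L N - L M = (\<Sum>d\<in>sqfree_upto N - sqfree_upto M. 1 / real d)"
      unfolding L_def using s by (subst sum_diff) auto
    moreover have "\<dots> \<le> (\<Sum>d\<in>{M<..N}. 1 / real d)" using s by (intro sum_mono2) auto
    moreover have "(\<Sum>d\<in>{M<..N}. 1 / real d) = harm N - harm M"
    proof -
      have "{M<..N} = {1..N} - {1..M}" by auto
      then show ?thesis using that unfolding harm_eq_sum by (simp add: sum_diff)
    qed
    moreover have "(\<Sum>d\<in>sqfree_upto N - sqfree_upto M. 1 / real d) \<ge> 0" by (intro sum_nonneg) auto
    ultimately show ?thesis by simp
  qed
  have L0: "L 0 = 0" by (simp add: L_def sqfree_upto_def)
  have LN: "L N \<ge> 0" "L N \<le> harm N" for N using Lle[of 0 N] by (simp_all add: L0 harm_expand)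
  have diff: "L N - L (N div a\<^sup>2) \<le> 1 + 2 * ln (real a)" if "N \<ge> 1" "a \<ge> 1" for a N
  proof -
    have a2: "ln (real (a\<^sup>2)) = 2 * ln (real a)" using that by (simp add: ln_realpow)
    have "real N < real (N div a\<^sup>2 + 1) * real (a\<^sup>2)"
    proof -
      have "N < (N div a\<^sup>2 + 1) * a\<^sup>2"
        using that dividend_less_div_times[of "a\<^sup>2" N] by (simp add: algebra_simps)
      then show ?thesis by (simp only: of_nat_less_iff of_nat_mult[symmetric])
    qed
    then have "ln (real N) \<le> ln (real (N div a\<^sup>2 + 1) * real (a\<^sup>2))"
      using that by (subst ln_le_cancel_iff) auto
    also have "\<dots> = ln (real (N div a\<^sup>2 + 1)) + 2 * ln (real a)"
      using that a2 by (subst ln_mult_pos) auto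
    also have "ln (real (N div a\<^sup>2 + 1)) \<le> harm (N div a\<^sup>2)"
      using ln_le_harm[of "N div a\<^sup>2"] by (simp add: add.commute)
    finally have "harm N - harm (N div a\<^sup>2) \<le> 1 + 2 * ln (real a)"
      using harm_le_ln[OF that(1)] by simp
    then show ?thesis using Lle[of "N div a\<^sup>2" N] by simp
  qed
  have main: "\<bar>L N * (pi\<^sup>2 / 6) - ln (real N)\<bar> \<le> K + 3" if N: "N \<ge> 1" for N
  proof -
    have "harm N = (\<Sum>a=1..N. (1 / real a ^ 2) * L (N div a\<^sup>2))"
      unfolding harm_eq_sum L_def by (rule sum_sqfree_decompose) simp
    then have e: "(\<Sum>a=1..N. 1 / real a ^ 2) * L N - harm N = (\<Sum>a=1..N. (1 / real a ^ 2) * (L N - L (N div a\<^sup>2)))"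
      by (simp add: sum_distrib_right right_diff_distrib sum_subtractf)
    have "(\<Sum>a=1..N. (1 / real a ^ 2) * (L N - L (N div a\<^sup>2))) \<le> (\<Sum>a=1..N. 4 * real a powr - (3/2))"
    proof (rule sum_mono)
      fix a assume "a \<in> {1..N}"
      then have a: "a \<ge> 1" by simp
      have "ln (sqrt (real a)) \<le> sqrt (real a) - 1" using a by (intro ln_le_minus_one) auto
      then have "ln (real a) \<le> 2 * sqrt (real a) - 2" using a by (simp add: ln_sqrt)
      then have "L N - L (N div a\<^sup>2) \<le> 4 * sqrt (real a)" using diff[OF N a] by simp
      then have "(1 / real a ^ 2) * (L N - L (N div a\<^sup>2)) \<le> (1 / real a ^ 2) * (4 * sqrt (real a))"
        by (intro mult_left_mono) auto
      also have "\<dots> = 4 * (real a powr (1/2) / real a powr 2)"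
        using a by (simp add: powr_half_sqrt powr_numeral)
      also have "real a powr (1/2) / real a powr 2 = real a powr (1/2 - 2)" by (rule powr_diff[symmetric])
      also have "4 * real a powr (1/2 - 2) = 4 * real a powr - (3/2)" by simp
      finally show "(1 / real a ^ 2) * (L N - L (N div a\<^sup>2)) \<le> 4 * real a powr - (3/2)" .
    qed
    also have "\<dots> = 4 * (1 + (\<Sum>a\<in>{1<..N}. real a powr - (3/2)))"
    proof -
      have "{1..N} = insert 1 {1<..N}" using N by auto
      then show ?thesis by (simp flip: sum_distrib_left)
    qed
    also have "\<dots> \<le> K" using sum_powr_le[of "3/2" 1 N] by (simp add: K_def)
    finally have u: "(\<Sum>a=1..N. 1 / real a ^ 2) * L N - harm N \<le> K" using e by simp
    have l: "(\<Sum>a=1..N. 1 / real a ^ 2) * L N - harm N \<ge> 0"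
      unfolding e using Lle by (intro sum_nonneg mult_nonneg_nonneg) auto
    have z: "(\<Sum>a=1..N. 1 / real a ^ 2) \<le> pi\<^sup>2 / 6 \<and> pi\<^sup>2 / 6 \<le> (\<Sum>a=1..N. 1 / real a ^ 2) + 1 / real N"
    proof -
      have sm: "(\<lambda>n. 1 / real (n + 1) ^ 2) sums (pi\<^sup>2 / 6)"
        using inverse_squares_sums by simp
      have p: "(\<Sum>a=1..M. 1 / real a ^ 2) = (\<Sum>n<M. 1 / real (n + 1) ^ 2)" for M
        by (rule sum.reindex_bij_witness[of _ "\<lambda>n. n + 1" "\<lambda>a. a - 1"]) auto
      have 1: "(\<Sum>n<N. 1 / real (n + 1) ^ 2) \<le> pi\<^sup>2 / 6"
        using sum_le_suminf[OF sums_summable[OF sm], of "{..<N}"] sums_unique[OF sm] by simp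
      have "(\<Sum>n<M. 1 / real (n + 1) ^ 2) \<le> (\<Sum>a=1..N. 1 / real a ^ 2) + 1 / real N" for M
      proof -
        have "(\<Sum>n<M. 1 / real (n + 1) ^ 2) = (\<Sum>a=1..M. 1 / real a ^ 2)" by (simp only: p)
        also have "\<dots> \<le> (\<Sum>a\<in>{1..N} \<union> {N<..M}. 1 / real a ^ 2)" by (intro sum_mono2) auto
        also have "\<dots> = (\<Sum>a=1..N. 1 / real a ^ 2) + (\<Sum>a\<in>{N<..M}. 1 / real a ^ 2)"
          by (intro sum.union_disjoint) auto
        also have "(\<Sum>a\<in>{N<..M}. 1 / real a ^ 2) = (\<Sum>a\<in>{N<..M}. real a powr - 2)"
          by (intro sum.cong) (auto simp: powr_minus divide_inverse powr_numeral)
        also have "\<dots> \<le> real N powr (1 - 2) / (2 - 1)" by (intro sum_powr_le N) auto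
        also have "\<dots> = 1 / real N" using N by (simp add: powr_minus_divide)
        finally show ?thesis by simp
      qed
      then have "pi\<^sup>2 / 6 \<le> (\<Sum>a=1..N. 1 / real a ^ 2) + 1 / real N"
        using sm by (intro LIMSEQ_le_const2[of _ "pi\<^sup>2 / 6"]) (auto simp: sums_def)
      then show ?thesis using 1 unfolding p by simp
    qed
    have "L N * (pi\<^sup>2 / 6) \<le> L N * ((\<Sum>a=1..N. 1 / real a ^ 2) + 1 / real N)"
       "L N * (\<Sum>a=1..N. 1 / real a ^ 2) \<le> L N * (pi\<^sup>2 / 6)"
      using z LN(1) by (intro mult_left_mono; simp)+
    moreover have "L N / real N \<le> 1"
    proof -
      have "harm N \<le> real N"
      proof -
        have "harm N \<le> (\<Sum>k=1..N. 1 :: real)" unfolding harm_eq_sum by (intro sum_mono) auto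
        then show ?thesis by simp
      qed
      then show ?thesis using LN[of N] N by simp
    qed
    moreover have "\<bar>l * p - h\<bar> \<le> K + 1"
      if "l * p \<le> l * (S + 1 / n)" "l * S \<le> l * p" "l / n \<le> 1" "S * l - h \<le> K" "S * l - h \<ge> 0" for l p h S n
      using that by (simp add: distrib_left mult.commute[of S] K_def abs_le_iff)
    ultimately have "\<bar>L N * (pi\<^sup>2 / 6) - harm N\<bar> \<le> K + 1"
      using u l by blast
    moreover have "\<bar>harm N - ln (real N)\<bar> \<le> 1"
    proof -
      have "ln (real N) \<le> ln (real N + 1)" using N by simp
      then show ?thesis using harm_le_ln[OF N] ln_le_harm[of N] by linarith
    qed
    ultimately show ?thesis by linarith
  qed
  show ?thesis
  proof (rule that[of "6 / pi\<^sup>2 * (K + 3)"])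
    fix N :: nat assume "N \<ge> 1"
    have "L N - 6 / pi\<^sup>2 * ln (real N) = 6 / pi\<^sup>2 * (L N * (pi\<^sup>2 / 6) - ln (real N))"
      by (simp add: field_simps)
    moreover have "\<bar>6 / pi\<^sup>2\<bar> = 6 / pi\<^sup>2" by simp
    ultimately have "\<bar>L N - 6 / pi\<^sup>2 * ln (real N)\<bar> = 6 / pi\<^sup>2 * \<bar>L N * (pi\<^sup>2 / 6) - ln (real N)\<bar>"
      by (simp only: abs_mult)
    also have "\<dots> \<le> 6 / pi\<^sup>2 * (K + 3)" using main[OF \<open>N \<ge> 1\<close>] by (intro mult_left_mono) auto
    finally show "\<bar>(\<Sum>d\<in>sqfree_upto N. 1 / real d) - 6 / pi\<^sup>2 * ln (real N)\<bar> \<le> 6 / pi\<^sup>2 * (K + 3)"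
      by (simp add: L_def)
  qed (simp add: K_def)
qed

lemma summable_on_powr: "s > 1 \<Longrightarrow> (\<lambda>n. real n powr - s) summable_on A"
proof (rule summable_on_subset_banach[of _ UNIV])
  assume "s > 1"
  then have "summable (\<lambda>n. real n powr - s)" by (simp add: summable_real_powr_iff)
  then show "(\<lambda>n. real n powr - s) summable_on UNIV" by (rule summable_nonneg_imp_summable_on) simp
qed simp

lemma zeta_eq_infsum:
  assumes "s > 1"
  shows "zeta s = (\<Sum>\<^sub>\<infinity>n\<in>{1..}. real n powr - s)"
proof -
  have "summable (\<lambda>n. real n powr - s)" using assms by (simp add: summable_real_powr_iff)
  then have "summable (\<lambda>n. real (Suc n) powr - s)" by (rule summable_Suc_iff[THEN iffD2])
  then have "(\<lambda>n. 1 / real (Suc n) powr s) sums zeta s"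
    unfolding zeta_def by (intro summable_sums) (simp add: powr_minus_divide)
  then have "((\<lambda>n. real (Suc n) powr - s) has_sum zeta s) UNIV"
    by (intro sums_nonneg_imp_has_sum) (simp_all add: powr_minus_divide)
  then have "((\<lambda>n. real n powr - s) \<circ> Suc has_sum zeta s) UNIV" by (simp add: o_def)
  then have "((\<lambda>n. real n powr - s) has_sum zeta s) (range Suc)"
    by (subst has_sum_reindex) auto
  moreover have "range Suc = {1..}" by (auto simp: image_iff Suc_le_eq gr0_conv_Suc)
  ultimately show ?thesis by (simp add: infsumI)
qed

lemma zeta_pos: "s > 1 \<Longrightarrow> zeta s > 0"
proof -
  assume s: "s > 1"
  have "(\<Sum>n\<in>{1}. real n powr - s) \<le> (\<Sum>\<^sub>\<infinity>n\<in>{1..}. real n powr - s)"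
    by (intro finite_sum_le_infsum summable_on_powr s) auto
  then show ?thesis by (simp add: zeta_eq_infsum[OF s])
qed

text \<open>Unique decomposition n = d a^2 splits the series of zeta s into zeta (2s), from the
  squares, and the series over squarefree d.\<close>

lemma infsum_sqfree_powr:
  assumes "s > 1"
  shows "(\<Sum>\<^sub>\<infinity>d\<in>{d. squarefree d}. real d powr - s) = zeta s / zeta (2 * s)"
proof -
  let ?A = "{1::nat..}" and ?S = "{d::nat. squarefree d}" and ?f = "\<lambda>n. real n powr - s"
  have f: "?f (d * a\<^sup>2) = real a powr - (2 * s) * real d powr - s" if "a \<in> ?A" for a d
  proof -
    have "real (a\<^sup>2) powr - s = real a powr - (2 * s)"
      using that by (simp add: powr_powr flip: powr_numeral)
    then show ?thesis by (simp add: powr_mult)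
  qed
  have sm: "(\<lambda>p. ?f (case p of (a, d) \<Rightarrow> d * a\<^sup>2)) summable_on ?A \<times> ?S"
    by (subst summable_on_reindex_bij_betw[OF squarefree_decomposition_bij]) (rule summable_on_powr[OF assms])
  have "zeta s = (\<Sum>\<^sub>\<infinity>p\<in>?A \<times> ?S. ?f (case p of (a, d) \<Rightarrow> d * a\<^sup>2))"
    unfolding zeta_eq_infsum[OF assms] by (rule infsum_reindex_bij_betw[OF squarefree_decomposition_bij, symmetric])
  also have "\<dots> = (\<Sum>\<^sub>\<infinity>a\<in>?A. \<Sum>\<^sub>\<infinity>d\<in>?S. ?f (case (a, d) of (a, d) \<Rightarrow> d * a\<^sup>2))"
  proof -
    have "(\<lambda>(a, d). ?f (d * a\<^sup>2)) summable_on ?A \<times> ?S" using sm by (simp only: case_prod_unfold)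
    from infsum_Sigma'_banach[OF this] show ?thesis by (simp only: case_prod_unfold fst_conv snd_conv)
  qed
  also have "\<dots> = (\<Sum>\<^sub>\<infinity>a\<in>?A. real a powr - (2 * s) * (\<Sum>\<^sub>\<infinity>d\<in>?S. ?f d))"
  proof (rule infsum_cong)
    fix a :: nat assume a: "a \<in> ?A"
    have "(\<Sum>\<^sub>\<infinity>d\<in>?S. ?f (case (a, d) of (a, d) \<Rightarrow> d * a\<^sup>2)) = (\<Sum>\<^sub>\<infinity>d\<in>?S. real a powr - (2 * s) * ?f d)"
      using f[OF a] by (intro infsum_cong) simp
    then show "(\<Sum>\<^sub>\<infinity>d\<in>?S. ?f (case (a, d) of (a, d) \<Rightarrow> d * a\<^sup>2)) = real a powr - (2 * s) * (\<Sum>\<^sub>\<infinity>d\<in>?S. ?f d)"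
      by (simp add: infsum_cmult_right')
  qed
  also have "\<dots> = zeta (2 * s) * (\<Sum>\<^sub>\<infinity>d\<in>?S. ?f d)"
    using assms by (subst zeta_eq_infsum) (auto simp: infsum_cmult_left')
  finally show ?thesis using zeta_pos[of "2 * s"] assms by (simp add: field_simps)
qed

lemma sum_sqfree_powr:
  assumes "s > 1" "N \<ge> 1"
  shows "\<bar>(\<Sum>d\<in>sqfree_upto N. real d powr - s) - zeta s / zeta (2 * s)\<bar> \<le> real N powr (1 - s) / (s - 1)"
proof -
  let ?f = "\<lambda>n. real n powr - s" and ?T = "{d. squarefree d \<and> N < d}"
  have "{d. squarefree d} = sqfree_upto N \<union> ?T" 
    using squarefree_nat_pos by (fastforce simp: sqfree_upto_def)
  then have "zeta s / zeta (2 * s) = (\<Sum>\<^sub>\<infinity>d\<in>sqfree_upto N \<union> ?T. ?f d)"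
    using infsum_sqfree_powr[OF assms(1)] by simp
  also have "\<dots> = (\<Sum>\<^sub>\<infinity>d\<in>sqfree_upto N. ?f d) + (\<Sum>\<^sub>\<infinity>d\<in>?T. ?f d)"
    by (intro infsum_Un_disjoint summable_on_powr assms) (auto simp: sqfree_upto_def)
  finally have e: "zeta s / zeta (2 * s) = (\<Sum>d\<in>sqfree_upto N. ?f d) + (\<Sum>\<^sub>\<infinity>d\<in>?T. ?f d)" by simp
  have "(\<Sum>\<^sub>\<infinity>d\<in>?T. ?f d) \<ge> 0" by (intro infsum_nonneg) auto
  moreover have "(\<Sum>\<^sub>\<infinity>d\<in>?T. ?f d) \<le> real N powr (1 - s) / (s - 1)"
  proof (rule infsum_le_finite_sums[OF summable_on_powr[OF assms(1)]])
    fix F assume F: "finite F" "F \<subseteq> ?T"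
    obtain M where "\<forall>x\<in>F. x \<le> M" using F(1) finite_nat_set_iff_bounded_le by blast
    then have "F \<subseteq> {N<..M}" using F(2) by auto
    then have "sum ?f F \<le> (\<Sum>k\<in>{N<..M}. ?f k)" by (intro sum_mono2) auto
    also have "\<dots> \<le> real N powr (1 - s) / (s - 1)" by (rule sum_powr_le[OF assms])
    finally show "sum ?f F \<le> real N powr (1 - s) / (s - 1)" .
  qed
  ultimately show ?thesis unfolding e by simp
qed

section \<open>Integral and reciprocal polynomials\<close>

lemma map_poly_of_int_mult:
  "map_poly of_int (p * q) = (map_poly of_int p * map_poly of_int q :: 'a::comm_ring_1 poly)"
  by (rule poly_eqI) (simp add: coeff_map_poly coeff_mult)

lemma map_poly_of_int_inject: "map_poly of_int p = (map_poly of_int q :: 'a::ring_char_0 poly) \<longleftrightarrow> p = q"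
proof
  assume eq: "map_poly of_int p = (map_poly of_int q :: 'a poly)"
  show "p = q"
  proof (rule poly_eqI)
    fix i
    have "coeff (map_poly of_int p :: 'a poly) i = coeff (map_poly of_int q) i" using eq by simp
    then show "coeff p i = coeff q i" by (simp add: coeff_map_poly)
  qed
qed simp

lemma map_poly_of_rat_of_int:
  "map_poly of_rat (map_poly of_int p :: rat poly) = (map_poly of_int p :: 'a::field_char_0 poly)"
  by (rule poly_eqI) (simp add: coeff_map_poly)

lemma degree_map_poly_of_int [simp]: "degree (map_poly of_int p :: 'a::ring_char_0 poly) = degree p"
  by (rule degree_map_poly) simp

lemma degree_map_poly_of_rat [simp]: "degree (map_poly of_rat p :: 'a::field_char_0 poly) = degree p"
  by (rule degree_map_poly) simp

lemma poly_map_poly_of_real: "poly (map_poly complex_of_real p) (of_real x) = of_real (poly p x)"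
  by (induction p) (simp_all add: map_poly_pCons)

lemma poly_of_int_of_real: "poly (map_poly of_int p :: complex poly) (of_real x) = of_real (poly (map_poly of_int p) x)"
  by (induction p) (simp_all add: map_poly_pCons)

lemma map_poly_of_real_mult:
  "map_poly complex_of_real (p * q) = map_poly complex_of_real p * map_poly complex_of_real q"
  by (rule poly_eqI) (simp add: coeff_map_poly coeff_mult)

lemma rat_poly_common_denominator:
  fixes f :: "rat poly"
  obtains D :: int and F :: "int poly" where "D > 0" "smult (of_int D) f = map_poly of_int F"
proof -
  have "\<exists>D F. D > (0::int) \<and> smult (of_int D) f = map_poly of_int F"
  proof (induction f)
    case 0
    show ?case by (intro exI[of _ 1] exI[of _ 0]) simp
  next
    case (pCons a f)
    then obtain D F where DF: "D > 0" "smult (of_int D) f = map_poly of_int F" by blast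
    obtain u v where uv: "quotient_of a = (u, v)" by force
    then have v: "v > 0" "a = of_int u / of_int v" by (auto simp: quotient_of_denom_pos quotient_of_div)
    have m: "smult (of_int v) (map_poly of_int F) = (map_poly of_int (smult v F) :: rat poly)"
      by (rule poly_eqI) (simp add: coeff_map_poly)
    have "smult (of_int (D * v)) (pCons a f) = pCons (of_int (D * u)) (smult (of_int v) (smult (of_int D) f))"
      using v by (simp add: mult.commute)
    also have "\<dots> = map_poly of_int (pCons (D * u) (smult v F))"
      unfolding DF(2) m by (simp add: map_poly_pCons)
    finally show ?case using DF v by (intro exI[of _ "D * v"] exI[of _ "pCons (D * u) (smult v F)"]) simp
  qed
  then show ?thesis using that by blast
qed

lemma monic_rat_poly_primitive:
  fixes f :: "rat poly"
  assumes "lead_coeff f = 1"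
  obtains F L where "L > 0" "Polynomial.content F = 1" "smult (of_int L) f = map_poly of_int F"
proof -
  obtain D F0 where D: "D > 0" "smult (of_int D) f = map_poly of_int F0"
    by (rule rat_poly_common_denominator)
  have deg: "degree F0 = degree f" using arg_cong[OF D(2), of degree] D(1) by simp
  have "(of_int D :: rat) = of_int (lead_coeff F0)"
    using arg_cong[OF D(2), of "\<lambda>p. coeff p (degree f)"] assms by (simp add: deg coeff_map_poly)
  then have lc: "lead_coeff F0 = D" by simp
  then have "F0 \<noteq> 0" using D(1) by auto
  define c where "c = Polynomial.content F0"
  define F where "F = primitive_part F0"
  have F0: "F0 = smult c F" by (simp add: c_def F_def)
  have c: "c > 0"
    using \<open>F0 \<noteq> 0\<close> unfolding c_def by (metis content_eq_zero_iff le_less normalize_content abs_ge_zero normalize_int_def)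
  have "degree F = degree f" by (simp add: F_def deg)
  then have D2: "D = c * lead_coeff F" using lc c by (simp add: F0)
  then have L: "lead_coeff F > 0" using D(1) c by (simp add: zero_less_mult_iff)
  have m: "map_poly of_int (smult c F) = (smult (of_int c) (map_poly of_int F) :: rat poly)"
    by (rule poly_eqI) (simp add: coeff_map_poly)
  have "smult (of_int c) (smult (of_int (lead_coeff F)) f) = smult (of_int c) (map_poly of_int F)"
    using D(2) unfolding F0 m D2 by simp
  then have "smult (of_int (lead_coeff F)) f = map_poly of_int F" using c by (simp add: smult_eq_iff)
  moreover have "Polynomial.content F = 1" unfolding F_def using \<open>F0 \<noteq> 0\<close> by (rule content_primitive_part)
  ultimately show ?thesis using L that by blast
qed

text \<open>Gauss's lemma: for primitive multiples L f and K g the product L K p has content 1. The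
  monic p has content 1 as well, so L K = 1.\<close>

lemma gauss_monic_factor:
  fixes f g :: "rat poly" and p :: "int poly"
  assumes "lead_coeff f = 1" "lead_coeff g = 1" "f * g = map_poly of_int p"
  obtains F where "f = map_poly of_int F"
proof -
  obtain F L where F: "L > 0" "Polynomial.content F = 1" "smult (of_int L) f = map_poly of_int F"
    using monic_rat_poly_primitive[OF assms(1)] by blast
  obtain G K where G: "K > 0" "Polynomial.content G = 1" "smult (of_int K) g = map_poly of_int G"
    using monic_rat_poly_primitive[OF assms(2)] by blast
  have "map_poly of_int (F * G) = smult (of_int L) f * smult (of_int K) g"
    by (simp only: map_poly_of_int_mult F(3) G(3))
  also have "\<dots> = smult (of_int (L * K)) (f * g)" by (simp add: mult.commute)
  also have "\<dots> = (map_poly of_int (smult (L * K) p) :: rat poly)"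
    unfolding assms(3) by (rule poly_eqI) (simp add: coeff_map_poly)
  finally have "(map_poly of_int (F * G) :: rat poly) = map_poly of_int (smult (L * K) p)" .
  then have FG: "F * G = smult (L * K) p" by (simp only: map_poly_of_int_inject)
  have "lead_coeff (f * g) = 1" by (simp only: lead_coeff_mult assms(1,2) mult_1)
  then have "lead_coeff p = 1" unfolding assms(3) by (simp add: coeff_map_poly)
  then have "Polynomial.content p dvd 1" using content_dvd_coeff[of p "degree p"] by simp
  then have cp: "Polynomial.content p = 1" by (metis is_unit_normalize normalize_content)
  have "Polynomial.content (F * G) = 1" by (simp add: content_mult F(2) G(2))
  then have "normalize (L * K) * Polynomial.content p = 1" by (simp add: FG)
  then have "\<bar>L * K\<bar> = 1" by (simp add: cp)
  then have "L = 1" using F(1) G(1) by (metis abs_of_pos mult_pos_pos pos_zmult_eq_1_iff)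
  then have "f = map_poly of_int F" using F(3) by simp
  then show ?thesis by (rule that)
qed

lemma min_poly_rat_props:
  fixes x :: "'a::field_char_0"
  assumes "algebraic x"
  shows "lead_coeff (min_poly_rat x) = 1" "irreducible (min_poly_rat x)"
    "poly (map_poly of_rat (min_poly_rat x)) x = 0"
  using theI'[OF min_poly_rat_ex1[OF assms]] unfolding min_poly_rat_def by blast+

text \<open>Formulated for a root in an arbitrary extension, because it is applied to conjugates and
  to -1. A polynomial p of least degree with root z divides M and f; since M is irreducible and p is
  no unit, M divides p.\<close>

lemma irreducible_rat_poly_common_root:
  fixes M f :: "rat poly" and z :: "'a::field_char_0"
  assumes "irreducible M" "poly (map_poly of_rat M) z = 0" "poly (map_poly of_rat f) z = 0"
  shows "M dvd f"
proof -
  define R where "R = (\<lambda>p :: rat poly. p \<noteq> 0 \<and> poly (map_poly of_rat p) z = 0)"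
  have "R M" using assms(1,2) by (auto simp: R_def)
  then obtain p where p: "R p" and pmin: "\<And>q. R q \<Longrightarrow> degree p \<le> degree q"
    using ex_has_least_nat[of R M degree] by blast
  have nz: "p \<noteq> 0" using p by (simp add: R_def)
  have dv: "p dvd a" if a: "poly (map_poly of_rat a) z = 0" for a
  proof -
    have "poly (map_poly of_rat ((a div p) * p + a mod p)) z = 0" using a by simp
    then have "poly (map_poly of_rat (a mod p)) z = 0"
      using p by (simp only: map_poly_of_rat_mult map_poly_of_rat_add R_def poly_mult poly_add) simp
    then have "a mod p = 0"
      using pmin[of "a mod p"] degree_mod_less[OF nz, of a] unfolding R_def by (metis not_le)
    then show ?thesis by (simp only: mod_eq_0_iff_dvd)
  qed
  obtain k where k: "M = p * k" using dv[OF assms(2)] by (rule dvdE)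
  have "\<not> p dvd 1"
  proof
    assume "p dvd 1"
    then obtain a where "p = [:a:]" "a \<noteq> 0" using nz by (auto simp: is_unit_poly_iff)
    then show False using p by (simp add: R_def map_poly_pCons)
  qed
  then have "k dvd 1" using assms(1) k by (auto simp: irreducible_def)
  then obtain k' where k': "1 = k * k'" by (rule dvdE)
  have "M * k' = p" unfolding k using k' by (metis mult.assoc mult.right_neutral)
  then have "M dvd p" by (metis dvd_triv_left)
  then show ?thesis using dv[OF assms(3)] by (rule dvd_trans)
qed

text \<open>Otherwise M would divide its derivative, which is nonzero and of smaller degree.\<close>

lemma irreducible_rat_poly_simple_root:
  fixes M :: "rat poly" and z :: "'a::field_char_0"
  assumes "irreducible M" "poly (map_poly of_rat M) z = 0"
  shows "poly (pderiv (map_poly of_rat M)) z \<noteq> 0"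
proof
  have e: "pderiv (map_poly of_rat M) = (map_poly of_rat (pderiv M) :: 'a poly)"
    by (rule poly_eqI) (simp add: coeff_pderiv coeff_map_poly of_rat_mult of_rat_add)
  assume "poly (pderiv (map_poly of_rat M)) z = 0"
  then have "M dvd pderiv M" unfolding e by (rule irreducible_rat_poly_common_root[OF assms])
  moreover have "degree M > 0"
  proof (rule ccontr)
    assume "\<not> degree M > 0"
    then obtain a where "M = [:a:]" by (auto elim: degree_eq_zeroE)
    then show False using assms by (simp add: map_poly_pCons)
  qed
  ultimately show False
    using dvd_imp_degree_le[of M "pderiv M"] by (simp add: pderiv_eq_0_iff degree_pderiv)
qed

lemma min_poly_rat_dvd:
  fixes x :: "'a::field_char_0"
  assumes "algebraic x" "poly (map_poly of_rat f) x = 0"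
  shows "min_poly_rat x dvd f"
  using irreducible_rat_poly_common_root min_poly_rat_props[OF assms(1)] assms(2) by blast

lemma integral_min_poly_rat:
  fixes x :: real and p :: "int poly"
  assumes "poly (map_poly of_int p) x = 0" "lead_coeff p = 1"
  obtains M \<nu> where "min_poly_rat x = map_poly of_int M" "p = M * \<nu>" "lead_coeff M = 1" "lead_coeff \<nu> = 1"
proof -
  have alg: "algebraic x"
    using assms by (intro algebraicI[of "map_poly of_int p"]) (auto simp: coeff_map_poly map_poly_eq_0_iff)
  note mp = min_poly_rat_props[OF alg]
  let ?P = "map_poly of_int p :: rat poly"
  have "min_poly_rat x dvd ?P"
    using assms(1) by (intro min_poly_rat_dvd[OF alg]) (simp add: map_poly_of_rat_of_int)
  then obtain g where g: "?P = min_poly_rat x * g" by (auto elim: dvdE)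
  have "lead_coeff ?P = 1" using assms(2) by (simp add: coeff_map_poly)
  then have lg: "lead_coeff g = 1" using mp(1) unfolding g lead_coeff_mult by simp
  obtain M where M: "min_poly_rat x = map_poly of_int M"
    using gauss_monic_factor[OF mp(1) lg g[symmetric]] by blast
  obtain \<nu> where \<nu>: "g = map_poly of_int \<nu>"
    using gauss_monic_factor[OF lg mp(1)] g by (metis mult.commute)
  have "(map_poly of_int p :: rat poly) = map_poly of_int (M * \<nu>)"
    using g by (simp only: M \<nu> map_poly_of_int_mult)
  then have "p = M * \<nu>" by (simp only: map_poly_of_int_inject)
  moreover have "lead_coeff M = 1" "lead_coeff \<nu> = 1"
    using mp(1) lg unfolding M \<nu> by (simp_all add: coeff_map_poly)
  ultimately show ?thesis using that M by blast
qed

section \<open>Palindromic polynomials as x^k F(x + 1/x)\<close>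

text \<open>The polynomial x^k F(x + 1/x) without division, built along the Horner recursion of
  \<open>monic_poly\<close>: a factor x + 1/x becomes 1 + x^2 after multiplication by x.\<close>

primrec recip_poly :: "nat \<Rightarrow> (nat \<Rightarrow> 'a::comm_ring_1) \<Rightarrow> 'a poly" where
  "recip_poly 0 c = 1"
| "recip_poly (Suc k) c = [:1, 0, 1:] * recip_poly k c + monom (c k) (Suc k)"

lemma poly_recip_poly:
  fixes c :: "nat \<Rightarrow> 'a::field"
  assumes "t \<noteq> 0"
  shows "poly (recip_poly k c) t = t ^ k * poly (monic_poly k c) (t + 1 / t)"
proof (induction k)
  case (Suc k)
  have "poly (recip_poly (Suc k) c) t = (1 + t * t) * poly (recip_poly k c) t + c k * t ^ Suc k"
    by (simp add: poly_monom algebra_simps)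
  also have "1 + t * t = t * (t + 1 / t)" using assms by (simp add: field_simps)
  finally show ?case by (simp add: Suc algebra_simps)
qed simp

lemma map_poly_recip_poly: "map_poly complex_of_real (recip_poly k c) = recip_poly k (\<lambda>i. of_real (c i))"
proof (induction k)
  case (Suc k)
  have "map_poly complex_of_real (p + q) = map_poly complex_of_real p + map_poly complex_of_real q" for p q
    by (rule poly_eqI) (simp add: coeff_map_poly)
  then show ?case using Suc
    by (simp only: recip_poly.simps map_poly_of_real_mult) (simp add: map_poly_pCons map_poly_monom)
qed simp

lemma map_poly_monic_poly: "map_poly complex_of_real (monic_poly k c) = monic_poly k (\<lambda>i. of_real (c i))"
  by (induction k) (simp_all add: map_poly_pCons)

lemma coeff_recip_mult:
  "coeff ([:1, 0, 1:] * p) j = coeff p j + (if j < 2 then 0 else coeff (p :: 'a::comm_ring_1 poly) (j - 2))"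
proof (cases j)
  case (Suc i)
  then show ?thesis by (cases i) simp_all
qed simp

lemma recip_poly_degree: "degree (recip_poly k (c :: nat \<Rightarrow> 'a::field_char_0)) = 2 * k"
  and lead_coeff_recip_poly: "coeff (recip_poly k c) (2 * k) = (1 :: 'a)"
proof -
  have "degree (recip_poly k c) \<le> 2 * k \<and> coeff (recip_poly k c) (2 * k) = (1 :: 'a)"
  proof (induction k)
    case (Suc k)
    then have h: "coeff (recip_poly k c) j = 0" if "j > 2 * k" for j
      using that by (intro coeff_eq_0) auto
    have "degree (recip_poly (Suc k) c) \<le> 2 * Suc k"
    proof (rule degree_le, intro allI impI)
      fix i assume "2 * Suc k < i"
      then show "coeff (recip_poly (Suc k) c) i = 0"
        by (simp add: coeff_recip_mult h del: mult_pCons_left)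
    qed
    then show ?case using Suc by (simp add: coeff_recip_mult h del: mult_pCons_left)
  qed simp
  then show "degree (recip_poly k c) = 2 * k" "coeff (recip_poly k c) (2 * k) = (1 :: 'a)"
    by (auto intro!: antisym le_degree)
qed

lemma recip_poly_sym: "i \<le> 2 * k \<Longrightarrow> coeff (recip_poly k c) i = coeff (recip_poly k (c :: nat \<Rightarrow> 'a::field_char_0)) (2 * k - i)"
proof (induction k arbitrary: i)
  case (Suc k)
  have hi: "coeff (recip_poly k c) j = 0" if "j > 2 * k" for j
    using that by (intro coeff_eq_0) (simp add: recip_poly_degree)
  define g where "g = coeff (recip_poly k c)"
  have g: "g j = g (2 * k - j)" if "j \<le> 2 * k" for j using Suc.IH[OF that] by (simp add: g_def)
  have g0: "g j = 0" if "j > 2 * k" for j using hi[OF that] by (simp add: g_def)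
  have c: "coeff (recip_poly (Suc k) c) j = g j + (if j < 2 then 0 else g (j - 2)) + (if j = Suc k then c k else 0)" for j
    by (simp add: coeff_recip_mult g_def del: mult_pCons_left)
  have A: "g i = (if 2 * Suc k - i < 2 then 0 else g (2 * Suc k - i - 2))"
  proof (cases "i \<le> 2 * k")
    case True
    then show ?thesis using g[OF True] by (simp add: algebra_simps numeral_2_eq_2 Suc_diff_le)
  next
    case False
    then show ?thesis using g0[of i] Suc.prems by simp
  qed
  have B: "g (2 * Suc k - i) = (if i < 2 then 0 else g (i - 2))"
  proof (cases "i < 2")
    case True
    then show ?thesis using g0[of "2 * Suc k - i"] by simp
  next
    case False
    then have "2 * Suc k - i \<le> 2 * k" "2 * k - (2 * Suc k - i) = i - 2" using Suc.prems by auto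
    then show ?thesis using g[of "2 * Suc k - i"] False by simp
  qed
  have "(i = Suc k) = (2 * Suc k - i = Suc k)" using Suc.prems by auto
  then show ?case unfolding c using A B by simp
qed simp

lemma palindromic_iff:
  fixes q :: "real poly"
  assumes "degree q = N"
  shows "palindromic q \<longleftrightarrow> (\<forall>i\<le>N. coeff q i = coeff q (N - i))"
proof
  assume "palindromic q"
  then have "coeff q i = coeff (reflect_poly q) i" for i by (simp add: palindromic_def)
  then show "\<forall>i\<le>N. coeff q i = coeff q (N - i)" using assms by (simp add: coeff_reflect_poly)
next
  assume "\<forall>i\<le>N. coeff q i = coeff q (N - i)"
  then show "palindromic q"
    unfolding palindromic_def
  proof (intro poly_eqI)
    fix i
    show "coeff q i = coeff (reflect_poly q) i"
    proof (cases "i \<le> N")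
      case True
      then have "coeff q i = coeff q (N - i)" using \<open>\<forall>i\<le>N. coeff q i = coeff q (N - i)\<close> by blast
      then show ?thesis unfolding coeff_reflect_poly assms using True by simp
    qed (use assms in \<open>simp add: coeff_reflect_poly coeff_eq_0\<close>)
  qed
qed

lemma palindromic_recip_poly: "palindromic (recip_poly k (c :: nat \<Rightarrow> real))"
  using recip_poly_sym palindromic_iff[OF recip_poly_degree] by blast

section \<open>Coefficients graded by the parity of the degree\<close>

text \<open>Admissible values for the coefficient of x^j in q. Entry i of c contributes to q only in
  degrees of the parity of i + 1, which explains the index \<open>Suc i\<close> wherever
  \<open>c i\<close> is concerned.\<close>

definition coeff_class :: "nat \<Rightarrow> nat \<Rightarrow> real set" where
  "coeff_class d j = range (\<lambda>k::int. (if even j then 1 else sqrt (real d)) * of_int k)"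

lemma coeff_classI: "x = (if even j then 1 else sqrt (real d)) * of_int k \<Longrightarrow> x \<in> coeff_class d j"
  unfolding coeff_class_def by (rule range_eqI)

lemma coeff_classE:
  assumes "x \<in> coeff_class d j"
  obtains k :: int where "x = (if even j then 1 else sqrt (real d)) * of_int k"
  using assms unfolding coeff_class_def by blast

lemma coeff_class_even: "even j \<Longrightarrow> coeff_class d j = \<int>"
  by (simp add: coeff_class_def Ints_def)

lemma coeff_class_cong: "even i = even j \<Longrightarrow> coeff_class d i = coeff_class d j"
  by (simp add: coeff_class_def)

lemma coeff_class_0 [simp]: "0 \<in> coeff_class d j"
  by (rule coeff_classI[of _ _ _ 0]) simp

lemma coeff_class_add: "x \<in> coeff_class d j \<Longrightarrow> y \<in> coeff_class d j \<Longrightarrow> x + y \<in> coeff_class d j"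
proof -
  assume "x \<in> coeff_class d j" "y \<in> coeff_class d j"
  then obtain a b :: int where "x = (if even j then 1 else sqrt (real d)) * of_int a"
      "y = (if even j then 1 else sqrt (real d)) * of_int b"
    by (elim coeff_classE)
  then show ?thesis by (intro coeff_classI[of _ _ _ "a + b"]) (simp add: distrib_left)
qed

lemma coeff_class_mult_int: "x \<in> coeff_class d j \<Longrightarrow> k \<in> \<int> \<Longrightarrow> k * x \<in> coeff_class d j"
proof -
  assume "x \<in> coeff_class d j" "k \<in> \<int>"
  then obtain a b :: int where "x = (if even j then 1 else sqrt (real d)) * of_int a" "k = of_int b"
    by (elim coeff_classE Ints_cases)
  then show ?thesis by (intro coeff_classI[of _ _ _ "b * a"]) simp
qed

lemma coeff_class_uminus: "x \<in> coeff_class d j \<Longrightarrow> - x \<in> coeff_class d j"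
  using coeff_class_mult_int[of x d j "-1"] by simp

lemma coeff_class_mult: "x \<in> coeff_class d i \<Longrightarrow> y \<in> coeff_class d j \<Longrightarrow> even i = even j \<Longrightarrow> x * y \<in> \<int>"
proof -
  assume xy: "x \<in> coeff_class d i" "y \<in> coeff_class d j" "even i = even j"
  obtain k where k: "x = (if even i then 1 else sqrt (real d)) * of_int k" using xy(1) by (rule coeff_classE)
  obtain l where l: "y = (if even i then 1 else sqrt (real d)) * of_int l" using xy(2) unfolding xy(3) by (rule coeff_classE)
  have "x * y = of_int ((if even i then 1 else int d) * (k * l))"
    unfolding k l by simp
  then show ?thesis by simp
qed

lemma coeff_class_recip_poly:
  assumes "\<And>i. i < k \<Longrightarrow> c i \<in> coeff_class d (Suc i)"
  shows "coeff (recip_poly k c) j \<in> coeff_class d j"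
  using assms
proof (induction k arbitrary: j)
  case 0
  then show ?case by (cases j) (auto simp: coeff_class_even)
next
  case (Suc k)
  have 1: "coeff (recip_poly k c) j \<in> coeff_class d j" using Suc by simp
  have 2: "(if j < 2 then 0 else coeff (recip_poly k c) (j - 2)) \<in> coeff_class d j"
  proof (cases "j < 2")
    case False
    then have "coeff_class d (j - 2) = coeff_class d j" by (intro coeff_class_cong) simp
    moreover have "coeff (recip_poly k c) (j - 2) \<in> coeff_class d (j - 2)" using Suc by simp
    ultimately show ?thesis using False by simp
  qed simp
  have 3: "(if j = Suc k then c k else 0) \<in> coeff_class d j" using Suc.prems[of k] by simp
  have e: "coeff (recip_poly (Suc k) c) j =
      coeff (recip_poly k c) j + (if j < 2 then 0 else coeff (recip_poly k c) (j - 2)) + (if j = Suc k then c k else 0)"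
    unfolding recip_poly.simps coeff_add coeff_recip_mult coeff_monom by (simp only: eq_commute)
  show ?case unfolding e by (intro coeff_class_add 1 2 3)
qed

lemma coeff_pcompose_minus: "coeff (pcompose p [:0, -1:]) j = (-1) ^ j * coeff (p :: 'a::comm_ring_1 poly) j"
  using coeff_pcompose_linear[of p "-1" j] by simp

lemma coeff_pcompose_square:
  "coeff (pcompose p [:0, 0, 1:]) j = (if even j then coeff (p :: 'a::comm_ring_1 poly) (j div 2) else 0)"
proof (induction p arbitrary: j)
  case (pCons a p)
  have sq: "[:0, 0, 1:] = (monom 1 2 :: 'a poly)" by (simp add: monom_altdef numeral_2_eq_2)
  have "coeff (pcompose (pCons a p) [:0, 0, 1:]) j =
      coeff [:a:] j + (if 2 \<le> j then coeff (pcompose p [:0, 0, 1:]) (j - 2) else 0)"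
    unfolding pcompose_pCons coeff_add by (simp add: sq coeff_monom_mult)
  also have "\<dots> = (if even j then coeff (pCons a p) (j div 2) else 0)"
  proof (cases "2 \<le> j")
    case True
    then obtain i where "j = Suc (Suc i)" by (metis add_2_eq_Suc le_Suc_ex)
    then show ?thesis using pCons.IH[of i] by simp
  next
    case False
    then have "j = 0 \<or> j = 1" by auto
    then show ?thesis by auto
  qed
  finally show ?case .
qed simp

lemma pcompose_square_inject: "pcompose p [:0, 0, 1:] = pcompose q [:0, 0, 1 :: 'a::comm_ring_1:] \<Longrightarrow> p = q"
proof (rule poly_eqI)
  fix i assume "pcompose p [:0, 0, 1:] = pcompose q [:0, 0, 1 :: 'a:]"
  then have "coeff (pcompose p [:0, 0, 1:]) (2 * i) = coeff (pcompose q [:0, 0, 1:]) (2 * i)" by simp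
  then show "coeff p i = coeff q i" by (simp add: coeff_pcompose_square)
qed

lemma coeff_mult_reflect_odd:
  assumes "odd j"
  shows "coeff (q * pcompose q [:0, -1:]) j = (0 :: real)"
proof -
  let ?r = "q * pcompose q [:0, -1:]"
  have i: "pcompose (pcompose q [:0, -1:]) [:0, -1:] = q"
    by (rule poly_eqI) (simp add: coeff_pcompose_minus flip: mult.assoc power_mult_distrib)
  have "pcompose ?r [:0, -1:] = ?r"
    by (simp only: pcompose_mult i mult.commute)
  then have "coeff (pcompose ?r [:0, -1:]) j = coeff ?r j" by simp
  then show ?thesis using assms by (simp add: coeff_pcompose_minus)
qed

text \<open>In q(x) q(-x) odd degrees cancel by symmetry. In even degrees the two indices of each
  product have the same parity, so square roots of d occur in pairs.\<close>

lemma square_poly_ex: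
  fixes q :: "real poly"
  assumes "\<And>j. coeff q j \<in> coeff_class d j"
  obtains p :: "int poly" where "q * pcompose q [:0, -1:] = pcompose (map_poly of_int p) [:0, 0, 1:]"
    "degree p = degree q" "q \<noteq> 0 \<Longrightarrow> even (degree q) \<Longrightarrow> lead_coeff q = 1 \<Longrightarrow> lead_coeff p = 1"
proof -
  let ?r = "q * pcompose q [:0, -1:]"
  have "coeff ?r (2 * j) \<in> \<int>" for j
    unfolding coeff_mult coeff_pcompose_minus
  proof (rule Ints_sum)
    fix i assume "i \<in> {..2 * j}"
    then have "coeff q i * coeff q (2 * j - i) \<in> \<int>"
      by (intro coeff_class_mult[OF assms assms]) auto
    then have "(-1) ^ (2 * j - i) * (coeff q i * coeff q (2 * j - i)) \<in> \<int>"
      by (rule Ints_mult[rotated]) (intro Ints_power Ints_minus Ints_1)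
    then show "coeff q i * ((-1) ^ (2 * j - i) * coeff q (2 * j - i)) \<in> \<int>" by (simp add: mult_ac)
  qed
  then have "\<forall>j. \<exists>k::int. coeff ?r (2 * j) = of_int k" by (metis Ints_cases)
  then obtain k :: "nat \<Rightarrow> int" where k: "\<And>j. coeff ?r (2 * j) = of_int (k j)" by metis
  define p where "p = (\<Sum>j\<le>degree ?r. monom (k j) j)"
  have k0: "k j = 0" if "j > degree ?r" for j
    using k[of j] coeff_eq_0[of ?r "2 * j"] that by simp
  have cp: "coeff p j = k j" for j
    using k0[of j] by (cases "j \<le> degree ?r") (auto simp: p_def coeff_sum)
  have 1: "?r = pcompose (map_poly of_int p) [:0, 0, 1:]"
  proof (rule poly_eqI)
    fix j show "coeff ?r j = coeff (pcompose (map_poly of_int p) [:0, 0, 1:]) j"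
    proof (cases "even j")
      case True
      then obtain i where "j = 2 * i" by (auto elim: evenE)
      then show ?thesis using k[of i] by (simp add: coeff_pcompose_square coeff_map_poly cp)
    qed (simp add: coeff_pcompose_square coeff_mult_reflect_odd)
  qed
  have dq: "degree (pcompose q [:0, -1:]) = degree q" by (simp add: degree_pcompose)
  have 2: "degree p = degree q"
  proof (cases "q = 0")
    case True
    then have "pcompose (map_poly of_int p :: real poly) [:0, 0, 1:] = pcompose 0 [:0, 0, 1:]" using 1 by simp
    then have "(map_poly of_int p :: real poly) = 0" by (rule pcompose_square_inject)
    then have "degree (map_poly of_int p :: real poly) = 0" by simp
    then show ?thesis using True by simp
  next
    case False
    then have "pcompose q [:0, -1:] \<noteq> 0" by (simp add: pcompose_eq_0_iff)
    then have "degree ?r = 2 * degree q" using False dq by (simp add: degree_mult_eq)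
    moreover have "degree ?r = 2 * degree p" unfolding 1 by (simp add: degree_pcompose)
    ultimately show ?thesis by simp
  qed
  have 3: "lead_coeff p = 1" if "q \<noteq> 0" "even (degree q)" "lead_coeff q = 1"
  proof -
    have "lead_coeff ?r = 1"
      unfolding lead_coeff_mult dq coeff_pcompose_minus using that by simp
    moreover have "degree ?r = 2 * degree p" unfolding 1 by (simp add: degree_pcompose)
    ultimately have "coeff ?r (2 * degree p) = 1" by simp
    then show ?thesis unfolding 1 by (simp add: coeff_pcompose_square coeff_map_poly)
  qed
  show ?thesis using that 1 2 3 by blast
qed

lemma poly_square_eq:
  assumes "q * pcompose q [:0, -1:] = pcompose (map_poly of_int p) [:0, 0, 1:]"
  shows "poly (map_poly of_int p) (w\<^sup>2) = poly (map_poly complex_of_real q) w * poly (map_poly complex_of_real q) (- w)"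
proof -
  have m: "map_poly complex_of_real (pcompose q r) = pcompose (map_poly complex_of_real q) (map_poly complex_of_real r)" for q r
  proof (induction q)
    case (pCons a q)
    have "map_poly complex_of_real (p + q) = map_poly complex_of_real p + map_poly complex_of_real q" for p q
      by (rule poly_eqI) (simp add: coeff_map_poly)
    then show ?case using pCons by (simp add: pcompose_pCons map_poly_of_real_mult map_poly_pCons)
  qed simp
  have "poly (map_poly complex_of_real (q * pcompose q [:0, -1:])) w = poly (map_poly complex_of_real (pcompose (map_poly of_int p) [:0, 0, 1:])) w"
    using assms by simp
  moreover have "map_poly complex_of_real (map_poly of_int p) = map_poly of_int p"
    by (rule poly_eqI) (simp add: coeff_map_poly)
  ultimately show ?thesis
    by (simp add: map_poly_of_real_mult m poly_pcompose map_poly_pCons power2_eq_square)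
qed

lemma rats_common_denominator:
  fixes r :: "nat \<Rightarrow> real"
  assumes "\<And>i. r i \<in> \<rat>"
  shows "\<exists>D::nat. D > 0 \<and> (\<forall>i<N. real D * r i \<in> \<int>)"
proof (induction N)
  case 0
  show ?case by (intro exI[of _ 1]) simp
next
  case (Suc N)
  then obtain D where D: "D > 0" "\<And>i. i < N \<Longrightarrow> real D * r i \<in> \<int>" by blast
  obtain a b :: int where ab: "b > 0" "r N = of_int a / of_int b"
    using assms[of N] by (elim Rats_cases') blast
  define b' where "b' = nat b"
  have b': "b' > 0" "real b' = of_int b" using ab(1) by (simp_all add: b'_def)
  have "real (D * b') * r i \<in> \<int>" if "i < Suc N" for i
  proof (cases "i = N")
    case True
    have "real (D * b') * r N = of_int (int D * a)" using ab b' by simp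
    then show ?thesis unfolding True by (simp only: Ints_of_int)
  next
    case False
    then have "real D * r i \<in> \<int>" using D(2)[of i] that by simp
    then have "real b' * (real D * r i) \<in> \<int>" by (rule Ints_mult[OF Ints_of_nat])
    then show ?thesis by (simp add: mult_ac)
  qed
  then show ?case using D(1) b'(1) by (intro exI[of _ "D * b'"]) simp
qed

text \<open>
  The odd coefficients carry a factor \<open>\<surd>d\<close>, so Gauss's lemma does not apply directly.  At a prime \<open>p\<close> of a
  minimal common denominator the diagonal coefficients of \<open>q(x)q(-x)\<close> force \<open>p\<close> into all numerators:
  by induction from below, first the even ones and then, when \<open>p\<close> divides \<open>d\<close>, the odd ones modulo \<open>p\<^sup>2\<close>.
\<close>

lemma coeff_class_integral:
  fixes q :: "real poly" and p :: "int poly"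
  assumes d: "squarefree d"
    and q: "\<And>i. \<exists>r\<in>\<rat>. coeff q i = (if even i then 1 else sqrt (real d)) * r"
    and p: "q * pcompose q [:0, -1:] = pcompose (map_poly of_int p) [:0, 0, 1:]"
  shows "coeff q i \<in> coeff_class d i"
proof -
  define g where "g = (\<lambda>i :: nat. if even i then 1 else sqrt (real d))"
  define h where "h = (\<lambda>i :: nat. if even i then 1 else int d)"
  have d0: "d > 0" using d by (auto intro!: Nat.gr0I)
  have "\<forall>i. \<exists>r. r \<in> \<rat> \<and> coeff q i = g i * r" using q by (fastforce simp: g_def)
  then obtain r where r: "\<And>i. r i \<in> \<rat>" "\<And>i. coeff q i = g i * r i" by metis
  have g0: "g i > 0" for i using d0 by (simp add: g_def)
  define good where "good = (\<lambda>D::nat. D > 0 \<and> (\<forall>i. \<exists>e::int. real D * coeff q i = g i * of_int e))"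
  obtain D0 where D0: "D0 > 0" "\<And>i. i < Suc (degree q) \<Longrightarrow> real D0 * r i \<in> \<int>"
    using rats_common_denominator[of r "Suc (degree q)", OF r(1)] by blast
  have "good D0"
    unfolding good_def
  proof (intro conjI allI)
    fix i
    show "\<exists>e::int. real D0 * coeff q i = g i * of_int e"
    proof (cases "i < Suc (degree q)")
      case True
      then obtain e where "real D0 * r i = of_int e" using Ints_cases[OF D0(2)[OF True]] by blast
      then show ?thesis unfolding r(2) by (intro exI[of _ e]) (simp add: mult_ac)
    qed (simp add: coeff_eq_0 exI[of _ 0])
  qed (rule D0)
  define D where "D = (LEAST D. good D)"
  have D: "good D" unfolding D_def using \<open>good D0\<close> by (rule LeastI)
  then obtain e :: "nat \<Rightarrow> int" where e: "\<And>i. real D * coeff q i = g i * of_int (e i)" and Dpos: "D > 0"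
    unfolding good_def by metis
  have conv: "(\<Sum>i\<le>2 * j. (-1) ^ i * (h i * (e i * e (2 * j - i)))) = (int D)\<^sup>2 * coeff p j" for j
  proof -
    have "real_of_int (\<Sum>i\<le>2 * j. (-1) ^ i * (h i * (e i * e (2 * j - i)))) =
        (\<Sum>i\<le>2 * j. (real D)\<^sup>2 * (coeff q i * ((-1) ^ (2 * j - i) * coeff q (2 * j - i))))"
      unfolding of_int_sum
    proof (intro sum.cong refl)
      fix i assume "i \<in> {..2 * j}"
      then have i: "i \<le> 2 * j" by simp
      have s: "(-1) ^ (2 * j - i) = ((-1) ^ i :: real)" using i by (simp add: power_diff_conv_inverse minus_one_power_iff)
      have gg: "g i * g (2 * j - i) = of_int (h i)" using i d0 by (simp add: g_def h_def)
      have "(real D)\<^sup>2 * (coeff q i * ((-1) ^ (2 * j - i) * coeff q (2 * j - i))) =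
          (-1) ^ i * ((real D * coeff q i) * (real D * coeff q (2 * j - i)))"
        unfolding s by (simp add: power2_eq_square mult_ac)
      also have "\<dots> = (-1) ^ i * ((g i * g (2 * j - i)) * (of_int (e i) * of_int (e (2 * j - i))))"
        unfolding e by (simp only: mult_ac)
      finally show "real_of_int ((-1) ^ i * (h i * (e i * e (2 * j - i)))) =
          (real D)\<^sup>2 * (coeff q i * ((-1) ^ (2 * j - i) * coeff q (2 * j - i)))"
        unfolding gg by simp
    qed
    also have "\<dots> = (real D)\<^sup>2 * coeff (q * pcompose q [:0, -1:]) (2 * j)"
      unfolding coeff_mult coeff_pcompose_minus by (simp only: sum_distrib_left)
    also have "\<dots> = real_of_int ((int D)\<^sup>2 * coeff p j)"
      unfolding p coeff_pcompose_square by (simp add: coeff_map_poly)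
    finally show ?thesis by (simp only: of_int_eq_iff)
  qed
  \<comment> \<open>In the coefficient of x^(2i) every other product has an index below i.
    Divisibility thus passes from the smaller indices to \<open>e i\<close>.\<close>
  have diag: "(-1) ^ i * (h i * (e i * e i)) = (int D)\<^sup>2 * coeff p i -
      (\<Sum>k\<in>{..2 * i} - {i}. (-1) ^ k * (h k * (e k * e (2 * i - k))))" for i
    unfolding conv[of i, symmetric] by (subst sum.remove[of "{..2 * i}" i]) auto
  have sgn: "x dvd (-1) ^ i * y \<longleftrightarrow> x dvd y" for x y :: int and i :: nat
    by (cases "even i") simp_all
  have step: "x dvd h i * (e i * e i)"
    if "\<And>k. k \<in> {..2 * i} - {i} \<Longrightarrow> x dvd h k * (e k * e (2 * i - k))" "x dvd (int D)\<^sup>2" for x i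
  proof -
    have "x dvd (-1) ^ i * (h i * (e i * e i))"
      unfolding diag by (rule dvd_diff[OF dvd_mult2[OF that(2)] dvd_sum]) (simp only: sgn that(1))
    then show ?thesis by (simp only: sgn)
  qed
  have "D = 1"
  proof (rule ccontr)
    assume "D \<noteq> 1"
    then obtain pr where pr: "prime pr" "pr dvd D" using prime_factor_nat by blast
    define P where "P = int pr"
    have P: "prime P" "P dvd int D" using pr by (auto simp: P_def)
    have P2: "P * P dvd (int D)\<^sup>2" unfolding power2_eq_square using P(2) by (intro mult_dvd_mono) auto
    have PD: "P dvd (int D)\<^sup>2" using P(2) by (simp add: power2_eq_square)
    have all: "P dvd e i" for i
    proof (cases "P dvd int d")
      case False
      show ?thesis
      proof (induction i rule: less_induct)
        case (less i)
        have "P dvd e k * e (2 * i - k)" if "k \<in> {..2 * i} - {i}" for k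
        proof (cases "k < i")
          case True
          then show ?thesis using less by simp
        next
          case F: False
          then have "2 * i - k < i" using that by auto
          then show ?thesis using less by simp
        qed
        then have "P dvd h i * (e i * e i)" by (intro step[OF dvd_mult] PD)
        moreover have "\<not> P dvd h i"
          using False P(1) by (auto simp: h_def not_prime_unit)
        ultimately show ?case using P(1) by (simp add: prime_dvd_mult_iff)
      qed
    next
      case True
      have ev: "P dvd e i" if "even i" for i
        using that
      proof (induction i rule: less_induct)
        case (less i)
        have "P dvd h k * (e k * e (2 * i - k))" if k: "k \<in> {..2 * i} - {i}" for k
        proof (cases "even k")
          case True
          consider "k < i" | "2 * i - k < i" using k by force
          then show ?thesis
          proof cases
            case 1
            then show ?thesis using less.IH True by simp
          next
            case 2
            moreover have "even (2 * i - k)" using True by simp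
            ultimately show ?thesis using less.IH by simp
          qed
        next
          case False
          then show ?thesis using \<open>P dvd int d\<close> by (simp add: h_def)
        qed
        then have "P dvd h i * (e i * e i)" by (intro step PD)
        then show ?case using P(1) less.prems by (simp add: h_def prime_dvd_mult_iff)
      qed
      obtain d' where d': "int d = P * d'" using True by (auto elim: dvdE)
      \<comment> \<open>By squarefreeness P divides d only once, so that divisibility of d (e i)^2
        by P^2 still forces P to divide \<open>e i\<close>.\<close>
      have nd': "\<not> P dvd d'"
      proof
        assume "P dvd d'"
        then have "P * P dvd int d" unfolding d' by (rule mult_dvd_mono[OF dvd_refl])
        then have "int (pr\<^sup>2) dvd int d" by (simp add: P_def power2_eq_square)
        then have "pr\<^sup>2 dvd d" by (simp only: int_dvd_int_iff)
        then show False using squarefreeD[OF d] pr(1) by (metis not_prime_unit)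
      qed
      have od: "P dvd e i" if "odd i" for i
        using that
      proof (induction i rule: less_induct)
        case (less i)
        have "P * P dvd h k * (e k * e (2 * i - k))" if k: "k \<in> {..2 * i} - {i}" for k
        proof (cases "even k")
          case True
          then have "P dvd e k" "P dvd e (2 * i - k)" using ev k by auto
          then show ?thesis by (intro dvd_mult mult_dvd_mono)
        next
          case False
          consider "k < i" | "2 * i - k < i" using k by force
          then have "P dvd e k * e (2 * i - k)"
          proof cases
            case 1
            then show ?thesis using less.IH False by simp
          next
            case 2
            moreover have "odd (2 * i - k)" using False k by simp
            ultimately show ?thesis using less.IH by simp
          qed
          then show ?thesis using False \<open>P dvd int d\<close> by (simp add: h_def mult_dvd_mono)
        qed
        then have "P * P dvd h i * (e i * e i)" by (intro step P2)
        then have "P * P dvd P * (d' * (e i * e i))" using less.prems by (simp add: h_def d' mult.assoc)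
        then have "P dvd d' * (e i * e i)" using P(1) by (subst (asm) dvd_mult_cancel_left) auto
        then show ?case using P(1) nd' by (simp add: prime_dvd_mult_iff)
      qed
      show ?thesis using ev od by (cases "even i") auto
    qed
    obtain D' where D': "D = pr * D'" using pr(2) by (auto elim: dvdE)
    have "good D'"
      unfolding good_def
    proof (intro conjI allI)
      show "D' > 0" using Dpos D' by (auto intro!: Nat.gr0I)
      fix i
      obtain e' where e': "e i = P * e'" using all[of i] by (auto elim: dvdE)
      have "real pr * (real D' * coeff q i) = real pr * (g i * of_int e')"
        using e[of i] by (simp add: D' e' P_def mult_ac)
      moreover have "real pr \<noteq> 0" using pr(1) by (auto simp: prime_gt_0_nat)
      ultimately show "\<exists>e::int. real D' * coeff q i = g i * of_int e"
        using mult_left_cancel[of "real pr" "real D' * coeff q i" "g i * of_int e'"] by blast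
    qed
    then have "D \<le> D'" unfolding D_def by (rule Least_le)
    moreover have "D' < D" using D' pr(1) Dpos prime_gt_1_nat[of pr] by simp
    ultimately show False by simp
  qed
  then show ?thesis using e[of i] by (intro coeff_classI[of _ _ _ "e i"]) (simp add: g_def)
qed

text \<open>The outer coefficients are removed inductively: q minus q(0) (1 + x^2)^(m+1) is x q'
  with q' palindromic for the formal degree 2m. The actual degree of q' may be smaller, so only a
  bound is assumed. Division by x shifts all degrees by one, and s keeps track of the
  parity.\<close>

lemma palindromic_expansion:
  fixes q :: "real poly"
  assumes "degree q \<le> 2 * m" "\<And>i. i \<le> 2 * m \<Longrightarrow> coeff q i = coeff q (2 * m - i)"
    "\<And>i. coeff q i \<in> coeff_class d (i + s)"
  shows "\<exists>b. (\<forall>j\<le>m. b j \<in> coeff_class d (m - j + s)) \<and> b m = coeff q 0 \<and>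
    (\<forall>t. t \<noteq> 0 \<longrightarrow> poly q t = t ^ m * (\<Sum>j\<le>m. b j * (t + 1 / t) ^ j))"
  using assms
proof (induction m arbitrary: q s)
  case 0
  then obtain a where "q = [:a:]" by (auto elim: degree_eq_zeroE)
  then show ?case using "0.prems"(3)[of 0] by (intro exI[of _ "\<lambda>_. a"]) simp
next
  case (Suc m)
  define A where "A = [:1, 0, 1 :: real:] ^ Suc m"
  have A: "A = recip_poly (Suc m) (\<lambda>_. 0)"
    unfolding A_def by (induction m) simp_all
  define a where "a = coeff q 0"
  define R where "R = q - smult a A"
  have cA1: "coeff A i \<in> coeff_class d i" for i
    unfolding A by (rule coeff_class_recip_poly) simp
  have cA2: "coeff A i = coeff A (2 * Suc m - i)" if "i \<le> 2 * Suc m" for i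
    unfolding A using that by (rule recip_poly_sym)
  have dA: "degree A = 2 * Suc m" unfolding A by (rule recip_poly_degree)
  have A0: "coeff A 0 = 1" using cA2[of 0] lead_coeff_recip_poly[of "Suc m" "\<lambda>_. 0 :: real"] by (simp add: A del: recip_poly.simps)
  have R0: "coeff R 0 = 0" by (simp add: R_def a_def A0)
  obtain q' where q': "R = pCons 0 q'" using R0 by (metis coeff_pCons_0 pCons_cases)
  have cq': "coeff q' i = coeff q (Suc i) - a * coeff A (Suc i)" for i
    using arg_cong[OF q', of "\<lambda>p. coeff p (Suc i)"] by (simp add: R_def)
  have sym: "coeff q' i = coeff q' (2 * m - i)" if "i \<le> 2 * m" for i
  proof -
    have "2 * Suc m - Suc i = Suc (2 * m - i)" using that by simp
    then show ?thesis
      unfolding cq' using Suc.prems(2)[of "Suc i"] cA2[of "Suc i"] that by simp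
  qed
  have top: "coeff q (2 * Suc m) = a" using Suc.prems(2)[of 0] by (simp add: a_def)
  have topA: "coeff A (2 * Suc m) = 1" using cA2[of 0] A0 by simp
  have deg: "degree q' \<le> 2 * m"
  proof (rule degree_le, intro allI impI)
    fix i assume i: "2 * m < i"
    show "coeff q' i = 0"
    proof (cases "Suc i = 2 * Suc m")
      case True
      then show ?thesis unfolding cq' True by (simp only: top topA)
    next
      case False
      then have "2 * Suc m < Suc i" using i by simp
      then show ?thesis unfolding cq' using Suc.prems(1) dA by (simp add: coeff_eq_0)
    qed
  qed
  have cl: "coeff q' i \<in> coeff_class d (i + Suc s)" for i
  proof -
    have "coeff q (Suc i) \<in> coeff_class d (i + Suc s)" using Suc.prems(3)[of "Suc i"] by simp
    moreover have "a * coeff A (Suc i) \<in> coeff_class d (i + Suc s)"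
    proof -
      obtain k where k: "a = (if even s then 1 else sqrt (real d)) * of_int k"
        using Suc.prems(3)[of 0] by (auto simp: a_def elim: coeff_classE)
      show ?thesis
      proof (cases "even (Suc i)")
        case True
        then obtain l where l: "coeff A (Suc i) = of_int l" using cA1[of "Suc i"] by (auto elim: coeff_classE)
        have "a * coeff A (Suc i) = (if even (i + Suc s) then 1 else sqrt (real d)) * of_int (k * l)"
          using True by (simp add: k l)
        then show ?thesis by (rule coeff_classI)
      next
        case False
        have "coeff A j = 0" if "odd j" for j
          unfolding A using that
        proof (induction m arbitrary: j)
          case 0
          then show ?case by (cases j) (auto simp: coeff_pCons split: nat.splits)
        next
          case (Suc m)
          show ?case
            unfolding recip_poly.simps(2)[of "Suc m"] coeff_add coeff_recip_mult
            using Suc.IH[of j] Suc.IH[of "j - 2"] Suc.prems by simp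
        qed
        then show ?thesis using False by simp
      qed
    qed
    ultimately show ?thesis
      unfolding cq' diff_conv_add_uminus by (intro coeff_class_add coeff_class_uminus)
  qed
  obtain b where b: "\<And>j. j \<le> m \<Longrightarrow> b j \<in> coeff_class d (m - j + Suc s)"
    "\<And>t. t \<noteq> 0 \<Longrightarrow> poly q' t = t ^ m * (\<Sum>j\<le>m. b j * (t + 1 / t) ^ j)"
    using Suc.IH[OF deg sym cl] by blast
  show ?case
  proof (intro exI[of _ "b(Suc m := a)"] conjI allI impI)
    fix j assume j: "j \<le> Suc m"
    show "(b(Suc m := a)) j \<in> coeff_class d (Suc m - j + s)"
    proof (cases "j = Suc m")
      case True
      then show ?thesis using Suc.prems(3)[of 0] by (simp add: a_def)
    next
      case False
      then have "j \<le> m" using j by simp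
      then show ?thesis using b(1)[of j] by (simp add: Suc_diff_le)
    qed
  next
    fix t :: real assume t: "t \<noteq> 0"
    have "q = pCons 0 q' + smult a A" using q' by (simp add: R_def)
    then have qt: "poly q t = t * poly q' t + a * poly A t" by simp
    have At: "poly A t = t ^ Suc m * (t + 1 / t) ^ Suc m"
    proof -
      have e: "1 + t * t = t * (t + 1 / t)" using t by (simp add: distrib_left)
      have "poly A t = (1 + t * t) ^ Suc m" unfolding A_def poly_power by simp
      then show ?thesis unfolding e by (simp only: power_mult_distrib)
    qed
    have s: "(\<Sum>j\<le>Suc m. (b(Suc m := a)) j * (t + 1 / t) ^ j) = (\<Sum>j\<le>m. b j * (t + 1 / t) ^ j) + a * (t + 1 / t) ^ Suc m"
      by simp
    show "poly q t = t ^ Suc m * (\<Sum>j\<le>Suc m. (b(Suc m := a)) j * (t + 1 / t) ^ j)"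
      unfolding qt At b(2)[OF t] s by (simp only: power_Suc distrib_left mult_ac)
  qed (simp add: a_def)
qed

lemma poly_eq_nonzero:
  fixes p q :: "real poly"
  assumes "\<And>t. t \<noteq> 0 \<Longrightarrow> poly p t = poly q t"
  shows "p = q"
proof -
  have "poly (p - q) t = 0" if "t \<noteq> 0" for t using assms[OF that] by simp
  then have "- {0} \<subseteq> {t. poly (p - q) t = 0}" by auto
  moreover have "infinite (- {0 :: real})" by (simp add: infinite_UNIV_char_0)
  ultimately have "p - q = 0" using poly_roots_finite finite_subset by blast
  then show ?thesis by simp
qed

text \<open>The expansion with s = 0. Its top coefficient is q(0), which equals the leading
  coefficient 1 by symmetry, so F is monic.\<close>

lemma palindromic_eq_recip_poly:
  fixes q :: "real poly"
  assumes "degree q = 2 * m" "lead_coeff q = 1" "palindromic q" "\<And>i. coeff q i \<in> coeff_class d i"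
  obtains c where "q = recip_poly m c" "supp_below m c" "\<And>i. i < m \<Longrightarrow> c i \<in> coeff_class d (Suc i)"
proof -
  have sym: "coeff q i = coeff q (2 * m - i)" if "i \<le> 2 * m" for i
    using assms(3) that unfolding palindromic_iff[OF assms(1)] by blast
  have "coeff q i \<in> coeff_class d (i + 0)" for i using assms(4) by simp
  then obtain b where b: "\<And>j. j \<le> m \<Longrightarrow> b j \<in> coeff_class d (m - j + 0)" "b m = coeff q 0"
      "\<And>t. t \<noteq> 0 \<Longrightarrow> poly q t = t ^ m * (\<Sum>j\<le>m. b j * (t + 1 / t) ^ j)"
    using palindromic_expansion[OF eq_refl[OF assms(1)] sym] by blast
  have bm: "b m = 1" using b(2) sym[of 0] assms(2)[unfolded assms(1)] by simp
  define c where "c = (\<lambda>i. if i < m then b (m - 1 - i) else 0)"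
  have "monic_poly m c = (\<Sum>j\<le>m. monom (b j) j)"
  proof (rule poly_eqI)
    fix i
    show "coeff (monic_poly m c) i = coeff (\<Sum>j\<le>m. monom (b j) j) i"
    proof (cases i m rule: linorder_cases)
      case less
      then show ?thesis by (simp add: coeff_monic_poly coeff_sum c_def)
    next
      case equal
      then show ?thesis by (simp add: lead_coeff_monic_poly coeff_sum bm)
    next
      case greater
      then show ?thesis by (simp add: coeff_eq_0 coeff_sum)
    qed
  qed
  then have F: "poly (monic_poly m c) y = (\<Sum>j\<le>m. b j * y ^ j)" for y
    by (simp add: poly_sum poly_monom)
  have "q = recip_poly m c"
    by (rule poly_eq_nonzero) (simp add: poly_recip_poly F b(3))
  moreover have "supp_below m c" by (simp add: c_def supp_below_def)
  moreover have "c i \<in> coeff_class d (Suc i)" if "i < m" for i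
    using b(1)[of "m - 1 - i"] that by (simp add: c_def Suc_diff_Suc)
  ultimately show ?thesis by (rule that)
qed

text \<open>The values t + 1/t with t > 0 fill the half-line from 2 on, so q determines F at
  infinitely many points.\<close>

lemma recip_poly_inject:
  fixes c e :: "nat \<Rightarrow> real"
  assumes "recip_poly m c = recip_poly m e" "supp_below m c" "supp_below m e"
  shows "c = e"
proof (rule monic_poly_inject_supp[OF _ assms(2,3)])
  have "poly (monic_poly m c - monic_poly m e) (t + 1 / t) = 0" if "t > 0" for t
    using arg_cong[OF assms(1), of "\<lambda>p. poly p t"] that by (simp add: poly_recip_poly)
  moreover have "\<exists>t>0. y = t + 1 / t" if "y \<ge> 2" for y :: real
  proof -
    define t where "t = (y + sqrt (y\<^sup>2 - 4)) / 2"
    have "y\<^sup>2 \<ge> 2\<^sup>2" using that by (intro power_mono) auto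
    then have s: "(sqrt (y\<^sup>2 - 4))\<^sup>2 = y\<^sup>2 - 4" "sqrt (y\<^sup>2 - 4) \<ge> 0" by simp_all
    have t: "t > 0" unfolding t_def using that s(2) by (intro divide_pos_pos add_pos_nonneg) simp_all
    have "t * t + 1 = y * t" unfolding t_def using s(1) by (simp add: power2_eq_square field_simps)
    then have "y = t + 1 / t" using t by (simp add: field_simps)
    then show ?thesis using t by blast
  qed
  ultimately have "{2..} \<subseteq> {y. poly (monic_poly m c - monic_poly m e) y = 0}" by auto
  moreover have "infinite {2 :: real..}" by (rule infinite_Ici)
  ultimately have "monic_poly m c - monic_poly m e = 0" using poly_roots_finite finite_subset by blast
  then show "monic_poly m c = monic_poly m e" by simp
qed

section \<open>Trace polynomials of Salem numbers\<close>

text \<open>The inverse of \<lambda> \<mapsto> sqrt \<lambda> + 1 / sqrt \<lambda> for \<lambda>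
  \<ge> 1.\<close>

definition salem_of :: "real \<Rightarrow> real" where
  "salem_of x = ((x + sqrt (x\<^sup>2 - 4)) / 2)\<^sup>2"

lemma salem_of_add_inverse:
  assumes "v \<ge> 1"
  shows "salem_of (v + 1 / v) = v\<^sup>2"
proof -
  have "(v + 1 / v)\<^sup>2 - 4 = (v - 1 / v)\<^sup>2"
    using assms by (simp add: power2_eq_square algebra_simps)
  moreover have "v - 1 / v \<ge> 0" using assms by (simp add: divide_le_eq mult_le_one order_trans[of 1 v "v * v"])
  ultimately have "sqrt ((v + 1 / v)\<^sup>2 - 4) = v - 1 / v" by simp
  then show ?thesis by (simp add: salem_of_def)
qed

lemma add_inverse_ex:
  assumes "x \<ge> 2"
  obtains v :: real where "v \<ge> 1" "x = v + 1 / v"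
proof -
  define v where "v = (x + sqrt (x\<^sup>2 - 4)) / 2"
  have "x\<^sup>2 \<ge> 2\<^sup>2" using assms by (intro power_mono) auto
  then have s: "(sqrt (x\<^sup>2 - 4))\<^sup>2 = x\<^sup>2 - 4" "sqrt (x\<^sup>2 - 4) \<ge> 0" by simp_all
  have "2 \<le> x + sqrt (x\<^sup>2 - 4)" using add_mono[OF assms s(2)] by simp
  then have v: "v \<ge> 1" by (simp add: v_def)
  have "v * v + 1 = x * v" unfolding v_def using s(1) by (simp add: power2_eq_square field_simps)
  then have "x = (v * v + 1) / v" using v by (simp add: eq_divide_eq)
  then have "x = v + 1 / v" using v by (simp add: add_divide_distrib)
  with v show ?thesis by (rule that)
qed

lemma add_inverse_strict_mono:
  assumes "1 \<le> u" "u < (v :: real)"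
  shows "u + 1 / u < v + 1 / v"
proof -
  have uv: "u * v > 1" using mult_le_less_imp_less[of 1 u 1 v] assms by simp
  define a b where "a = 1 / u" and "b = 1 / v"
  have ab: "u * a = 1" "v * b = 1" "a * b = 1 / (u * v)" using assms by (auto simp: a_def b_def)
  have "a * b < 1" unfolding ab(3) using uv by simp
  have "(v + b) - (u + a) = (v - u) * (1 - a * b)" using ab(1,2) by algebra
  also have "\<dots> > 0" using assms \<open>a * b < 1\<close> by (intro mult_pos_pos) auto
  finally show ?thesis by (simp add: a_def b_def)
qed

lemma add_inverse_le_iff:
  assumes "1 \<le> u" "1 \<le> (v :: real)"
  shows "u + 1 / u \<le> v + 1 / v \<longleftrightarrow> u \<le> v"
  using add_inverse_strict_mono[of u v] add_inverse_strict_mono[of v u] assms by (cases u v rule: linorder_cases) auto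

lemma unit_circle_of_add_inverse:
  fixes w :: complex
  assumes "w \<noteq> 0" "w + 1 / w = of_real r" "\<bar>r\<bar> \<le> 2"
  shows "norm w = 1"
proof -
  have e: "w * w + 1 = of_real r * w"
    using arg_cong[OF assms(2), of "\<lambda>z. z * w"] assms(1) by (simp add: distrib_right)
  define a b where "a = Re w" and "b = Im w"
  have re: "a * a - b * b + 1 = r * a" using arg_cong[OF e, of Re] by (simp add: a_def b_def)
  have im: "2 * a * b = r * b" using arg_cong[OF e, of Im] by (simp add: a_def b_def)
  have "a\<^sup>2 + b\<^sup>2 = 1"
  proof (cases "b = 0")
    case True
    have "r\<^sup>2 \<le> 2\<^sup>2" using assms(3) abs_le_square_iff[of r 2] by simp
    moreover have "(2 * a - r)\<^sup>2 = r\<^sup>2 - 4" using re True by (simp add: power2_eq_square algebra_simps)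
    ultimately have "(2 * a - r)\<^sup>2 = 0" using zero_le_power2[of "2 * a - r"] by simp
    then have "r = 2 * a" by simp
    then show ?thesis using re True by (simp add: power2_eq_square)
  next
    case False
    then have "r = 2 * a" using im by simp
    then show ?thesis using re by (simp add: power2_eq_square)
  qed
  then show ?thesis by (simp add: a_def b_def cmod_def)
qed

lemma add_inverse_of_unit_circle:
  fixes w :: complex
  assumes "norm w = 1"
  shows "w + 1 / w = of_real (2 * Re w)" "\<bar>2 * Re w\<bar> \<le> 2"
proof -
  have "w * cnj w = 1" using complex_norm_square[of w] assms by simp
  moreover from this have "w \<noteq> 0" by auto
  ultimately have "1 / w = cnj w" by (simp add: divide_eq_eq mult.commute)
  then show "w + 1 / w = of_real (2 * Re w)" by (simp only: complex_add_cnj)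
  show "\<bar>2 * Re w\<bar> \<le> 2" using abs_Re_le_cmod[of w] assms by simp
qed

lemma add_inverse_eq_imp:
  fixes w u :: "'a::field"
  assumes "w \<noteq> 0" "u \<noteq> 0" "w + 1 / w = u + 1 / u"
  shows "w = u \<or> w = 1 / u"
proof -
  have "(w - u) * (w - 1 / u) = w * ((w + 1 / w) - (u + 1 / u))"
    using assms(1,2) by (simp add: field_simps)
  then have "(w - u) * (w - 1 / u) = 0" using assms(3) by simp
  then show ?thesis by simp
qed

lemma complex_add_inverse_ex:
  obtains w :: complex where "w \<noteq> 0" "y = w + 1 / w"
proof -
  define s where "s = csqrt (y\<^sup>2 - 4)"
  have s: "s * s = y * y - 4" using power2_csqrt[of "y\<^sup>2 - 4"] unfolding s_def by (simp only: power2_eq_square)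
  define w where "w = (y + s) / 2"
  have "4 * (w * w + 1) = y * y + 2 * (y * s) + s * s + 4" by (simp add: w_def field_simps)
  also have "\<dots> = 4 * (y * w)" unfolding s by (simp add: w_def field_simps)
  finally have "w * w + 1 = y * w" by (simp only: mult_cancel_left) simp
  moreover from this have "w \<noteq> 0" by auto
  ultimately have "y = (w * w + 1) / w" by (simp add: eq_divide_eq)
  then have "y = w + 1 / w" using \<open>w \<noteq> 0\<close> by (simp add: add_divide_distrib)
  with \<open>w \<noteq> 0\<close> show ?thesis by (rule that)
qed

abbreviation cmonic_poly :: "nat \<Rightarrow> (nat \<Rightarrow> real) \<Rightarrow> complex poly" where
  "cmonic_poly m c \<equiv> monic_poly m (\<lambda>i. complex_of_real (c i))"

lemma poly_cmonic_of_real: "poly (cmonic_poly m c) (of_real y) = of_real (poly (monic_poly m c) y)"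
  using poly_map_poly_of_real[of "monic_poly m c" y] by (simp only: map_poly_monic_poly)

lemma poly_cmonic_root_coeffs: "poly (cmonic_poly m (root_coeffs m z)) y = (\<Prod>i<m. y - of_real (z i))"
proof -
  have "map_poly complex_of_real (\<Prod>i<m. [:- z i, 1:]) = (\<Prod>i<m. [:- of_real (z i), 1:])"
    by (induction m) (simp_all add: map_poly_of_real_mult map_poly_pCons del: mult_pCons_left mult_pCons_right)
  then have "cmonic_poly m (root_coeffs m z) = (\<Prod>i<m. [:- of_real (z i), 1:])"
    unfolding map_poly_monic_poly[symmetric] monic_poly_root_coeffs .
  then show ?thesis by (simp add: poly_prod)
qed

lemma poly_crecip:
  "w \<noteq> 0 \<Longrightarrow> poly (map_poly complex_of_real (recip_poly m c)) w = w ^ m * poly (cmonic_poly m c) (w + 1 / w)"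
  unfolding map_poly_recip_poly by (rule poly_recip_poly)

text \<open>\<open>trace_rel m c p\<close> says that \<open>p(x\<^sup>2) = q(x)q(-x)\<close> where \<open>q(x) = x\<^sup>m F(x + 1/x)\<close> and \<open>F\<close> has coefficients \<open>c\<close>.\<close>

definition trace_rel :: "nat \<Rightarrow> (nat \<Rightarrow> real) \<Rightarrow> int poly \<Rightarrow> bool" where
  "trace_rel m c p \<longleftrightarrow> lead_coeff p = 1 \<and> degree p = 2 * m \<and>
    recip_poly m c * pcompose (recip_poly m c) [:0, -1:] = pcompose (map_poly of_int p) [:0, 0, 1:]"

lemma trace_rel_ex:
  assumes "\<And>i. i < m \<Longrightarrow> c i \<in> coeff_class d (Suc i)"
  obtains p where "trace_rel m c p"
proof -
  have deg: "degree (recip_poly m c) = 2 * m" by (rule recip_poly_degree)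
  have lc: "lead_coeff (recip_poly m c) = 1" unfolding deg by (rule lead_coeff_recip_poly)
  then have nz: "recip_poly m c \<noteq> 0" by auto
  obtain p where "recip_poly m c * pcompose (recip_poly m c) [:0, -1:] = pcompose (map_poly of_int p) [:0, 0, 1:]"
     "degree p = degree (recip_poly m c)" "lead_coeff p = 1"
    using square_poly_ex[of "recip_poly m c" d] coeff_class_recip_poly[OF assms] nz deg lc by (metis dvd_triv_left)
  then show ?thesis using that[of p] by (simp add: trace_rel_def deg)
qed

lemma trace_rel_square:
  assumes "trace_rel m c p"
  shows "poly (map_poly of_int p) (w\<^sup>2) =
    poly (map_poly complex_of_real (recip_poly m c)) w * poly (map_poly complex_of_real (recip_poly m c)) (- w)"
  using assms unfolding trace_rel_def by (intro poly_square_eq) blast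

lemma trace_rel_poly:
  assumes "trace_rel m c p" "w \<noteq> 0"
  shows "poly (map_poly of_int p) (w\<^sup>2) =
    (-1) ^ m * w ^ (2 * m) * (poly (cmonic_poly m c) (w + 1 / w) * poly (cmonic_poly m c) (- (w + 1 / w)))"
proof -
  have "- w + 1 / (- w) = - (w + 1 / w)" using assms(2) by simp
  then have "poly (map_poly complex_of_real (recip_poly m c)) (- w) = (- w) ^ m * poly (cmonic_poly m c) (- (w + 1 / w))"
    using poly_crecip[of "- w" m c] assms(2) by simp
  moreover have "(- w) ^ m = (-1) ^ m * w ^ m" by (rule power_minus)
  moreover have "w ^ (2 * m) = w ^ m * w ^ m" by (simp add: mult_2 power_add)
  ultimately show ?thesis
    unfolding trace_rel_square[OF assms(1)] poly_crecip[OF assms(2)] by (simp only: mult_ac)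
qed

lemma trace_rel_root_iff:
  assumes "trace_rel m c p" "w \<noteq> 0"
  shows "poly (map_poly of_int p) (w\<^sup>2) = 0 \<longleftrightarrow>
    poly (cmonic_poly m c) (w + 1 / w) = 0 \<or> poly (cmonic_poly m c) (- (w + 1 / w)) = 0"
  unfolding trace_rel_poly[OF assms] using assms(2) by simp

lemma trace_rel_coeff_0:
  assumes "trace_rel m c p"
  shows "coeff p 0 = 1"
proof -
  have "coeff (recip_poly m c) 0 = 1"
    using recip_poly_sym[of 0 m c] lead_coeff_recip_poly[of m c] by (simp add: poly_0_coeff_0)
  then have "coeff (recip_poly m c * pcompose (recip_poly m c) [:0, -1:]) 0 = 1"
    by (simp add: coeff_mult coeff_pcompose_minus poly_0_coeff_0)
  then show ?thesis using assms by (simp add: trace_rel_def coeff_pcompose_square coeff_map_poly poly_0_coeff_0)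
qed

lemma trace_rel_nonzero_root:
  assumes "trace_rel m c p" "poly (map_poly of_int p) z = (0 :: complex)"
  obtains w where "w \<noteq> 0" "z = w\<^sup>2" "poly (cmonic_poly m c) (w + 1 / w) = 0"
proof -
  have z: "z \<noteq> 0"
  proof
    assume "z = 0"
    then show False using assms(2) trace_rel_coeff_0[OF assms(1)] by (simp add: poly_0_coeff_0 coeff_map_poly)
  qed
  define w where "w = csqrt z"
  have w: "w \<noteq> 0" "z = w\<^sup>2" using z by (simp_all add: w_def)
  have "- w + 1 / (- w) = - (w + 1 / w)" by simp
  then show ?thesis
    using trace_rel_root_iff[OF assms(1) w(1)] assms(2) that[of w] that[of "- w"] w by auto
qed

text \<open>Irreducibility makes the roots of p simple, and so are the zeros of p(x^2) away from 0.
  A simple zero w of q(x) q(-x) with q(w) = 0 has q'(w) \<noteq> 0 and q(-w) \<noteq> 0. For F this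
  means that its roots are simple and no two of them are opposite.\<close>

lemma trace_rel_simple:
  assumes "trace_rel m c p" and irr: "irreducible (map_poly of_int p :: rat poly)"
    and w: "w \<noteq> 0" and root: "poly (cmonic_poly m c) (w + 1 / w) = 0"
  shows "poly (pderiv (cmonic_poly m c)) (w + 1 / w) \<noteq> 0" "poly (cmonic_poly m c) (- (w + 1 / w)) \<noteq> 0"
proof -
  define Q where "Q = map_poly complex_of_real (recip_poly m c)"
  define P where "P = (map_poly of_int p :: complex poly)"
  have PQ: "pcompose P [:0, 0, 1:] = Q * pcompose Q [:0, -1:]"
  proof -
    have "poly (pcompose P [:0, 0, 1:]) t = poly (Q * pcompose Q [:0, -1:]) t" for t
      using trace_rel_square[OF assms(1), of t] by (simp add: P_def Q_def poly_pcompose power2_eq_square)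
    then show ?thesis by (simp add: poly_eq_poly_eq_iff[symmetric] fun_eq_iff)
  qed
  have Qw: "poly Q w = 0" using poly_crecip[OF w, of m c] root by (simp add: Q_def)
  have P0: "poly P (w\<^sup>2) = 0" using trace_rel_square[OF assms(1), of w] Qw by (simp add: P_def Q_def)
  have "poly (pderiv (map_poly of_rat (map_poly of_int p :: rat poly))) (w\<^sup>2) \<noteq> 0"
    using irr P0 by (intro irreducible_rat_poly_simple_root) (simp_all add: map_poly_of_rat_of_int P_def)
  then have P': "poly (pderiv P) (w\<^sup>2) \<noteq> 0" by (simp add: map_poly_of_rat_of_int P_def)
  have "poly (pderiv (pcompose P [:0, 0, 1:])) w = poly (pderiv P) (w\<^sup>2) * (2 * w)"
    by (simp add: pderiv_pcompose poly_pcompose pderiv_pCons power2_eq_square)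
  then have nz: "poly (pderiv (Q * pcompose Q [:0, -1:])) w \<noteq> 0" using P' w unfolding PQ by simp
  have e: "poly (pderiv (Q * pcompose Q [:0, -1:])) w = poly (pderiv Q) w * poly Q (- w)"
    using Qw by (simp add: pderiv_mult poly_pcompose)
  have Q': "poly (pderiv Q) w \<noteq> 0" and Qm: "poly Q (- w) \<noteq> 0" using nz unfolding e by auto
  have "- w + 1 / (- w) = - (w + 1 / w)" by simp
  then show "poly (cmonic_poly m c) (- (w + 1 / w)) \<noteq> 0"
    using Qm poly_crecip[of "- w" m c] w by (auto simp: Q_def)
  show "poly (pderiv (cmonic_poly m c)) (w + 1 / w) \<noteq> 0"
  proof
    assume F': "poly (pderiv (cmonic_poly m c)) (w + 1 / w) = 0"
    define F where "F = cmonic_poly m c"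
    have i: "((\<lambda>t. t + 1 / t) has_field_derivative 1 - 1 / w\<^sup>2) (at w)"
      using w by (auto intro!: derivative_eq_intros simp: power2_eq_square divide_inverse)
    have dF: "((\<lambda>t. poly F (t + 1 / t)) has_field_derivative poly (pderiv F) (w + 1 / w) * (1 - 1 / w\<^sup>2)) (at w)"
      by (rule DERIV_chain2[OF poly_DERIV i])
    have "((\<lambda>t. t ^ m * poly F (t + 1 / t)) has_field_derivative
        (of_nat m * w ^ (m - 1)) * poly F (w + 1 / w) + (poly (pderiv F) (w + 1 / w) * (1 - 1 / w\<^sup>2)) * w ^ m) (at w)"
      using DERIV_mult[OF DERIV_power[OF DERIV_ident[of "at w"], of m] dF] by simp
    then have "((\<lambda>t. t ^ m * poly F (t + 1 / t)) has_field_derivative 0) (at w)"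
      using root F' by (simp add: F_def)
    then have "(poly Q has_field_derivative 0) (at w)"
    proof (rule has_field_derivative_transform_within_open[where S = "- {0}"])
      show "t ^ m * poly F (t + 1 / t) = poly Q t" if "t \<in> - {0}" for t
        using that poly_crecip[of t m c] by (simp add: Q_def F_def)
    qed (use w in auto)
    then have "poly (pderiv Q) w = 0" using poly_DERIV[of Q w] DERIV_unique by blast
    then show False using Q' by simp
  qed
qed

lemma trace_rel_rsquarefree:
  assumes "trace_rel m c p" "irreducible (map_poly of_int p :: rat poly)"
  shows "cmonic_poly m c = (\<Prod>y\<in>{y. poly (cmonic_poly m c) y = 0}. [:- y, 1:])"
    "card {y. poly (cmonic_poly m c) y = 0} = m"
proof -
  have "rsquarefree (cmonic_poly m c)"
    unfolding rsquarefree_roots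
  proof (intro allI notI)
    fix y assume y: "poly (cmonic_poly m c) y = 0 \<and> poly (pderiv (cmonic_poly m c)) y = 0"
    obtain w where "w \<noteq> 0" "y = w + 1 / w" by (rule complex_add_inverse_ex)
    then show False using trace_rel_simple(1)[OF assms] y by blast
  qed
  then have "smult (lead_coeff (cmonic_poly m c)) (\<Prod>y\<in>{y. poly (cmonic_poly m c) y = 0}. [:- y, 1:]) = cmonic_poly m c"
    by (rule complex_poly_decompose_rsquarefree)
  then show e: "cmonic_poly m c = (\<Prod>y\<in>{y. poly (cmonic_poly m c) y = 0}. [:- y, 1:])"
    by (simp add: lead_coeff_monic_poly)
  have "m = degree (cmonic_poly m c)" by simp
  also have "\<dots> = degree (\<Prod>y\<in>{y. poly (cmonic_poly m c) y = 0}. [:- y, 1:])" using e by (rule arg_cong)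
  also have "\<dots> = card {y. poly (cmonic_poly m c) y = 0}"
    by (subst degree_prod_eq_sum_degree) auto
  finally show "card {y. poly (cmonic_poly m c) y = 0} = m" by simp
qed

text \<open>On the region \<open>Max\<close> returns the root v + 1/v, since all other roots are at
  most 2; the value is then v^2.\<close>

definition salem_value :: "nat \<Rightarrow> (nat \<Rightarrow> real) \<Rightarrow> real" where
  "salem_value n c = salem_of (Max {x. poly (monic_poly (Suc n) c) x = 0})"

lemma salem_region_data:
  assumes "c \<in> salem_region n X"
  obtains z v where "c = root_coeffs (Suc n) z" "\<forall>i<n. \<bar>z i\<bar> \<le> 2" "2 \<le> z n" "z n \<le> X"
    "v \<ge> 1" "z n = v + 1 / v" "salem_value n c = v\<^sup>2"
    "Max {x. poly (monic_poly (Suc n) c) x = 0} = z n"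
proof -
  obtain z where z: "c = root_coeffs (Suc n) z" "ordered_tuple n (-2) 2 z" "2 \<le> z n" "z n \<le> X"
    using assms unfolding salem_region_altdef by auto
  have zi: "\<forall>i<n. \<bar>z i\<bar> \<le> 2" using z(2) by (auto simp: ordered_tuple_def)
  have "{x. poly (monic_poly (Suc n) c) x = 0} = z ` {..n}"
    unfolding z(1) poly_root_coeffs by (auto simp: less_Suc_eq_le simp del: prod.lessThan_Suc)
  moreover have "Max (z ` {..n}) = z n"
  proof (rule Max_eqI)
    fix y assume "y \<in> z ` {..n}"
    then obtain i where i: "i \<le> n" "y = z i" by auto
    show "y \<le> z n"
    proof (cases "i = n")
      case False
      then have "\<bar>z i\<bar> \<le> 2" using zi i(1) by simp
      then show ?thesis using z(3) i(2) by linarith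
    qed (use i in simp)
  qed auto
  ultimately have M: "Max {x. poly (monic_poly (Suc n) c) x = 0} = z n" by simp
  obtain v where v: "v \<ge> 1" "z n = v + 1 / v" using add_inverse_ex[OF z(3)] by blast
  have "salem_value n c = v\<^sup>2" unfolding salem_value_def M v(2) by (rule salem_of_add_inverse[OF v(1)])
  then show ?thesis by (intro that[OF z(1) zi z(3,4) v _ M])
qed

text \<open>The root z n of F accounts for \<lambda> and its inverse. Any other root lies in
  [-2, 2], and w + 1/w in that interval forces w onto the unit circle.\<close>

lemma trace_rel_conjugates:
  fixes v :: real and \<zeta> :: complex
  assumes "trace_rel (Suc n) c p" "c = root_coeffs (Suc n) z" "\<forall>i<n. \<bar>z i\<bar> \<le> 2" "z n = v + 1 / v" "v \<ge> 1"
  shows "poly (map_poly of_int p) (v\<^sup>2) = 0" "poly (map_poly of_int p) (complex_of_real (1 / v\<^sup>2)) = 0"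
    "poly (map_poly of_int p) \<zeta> = 0 \<Longrightarrow> \<zeta> = of_real (v\<^sup>2) \<or> \<zeta> = of_real (1 / v\<^sup>2) \<or> norm \<zeta> = 1"
proof -
  have F: "poly (cmonic_poly (Suc n) c) y = (\<Prod>i<Suc n. y - of_real (z i))" for y
    unfolding assms(2) by (rule poly_cmonic_root_coeffs)
  have F0: "poly (cmonic_poly (Suc n) c) (of_real v + 1 / of_real v) = 0"
    unfolding F by (rule prod_zero) (use assms(4) in \<open>auto intro!: bexI[of _ n]\<close>)
  have v: "complex_of_real v \<noteq> 0" "complex_of_real (1 / v) \<noteq> 0" using assms(5) by auto
  have "poly (map_poly of_int p) ((complex_of_real v)\<^sup>2) = 0"
    unfolding trace_rel_root_iff[OF assms(1) v(1)] using F0 by blast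
  then have "complex_of_real (poly (map_poly of_int p) (v\<^sup>2)) = 0"
    using poly_of_int_of_real[of p "v\<^sup>2"] by simp
  then show "poly (map_poly of_int p) (v\<^sup>2) = 0" by simp
  have "poly (map_poly of_int p) ((complex_of_real (1 / v))\<^sup>2) = 0"
    unfolding trace_rel_root_iff[OF assms(1) v(2)] using F0 v(1) by (simp add: add.commute)
  then show "poly (map_poly of_int p) (complex_of_real (1 / v\<^sup>2)) = 0" by (simp add: power_divide)
  show "\<zeta> = of_real (v\<^sup>2) \<or> \<zeta> = of_real (1 / v\<^sup>2) \<or> norm \<zeta> = 1" if \<zeta>0: "poly (map_poly of_int p) \<zeta> = 0"
  proof -
    obtain w where w: "w \<noteq> 0" "\<zeta> = w\<^sup>2" "poly (cmonic_poly (Suc n) c) (w + 1 / w) = 0"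
      using trace_rel_nonzero_root[OF assms(1) \<zeta>0] by blast
    then obtain i where i: "i < Suc n" "w + 1 / w = of_real (z i)"
      unfolding F by (auto simp del: prod.lessThan_Suc)
    show ?thesis
    proof (cases "i = n")
      case True
      then have "w + 1 / w = of_real v + 1 / of_real v" using i(2) assms(4) by simp
      then have "w = of_real v \<or> w = 1 / of_real v" by (rule add_inverse_eq_imp[OF w(1) v(1)])
      then show ?thesis using w(2) by (auto simp: power_divide)
    next
      case False
      then have "\<bar>z i\<bar> \<le> 2" using i(1) assms(3) by simp
      then have "norm w = 1" using i(2) w(1) by (intro unit_circle_of_add_inverse)
      then show ?thesis using w(2) by (simp add: norm_power)
    qed
  qed
qed

lemma grid_points_coeff_class:
  assumes "c \<in> grid_points n X (root_step d)" "i < Suc n"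
  shows "c i \<in> coeff_class d (Suc i)"
proof -
  obtain k :: int where "c i = root_step d i * of_int k" using assms by (auto simp: grid_points_def less_Suc_eq_le)
  then show ?thesis by (intro coeff_classI[of _ _ _ k]) (simp add: root_step_def)
qed

text \<open>For a grid point p is monic, integral, of degree 2(n+1) and has the root \<lambda>, so
  full degree of the minimal polynomial expresses that p is irreducible.\<close>

definition good_points :: "nat \<Rightarrow> real \<Rightarrow> nat \<Rightarrow> (nat \<Rightarrow> real) set" where
  "good_points n X d = {c \<in> grid_points n X (root_step d). degree (min_poly_rat (salem_value n c)) = 2 * Suc n}"

text \<open>By Gauss's lemma p is the minimal polynomial times a monic integral cofactor, and
  comparing degrees leaves the cofactor 1.\<close>

lemma good_points_data:
  assumes "c \<in> good_points n X d"
  obtains z v p where "c = root_coeffs (Suc n) z" "\<forall>i<n. \<bar>z i\<bar> \<le> 2" "2 < z n" "z n \<le> X"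
    "v > 1" "z n = v + 1 / v" "salem_value n c = v\<^sup>2" "trace_rel (Suc n) c p"
    "min_poly_rat (v\<^sup>2) = map_poly of_int p" "irreducible (map_poly of_int p :: rat poly)" "algebraic_int (v\<^sup>2)"
proof -
  have c: "c \<in> salem_region n X" "c \<in> grid_points n X (root_step d)"
    and deg: "degree (min_poly_rat (salem_value n c)) = 2 * Suc n"
    using assms by (auto simp: good_points_def grid_points_def salem_cell_def)
  obtain z v where z: "c = root_coeffs (Suc n) z" "\<forall>i<n. \<bar>z i\<bar> \<le> 2" "2 \<le> z n" "z n \<le> X"
    "v \<ge> 1" "z n = v + 1 / v" "salem_value n c = v\<^sup>2" "Max {x. poly (monic_poly (Suc n) c) x = 0} = z n"
    by (rule salem_region_data[OF c(1)])
  obtain p where p: "trace_rel (Suc n) c p"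
    using trace_rel_ex[of "Suc n" c d] grid_points_coeff_class[OF c(2)] by blast
  have lc: "lead_coeff p = 1" "degree p = 2 * Suc n" using p by (auto simp: trace_rel_def)
  have p0: "poly (map_poly of_int p) (v\<^sup>2) = 0"
    by (rule trace_rel_conjugates(1)[OF p z(1,2,6,5)])
  obtain M \<nu> where M: "min_poly_rat (v\<^sup>2) = map_poly of_int M" "p = M * \<nu>" "lead_coeff M = 1" "lead_coeff \<nu> = 1"
    using integral_min_poly_rat[OF p0 lc(1)] by blast
  have "degree M = 2 * Suc n" using deg M(1) z(7) by simp
  moreover have "degree p = degree M + degree \<nu>"
  proof -
    have "M \<noteq> 0" "\<nu> \<noteq> 0" using M(3,4) by auto
    then show ?thesis unfolding M(2) by (rule degree_mult_eq)
  qed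
  ultimately have "degree \<nu> = 0" using lc(2) by simp
  then obtain a where "\<nu> = [:a:]" by (auto elim: degree_eq_zeroE)
  then have "p = M" using M(2,4) by simp
  have ai: "algebraic_int (v\<^sup>2)"
    using p0 lc(1) by (intro algebraic_int.intros[of "map_poly of_int p"]) (auto simp: coeff_map_poly)
  have "irreducible (map_poly of_int p :: rat poly)"
    using min_poly_rat_props(2)[OF algebraic_int_imp_algebraic[OF ai]] M(1) \<open>p = M\<close> by simp
  \<comment> \<open>For v = 1 the minimal polynomial would be linear.\<close>
  moreover have "v \<noteq> 1"
  proof
    assume "v = 1"
    have "poly (map_poly of_rat [:-1, 1:]) (1 :: real) = 0" by (simp add: map_poly_pCons)
    then have "min_poly_rat (1 :: real) dvd [:-1, 1:]"
      by (intro min_poly_rat_dvd) auto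
    then have "degree (min_poly_rat (1 :: real)) \<le> 1" using dvd_imp_degree_le[of _ "[:-1, 1 :: rat:]"] by simp
    then show False using deg z(7) \<open>v = 1\<close> by simp
  qed
  then have "v > 1" using z(5) by simp
  moreover from this have "2 < z n" using add_inverse_strict_mono[of 1 v] z(6) by simp
  moreover have "min_poly_rat (v\<^sup>2) = map_poly of_int p" using M(1) \<open>p = M\<close> by simp
  ultimately show ?thesis
    using that[OF z(1,2) _ z(4) _ z(6,7) p _ _ ai] by blast
qed

lemma good_point_Sal_sq:
  assumes c: "c \<in> good_points n (sqrt Q + 1 / sqrt Q) d" and Q: "Q > 1" and d: "d \<ge> 1"
  shows "salem_value n c \<in> Sal_sq (Suc n) Q"
proof -
  let ?X = "sqrt Q + 1 / sqrt Q"
  obtain z v p where z: "c = root_coeffs (Suc n) z" "\<forall>i<n. \<bar>z i\<bar> \<le> 2" "2 < z n" "z n \<le> ?X"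
    "v > 1" "z n = v + 1 / v" "salem_value n c = v\<^sup>2" and p: "trace_rel (Suc n) c p"
    "min_poly_rat (v\<^sup>2) = map_poly of_int p" and "irreducible (map_poly of_int p :: rat poly)" and ai: "algebraic_int (v\<^sup>2)"
    by (rule good_points_data[OF c])
  have v1: "v \<ge> 1" using z(5) by simp
  note conj = trace_rel_conjugates[OF p(1) z(1,2,6) v1]
  have cj: "conjugates (v\<^sup>2) = {\<zeta>. poly (map_poly of_int p) \<zeta> = 0}"
    unfolding conjugates_def p(2) map_poly_of_rat_of_int ..
  have v2: "v\<^sup>2 > 1" using z(5) by simp
  have "salem_number (v\<^sup>2)"
    unfolding salem_number_def cj
  proof (intro conjI ballI)
    show "algebraic_int (v\<^sup>2)" "v\<^sup>2 > 1" by (fact ai, fact v2)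
    show "complex_of_real (inverse (v\<^sup>2)) \<in> {\<zeta>. poly (map_poly of_int p) \<zeta> = 0}"
      using conj(2) by (simp only: inverse_eq_divide mem_Collect_eq)
    fix \<zeta> assume "\<zeta> \<in> {\<zeta>. poly (map_poly of_int p) \<zeta> = 0} - {complex_of_real (v\<^sup>2), complex_of_real (inverse (v\<^sup>2))}"
    then show "norm \<zeta> = 1" using conj(3)[of \<zeta>] by (simp only: inverse_eq_divide Diff_iff mem_Collect_eq insert_iff) blast
  qed
  moreover have "degree (min_poly_rat (v\<^sup>2)) = 2 * Suc n" using p by (simp add: trace_rel_def)
  moreover have "square_rootable (v\<^sup>2)"
    unfolding square_rootable_def
  proof (intro exI[of _ "of_nat d :: rat"] exI[of _ "recip_poly (Suc n) c"] conjI allI impI)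
    let ?q = "recip_poly (Suc n) c"
    show "(0 :: rat) < of_nat d" using d by simp
    have "degree ?q = 2 * Suc n" by (rule recip_poly_degree)
    then show "lead_coeff ?q = 1" using lead_coeff_recip_poly[of "Suc n" c] by simp
    show "palindromic ?q" by (rule palindromic_recip_poly)
    have cl: "coeff ?q i \<in> coeff_class d i" for i
      using c by (intro coeff_class_recip_poly grid_points_coeff_class) (auto simp: good_points_def)
    show "coeff ?q i \<in> \<rat>" if "even i" for i
      using cl[of i] that Ints_subset_Rats by (auto simp: coeff_class_even)
    show "\<exists>r\<in>\<rat>. coeff ?q i = sqrt (of_rat (of_nat d)) * r" if "odd i" for i
    proof -
      obtain k :: int where k: "coeff ?q i = (if even i then 1 else sqrt (real d)) * of_int k"
        by (rule coeff_classE[OF cl])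
      have s: "sqrt (of_rat (of_nat d)) = sqrt (real d)" by simp
      show ?thesis unfolding k s using that by (intro bexI[of _ "of_int k"]) auto
    qed
    have "map_poly of_rat (min_poly_rat (v\<^sup>2)) = (map_poly of_int p :: real poly)"
      unfolding p(2) by (rule map_poly_of_rat_of_int)
    then show "?q * pcompose ?q [:0, -1:] = pcompose (map_poly of_rat (min_poly_rat (v\<^sup>2))) [:0, 0, 1:]"
      using p(1) by (simp only: trace_rel_def)
  qed
  moreover have "v\<^sup>2 \<le> Q"
  proof -
    have "v \<le> sqrt Q" using add_inverse_le_iff[OF v1, of "sqrt Q"] z(4,6) Q by simp
    then have "v\<^sup>2 \<le> (sqrt Q)\<^sup>2" using v1 by (intro power_mono) auto
    then show ?thesis using Q by simp
  qed
  ultimately show ?thesis using v2 unfolding z(7) Sal_sq_def by simp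
qed

section \<open>Factors with all roots on the unit circle\<close>

lemma norm_coeff_prod_linear_le:
  fixes z :: "nat \<Rightarrow> complex"
  assumes "\<And>i. i < N \<Longrightarrow> norm (z i) \<le> 1"
  shows "norm (coeff (\<Prod>i<N. [:- z i, 1:]) k) \<le> 2 ^ N"
  using assms
proof (induction N arbitrary: k)
  case 0
  then show ?case by (cases k) auto
next
  case (Suc N)
  define P where "P = (\<Prod>i<N. [:- z i, 1:])"
  have IH: "norm (coeff P j) \<le> 2 ^ N" for j using Suc unfolding P_def by simp
  have eq: "(\<Prod>i<Suc N. [:- z i, 1:]) = smult (- z N) P + pCons 0 P"
    unfolding P_def by simp
  have "norm (coeff (pCons 0 P) k) \<le> 2 ^ N" using IH by (cases k) auto
  moreover have "norm (coeff (smult (- z N) P) k) \<le> 2 ^ N"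
  proof -
    have "norm (z N) * norm (coeff P k) \<le> 1 * 2 ^ N" using Suc.prems IH by (intro mult_mono) auto
    then show ?thesis by (simp add: norm_mult)
  qed
  ultimately show ?case unfolding eq coeff_add using norm_triangle_ineq[of "coeff (smult (- z N) P) k" "coeff (pCons 0 P) k"]
    unfolding power_Suc by linarith
qed

lemma finite_bounded_int_polys: "finite {p :: int poly. degree p \<le> N \<and> (\<forall>i. \<bar>coeff p i\<bar> \<le> B)}"
proof (rule finite_subset)
  show "finite (Poly ` {xs. set xs \<subseteq> {-B..B} \<and> length xs \<le> Suc N})"
    by (intro finite_imageI finite_lists_length_le) auto
  show "{p. degree p \<le> N \<and> (\<forall>i. \<bar>coeff p i\<bar> \<le> B)} \<subseteq> Poly ` {xs. set xs \<subseteq> {-B..B} \<and> length xs \<le> Suc N}"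
  proof
    fix p assume "p \<in> {p. degree p \<le> N \<and> (\<forall>i. \<bar>coeff p i\<bar> \<le> B)}"
    then have p: "degree p \<le> N" "\<And>i. \<bar>coeff p i\<bar> \<le> B" by auto
    have "length (coeffs p) \<le> Suc N" using p(1) by (cases "p = 0") (auto simp: length_coeffs)
    moreover have "set (coeffs p) \<subseteq> {-B..B}"
    proof
      fix a assume "a \<in> set (coeffs p)"
      then have "a \<in> range (coeff p)" using range_coeff[of p] by blast
      then obtain i where "a = coeff p i" by blast
      then show "a \<in> {-B..B}" using p(2)[of i] by auto
    qed
    moreover have "p = Poly (coeffs p)" by simp
    ultimately show "p \<in> Poly ` {xs. set xs \<subseteq> {-B..B} \<and> length xs \<le> Suc N}" by blast
  qed
qed

lemma monic_complex_factors:
  fixes p :: "int poly"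
  assumes "lead_coeff p = 1"
  obtains r where "map_poly complex_of_int p = (\<Prod>i<degree p. [:- r i, 1:])"
    "\<And>i. i < degree p \<Longrightarrow> poly (map_poly of_int p) (r i) = 0"
proof -
  have lc: "lead_coeff (map_poly complex_of_int p) = 1" using assms by (simp add: coeff_map_poly)
  have deg: "degree (map_poly complex_of_int p) = degree p" by (intro degree_map_poly) auto
  obtain r where "smult (lead_coeff (map_poly complex_of_int p)) (\<Prod>i<degree (map_poly complex_of_int p). [:- r i, 1:]) = map_poly complex_of_int p"
    by (rule complex_poly_decompose')
  then have r: "map_poly complex_of_int p = (\<Prod>i<degree p. [:- r i, 1:])" unfolding lc unfolding deg by simp
  show ?thesis
  proof (rule that[OF r])
    fix i assume "i < degree p"
    then show "poly (map_poly of_int p) (r i) = 0" unfolding r poly_prod by (intro prod_zero) (auto intro!: bexI[of _ i])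
  qed
qed

text \<open>The product of the absolute values of the roots is |p(0)|, a positive integer. As no
  factor exceeds 1, none can be smaller.\<close>

lemma norm_root_eq_1:
  fixes p :: "int poly"
  assumes "lead_coeff p = 1" "coeff p 0 \<noteq> 0"
    and le: "\<And>z::complex. poly (map_poly of_int p) z = 0 \<Longrightarrow> norm z \<le> 1"
    and z: "poly (map_poly of_int p) (z::complex) = 0"
  shows "norm z = 1"
proof (rule ccontr)
  assume "norm z \<noteq> 1"
  then have lt: "norm z < 1" using le[OF z] by simp
  obtain r where r: "map_poly complex_of_int p = (\<Prod>i<degree p. [:- r i, 1:])"
    "\<And>i. i < degree p \<Longrightarrow> poly (map_poly of_int p) (r i) = 0"
    using monic_complex_factors[OF assms(1)] by blast
  obtain j where j: "j < degree p" "z = r j" using z unfolding r(1) poly_prod by auto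
  have "poly (map_poly complex_of_int p) 0 = of_int (coeff p 0)" by (simp add: poly_0_coeff_0 coeff_map_poly)
  then have "real_of_int \<bar>coeff p 0\<bar> = norm (poly (map_poly complex_of_int p) 0)" by simp
  also have "\<dots> = (\<Prod>i<degree p. norm (r i))" unfolding r(1) poly_prod prod_norm[symmetric] by simp
  also have "\<dots> = norm (r j) * (\<Prod>i\<in>{..<degree p} - {j}. norm (r i))" using j(1) by (intro prod.remove) auto
  also have "\<dots> \<le> norm (r j) * 1" using le r(2) by (intro mult_left_mono prod_le_1) auto
  also have "\<dots> < 1" using lt j(2) by simp
  finally show False using assms(2) by simp
qed

text \<open>The roots bound every coefficient by 2^N, which leaves finitely many integral
  polynomials.\<close>

lemma finite_unit_circle_int_polys:
  "finite {p :: int poly. lead_coeff p = 1 \<and> degree p \<le> N \<and> (\<forall>z::complex. poly (map_poly of_int p) z = 0 \<longrightarrow> norm z = 1)}"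
proof (rule finite_subset[OF _ finite_bounded_int_polys[of N "2 ^ N"]], intro subsetI CollectI conjI allI)
  fix p :: "int poly" and i
  assume "p \<in> {p. lead_coeff p = 1 \<and> degree p \<le> N \<and> (\<forall>z::complex. poly (map_poly of_int p) z = 0 \<longrightarrow> norm z = 1)}"
  then have p: "lead_coeff p = 1" "degree p \<le> N" "\<And>z::complex. poly (map_poly of_int p) z = 0 \<Longrightarrow> norm z = 1" by auto
  show "degree p \<le> N" by (rule p(2))
  obtain r where r: "map_poly complex_of_int p = (\<Prod>i<degree p. [:- r i, 1:])"
    "\<And>i. i < degree p \<Longrightarrow> poly (map_poly of_int p) (r i) = 0"
    using monic_complex_factors[OF p(1)] by blast
  have "norm (coeff (map_poly complex_of_int p) i) \<le> 2 ^ degree p"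
    unfolding r(1) using p(3)[OF r(2)] by (intro norm_coeff_prod_linear_le) simp
  also have "\<dots> \<le> 2 ^ N" using p(2) by (intro power_increasing) auto
  finally have "real_of_int \<bar>coeff p i\<bar> \<le> real_of_int (2 ^ N)" by (simp add: coeff_map_poly)
  then show "\<bar>coeff p i\<bar> \<le> 2 ^ N" by (simp only: of_int_le_iff)
qed

lemma poly_eqI_nonzero:
  fixes a b :: "complex poly"
  assumes "\<And>t. t \<noteq> 0 \<Longrightarrow> poly a t = poly b t"
  shows "a = b"
proof -
  have "poly (pCons 0 a) t = poly (pCons 0 b) t" for t using assms[of t] by (cases "t = 0") auto
  then have "pCons 0 a = pCons 0 b" by (intro poly_eq_poly_eq_iff[THEN iffD1] ext)
  then show ?thesis by simp
qed

text \<open>With y = w + 1/w and t = w^2, the factors of F at y and - y combine to w^2 (y^2 - (z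
  i)^2) = (t + 1)^2 - (z i)^2 t. In contrast to \<open>trace_rel_root_iff\<close> this keeps track
  of multiplicities.\<close>

lemma trace_rel_prod:
  assumes "trace_rel m c p" "c = root_coeffs m z"
  shows "map_poly complex_of_int p = (\<Prod>i<m. [:1, 2 - of_real (z i) ^ 2, 1:])"
proof (rule poly_eqI_nonzero)
  fix t :: complex assume "t \<noteq> 0"
  define w where "w = csqrt t"
  have w: "w \<noteq> 0" "t = w\<^sup>2" using \<open>t \<noteq> 0\<close> by (simp_all add: w_def)
  define y where "y = w + 1 / w"
  have wy: "w * y = w * w + 1" using w(1) by (simp add: y_def distrib_left)
  have "poly (map_poly of_int p) t = (-1) ^ m * (w ^ 2) ^ m * ((\<Prod>i<m. y - of_real (z i)) * (\<Prod>i<m. - y - of_real (z i)))"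
    unfolding w(2) trace_rel_poly[OF assms(1) w(1)] assms(2) poly_cmonic_root_coeffs y_def power_mult ..
  also have "\<dots> = (\<Prod>i<m. (-1) * w ^ 2 * ((y - of_real (z i)) * (- y - of_real (z i))))"
    by (simp only: prod.distrib prod_constant card_lessThan)
  also have "\<dots> = (\<Prod>i<m. poly [:1, 2 - of_real (z i) ^ 2, 1:] t)"
  proof (rule prod.cong[OF refl])
    fix i
    have "(-1) * w ^ 2 * ((y - of_real (z i)) * (- y - of_real (z i))) = (w * y) * (w * y) - of_real (z i) ^ 2 * (w * w)"
      by (simp add: power2_eq_square algebra_simps)
    also have "\<dots> = poly [:1, 2 - of_real (z i) ^ 2, 1:] t"
      unfolding wy w(2) by (simp add: power2_eq_square algebra_simps)
    finally show "(-1) * w ^ 2 * ((y - of_real (z i)) * (- y - of_real (z i))) = poly [:1, 2 - of_real (z i) ^ 2, 1:] t" .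
  qed
  finally show "poly (map_poly of_int p) t = poly (\<Prod>i<m. [:1, 2 - of_real (z i) ^ 2, 1:]) t"
    by (simp only: poly_prod)
qed

text \<open>\<lambda> is a simple root of p even when p is reducible, so the cofactor of its minimal
  polynomial does not vanish there. A double root would have to be a root of a quadratic factor that
  belongs to some z i in [-2, 2], and these are positive at \<lambda>.\<close>

lemma trace_rel_salem_root_simple:
  fixes v :: real
  assumes tr: "trace_rel (Suc n) c p" and c: "c = root_coeffs (Suc n) z" and z: "\<forall>i<n. \<bar>z i\<bar> \<le> 2"
    and v: "z n = v + 1 / v" "v > 1" and p: "p = M * \<nu>" and M: "poly (map_poly of_int M) (v\<^sup>2) = 0"
  shows "poly (map_poly of_int \<nu>) (complex_of_real (v\<^sup>2)) \<noteq> 0"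
proof
  define l where "l = complex_of_real (v\<^sup>2)"
  define l' where "l' = complex_of_real (1 / v\<^sup>2)"
  define R where "R = (\<Prod>i<n. [:1, 2 - complex_of_real (z i) ^ 2, 1:])"
  assume \<nu>: "poly (map_poly of_int \<nu>) (complex_of_real (v\<^sup>2)) = 0"
  have "poly (map_poly of_int M) l = 0" using M poly_of_int_of_real[of M "v\<^sup>2"] unfolding l_def by simp
  then have "[:- l, 1:] * [:- l, 1:] dvd map_poly of_int M * map_poly of_int \<nu>"
    using \<nu> unfolding l_def poly_eq_0_iff_dvd by (rule mult_dvd_mono)
  also have "map_poly of_int M * map_poly of_int \<nu> = map_poly complex_of_int p"
    unfolding p map_poly_of_int_mult ..
  also have "\<dots> = R * [:1, 2 - complex_of_real (z n) ^ 2, 1:]"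
    unfolding trace_rel_prod[OF tr c] R_def by (rule prod.lessThan_Suc)
  also have "[:1, 2 - complex_of_real (z n) ^ 2, 1:] = [:- l, 1:] * [:- l', 1:]"
  proof -
    have "l * l' = 1" using v(2) unfolding l_def l'_def of_real_mult[symmetric] by simp
    moreover have "2 - complex_of_real (z n) ^ 2 = - l - l'"
    proof -
      have "2 - (z n)\<^sup>2 = - (v\<^sup>2) - 1 / v\<^sup>2" using v by (simp add: power2_sum power_divide)
      then have "complex_of_real (2 - (z n)\<^sup>2) = complex_of_real (- (v\<^sup>2) - 1 / v\<^sup>2)" by (rule arg_cong)
      then show ?thesis by (simp add: l_def l'_def)
    qed
    ultimately show ?thesis by (simp add: algebra_simps)
  qed
  also have "R * ([:- l, 1:] * [:- l', 1:]) = [:- l, 1:] * (R * [:- l', 1:])" by (simp only: mult_ac)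
  finally have "[:- l, 1:] dvd R * [:- l', 1:]"
    unfolding dvd_mult_cancel_left by (metis one_neq_zero pCons_eq_0_iff)
  then have "poly R l * (l - l') = 0" unfolding poly_eq_0_iff_dvd[symmetric] by simp
  moreover have "l \<noteq> l'"
  proof -
    have "1 / v\<^sup>2 < 1" "1 < v\<^sup>2" using v(2) by simp_all
    then have "v\<^sup>2 \<noteq> 1 / v\<^sup>2" by linarith
    then show ?thesis unfolding l_def l'_def of_real_eq_iff .
  qed
  ultimately have "poly R l = 0" by simp
  then obtain i where i: "i < n" "poly [:1, 2 - complex_of_real (z i) ^ 2, 1:] l = 0" unfolding R_def poly_prod by auto
  have eq: "poly [:1, 2 - complex_of_real (z i) ^ 2, 1:] l = complex_of_real (1 + v\<^sup>2 * (2 - (z i)\<^sup>2 + v\<^sup>2))"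
    by (simp add: l_def)
  have e: "1 + v\<^sup>2 * (2 - (z i)\<^sup>2 + v\<^sup>2) = 0" using i(2) unfolding eq of_real_eq_0_iff .
  have "\<bar>z i\<bar> \<le> \<bar>2\<bar>" using z i(1) by simp
  then have "(z i)\<^sup>2 \<le> 2\<^sup>2" unfolding abs_le_square_iff .
  \<comment> \<open>Since (z i)^2 \<le> 4, the quadratic at \<lambda> = v^2 is at least (\<lambda> -
    1)^2 > 0.\<close>
  then have "v\<^sup>2 * (v\<^sup>2 - 2) \<le> v\<^sup>2 * (2 - (z i)\<^sup>2 + v\<^sup>2)" by (intro mult_left_mono) auto
  then have "(v\<^sup>2 - 1) * (v\<^sup>2 - 1) \<le> 0" using e by (simp add: algebra_simps)
  moreover have "(v\<^sup>2 - 1) * (v\<^sup>2 - 1) > 0" using v(2) by (intro mult_pos_pos) auto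
  ultimately show False by simp
qed

text \<open>
  A grid point that is not good gives a factor of \<open>p\<close> without the root \<open>\<lambda>\<close>. All roots of
  that factor lie on the unit circle, so it is one of finitely many polynomials.
\<close>

lemma bad_points_cover:
  obtains Z :: "real set" where "finite Z"
    "\<And>X d c. c \<in> grid_points n X (root_step d) - good_points n X d \<Longrightarrow> \<exists>\<beta>\<in>Z. poly (monic_poly (Suc n) c) \<beta> = 0"
proof -
  define S where "S = {p :: int poly. lead_coeff p = 1 \<and> degree p \<le> 2 * Suc n \<and> (\<forall>z::complex. poly (map_poly of_int p) z = 0 \<longrightarrow> norm z = 1)}"
  define Zc where "Zc = (\<Union>\<nu>\<in>S. {z. poly (map_poly complex_of_int \<nu>) z = 0})"
  \<comment> \<open>Up to sign, g gives the root of F from which a root \<zeta> of p on the unit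
    circle arises. The sign depends on the choice of the square root of \<zeta>, so Z contains both;
    the additional element 2 covers the case v = 1.\<close>
  define g where "g = (\<lambda>\<zeta>. Re (csqrt \<zeta> + 1 / csqrt \<zeta>))"
  define Z where "Z = insert 2 (g ` Zc \<union> (\<lambda>\<zeta>. - g \<zeta>) ` Zc)"
  have "finite {z. poly (map_poly complex_of_int \<nu>) z = 0}" if "\<nu> \<in> S" for \<nu>
  proof (rule poly_roots_finite)
    have "coeff (map_poly complex_of_int \<nu>) (degree \<nu>) = 1" using that by (simp add: S_def coeff_map_poly)
    then show "map_poly complex_of_int \<nu> \<noteq> 0" by auto
  qed
  moreover have "finite S" unfolding S_def by (rule finite_unit_circle_int_polys)
  ultimately have "finite Zc" unfolding Zc_def by blast
  then have "finite Z" unfolding Z_def by simp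
  moreover have "\<exists>\<beta>\<in>Z. poly (monic_poly (Suc n) c) \<beta> = 0"
    if bad: "c \<in> grid_points n X (root_step d) - good_points n X d" for X d c
  proof -
    have c: "c \<in> salem_region n X" "c \<in> grid_points n X (root_step d)"
      and deg: "degree (min_poly_rat (salem_value n c)) \<noteq> 2 * Suc n"
      using bad by (auto simp: good_points_def grid_points_def salem_cell_def)
    obtain z v where z: "c = root_coeffs (Suc n) z" "\<forall>i<n. \<bar>z i\<bar> \<le> 2" "2 \<le> z n" "z n \<le> X"
      "v \<ge> 1" "z n = v + 1 / v" "salem_value n c = v\<^sup>2" "Max {x. poly (monic_poly (Suc n) c) x = 0} = z n"
      by (rule salem_region_data[OF c(1)])
    obtain p where p: "trace_rel (Suc n) c p"
      using trace_rel_ex[of "Suc n" c d] grid_points_coeff_class[OF c(2)] by blast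
    have lc: "lead_coeff p = 1" "degree p = 2 * Suc n" using p by (auto simp: trace_rel_def)
    have zroot: "poly (monic_poly (Suc n) c) (z i) = 0" if "i < Suc n" for i
      unfolding z(1) poly_root_coeffs using that by (intro prod_zero) (auto intro!: bexI[of _ i])
    show ?thesis
    proof (cases "v = 1")
      case True
      then have "z n = 2" using z(6) by simp
      then show ?thesis using zroot[of n] by (intro bexI[of _ 2]) (simp_all add: Z_def)
    next
      case False
      then have v: "v > 1" using z(5) by simp
      note conj = trace_rel_conjugates[OF p z(1,2,6,5)]
      obtain M \<nu> where M: "min_poly_rat (v\<^sup>2) = map_poly of_int M" "p = M * \<nu>" "lead_coeff M = 1" "lead_coeff \<nu> = 1"
        using integral_min_poly_rat[OF conj(1) lc(1)] by blast
      have ai: "algebraic_int (v\<^sup>2)" unfolding algebraic_int_altdef_ipoly using conj(1) lc(1) by blast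
      have "poly (map_poly of_rat (min_poly_rat (v\<^sup>2))) (v\<^sup>2) = 0"
        by (rule min_poly_rat_props(3)[OF algebraic_int_imp_algebraic[OF ai]])
      then have M0: "poly (map_poly of_int M) (v\<^sup>2) = 0" unfolding M(1) map_poly_of_rat_of_int .
      have nz: "M \<noteq> 0" "\<nu> \<noteq> 0" using M(3,4) by auto
      have degs: "degree p = degree M + degree \<nu>" unfolding M(2) using nz by (rule degree_mult_eq)
      have "degree M = degree (min_poly_rat (v\<^sup>2))" unfolding M(1) by (simp add: degree_map_poly)
      then have d\<nu>: "degree \<nu> \<noteq> 0" using deg degs lc(2) unfolding z(7) by linarith
      have root_p: "poly (map_poly of_int p) \<zeta> = 0" if "poly (map_poly of_int \<nu>) \<zeta> = 0" for \<zeta> :: complex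
        unfolding M(2) map_poly_of_int_mult using that by simp
      have no: "poly (map_poly of_int \<nu>) (complex_of_real (v\<^sup>2)) \<noteq> 0"
        by (rule trace_rel_salem_root_simple[OF p z(1,2,6) v M(2) M0])
      \<comment> \<open>At this stage the inverse of \<lambda> is still a possible root of \<nu>. It
        is ruled out by \<open>norm_root_eq_1\<close>, because the constant coefficient is
        nonzero.\<close>
      have le: "norm \<zeta> \<le> 1" if \<zeta>: "poly (map_poly of_int \<nu>) \<zeta> = 0" for \<zeta> :: complex
      proof -
        have "\<zeta> \<noteq> of_real (v\<^sup>2)" using no \<zeta> by blast
        then have "\<zeta> = of_real (1 / v\<^sup>2) \<or> norm \<zeta> = 1" using conj(3)[OF root_p[OF \<zeta>]] by blast
        moreover have "norm (complex_of_real (1 / v\<^sup>2)) \<le> 1" using v unfolding norm_of_real by simp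
        ultimately show ?thesis by auto
      qed
      have "coeff M 0 * coeff \<nu> 0 = 1" using trace_rel_coeff_0[OF p] unfolding M(2) coeff_mult_0 .
      then have c0: "coeff \<nu> 0 \<noteq> 0" by auto
      have one: "norm \<zeta> = 1" if "poly (map_poly of_int \<nu>) \<zeta> = 0" for \<zeta> :: complex
        using M(4) c0 le that by (rule norm_root_eq_1)
      then have S: "\<nu> \<in> S" using M(4) degs lc(2) by (simp add: S_def)
      have "degree (map_poly complex_of_int \<nu>) = degree \<nu>" by (intro degree_map_poly) auto
      then have "\<not> constant (poly (map_poly complex_of_int \<nu>))" using d\<nu> by (simp add: constant_degree)
      then obtain \<zeta> where \<zeta>: "poly (map_poly complex_of_int \<nu>) \<zeta> = 0" using fundamental_theorem_of_algebra by blast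
      then have Zc: "\<zeta> \<in> Zc" using S unfolding Zc_def by blast
      define w where "w = csqrt \<zeta>"
      have w: "w \<noteq> 0" "\<zeta> = w\<^sup>2" using one[OF \<zeta>] by (auto simp: w_def)
      have "poly (cmonic_poly (Suc n) c) (w + 1 / w) = 0 \<or> poly (cmonic_poly (Suc n) c) (- (w + 1 / w)) = 0"
        using root_p[OF \<zeta>] unfolding w(2) trace_rel_root_iff[OF p w(1)] .
      then obtain i where i: "i < Suc n" "w + 1 / w = of_real (z i) \<or> - (w + 1 / w) = of_real (z i)"
        unfolding z(1) poly_cmonic_root_coeffs prod_zero_iff[OF finite_lessThan] right_minus_eq lessThan_iff Bex_def by blast
      have gw: "g \<zeta> = Re (w + 1 / w)" by (simp only: g_def w_def)
      have "z i = g \<zeta> \<or> z i = - g \<zeta>"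
      proof (rule disjE[OF i(2)])
        assume "w + 1 / w = of_real (z i)"
        then show ?thesis unfolding gw by simp
      next
        assume "- (w + 1 / w) = of_real (z i)"
        then have "w + 1 / w = - of_real (z i)" by (metis minus_minus)
        then show ?thesis unfolding gw by simp
      qed
      then have "z i \<in> Z" using Zc unfolding Z_def by blast
      then show ?thesis using zroot[OF i(1)] by blast
    qed
  qed
  ultimately show ?thesis by (rule that)
qed

section \<open>How far a Salem number determines d and q\<close>

lemma sqrt_mult_int_unique:
  assumes "squarefree d" "squarefree e" "real d * (of_int k)\<^sup>2 = real e * (of_int l)\<^sup>2" "k \<noteq> 0"
  shows "d = e"
proof -
  have "real (d * (nat \<bar>k\<bar>)\<^sup>2) = real (e * (nat \<bar>l\<bar>)\<^sup>2)" using assms(3) by simp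
  then have "d * (nat \<bar>k\<bar>)\<^sup>2 = e * (nat \<bar>l\<bar>)\<^sup>2" by (simp only: of_nat_eq_iff)
  then show ?thesis using squarefree_mult_square_unique[OF assms(1,2), of "nat \<bar>k\<bar>" "nat \<bar>l\<bar>"] assms(4) by simp
qed

lemma root_step_square: "even i \<Longrightarrow> (root_step d i * x)\<^sup>2 = real d * x\<^sup>2"
  by (simp add: root_step_def power_mult_distrib)

text \<open>For a nonzero entry with even index i the square of \<open>c i\<close> is d times an
  integer square, so d is its squarefree part.\<close>

lemma good_points_disjoint:
  assumes "squarefree d" "squarefree e" "c \<in> good_points n X d" "c \<in> good_points n X e"
  shows "d = e"
proof -
  obtain z v p where z: "c = root_coeffs (Suc n) z" "\<forall>i<n. \<bar>z i\<bar> \<le> 2" "2 < z n" "z n \<le> X"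
    "v > 1" "z n = v + 1 / v" "salem_value n c = v\<^sup>2" and "trace_rel (Suc n) c p"
    "min_poly_rat (v\<^sup>2) = map_poly of_int p" and "irreducible (map_poly of_int p :: rat poly)" and "algebraic_int (v\<^sup>2)"
    by (rule good_points_data[OF assms(3)])
  have "poly (monic_poly (Suc n) c) (z n) = 0" unfolding z(1) poly_root_coeffs by simp
  moreover have g: "c \<in> grid_points n X (root_step d)" "c \<in> grid_points n X (root_step e)"
    using assms(3,4) by (simp_all add: good_points_def)
  then have "c \<in> salem_region n X" by (simp add: grid_points_def salem_cell_def)
  ultimately obtain i where i: "i \<le> n" "even i" "c i \<noteq> 0" using salem_region_even_coeff z(3) by blast
  obtain k :: int where k: "c i = root_step d i * of_int k" using g(1) i(1) unfolding grid_points_def by blast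
  obtain l :: int where l: "c i = root_step e i * of_int l" using g(2) i(1) unfolding grid_points_def by blast
  have "real d * (of_int k)\<^sup>2 = (c i)\<^sup>2" unfolding k by (rule root_step_square[OF i(2), symmetric])
  also have "\<dots> = real e * (of_int l)\<^sup>2" unfolding l by (rule root_step_square[OF i(2)])
  finally show ?thesis using sqrt_mult_int_unique[OF assms(1,2)] i(3) k by auto
qed

text \<open>For w the imaginary unit w + 1/w is 0, and F(0) is the last entry of c.\<close>

lemma trace_rel_minus_one:
  assumes "trace_rel (Suc n) c p"
  shows "poly (map_poly of_int p) (-1) = (complex_of_real (c n))\<^sup>2"
proof -
  have "poly (cmonic_poly (Suc n) c) 0 = complex_of_real (c n)" by (simp add: poly_0_coeff_0 coeff_monic_poly)
  moreover have "\<i> + 1 / \<i> = 0" by simp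
  moreover have "(-1 :: complex) ^ Suc n * \<i> ^ (2 * Suc n) = 1"
    unfolding power_mult i_squared by (simp flip: power_mult_distrib)
  ultimately show ?thesis using trace_rel_poly[OF assms, of \<i>] by (simp add: power2_eq_square)
qed

text \<open>For even n the constant coefficient of F is one of those carrying sqrt d, so p(-1)
  yields the same d for both vectors. It remains to see that q is determined by d and \<lambda>,
  which follows from a degree comparison for the difference of two candidates.\<close>

lemma good_points_even_inject:
  assumes "even n" "squarefree d" "squarefree e" "c \<in> good_points n X d" "c' \<in> good_points n X e"
    and eq: "salem_value n c = salem_value n c'"
  shows "c = c'"
proof -
  obtain z v p where z: "c = root_coeffs (Suc n) z" "\<forall>i<n. \<bar>z i\<bar> \<le> 2" "2 < z n" "z n \<le> X"
    "v > 1" "z n = v + 1 / v" "salem_value n c = v\<^sup>2" and p: "trace_rel (Suc n) c p"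
    "min_poly_rat (v\<^sup>2) = map_poly of_int p" and "irreducible (map_poly of_int p :: rat poly)" and ai: "algebraic_int (v\<^sup>2)"
    by (rule good_points_data[OF assms(4)])
  obtain z' v' p' where z': "c' = root_coeffs (Suc n) z'" "\<forall>i<n. \<bar>z' i\<bar> \<le> 2" "2 < z' n" "z' n \<le> X"
    "v' > 1" "z' n = v' + 1 / v'" "salem_value n c' = v'\<^sup>2" and p': "trace_rel (Suc n) c' p'"
    "min_poly_rat (v'\<^sup>2) = map_poly of_int p'" and "irreducible (map_poly of_int p' :: rat poly)" and "algebraic_int (v'\<^sup>2)"
    by (rule good_points_data[OF assms(5)])
  have "v\<^sup>2 = v'\<^sup>2" using eq z(7) z'(7) by simp
  then have vv: "v' = v" using z(5) z'(5) by (simp add: power2_eq_iff_nonneg)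
  have pp: "p' = p" using p(2) p'(2) unfolding vv by (simp add: map_poly_of_int_inject)
  have g: "c \<in> grid_points n X (root_step d)" "c' \<in> grid_points n X (root_step e)"
    using assms(4,5) by (simp_all add: good_points_def)
  obtain k :: int where k: "c n = root_step d n * of_int k" using g(1) unfolding grid_points_def by blast
  obtain l :: int where l: "c' n = root_step e n * of_int l" using g(2) unfolding grid_points_def by blast
  have cn: "c n \<noteq> 0" using g(1) unfolding grid_points_def salem_cell_def by blast
  have "complex_of_real ((c n)\<^sup>2) = complex_of_real ((c' n)\<^sup>2)"
    using trace_rel_minus_one[OF p(1)] trace_rel_minus_one[OF p'(1)] unfolding pp by simp
  then have "(c n)\<^sup>2 = (c' n)\<^sup>2" unfolding of_real_eq_iff .
  then have "real d * (of_int k)\<^sup>2 = real e * (of_int l)\<^sup>2"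
    unfolding k l root_step_square[OF assms(1)] .
  then have de: "d = e" using sqrt_mult_int_unique[OF assms(2,3)] cn k by auto
  define q where "q = recip_poly (Suc n) c"
  define q' where "q' = recip_poly (Suc n) c'"
  \<comment> \<open>E vanishes at sqrt \<lambda> and is again graded by parity, so E(x) E(-x) =
    r(x^2) with integral r and r(\<lambda>) = 0. The leading terms cancel, so r has smaller degree
    than p and must vanish.\<close>
  define E where "E = q + smult (-1) q'"
  have cl: "coeff E j \<in> coeff_class d j" for j
  proof -
    have "coeff q j \<in> coeff_class d j" unfolding q_def
      by (intro coeff_class_recip_poly grid_points_coeff_class[OF g(1)])
    moreover have "coeff q' j \<in> coeff_class d j" unfolding q'_def de
      by (intro coeff_class_recip_poly grid_points_coeff_class[OF g(2)])
    ultimately show ?thesis using coeff_class_add[OF _ coeff_class_uminus] by (simp add: E_def)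
  qed
  have v0: "v \<noteq> 0" using z(5) by simp
  have "poly (monic_poly (Suc n) c) (v + 1 / v) = 0" unfolding z(6)[symmetric] z(1) poly_root_coeffs by simp
  then have "poly q v = 0" unfolding q_def poly_recip_poly[OF v0] by simp
  moreover have "poly (monic_poly (Suc n) c') (v + 1 / v) = 0"
    unfolding vv[symmetric] z'(6)[symmetric] z'(1) poly_root_coeffs by simp
  then have "poly q' v = 0" unfolding q'_def poly_recip_poly[OF v0] by simp
  ultimately have Ev: "poly E v = 0" by (simp add: E_def)
  obtain r where r: "E * pcompose E [:0, -1:] = pcompose (map_poly of_int r) [:0, 0, 1:]" "degree r = degree E"
    using square_poly_ex[OF cl] by blast
  have "E = 0"
  proof (rule ccontr)
    assume "E \<noteq> 0"
    have "degree E \<noteq> 2 * Suc n"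
    proof
      assume a: "degree E = 2 * Suc n"
      have "coeff q (2 * Suc n) = 1" "coeff q' (2 * Suc n) = 1" unfolding q_def q'_def by (rule lead_coeff_recip_poly)+
      then have "coeff E (2 * Suc n) = 0" unfolding E_def by simp
      then have "lead_coeff E = 0" unfolding a .
      then show False using \<open>E \<noteq> 0\<close> by simp
    qed
    moreover have "degree E \<le> 2 * Suc n" unfolding E_def
      by (intro degree_add_le order_trans[OF degree_smult_le]) (simp_all only: q_def q'_def recip_poly_degree order_refl)
    ultimately have lt: "degree E < 2 * Suc n" by simp
    have "poly (map_poly of_int r) (v\<^sup>2) = 0"
      using arg_cong[OF r(1), of "\<lambda>f. poly f v"] Ev by (simp add: poly_pcompose power2_eq_square)
    then have "poly (map_poly of_rat (map_poly of_int r :: rat poly)) (v\<^sup>2) = 0"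
      unfolding map_poly_of_rat_of_int .
    then have "min_poly_rat (v\<^sup>2) dvd map_poly of_int r"
      by (rule min_poly_rat_dvd[OF algebraic_int_imp_algebraic[OF ai]])
    then have dv: "(map_poly of_int p :: rat poly) dvd map_poly of_int r" unfolding p(2) .
    have "r \<noteq> 0"
    proof
      assume "r = 0"
      then have "E * pcompose E [:0, -1:] = 0" using r(1) by simp
      moreover have "pcompose E [:0, -1:] \<noteq> 0" using \<open>E \<noteq> 0\<close> by (simp add: pcompose_eq_0_iff)
      ultimately show False using \<open>E \<noteq> 0\<close> by simp
    qed
    then have "map_poly rat_of_int r \<noteq> 0" by (simp add: map_poly_eq_0_iff)
    then have "degree (map_poly rat_of_int p) \<le> degree (map_poly rat_of_int r)" by (rule dvd_imp_degree_le[OF dv])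
    then have "degree p \<le> degree r" by (simp add: degree_map_poly)
    then show False using lt r(2) p(1) by (simp add: trace_rel_def)
  qed
  then have "q = q'" by (simp add: E_def)
  moreover have "supp_below (Suc n) c" "supp_below (Suc n) c'"
    using g supp_salem_region unfolding grid_points_def salem_cell_def by blast+
  ultimately show ?thesis unfolding q_def q'_def by (rule recip_poly_inject)
qed

text \<open>The roots of one F together with their negatives form a set W of at most 2(n+1) elements
  that contains the roots of all the others. As roots are simple, a vector is recovered from its set
  of roots, and the bound is the number of subsets of W.\<close>

lemma good_points_fibre_card:
  assumes "finite A" and A: "\<And>c. c \<in> A \<Longrightarrow> \<exists>d. c \<in> good_points n X d \<and> salem_value n c = l"
  shows "card A \<le> 2 ^ (2 * Suc n)"
proof (cases "A = {}")
  case False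
  then obtain c0 where c0: "c0 \<in> A" by blast
  have l: "l > 0" and ex: "\<exists>p. trace_rel (Suc n) c p \<and> min_poly_rat l = map_poly of_int p \<and> irreducible (map_poly of_int p :: rat poly)
    \<and> supp_below (Suc n) c" if cA: "c \<in> A" for c
  proof -
    obtain d where d: "c \<in> good_points n X d" "salem_value n c = l" using A[OF cA] by blast
    obtain z v p where z: "c = root_coeffs (Suc n) z" "\<forall>i<n. \<bar>z i\<bar> \<le> 2" "2 < z n" "z n \<le> X"
      "v > 1" "z n = v + 1 / v" "salem_value n c = v\<^sup>2" and p: "trace_rel (Suc n) c p"
      "min_poly_rat (v\<^sup>2) = map_poly of_int p" "irreducible (map_poly of_int p :: rat poly)" and "algebraic_int (v\<^sup>2)"
      by (rule good_points_data[OF d(1)])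
    have "supp_below (Suc n) c"
      using d(1) supp_salem_region unfolding good_points_def grid_points_def salem_cell_def by blast
    moreover have lv: "l = v\<^sup>2" using d(2) z(7) by simp
    ultimately show "\<exists>p. trace_rel (Suc n) c p \<and> min_poly_rat l = map_poly of_int p \<and> irreducible (map_poly of_int p :: rat poly)
      \<and> supp_below (Suc n) c" using p by blast
    show "l > 0" using lv z(5) by simp
  qed
  obtain p where p: "trace_rel (Suc n) c0 p" "min_poly_rat l = map_poly of_int p" "irreducible (map_poly of_int p :: rat poly)"
    using ex[OF c0] by blast
  have tr: "trace_rel (Suc n) c p" if cA: "c \<in> A" for c
  proof -
    obtain p' where p': "trace_rel (Suc n) c p'" "min_poly_rat l = map_poly of_int p'" using ex[OF cA] by blast
    have "p' = p" using p'(2) p(2) by (simp add: map_poly_of_int_inject)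
    then show ?thesis using p'(1) by simp
  qed
  define R where "R = (\<lambda>c. {y. poly (cmonic_poly (Suc n) c) y = 0})"
  define W where "W = R c0 \<union> uminus ` R c0"
  have card_R: "card (R c0) = Suc n" unfolding R_def by (rule trace_rel_rsquarefree(2)[OF p(1,3)])
  then have "finite (R c0)" using card.infinite by fastforce
  then have fin: "finite W" unfolding W_def by simp
  have "card W \<le> card (R c0) + card (uminus ` R c0)" unfolding W_def by (rule card_Un_le)
  also have "\<dots> \<le> 2 * Suc n" using card_image_le[OF \<open>finite (R c0)\<close>, of uminus] card_R by simp
  finally have cW: "card W \<le> 2 * Suc n" .
  have sub: "R c \<subseteq> W" if c: "c \<in> A" for c
  proof
    fix y assume y: "y \<in> R c"
    obtain w where w: "w \<noteq> 0" "y = w + 1 / w" by (rule complex_add_inverse_ex)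
    have "poly (cmonic_poly (Suc n) c) (w + 1 / w) = 0" using y w(2) by (simp only: R_def mem_Collect_eq)
    then have "poly (map_poly of_int p) (w\<^sup>2) = 0" unfolding trace_rel_root_iff[OF tr[OF c] w(1)] by (rule disjI1)
    then have "poly (cmonic_poly (Suc n) c0) y = 0 \<or> poly (cmonic_poly (Suc n) c0) (- y) = 0"
      unfolding trace_rel_root_iff[OF p(1) w(1)] w(2) .
    then have "y \<in> R c0 \<or> - y \<in> R c0" by (simp only: R_def mem_Collect_eq)
    then show "y \<in> W" unfolding W_def by (metis UnI1 UnI2 image_eqI minus_minus)
  qed
  have "inj_on R A"
  proof (rule inj_onI)
    fix c c' assume c: "c \<in> A" "c' \<in> A" "R c = R c'"
    have "cmonic_poly (Suc n) c = (\<Prod>y\<in>R c. [:- y, 1:])"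
      unfolding R_def by (rule trace_rel_rsquarefree(1)[OF tr[OF c(1)] p(3)])
    moreover have "cmonic_poly (Suc n) c' = (\<Prod>y\<in>R c'. [:- y, 1:])"
      unfolding R_def by (rule trace_rel_rsquarefree(1)[OF tr[OF c(2)] p(3)])
    ultimately have e: "cmonic_poly (Suc n) c = cmonic_poly (Suc n) c'" unfolding c(3) by (rule trans[OF _ sym])
    have s: "supp_below (Suc n) c" "supp_below (Suc n) c'" using ex[OF c(1)] ex[OF c(2)] by blast+
    have "coeff (monic_poly (Suc n) c) j = coeff (monic_poly (Suc n) c') j" for j
      using arg_cong[OF e, of "\<lambda>f. coeff f j"] unfolding map_poly_monic_poly[symmetric] by (simp only: coeff_map_poly of_real_0 of_real_eq_iff)
    then have "monic_poly (Suc n) c = monic_poly (Suc n) c'" by (rule poly_eqI)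
    then show "c = c'" using s by (rule monic_poly_inject_supp)
  qed
  then have "card A = card (R ` A)" by (simp add: card_image)
  also have "\<dots> \<le> card (Pow W)" using sub fin by (intro card_mono) auto
  also have "\<dots> = 2 ^ card W" using fin by (rule card_Pow)
  also have "\<dots> \<le> 2 ^ (2 * Suc n)" using cW by (intro power_increasing) auto
  finally show ?thesis .
qed simp

section \<open>From square-rootable Salem numbers to grid points\<close>

lemma palindromic_pcompose_minus:
  fixes q :: "real poly"
  assumes "degree q = 2 * m" "palindromic q"
  shows "palindromic (pcompose q [:0, -1:])"
proof -
  have deg: "degree (pcompose q [:0, -1:]) = 2 * m" using assms(1) by (simp add: degree_pcompose)
  have sym: "\<forall>i\<le>2 * m. coeff q i = coeff q (2 * m - i)" using assms(2) unfolding palindromic_iff[OF assms(1)] .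
  show ?thesis
    unfolding palindromic_iff[OF deg] coeff_pcompose_minus
  proof (intro allI impI)
    fix i assume i: "i \<le> 2 * m"
    then have "even (2 * m - i) \<longleftrightarrow> even i" by simp
    then have "(-1 :: real) ^ (2 * m - i) = (-1) ^ i" by (simp only: minus_one_power_iff)
    moreover have "coeff q (2 * m - i) = coeff q i" using sym i by metis
    ultimately show "(-1) ^ i * coeff q i = (-1) ^ (2 * m - i) * coeff q (2 * m - i)" by (simp only:)
  qed
qed

text \<open>A fraction a/b equals ab / b^2, and d is the squarefree part of ab.\<close>

lemma sqrt_rat_squarefree:
  fixes \<alpha> :: rat
  assumes "\<alpha> > 0"
  obtains d :: nat and r :: real where "squarefree d" "r \<in> \<rat>" "sqrt (of_rat \<alpha>) = sqrt (real d) * r"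
proof -
  obtain a b where ab: "quotient_of \<alpha> = (a, b)" by (cases "quotient_of \<alpha>")
  have b: "b > 0" by (rule quotient_of_denom_pos[OF ab])
  have \<alpha>: "\<alpha> = of_int a / of_int b" by (rule quotient_of_div[OF ab])
  have a: "a > 0" using assms b unfolding \<alpha> by (simp add: zero_less_divide_iff)
  define N where "N = nat (a * b)"
  have N: "real N = of_int a * of_int b" using a b by (simp add: N_def)
  have sq: "squarefree (squarefree_part N)" by auto
  have "real N = real (squarefree_part N) * (real (square_part N))\<^sup>2"
    using arg_cong[OF squarefree_decompose[of N], of real] by simp
  moreover have "of_rat \<alpha> = real N / (of_int b)\<^sup>2"
    unfolding N \<alpha> using b by (simp add: of_rat_divide power2_eq_square)
  ultimately have "sqrt (of_rat \<alpha>) = sqrt (real (squarefree_part N)) * (real (square_part N) / of_int b)"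
    using b by (simp add: real_sqrt_divide real_sqrt_mult)
  moreover have "real (square_part N) / of_int b \<in> \<rat>" by simp
  ultimately show ?thesis using that sq by blast
qed

text \<open>The rational data of the definition are made integral by
  \<open>coeff_class_integral\<close>. Since q(sqrt \<lambda>) q(- sqrt \<lambda>) = p(\<lambda>) =
  0, one of q(x) and q(-x) vanishes at sqrt \<lambda>.\<close>

lemma Sal_sq_poly:
  assumes "l \<in> Sal_sq (Suc n) Q"
  obtains d M q where "squarefree d" "min_poly_rat l = map_poly of_int M" "lead_coeff M = 1" "degree M = 2 * Suc n"
    "irreducible (map_poly of_int M :: rat poly)" "degree q = 2 * Suc n" "lead_coeff q = 1" "palindromic q"
    "\<forall>i. coeff q i \<in> coeff_class d i" "q * pcompose q [:0, -1:] = pcompose (map_poly of_int M) [:0, 0, 1:]"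
    "poly q (sqrt l) = 0"
proof -
  have l: "algebraic_int l" "l > 1" "degree (min_poly_rat l) = 2 * Suc n" "square_rootable l"
    using assms by (auto simp: Sal_sq_def salem_number_def)
  obtain p :: "int poly" where "poly (map_poly of_int p) l = 0" "lead_coeff p = 1"
    using l(1) unfolding algebraic_int_altdef_ipoly by blast
  then obtain M \<nu> where M: "min_poly_rat l = map_poly of_int M" "p = M * \<nu>" "lead_coeff M = 1" "lead_coeff \<nu> = 1"
    by (rule integral_min_poly_rat)
  note props = min_poly_rat_props[OF algebraic_int_imp_algebraic[OF l(1)]]
  have dM: "degree M = 2 * Suc n" using l(3) M(1) by (simp add: degree_map_poly)
  have irr: "irreducible (map_poly of_int M :: rat poly)" using props(2) M(1) by simp
  have M0: "poly (map_poly of_int M) l = 0" using props(3) unfolding M(1) map_poly_of_rat_of_int .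
  obtain \<alpha> :: rat and q :: "real poly" where \<alpha>: "\<alpha> > 0" and q: "lead_coeff q = 1" "palindromic q"
    and qc: "\<forall>i. even i \<longrightarrow> coeff q i \<in> \<rat>" "\<forall>i. odd i \<longrightarrow> (\<exists>r\<in>\<rat>. coeff q i = sqrt (of_rat \<alpha>) * r)"
    and qq: "q * pcompose q [:0, -1:] = pcompose (map_poly of_rat (min_poly_rat l)) [:0, 0, 1:]"
    using l(4) unfolding square_rootable_def by blast
  have qM: "q * pcompose q [:0, -1:] = pcompose (map_poly of_int M) [:0, 0, 1:]"
    using qq unfolding M(1) map_poly_of_rat_of_int .
  obtain d r where d: "squarefree d" "r \<in> \<rat>" "sqrt (of_rat \<alpha>) = sqrt (real d) * r" by (rule sqrt_rat_squarefree[OF \<alpha>])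
  have cl: "coeff q i \<in> coeff_class d i" for i
  proof (rule coeff_class_integral[OF d(1) _ qM])
    fix j
    show "\<exists>r\<in>\<rat>. coeff q j = (if even j then 1 else sqrt (real d)) * r"
    proof (cases "even j")
      case True
      then show ?thesis using qc(1) by auto
    next
      case False
      then obtain t where t: "t \<in> \<rat>" "coeff q j = sqrt (real d) * r * t" using qc(2) d(3) by auto
      then show ?thesis using False d(2) by (intro bexI[of _ "r * t"]) (simp_all add: mult.assoc)
    qed
  qed
  have q0: "q \<noteq> 0" using q(1) by auto
  then have q0': "pcompose q [:0, -1:] \<noteq> 0" by (simp add: pcompose_eq_0_iff)
  have dq': "degree (pcompose q [:0, -1:]) = degree q" by (simp add: degree_pcompose)
  have "degree (q * pcompose q [:0, -1:]) = degree q + degree q" using q0 q0' by (simp add: degree_mult_eq dq')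
  moreover have "degree (pcompose (map_poly real_of_int M) [:0, 0, 1:]) = degree M * 2"
    by (simp add: degree_pcompose degree_map_poly)
  ultimately have dq: "degree q = 2 * Suc n" unfolding qM dM by simp
  have s: "(sqrt l)\<^sup>2 = l" using l(2) by simp
  have "poly q (sqrt l) * poly q (- sqrt l) = poly (map_poly of_int M) ((sqrt l)\<^sup>2)"
    using arg_cong[OF qM, of "\<lambda>f. poly f (sqrt l)"] by (simp add: poly_pcompose power2_eq_square)
  then have "poly q (sqrt l) * poly q (- sqrt l) = 0" unfolding s M0 .
  then consider "poly q (sqrt l) = 0" | "poly q (- sqrt l) = 0" by auto
  then show ?thesis
  proof cases
    case 1
    show ?thesis by (rule that[OF d(1) M(1,3) dM irr dq q _ qM 1]) (use cl in blast)
  next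
    \<comment> \<open>The polynomial q(-x) has the same properties and the required root; it
      replaces q.\<close>
    case 2
    let ?q = "pcompose q [:0, -1:]"
    have "degree ?q = 2 * Suc n" using dq' dq by simp
    moreover have "lead_coeff ?q = 1" unfolding dq' coeff_pcompose_minus using q(1) dq by simp
    moreover have "palindromic ?q" by (rule palindromic_pcompose_minus[OF dq q(2)])
    moreover have "\<forall>i. coeff ?q i \<in> coeff_class d i"
    proof
      fix i show "coeff ?q i \<in> coeff_class d i"
        unfolding coeff_pcompose_minus using cl[of i] coeff_class_uminus[OF cl[of i]] by (cases "even i") simp_all
    qed
    moreover have "pcompose ?q [:0, -1:] = q"
      by (rule poly_eqI) (simp add: coeff_pcompose_minus flip: mult.assoc power_mult_distrib)
    then have "?q * pcompose ?q [:0, -1:] = pcompose (map_poly of_int M) [:0, 0, 1:]" using qM by (simp add: mult.commute)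
    moreover have "poly ?q (sqrt l) = 0" using 2 by (simp add: poly_pcompose)
    ultimately show ?thesis by (rule that[OF d(1) M(1,3) dM irr])
  qed
qed

lemma enumerate_card:
  fixes A :: "real set"
  assumes "card A = N" "N > 0"
  obtains r where "A = r ` {..<N}" "\<And>i j. i < j \<Longrightarrow> j < N \<Longrightarrow> r i < r j"
proof (rule that[of "\<lambda>i. sorted_list_of_set A ! i"])
  have fin: "finite A" using assms card.infinite by fastforce
  have len: "length (sorted_list_of_set A) = N" using assms(1) by simp
  have "A = set (sorted_list_of_set A)" using fin by simp
  also have "\<dots> = (\<lambda>i. sorted_list_of_set A ! i) ` {..<N}" unfolding set_conv_nth len by auto
  finally show "A = (\<lambda>i. sorted_list_of_set A ! i) ` {..<N}" .
  show "sorted_list_of_set A ! i < sorted_list_of_set A ! j" if "i < j" "j < N" for i j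
    by (rule sorted_wrt_nth_less[OF strict_sorted_list_of_set that(1)]) (simp only: len that(2))
qed

text \<open>The roots of F are read off from the conjugates of \<lambda>. They are real and, as p is
  irreducible, distinct, so there are n + 1 of them, which places c in the region.\<close>

lemma Sal_sq_good_point:
  assumes lQ: "l \<in> Sal_sq (Suc n) Q" and Q: "Q > 1"
  obtains d c where "squarefree d" "c \<in> good_points n (sqrt Q + 1 / sqrt Q) d" "salem_value n c = l"
proof -
  obtain d M q where d: "squarefree d" and M: "min_poly_rat l = map_poly of_int M" "lead_coeff M = 1" "degree M = 2 * Suc n"
    "irreducible (map_poly of_int M :: rat poly)" and q: "degree q = 2 * Suc n" "lead_coeff q = 1" "palindromic q"
    "\<forall>i. coeff q i \<in> coeff_class d i" "q * pcompose q [:0, -1:] = pcompose (map_poly of_int M) [:0, 0, 1:]"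
    "poly q (sqrt l) = 0"
    by (rule Sal_sq_poly[OF lQ])
  have l: "l > 1" "l \<le> Q" "degree (min_poly_rat l) = 2 * Suc n" "salem_number l" using lQ by (simp_all add: Sal_sq_def)
  obtain c where c: "q = recip_poly (Suc n) c" "supp_below (Suc n) c" "\<And>i. i < Suc n \<Longrightarrow> c i \<in> coeff_class d (Suc i)"
    using palindromic_eq_recip_poly[OF q(1,2,3)] q(4) by blast
  have tr: "trace_rel (Suc n) c M" unfolding trace_rel_def using M(2,3) q(5) unfolding c(1) by blast
  define v where "v = sqrt l"
  have v: "v > 1" "v\<^sup>2 = l" using l(1) by (simp_all add: v_def)
  define x where "x = v + 1 / v"
  have x2: "x > 2" using add_inverse_strict_mono[of 1 v] v(1) by (simp add: x_def)
  have "v ^ Suc n * poly (monic_poly (Suc n) c) (v + 1 / v) = 0"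
    using q(6) poly_recip_poly[of v "Suc n" c] v(1) unfolding c(1) v_def[symmetric] by simp
  then have Fx: "poly (monic_poly (Suc n) c) x = 0" using v(1) unfolding x_def by simp
  have v0: "complex_of_real v \<noteq> 0" using v(1) by simp
  have xc: "complex_of_real v + 1 / complex_of_real v = of_real x" by (simp add: x_def)
  have Fxc: "poly (cmonic_poly (Suc n) c) (complex_of_real v + 1 / complex_of_real v) = 0"
    unfolding xc poly_cmonic_of_real Fx by simp
  have cj: "conjugates l = {\<zeta>. poly (map_poly of_int M) \<zeta> = 0}"
    unfolding conjugates_def M(1) map_poly_of_rat_of_int ..
  \<comment> \<open>A conjugate on the unit circle gives a root in [-2, 2]. The conjugates \<lambda>
    and 1/\<lambda> give x or - x, and - x is excluded because no two roots of F are
    opposite.\<close>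
  have real: "y = of_real x \<or> (\<exists>t. y = of_real t \<and> \<bar>t\<bar> \<le> 2)" if y: "poly (cmonic_poly (Suc n) c) y = 0" for y
  proof -
    obtain w where w: "w \<noteq> 0" "y = w + 1 / w" by (rule complex_add_inverse_ex)
    have "poly (map_poly of_int M) (w\<^sup>2) = 0"
      unfolding trace_rel_root_iff[OF tr w(1)] using y unfolding w(2) by (rule disjI1)
    then have "w\<^sup>2 \<in> conjugates l" unfolding cj by simp
    then consider "w\<^sup>2 = of_real l" | "w\<^sup>2 = of_real (inverse l)" | "norm (w\<^sup>2) = 1"
      using l(4) unfolding salem_number_def by blast
    then show ?thesis
    proof cases
      case 3
      then have "norm w = 1 \<or> norm w = -1" by (simp add: norm_power power2_eq_1_iff)
      then have "norm w = 1" using norm_ge_zero[of w] by linarith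
      from add_inverse_of_unit_circle[OF this] show ?thesis unfolding w(2) by blast
    next
      case 1
      then have "w\<^sup>2 = (complex_of_real v)\<^sup>2" using v(2) by (simp flip: of_real_power)
      then have "w = of_real v \<or> w = - of_real v" by (simp only: power2_eq_iff)
      then have "y = of_real x \<or> y = - of_real x" unfolding w(2) xc[symmetric] by auto
      moreover have "y \<noteq> - of_real x" using trace_rel_simple(2)[OF tr M(4) v0 Fxc] y unfolding xc by metis
      ultimately show ?thesis by blast
    next
      case 2
      then have "w\<^sup>2 = (1 / complex_of_real v)\<^sup>2" using v(2) by (simp add: inverse_eq_divide power_divide flip: of_real_power)
      then have "w = 1 / of_real v \<or> w = - (1 / of_real v)" by (simp only: power2_eq_iff)
      then have "y = of_real x \<or> y = - of_real x" unfolding w(2) xc[symmetric] by auto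
      moreover have "y \<noteq> - of_real x" using trace_rel_simple(2)[OF tr M(4) v0 Fxc] y unfolding xc by metis
      ultimately show ?thesis by blast
    qed
  qed
  define R where "R = {t. poly (monic_poly (Suc n) c) t = 0}"
  have small: "\<bar>t\<bar> \<le> 2" if "t \<in> R" "t \<noteq> x" for t
  proof -
    have "poly (cmonic_poly (Suc n) c) (of_real t) = 0" using that(1) unfolding poly_cmonic_of_real R_def by simp
    from real[OF this] show ?thesis using that(2) by auto
  qed
  have "{y. poly (cmonic_poly (Suc n) c) y = 0} = complex_of_real ` R"
  proof (intro equalityI subsetI)
    fix y assume "y \<in> {y. poly (cmonic_poly (Suc n) c) y = 0}"
    then have y: "poly (cmonic_poly (Suc n) c) y = 0" by simp
    then obtain t where t: "y = of_real t" using real by blast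
    have "poly (monic_poly (Suc n) c) t = 0" using y unfolding t poly_cmonic_of_real of_real_eq_0_iff .
    then show "y \<in> complex_of_real ` R" unfolding t R_def by blast
  next
    fix y assume "y \<in> complex_of_real ` R"
    then obtain t where "y = of_real t" "poly (monic_poly (Suc n) c) t = 0" unfolding R_def by blast
    then show "y \<in> {y. poly (cmonic_poly (Suc n) c) y = 0}" by (simp only: mem_Collect_eq poly_cmonic_of_real of_real_0)
  qed
  then have "card (complex_of_real ` R) = Suc n" using trace_rel_rsquarefree(2)[OF tr M(4)] by simp
  then have cR: "card R = Suc n" by (simp add: card_image inj_on_def)
  obtain r where r: "R = r ` {..<Suc n}" "\<And>i j. i < j \<Longrightarrow> j < Suc n \<Longrightarrow> r i < r j"
    by (rule enumerate_card[OF cR zero_less_Suc]) blast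
  have rR: "r i \<in> R" if "i < Suc n" for i using that r(1) by blast
  obtain j where j: "j < Suc n" "x = r j" using Fx r(1) unfolding R_def by blast
  have rn: "r n = x"
  proof (rule ccontr)
    assume a: "r n \<noteq> x"
    then have "j < n" using j by (metis less_Suc_eq)
    then have "x < r n" using r(2)[of j n] j(2) by simp
    then show False using small[OF rR[of n] a] x2 by simp
  qed
  have xX: "x \<le> sqrt Q + 1 / sqrt Q"
    unfolding x_def v_def using add_inverse_le_iff[of "sqrt l" "sqrt Q"] l(1,2) by simp
  have reg: "c \<in> salem_region n (sqrt Q + 1 / sqrt Q)"
  proof (rule salem_regionI[OF c(2), of r])
    show "poly (monic_poly (Suc n) c) (r i) = 0" if "i \<le> n" for i using rR[of i] that unfolding R_def by simp
    show "-2 \<le> r i \<and> r i \<le> 2" if "i < n" for i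
    proof -
      have "r i \<noteq> x" using r(2)[of i n] that rn by simp
      then show ?thesis using small[OF rR[of i]] that by (simp add: abs_le_iff)
    qed
    show "r i < r j" if "i < j" "j \<le> n" for i j using r(2)[of i j] that by simp
    show "2 \<le> r n" "r n \<le> sqrt Q + 1 / sqrt Q" using rn x2 xX by simp_all
  qed
  \<comment> \<open>Otherwise -1 would be a root of the irreducible polynomial M, whose degree
    exceeds 1.\<close>
  have cn: "c n \<noteq> 0"
  proof
    assume "c n = 0"
    then have "poly (map_poly of_int M) (-1 :: complex) = 0" unfolding trace_rel_minus_one[OF tr] by simp
    then have "poly (map_poly of_rat (map_poly of_int M :: rat poly)) (-1 :: complex) = 0"
      unfolding map_poly_of_rat_of_int .
    moreover have "poly (map_poly of_rat [:1, 1 :: rat:]) (-1 :: complex) = 0" by (simp add: map_poly_pCons)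
    ultimately have "(map_poly of_int M :: rat poly) dvd [:1, 1:]"
      by (rule irreducible_rat_poly_common_root[OF M(4)])
    then have "degree (map_poly of_int M :: rat poly) \<le> degree [:1, 1 :: rat:]" by (rule dvd_imp_degree_le) simp
    then show False using M(3) by (simp add: degree_map_poly)
  qed
  have grid: "c \<in> grid_points n (sqrt Q + 1 / sqrt Q) (root_step d)"
    unfolding grid_points_def salem_cell_def
  proof (intro CollectI conjI allI impI reg cn)
    fix i assume "i \<le> n"
    then have "c i \<in> coeff_class d (Suc i)" using c(3) by simp
    then obtain k :: int where "c i = (if even (Suc i) then 1 else sqrt (real d)) * of_int k" by (rule coeff_classE)
    then show "\<exists>k::int. c i = root_step d i * of_int k" by (intro exI[of _ k]) (simp add: root_step_def)
  qed
  have "Max R = x"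
  proof (rule Max_eqI)
    show "finite R" unfolding r(1) by simp
    show "x \<in> R" using Fx unfolding R_def by simp
    fix t assume "t \<in> R"
    then show "t \<le> x" using small[of t] x2 by (cases "t = x") auto
  qed
  then have "salem_value n c = v\<^sup>2"
    unfolding salem_value_def R_def x_def using v(1) by (simp only: salem_of_add_inverse less_imp_le)
  then have val: "salem_value n c = l" unfolding v(2) .
  then have "c \<in> good_points n (sqrt Q + 1 / sqrt Q) d" unfolding good_points_def using grid l(3) by simp
  then show ?thesis using that d val by blast
qed

section \<open>Counting\<close>

text \<open>These are coefficient vectors and not numbers. The union over d is disjoint by
  \<open>good_points_disjoint\<close>, but for odd n different vectors may yield the same Salem
  number.\<close>

definition sal_points :: "nat \<Rightarrow> real \<Rightarrow> (nat \<Rightarrow> real) set" where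
  "sal_points n Q = (\<Union>d\<in>{d. squarefree d}. good_points n (sqrt Q + 1 / sqrt Q) d)"

lemma Sal_sq_eq_image:
  assumes "Q > 1"
  shows "Sal_sq (Suc n) Q = salem_value n ` sal_points n Q"
proof (intro equalityI subsetI)
  fix l assume "l \<in> Sal_sq (Suc n) Q"
  then obtain d c where "squarefree d" "c \<in> good_points n (sqrt Q + 1 / sqrt Q) d" "salem_value n c = l"
    by (rule Sal_sq_good_point[OF _ assms])
  then show "l \<in> salem_value n ` sal_points n Q" unfolding sal_points_def by blast
next
  fix l assume "l \<in> salem_value n ` sal_points n Q"
  then obtain d c where c: "squarefree d" "c \<in> good_points n (sqrt Q + 1 / sqrt Q) d" "l = salem_value n c"
    unfolding sal_points_def by blast
  have "d \<ge> 1" using squarefree_nat_pos[OF c(1)] by simp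
  then show "l \<in> Sal_sq (Suc n) Q" unfolding c(3) by (rule good_point_Sal_sq[OF c(2) assms])
qed

lemma inj_on_salem_value: "even n \<Longrightarrow> inj_on (salem_value n) (sal_points n Q)"
  unfolding sal_points_def by (intro inj_onI) (auto intro: good_points_even_inject)

text \<open>A nonzero coefficient that carries sqrt d has absolute value at least sqrt d, while
  every coefficient of the region is O(X). Hence only d = O(X^2) contribute.\<close>

lemma good_points_step_bound:
  obtains M where "M \<ge> 1" "\<And>X d c. X \<ge> 2 \<Longrightarrow> c \<in> good_points n X d \<Longrightarrow> sqrt (real d) \<le> M * X"
proof -
  obtain M where M: "M \<ge> 1" "\<And>X c i. X \<ge> 2 \<Longrightarrow> c \<in> salem_region n X \<Longrightarrow> \<bar>c i\<bar> \<le> M * X"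
    by (rule salem_region_bound[of n]) blast
  have "sqrt (real d) \<le> M * X" if X: "X \<ge> 2" and c: "c \<in> good_points n X d" for X d c
  proof -
    obtain z v p where z: "c = root_coeffs (Suc n) z" "\<forall>i<n. \<bar>z i\<bar> \<le> 2" "2 < z n" "z n \<le> X"
      "v > 1" "z n = v + 1 / v" "salem_value n c = v\<^sup>2" and "trace_rel (Suc n) c p"
      "min_poly_rat (v\<^sup>2) = map_poly of_int p" and "irreducible (map_poly of_int p :: rat poly)" and "algebraic_int (v\<^sup>2)"
      by (rule good_points_data[OF c])
    have g: "c \<in> grid_points n X (root_step d)" using c by (simp add: good_points_def)
    then have reg: "c \<in> salem_region n X" by (simp add: grid_points_def salem_cell_def)
    have "poly (monic_poly (Suc n) c) (z n) = 0" unfolding z(1) poly_root_coeffs by simp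
    then obtain i where i: "i \<le> n" "even i" "c i \<noteq> 0" by (rule salem_region_even_coeff[OF _ z(3) reg])
    obtain k :: int where k: "c i = root_step d i * of_int k" using g i(1) unfolding grid_points_def by blast
    have "k \<noteq> 0" using i(3) k by auto
    then have "1 \<le> \<bar>real_of_int k\<bar>" by simp
    then have "sqrt (real d) * 1 \<le> sqrt (real d) * \<bar>real_of_int k\<bar>" by (intro mult_left_mono) auto
    also have "\<dots> = \<bar>c i\<bar>" unfolding k using i(2) by (simp add: root_step_def abs_mult)
    also have "\<dots> \<le> M * X" by (rule M(2)[OF X reg])
    finally show ?thesis by simp
  qed
  then show ?thesis using that M(1) by blast
qed

text \<open>The threshold 9 ensures X = sqrt Q + 1/sqrt Q \<ge> 3, as the volume estimates
  demand.\<close>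

lemma sqrt_add_inverse_bounds:
  assumes "Q \<ge> 9"
  shows "sqrt Q \<ge> 3" "sqrt Q + 1 / sqrt Q \<ge> 3" "sqrt Q + 1 / sqrt Q \<le> 2 * sqrt Q"
    "(sqrt Q + 1 / sqrt Q)\<^sup>2 \<ge> Q + 2"
proof -
  show r: "sqrt Q \<ge> 3" using assms real_le_rsqrt[of 3 Q] by simp
  then have r0: "sqrt Q > 0" by linarith
  have i: "1 / sqrt Q > 0" "1 / sqrt Q \<le> 1"
    by (rule divide_pos_pos[OF zero_less_one r0], subst pos_divide_le_eq[OF r0], use r in linarith)
  show "sqrt Q + 1 / sqrt Q \<ge> 3" "sqrt Q + 1 / sqrt Q \<le> 2 * sqrt Q" using r i by linarith+
  have "(sqrt Q + 1 / sqrt Q)\<^sup>2 = (sqrt Q)\<^sup>2 + 2 + (1 / sqrt Q)\<^sup>2" using r assms by (simp add: power2_sum)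
  then show "(sqrt Q + 1 / sqrt Q)\<^sup>2 \<ge> Q + 2" using assms by simp
qed

text \<open>Summation over d up to a cut-off N comparable to Q. The lower bound N \<ge> Q makes the
  tail of a convergent series small; the upper bound N \<le> B Q controls the error sum and keeps
  log N within O(1) of log Q.\<close>

lemma sal_points_estimate:
  assumes n: "n > 0"
  obtains C B where "C \<ge> 0" "B \<ge> 1" "\<And>Q. Q \<ge> 9 \<Longrightarrow> finite (sal_points n Q)"
    "\<And>Q. Q \<ge> 9 \<Longrightarrow> \<exists>N. Q \<le> real N \<and> real N \<le> B * Q \<and>
      \<bar>real (card (sal_points n Q)) - w_const n * (sqrt Q + 1 / sqrt Q) ^ Suc n * (\<Sum>d\<in>sqfree_upto N. 1 / sqrt (real d) ^ odd_codim n)\<bar>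
        \<le> C * (sqrt Q + 1 / sqrt Q) ^ n * (\<Sum>d\<in>sqfree_upto N. 1 / sqrt (real d) ^ (odd_codim n - 1))"
proof -
  obtain M where M: "M \<ge> 1" "\<And>X d c. X \<ge> 2 \<Longrightarrow> c \<in> good_points n X d \<Longrightarrow> sqrt (real d) \<le> M * X"
    by (rule good_points_step_bound[of n]) blast
  obtain Z :: "real set" where Z: "finite Z"
    "\<And>X d c. c \<in> grid_points n X (root_step d) - good_points n X d \<Longrightarrow> \<exists>\<beta>\<in>Z. poly (monic_poly (Suc n) c) \<beta> = 0"
    by (rule bad_points_cover[of n]) blast
  have M0: "M > 0" using M(1) by simp
  obtain C where C: "C \<ge> 0" "\<And>X d G. X \<ge> 3 \<Longrightarrow> d \<ge> 1 \<Longrightarrow> sqrt (real d) \<le> M * X \<Longrightarrow>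
    G \<subseteq> grid_points n X (root_step d) \<Longrightarrow>
    (\<And>c. c \<in> grid_points n X (root_step d) - G \<Longrightarrow> \<exists>\<beta>\<in>Z. poly (monic_poly (Suc n) c) \<beta> = 0) \<Longrightarrow>
    \<bar>real (card G) - disc_vol n / real (Suc n) * X ^ Suc n / sqrt (real d) ^ odd_codim n\<bar>
      \<le> C * X ^ n / sqrt (real d) ^ (odd_codim n - 1)"
    by (rule card_grid_points_generic[OF n M0 Z(1)]) blast
  have w: "disc_vol n / real (Suc n) = w_const n"
    by (simp add: w_const_def disc_vol_def ordered_vol_def)
  have main: "finite (sal_points n Q) \<and> (\<exists>N. Q \<le> real N \<and> real N \<le> (M\<^sup>2 * 4) * Q \<and>
      \<bar>real (card (sal_points n Q)) - w_const n * (sqrt Q + 1 / sqrt Q) ^ Suc n * (\<Sum>d\<in>sqfree_upto N. 1 / sqrt (real d) ^ odd_codim n)\<bar>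
        \<le> C * (sqrt Q + 1 / sqrt Q) ^ n * (\<Sum>d\<in>sqfree_upto N. 1 / sqrt (real d) ^ (odd_codim n - 1)))"
    if Q: "Q \<ge> 9" for Q
  proof -
    define X where "X = sqrt Q + 1 / sqrt Q"
    note b = sqrt_add_inverse_bounds[OF Q, folded X_def]
    \<comment> \<open>By \<open>good_points_step_bound\<close> there are no points for larger
      d.\<close>
    define N where "N = nat \<lfloor>(M * X)\<^sup>2\<rfloor>"
    have "1 * (Q + 2) \<le> M\<^sup>2 * X\<^sup>2" using M(1) b(4) Q by (intro mult_mono) auto
    then have lo: "Q + 2 \<le> (M * X)\<^sup>2" by (simp add: power_mult_distrib)
    have rN: "real N = of_int \<lfloor>(M * X)\<^sup>2\<rfloor>" using lo Q by (simp add: N_def)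
    have N: "Q \<le> real N" "real N \<le> (M * X)\<^sup>2" using lo unfolding rN by linarith+
    have "X\<^sup>2 \<le> (2 * sqrt Q)\<^sup>2" using b(2,3) by (intro power_mono) auto
    then have "X\<^sup>2 \<le> 4 * Q" using Q by (simp add: power_mult_distrib)
    then have "M\<^sup>2 * X\<^sup>2 \<le> M\<^sup>2 * (4 * Q)" by (intro mult_left_mono) auto
    then have NB: "real N \<le> (M\<^sup>2 * 4) * Q" using N(2) by (simp add: power_mult_distrib mult.assoc)
    have dN: "d \<in> sqfree_upto N" if d: "squarefree d" and c: "c \<in> good_points n X d" for d c
    proof -
      have "sqrt (real d) \<le> M * X" using M(2)[OF _ c] b(2) by simp
      then have "(sqrt (real d))\<^sup>2 \<le> (M * X)\<^sup>2" by (intro power_mono) auto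
      then have "real_of_int (int d) \<le> (M * X)\<^sup>2" by simp
      then have "int d \<le> \<lfloor>(M * X)\<^sup>2\<rfloor>" by (simp only: le_floor_iff)
      then have "d \<le> N" unfolding N_def by simp
      then show ?thesis using d squarefree_nat_pos[OF d] by (simp add: sqfree_upto_def)
    qed
    have U: "sal_points n Q = (\<Union>d\<in>sqfree_upto N. good_points n X d)"
      unfolding sal_points_def X_def[symmetric] using dN by (auto simp: sqfree_upto_def)
    have fg: "finite (grid_points n X (root_step d))" if "d \<in> sqfree_upto N" for d
      using that by (intro finite_grid_points root_step_pos) (auto simp: sqfree_upto_def)
    have sub: "good_points n X d \<subseteq> grid_points n X (root_step d)" for d by (auto simp: good_points_def)
    have fgood: "finite (good_points n X d)" if "d \<in> sqfree_upto N" for d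
      by (rule finite_subset[OF sub fg[OF that]])
    have disj: "good_points n X d \<inter> good_points n X e = {}" if "d \<in> sqfree_upto N" "e \<in> sqfree_upto N" "d \<noteq> e" for d e
      using good_points_disjoint[of d e _ n X] that by (auto simp: sqfree_upto_def)
    have "card (sal_points n Q) = (\<Sum>d\<in>sqfree_upto N. card (good_points n X d))"
      unfolding U using fgood disj finite_sqfree_upto by (intro card_UN_disjoint) auto
    then have cU: "real (card (sal_points n Q)) = (\<Sum>d\<in>sqfree_upto N. real (card (good_points n X d)))" by simp
    have each: "\<bar>real (card (good_points n X d)) - w_const n * X ^ Suc n * (1 / sqrt (real d) ^ odd_codim n)\<bar>
      \<le> C * X ^ n * (1 / sqrt (real d) ^ (odd_codim n - 1))" if d: "d \<in> sqfree_upto N" for d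
    proof -
      have d1: "d \<ge> 1" "real d \<le> real N" using d by (auto simp: sqfree_upto_def)
      have "sqrt (real d) \<le> sqrt ((M * X)\<^sup>2)" using d1(2) N(2) by (intro real_sqrt_le_mono) linarith
      also have "\<dots> = M * X" using M0 b(2) by simp
      finally have "sqrt (real d) \<le> M * X" .
      from C(2)[OF b(2) d1(1) this sub Z(2)] show ?thesis unfolding w by simp
    qed
    have "\<bar>real (card (sal_points n Q)) - w_const n * X ^ Suc n * (\<Sum>d\<in>sqfree_upto N. 1 / sqrt (real d) ^ odd_codim n)\<bar>
      = \<bar>\<Sum>d\<in>sqfree_upto N. real (card (good_points n X d)) - w_const n * X ^ Suc n * (1 / sqrt (real d) ^ odd_codim n)\<bar>"
      unfolding cU sum_subtractf sum_distrib_left ..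
    also have "\<dots> \<le> (\<Sum>d\<in>sqfree_upto N. C * X ^ n * (1 / sqrt (real d) ^ (odd_codim n - 1)))"
      by (rule order_trans[OF sum_abs sum_mono[OF each]])
    also have "\<dots> = C * X ^ n * (\<Sum>d\<in>sqfree_upto N. 1 / sqrt (real d) ^ (odd_codim n - 1))"
      by (rule sum_distrib_left[symmetric])
    finally have est: "\<bar>real (card (sal_points n Q)) - w_const n * X ^ Suc n * (\<Sum>d\<in>sqfree_upto N. 1 / sqrt (real d) ^ odd_codim n)\<bar>
      \<le> C * X ^ n * (\<Sum>d\<in>sqfree_upto N. 1 / sqrt (real d) ^ (odd_codim n - 1))" .
    have "finite (sal_points n Q)" unfolding U using fgood finite_sqfree_upto by blast
    then show ?thesis using N(1) NB est unfolding X_def by blast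
  qed
  have "1\<^sup>2 \<le> M\<^sup>2" using M(1) by (intro power_mono) auto
  then have "M\<^sup>2 * 4 \<ge> 1" by simp
  then show ?thesis by (rule that[OF C(1)]) (use main in blast)+
qed

text \<open>The base changes only by 1/sqrt Q, so the difference of the powers is O(sqrt
  Q^(n-1)).\<close>

lemma power_sqrt_add_inverse_diff:
  assumes "Q \<ge> 9"
  shows "0 \<le> (sqrt Q + 1 / sqrt Q) ^ Suc n - sqrt Q ^ Suc n"
    "((sqrt Q + 1 / sqrt Q) ^ Suc n - sqrt Q ^ Suc n) * sqrt Q \<le> real (Suc n) * 2 ^ n * sqrt Q ^ n"
proof -
  define r where "r = sqrt Q"
  note b = sqrt_add_inverse_bounds[OF assms, folded r_def]
  have "r ^ Suc n \<le> (r + 1 / r) ^ Suc n" using b(1) by (intro power_mono) auto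
  then show "0 \<le> (sqrt Q + 1 / sqrt Q) ^ Suc n - sqrt Q ^ Suc n" by (simp add: r_def)
  have "(r + 1 / r) ^ Suc n - r ^ Suc n \<le> real (Suc n) * ((r + 1 / r) - r) * (r + 1 / r) ^ n"
    using b(1) by (intro power_Suc_diff_le) auto
  then have "((r + 1 / r) ^ Suc n - r ^ Suc n) * r \<le> (real (Suc n) * ((r + 1 / r) - r) * (r + 1 / r) ^ n) * r"
    using b(1) by (intro mult_right_mono) auto
  also have "\<dots> = real (Suc n) * (r + 1 / r) ^ n" using b(1) by simp
  also have "\<dots> \<le> real (Suc n) * (2 * r) ^ n" using b by (intro mult_left_mono power_mono) auto
  also have "\<dots> = real (Suc n) * 2 ^ n * r ^ n" by (simp only: power_mult_distrib mult.assoc)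
  finally show "((sqrt Q + 1 / sqrt Q) ^ Suc n - sqrt Q ^ Suc n) * sqrt Q \<le> real (Suc n) * 2 ^ n * sqrt Q ^ n"
    by (simp only: r_def)
qed

lemma sqrt_add_inverse_power_le:
  assumes "Q \<ge> 9"
  shows "(sqrt Q + 1 / sqrt Q) ^ k \<le> 2 ^ k * sqrt Q ^ k"
proof -
  have "(sqrt Q + 1 / sqrt Q) ^ k \<le> (2 * sqrt Q) ^ k"
    using sqrt_add_inverse_bounds[OF assms] by (intro power_mono) auto
  then show ?thesis by (simp only: power_mult_distrib)
qed

text \<open>Replaces \<open>X\<close> by \<open>\<surd>Q\<close> and the sum \<open>S\<close> by its approximation \<open>S0\<close>.\<close>

lemma power_mult_approx:
  assumes Q: "Q \<ge> 9" and S: "\<bar>S - S0\<bar> \<le> e" and w: "w \<ge> 0"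
    and T: "\<bar>T - w * (sqrt Q + 1 / sqrt Q) ^ Suc n * S\<bar> \<le> C * (sqrt Q + 1 / sqrt Q) ^ n * E" and C: "C \<ge> 0" and E: "E \<ge> 0"
  shows "\<bar>T - w * S0 * sqrt Q ^ Suc n\<bar> \<le>
    C * (2 ^ n * sqrt Q ^ n) * E + w * (2 ^ Suc n * sqrt Q ^ Suc n * e + real (Suc n) * 2 ^ n * (sqrt Q ^ n / sqrt Q) * \<bar>S0\<bar>)"
proof -
  define r where "r = sqrt Q"
  define X where "X = r + 1 / r"
  have r: "r > 0" using Q by (simp add: r_def)
  have X0: "X > 0" using r by (simp add: X_def add_pos_pos)
  have e: "e \<ge> 0" using S by linarith
  have d: "0 \<le> X ^ Suc n - r ^ Suc n" "(X ^ Suc n - r ^ Suc n) * r \<le> real (Suc n) * 2 ^ n * r ^ n"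
    using power_sqrt_add_inverse_diff[OF Q, of n] unfolding X_def r_def by blast+
  have d2: "X ^ Suc n - r ^ Suc n \<le> real (Suc n) * 2 ^ n * (r ^ n / r)"
    using d(2) r by (simp add: pos_le_divide_eq)
  have p: "X ^ k \<le> 2 ^ k * r ^ k" for k using sqrt_add_inverse_power_le[OF Q, of k] by (simp only: X_def r_def)
  have "X ^ Suc n * S - r ^ Suc n * S0 = X ^ Suc n * (S - S0) + (X ^ Suc n - r ^ Suc n) * S0"
    by (simp add: algebra_simps)
  then have "\<bar>X ^ Suc n * S - r ^ Suc n * S0\<bar> \<le> \<bar>X ^ Suc n * (S - S0)\<bar> + \<bar>(X ^ Suc n - r ^ Suc n) * S0\<bar>"
    by (simp only: abs_triangle_ineq)
  also have "\<dots> = X ^ Suc n * \<bar>S - S0\<bar> + (X ^ Suc n - r ^ Suc n) * \<bar>S0\<bar>"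
    using d(1) X0 by (simp only: abs_mult abs_of_nonneg zero_le_power less_imp_le)
  also have "\<dots> \<le> (2 ^ Suc n * r ^ Suc n) * e + (real (Suc n) * 2 ^ n * (r ^ n / r)) * \<bar>S0\<bar>"
    using p[of "Suc n"] S d2 r e by (intro add_mono mult_mono) (auto simp del: power_Suc)
  finally have a: "w * \<bar>X ^ Suc n * S - r ^ Suc n * S0\<bar> \<le> w * ((2 ^ Suc n * r ^ Suc n) * e + (real (Suc n) * 2 ^ n * (r ^ n / r)) * \<bar>S0\<bar>)"
    using w by (rule mult_left_mono)
  have "C * X ^ n * E \<le> C * (2 ^ n * r ^ n) * E" using p[of n] C E by (intro mult_right_mono mult_left_mono) auto
  then have b: "\<bar>T - w * X ^ Suc n * S\<bar> \<le> C * (2 ^ n * r ^ n) * E" using T unfolding X_def r_def by linarith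
  have "T - w * S0 * r ^ Suc n = (T - w * X ^ Suc n * S) + w * (X ^ Suc n * S - r ^ Suc n * S0)"
    by (simp add: algebra_simps)
  then have "\<bar>T - w * S0 * r ^ Suc n\<bar> \<le> \<bar>T - w * X ^ Suc n * S\<bar> + w * \<bar>X ^ Suc n * S - r ^ Suc n * S0\<bar>"
    using abs_triangle_ineq[of "T - w * X ^ Suc n * S" "w * (X ^ Suc n * S - r ^ Suc n * S0)"] w by (simp only: abs_mult abs_of_nonneg)
  then show ?thesis using a b unfolding r_def by linarith
qed

lemma w_const_nonneg: "w_const n \<ge> 0"
  unfolding w_const_def by (intro mult_nonneg_nonneg divide_nonneg_nonneg prod_nonneg) auto

lemma powr_half_nat: "Q > 0 \<Longrightarrow> Q powr (real k / 2) = sqrt Q ^ k"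
  by (simp add: powr_half_sqrt[symmetric] powr_power)

lemma ln_le_of_real_bounds:
  assumes "Q \<ge> 9" "Q \<le> real N" "real N \<le> B * Q" "B \<ge> 1"
  shows "0 \<le> ln (real N) - ln Q" "ln (real N) - ln Q \<le> ln B"
proof -
  show "0 \<le> ln (real N) - ln Q" using assms by simp
  have "ln (real N) \<le> ln (B * Q)" using assms by simp
  also have "\<dots> = ln B + ln Q" using assms by (intro ln_mult_pos) auto
  finally show "ln (real N) - ln Q \<le> ln B" by simp
qed

lemma ln_ge_1: "Q \<ge> (9::real) \<Longrightarrow> ln Q \<ge> 1"
  using exp_le ln_ge_iff[of Q 1] by linarith

text \<open>Two coordinates carry sqrt d, so the main terms are a harmonic sum over squarefree d and
  produce the logarithm. The errors sum to X^n times the sum of d^(-1/2), which is O(sqrt Q) and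
  gives the order Q^((n+1)/2) of the error term.\<close>

lemma card_sal_points_small:
  assumes n: "n = 2 \<or> n = 3"
  obtains C where "\<And>Q. Q \<ge> 9 \<Longrightarrow> finite (sal_points n Q)" "C \<ge> 0"
    "\<And>Q. Q \<ge> 9 \<Longrightarrow> \<bar>real (card (sal_points n Q)) - w_const n * (6 / pi\<^sup>2) * Q powr (real (Suc n) / 2) * ln Q\<bar>
      \<le> C * Q powr (real (Suc n) / 2)"
proof -
  have n0: "n > 0" and oc: "odd_codim n = 2" using n by (auto simp: odd_codim_def)
  obtain C B where C: "C \<ge> 0" "B \<ge> 1" and fin: "\<And>Q. Q \<ge> 9 \<Longrightarrow> finite (sal_points n Q)"
    and est: "\<And>Q. Q \<ge> 9 \<Longrightarrow> \<exists>N. Q \<le> real N \<and> real N \<le> B * Q \<and>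
      \<bar>real (card (sal_points n Q)) - w_const n * (sqrt Q + 1 / sqrt Q) ^ Suc n * (\<Sum>d\<in>sqfree_upto N. 1 / sqrt (real d) ^ odd_codim n)\<bar>
        \<le> C * (sqrt Q + 1 / sqrt Q) ^ n * (\<Sum>d\<in>sqfree_upto N. 1 / sqrt (real d) ^ (odd_codim n - 1))"
    by (rule sal_points_estimate[OF n0]) blast
  obtain C1 where C1: "C1 \<ge> 0" "\<And>N. N \<ge> 1 \<Longrightarrow> \<bar>(\<Sum>d\<in>sqfree_upto N. 1 / real d) - 6 / pi\<^sup>2 * ln (real N)\<bar> \<le> C1"
    by (rule sum_sqfree_inverse) blast
  define a where "a = 6 / pi\<^sup>2"
  have a0: "a \<ge> 0" by (simp add: a_def)
  define e where "e = C1 + a * ln B"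
  have lB: "ln B \<ge> 0" using C(2) by simp
  define K where "K = C * 2 ^ n * (2 * sqrt B) + w_const n * (2 ^ Suc n * e + real (Suc n) * 2 ^ n * a)"
  have "\<bar>real (card (sal_points n Q)) - w_const n * (6 / pi\<^sup>2) * Q powr (real (Suc n) / 2) * ln Q\<bar>
      \<le> K * Q powr (real (Suc n) / 2)" if Q: "Q \<ge> 9" for Q
  proof -
    obtain N where N: "Q \<le> real N" "real N \<le> B * Q"
      "\<bar>real (card (sal_points n Q)) - w_const n * (sqrt Q + 1 / sqrt Q) ^ Suc n * (\<Sum>d\<in>sqfree_upto N. 1 / sqrt (real d) ^ odd_codim n)\<bar>
        \<le> C * (sqrt Q + 1 / sqrt Q) ^ n * (\<Sum>d\<in>sqfree_upto N. 1 / sqrt (real d) ^ (odd_codim n - 1))"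
      using est[OF Q] by blast
    define r where "r = sqrt Q"
    have r: "r \<ge> 3" using sqrt_add_inverse_bounds(1)[OF Q] by (simp add: r_def)
    have r2: "r * r = Q" using Q by (simp add: r_def)
    have "real N \<ge> 1" using N(1) Q by linarith
    then have N1: "N \<ge> 1" by simp
    define S where "S = (\<Sum>d\<in>sqfree_upto N. 1 / real d)"
    define E where "E = (\<Sum>d\<in>sqfree_upto N. 1 / sqrt (real d))"
    have Seq: "(\<Sum>d\<in>sqfree_upto N. 1 / sqrt (real d) ^ odd_codim n) = S" unfolding oc S_def by simp
    have Eeq: "(\<Sum>d\<in>sqfree_upto N. 1 / sqrt (real d) ^ (odd_codim n - 1)) = E" unfolding oc E_def by simp
    have E0: "E \<ge> 0" unfolding E_def by (intro sum_nonneg) auto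
    have "E \<le> (\<Sum>k=1..N. 1 / sqrt (real k))"
      unfolding E_def by (intro sum_mono2) (auto simp: sqfree_upto_def)
    also have "\<dots> \<le> 2 * sqrt (real N)" by (rule sum_inverse_sqrt_le)
    also have "\<dots> \<le> 2 * sqrt (B * Q)" using N(2) by simp
    also have "\<dots> = 2 * sqrt B * r" by (simp add: real_sqrt_mult r_def)
    finally have E: "E \<le> 2 * sqrt B * r" .
    note lnN = ln_le_of_real_bounds[OF Q N(1,2) C(2)]
    have "S - a * ln Q = (S - a * ln (real N)) + a * (ln (real N) - ln Q)" by (simp add: algebra_simps)
    moreover have "\<bar>S - a * ln (real N)\<bar> \<le> C1" using C1(2)[OF N1] by (simp add: S_def a_def)
    moreover have "0 \<le> a * (ln (real N) - ln Q)" "a * (ln (real N) - ln Q) \<le> a * ln B"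
      using lnN a0 by (simp_all add: mult_left_mono del: ln_le_cancel_iff diff_ge_0_iff_ge)
    ultimately have S: "\<bar>S - a * ln Q\<bar> \<le> e" unfolding e_def by linarith
    have "\<bar>real (card (sal_points n Q)) - w_const n * (a * ln Q) * r ^ Suc n\<bar> \<le>
      C * (2 ^ n * r ^ n) * E + w_const n * (2 ^ Suc n * r ^ Suc n * e + real (Suc n) * 2 ^ n * (r ^ n / r) * \<bar>a * ln Q\<bar>)"
      unfolding r_def by (rule power_mult_approx[OF Q S w_const_nonneg N(3)[unfolded Seq Eeq] C(1) E0])
    also have "\<dots> \<le> C * (2 ^ n * r ^ n) * (2 * sqrt B * r) + w_const n * (2 ^ Suc n * r ^ Suc n * e + real (Suc n) * 2 ^ n * (a * r ^ Suc n))"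
    proof -
      \<comment> \<open>Replacing X by sqrt Q gains a factor 1/Q, which absorbs the
        logarithm.\<close>
      have "ln Q \<le> r * r" using ln_le_minus_one[of Q] Q r2 by simp
      then have "\<bar>a * ln Q\<bar> \<le> a * (r * r)" using ln_ge_1[OF Q] a0 by (simp add: abs_mult mult_left_mono)
      then have "(r ^ n / r) * \<bar>a * ln Q\<bar> \<le> (r ^ n / r) * (a * (r * r))" using r by (intro mult_left_mono) auto
      also have "\<dots> = a * r ^ Suc n" using r by simp
      finally have "real (Suc n) * 2 ^ n * ((r ^ n / r) * \<bar>a * ln Q\<bar>) \<le> real (Suc n) * 2 ^ n * (a * r ^ Suc n)"
        by (intro mult_left_mono) auto
      then have "w_const n * (2 ^ Suc n * r ^ Suc n * e + real (Suc n) * 2 ^ n * (r ^ n / r) * \<bar>a * ln Q\<bar>)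
          \<le> w_const n * (2 ^ Suc n * r ^ Suc n * e + real (Suc n) * 2 ^ n * (a * r ^ Suc n))"
        using w_const_nonneg by (intro mult_left_mono) (simp_all only: mult.assoc add_left_mono)
      moreover have "C * (2 ^ n * r ^ n) * E \<le> C * (2 ^ n * r ^ n) * (2 * sqrt B * r)"
        using E C(1) r by (intro mult_left_mono) auto
      ultimately show ?thesis by linarith
    qed
    also have "\<dots> = K * r ^ Suc n" by (simp add: K_def algebra_simps)
    finally have "\<bar>real (card (sal_points n Q)) - w_const n * (a * ln Q) * r ^ Suc n\<bar> \<le> K * r ^ Suc n" .
    moreover have "Q powr (real (Suc n) / 2) = r ^ Suc n" unfolding r_def using Q by (intro powr_half_nat) simp
    moreover have "w_const n * (a * ln Q) * r ^ Suc n = w_const n * (6 / pi\<^sup>2) * r ^ Suc n * ln Q"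
      unfolding a_def by (simp only: mult_ac)
    ultimately show ?thesis by (simp only:)
  qed
  moreover have "K \<ge> 0" unfolding K_def e_def using C(1,2) C1(1) a0 lB w_const_nonneg
    by (intro add_nonneg_nonneg mult_nonneg_nonneg) auto
  ultimately show ?thesis using that fin by blast
qed

text \<open>At least three coordinates carry sqrt d, so s \<ge> 3/2: the main series converges, and
  its tail O(N^(1-s)) is O(1/sqrt Q). The errors are dominated by the harmonic sum up to N, the
  source of the logarithm in the error term.\<close>

lemma card_sal_points_large:
  assumes n: "n \<ge> 4" and s: "s = real (odd_codim n) / 2"
  obtains C where "\<And>Q. Q \<ge> 9 \<Longrightarrow> finite (sal_points n Q)" "C \<ge> 0"
    "\<And>Q. Q \<ge> 9 \<Longrightarrow> \<bar>real (card (sal_points n Q)) - w_const n * (zeta s / zeta (2 * s)) * Q powr (real (Suc n) / 2)\<bar>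
      \<le> C * (Q powr (real n / 2) * ln Q)"
proof -
  have n0: "n > 0" and oc: "odd_codim n \<ge> 3" using n by (auto simp: odd_codim_def)
  have s32: "s \<ge> 3 / 2" using oc unfolding s by simp
  obtain C B where C: "C \<ge> 0" "B \<ge> 1" and fin: "\<And>Q. Q \<ge> 9 \<Longrightarrow> finite (sal_points n Q)"
    and est: "\<And>Q. Q \<ge> 9 \<Longrightarrow> \<exists>N. Q \<le> real N \<and> real N \<le> B * Q \<and>
      \<bar>real (card (sal_points n Q)) - w_const n * (sqrt Q + 1 / sqrt Q) ^ Suc n * (\<Sum>d\<in>sqfree_upto N. 1 / sqrt (real d) ^ odd_codim n)\<bar>
        \<le> C * (sqrt Q + 1 / sqrt Q) ^ n * (\<Sum>d\<in>sqfree_upto N. 1 / sqrt (real d) ^ (odd_codim n - 1))"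
    by (rule sal_points_estimate[OF n0]) blast
  define a where "a = zeta s / zeta (2 * s)"
  have lB: "ln B \<ge> 0" using C(2) by simp
  define K where "K = C * 2 ^ n * (2 + ln B) + w_const n * (2 ^ Suc n * 2 + real (Suc n) * 2 ^ n * \<bar>a\<bar>)"
  have "\<bar>real (card (sal_points n Q)) - w_const n * (zeta s / zeta (2 * s)) * Q powr (real (Suc n) / 2)\<bar>
      \<le> K * (Q powr (real n / 2) * ln Q)" if Q: "Q \<ge> 9" for Q
  proof -
    obtain N where N: "Q \<le> real N" "real N \<le> B * Q"
      "\<bar>real (card (sal_points n Q)) - w_const n * (sqrt Q + 1 / sqrt Q) ^ Suc n * (\<Sum>d\<in>sqfree_upto N. 1 / sqrt (real d) ^ odd_codim n)\<bar>
        \<le> C * (sqrt Q + 1 / sqrt Q) ^ n * (\<Sum>d\<in>sqfree_upto N. 1 / sqrt (real d) ^ (odd_codim n - 1))"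
      using est[OF Q] by blast
    define r where "r = sqrt Q"
    have r: "r \<ge> 3" using sqrt_add_inverse_bounds(1)[OF Q] by (simp add: r_def)
    have "real N \<ge> 1" using N(1) Q by linarith
    then have N1: "N \<ge> 1" by simp
    define S where "S = (\<Sum>d\<in>sqfree_upto N. real d powr - s)"
    define E where "E = (\<Sum>d\<in>sqfree_upto N. 1 / sqrt (real d) ^ (odd_codim n - 1))"
    have Seq: "(\<Sum>d\<in>sqfree_upto N. 1 / sqrt (real d) ^ odd_codim n) = S"
      unfolding S_def
    proof (rule sum.cong[OF refl])
      fix d assume "d \<in> sqfree_upto N"
      then have "real d > 0" by (simp add: sqfree_upto_def)
      then have "real d powr s = sqrt (real d) ^ odd_codim n" unfolding s by (rule powr_half_nat)
      then show "1 / sqrt (real d) ^ odd_codim n = real d powr - s" by (simp add: powr_minus inverse_eq_divide)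
    qed
    have E0: "E \<ge> 0" unfolding E_def by (intro sum_nonneg) auto
    have "E \<le> (\<Sum>d\<in>sqfree_upto N. 1 / real d)"
      unfolding E_def
    proof (rule sum_mono)
      fix d assume "d \<in> sqfree_upto N"
      then have d: "d \<ge> 1" by (simp add: sqfree_upto_def)
      have "sqrt (real d) ^ 2 \<le> sqrt (real d) ^ (odd_codim n - 1)" using d oc by (intro power_increasing) auto
      then have "real d \<le> sqrt (real d) ^ (odd_codim n - 1)" by simp
      then show "1 / sqrt (real d) ^ (odd_codim n - 1) \<le> 1 / real d" using d by (intro divide_left_mono) auto
    qed
    also have "\<dots> \<le> (\<Sum>k=1..N. 1 / real k)" by (intro sum_mono2) (auto simp: sqfree_upto_def)
    also have "\<dots> = harm N" by (simp add: harm_def inverse_eq_divide)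
    also have "\<dots> \<le> ln (real N) + 1" using N1 by (rule harm_le_ln)
    also have "\<dots> \<le> ln Q + ln B + 1" using ln_le_of_real_bounds(2)[OF Q N(1,2) C(2)] by simp
    also have "\<dots> \<le> (2 + ln B) * ln Q"
    proof -
      have "ln B * 1 \<le> ln B * ln Q" using lB ln_ge_1[OF Q] by (intro mult_left_mono) auto
      then show ?thesis using ln_ge_1[OF Q] by (simp add: distrib_right)
    qed
    finally have E: "E \<le> (2 + ln B) * ln Q" .
    have "\<bar>S - a\<bar> \<le> real N powr (1 - s) / (s - 1)" unfolding S_def a_def using s32 N1 by (intro sum_sqfree_powr) auto
    also have "\<dots> \<le> (1 / r) / (1 / 2)"
    proof (rule frac_le)
      have "real N powr (1 - s) \<le> real N powr (- (1 / 2))" using s32 \<open>real N \<ge> 1\<close> by (intro powr_mono) auto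
      also have "\<dots> \<le> Q powr (- (1 / 2))" using N(1) Q by (intro powr_mono2') auto
      also have "\<dots> = 1 / r" using Q by (simp add: powr_minus powr_half_sqrt r_def inverse_eq_divide)
      finally show "real N powr (1 - s) \<le> 1 / r" .
    qed (use s32 r in auto)
    finally have S: "\<bar>S - a\<bar> \<le> 2 / r" by simp
    have "\<bar>real (card (sal_points n Q)) - w_const n * a * r ^ Suc n\<bar> \<le>
      C * (2 ^ n * r ^ n) * E + w_const n * (2 ^ Suc n * r ^ Suc n * (2 / r) + real (Suc n) * 2 ^ n * (r ^ n / r) * \<bar>a\<bar>)"
      unfolding r_def by (rule power_mult_approx[OF Q S[unfolded r_def] w_const_nonneg N(3)[unfolded Seq E_def[symmetric]] C(1) E0])
    also have "\<dots> \<le> C * (2 ^ n * r ^ n) * ((2 + ln B) * ln Q) + w_const n * (2 ^ Suc n * 2 + real (Suc n) * 2 ^ n * \<bar>a\<bar>) * (r ^ n * ln Q)"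
    proof -
      have l1: "r ^ n * 1 \<le> r ^ n * ln Q" using ln_ge_1[OF Q] r by (intro mult_left_mono) auto
      have "r ^ n / r \<le> r ^ n / 1" using r by (intro divide_left_mono) auto
      then have l2: "r ^ n / r \<le> r ^ n * ln Q" using l1 by simp
      have "real (Suc n) * 2 ^ n * (r ^ n / r) * \<bar>a\<bar> \<le> real (Suc n) * 2 ^ n * (r ^ n * ln Q) * \<bar>a\<bar>"
        using l2 by (intro mult_right_mono mult_left_mono) auto
      moreover have "2 ^ Suc n * r ^ Suc n * (2 / r) = 2 ^ Suc n * 2 * (r ^ n * 1)" using r by simp
      moreover have "2 ^ Suc n * 2 * (r ^ n * 1) \<le> 2 ^ Suc n * 2 * (r ^ n * ln Q)" by (rule mult_left_mono[OF l1]) simp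
      ultimately have "2 ^ Suc n * r ^ Suc n * (2 / r) + real (Suc n) * 2 ^ n * (r ^ n / r) * \<bar>a\<bar>
          \<le> (2 ^ Suc n * 2 + real (Suc n) * 2 ^ n * \<bar>a\<bar>) * (r ^ n * ln Q)"
        unfolding distrib_right by (simp only: mult_ac add_mono)
      then have "w_const n * (2 ^ Suc n * r ^ Suc n * (2 / r) + real (Suc n) * 2 ^ n * (r ^ n / r) * \<bar>a\<bar>)
          \<le> w_const n * ((2 ^ Suc n * 2 + real (Suc n) * 2 ^ n * \<bar>a\<bar>) * (r ^ n * ln Q))"
        using w_const_nonneg by (rule mult_left_mono)
      moreover have "C * (2 ^ n * r ^ n) * E \<le> C * (2 ^ n * r ^ n) * ((2 + ln B) * ln Q)"
        using E C(1) r by (intro mult_left_mono) auto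
      ultimately show ?thesis unfolding mult.assoc[of "w_const n"] by linarith
    qed
    also have "\<dots> = K * (r ^ n * ln Q)" by (simp add: K_def algebra_simps)
    finally have "\<bar>real (card (sal_points n Q)) - w_const n * a * r ^ Suc n\<bar> \<le> K * (r ^ n * ln Q)" .
    moreover have "Q powr (real (Suc n) / 2) = r ^ Suc n" "Q powr (real n / 2) = r ^ n"
      unfolding r_def using Q by (intro powr_half_nat; simp)+
    ultimately show ?thesis unfolding a_def by (simp only:)
  qed
  moreover have "K \<ge> 0" unfolding K_def using C(1) lB w_const_nonneg
    by (intro add_nonneg_nonneg mult_nonneg_nonneg) auto
  ultimately show ?thesis using that fin by blast
qed

lemma card_Sal_sq_le:
  assumes "Q > 1" "finite (sal_points n Q)"
  shows "card (Sal_sq (Suc n) Q) \<le> card (sal_points n Q)"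
  unfolding Sal_sq_eq_image[OF assms(1)] using assms(2) by (rule card_image_le)

lemma card_Sal_sq_eq:
  assumes "Q > 1" "even n"
  shows "card (Sal_sq (Suc n) Q) = card (sal_points n Q)"
  unfolding Sal_sq_eq_image[OF assms(1)] by (rule card_image[OF inj_on_salem_value[OF assms(2)]])

lemma card_Sal_sq_ge:
  assumes "Q > 1" "finite (sal_points n Q)"
  shows "card (sal_points n Q) \<le> 2 ^ (2 * Suc n) * card (Sal_sq (Suc n) Q)"
proof -
  let ?F = "\<lambda>l. {c \<in> sal_points n Q. salem_value n c = l}"
  have fib: "card (?F l) \<le> 2 ^ (2 * Suc n)" for l
  proof (rule good_points_fibre_card)
    show "finite (?F l)" using assms(2) by simp
    show "\<exists>d. c \<in> good_points n (sqrt Q + 1 / sqrt Q) d \<and> salem_value n c = l" if "c \<in> ?F l" for c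
      using that unfolding sal_points_def by blast
  qed
  have fS: "finite (Sal_sq (Suc n) Q)" unfolding Sal_sq_eq_image[OF assms(1)] using assms(2) by simp
  have "sal_points n Q = (\<Union>l\<in>Sal_sq (Suc n) Q. ?F l)" unfolding Sal_sq_eq_image[OF assms(1)] by blast
  then have "card (sal_points n Q) = card (\<Union>l\<in>Sal_sq (Suc n) Q. ?F l)" by (rule arg_cong)
  also have "\<dots> \<le> (\<Sum>l\<in>Sal_sq (Suc n) Q. card (?F l))" by (rule card_UN_le[OF fS])
  also have "\<dots> \<le> of_nat (card (Sal_sq (Suc n) Q)) * 2 ^ (2 * Suc n)" by (rule sum_bounded_above[OF fib])
  finally show ?thesis by (simp add: mult.commute)
qed

text \<open>The error function must satisfy its relation for all Q > 1, whereas the estimates begin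
  at 9. The difference itself is taken; its order is decided by large Q alone.\<close>

lemma error_term_eq:
  fixes f a g :: "real \<Rightarrow> real"
  assumes "\<And>Q. Q \<ge> 9 \<Longrightarrow> \<bar>f Q - a Q\<bar> \<le> C * g Q" "C \<ge> 0"
  shows "\<exists>h\<in>O[at_top](g). \<forall>Q>1. f Q = a Q + h Q"
proof (rule bexI[where x = "\<lambda>Q. f Q - a Q"])
  have "\<bar>f Q - a Q\<bar> \<le> C * \<bar>g Q\<bar>" if "Q \<ge> 9" for Q
    using assms(1)[OF that] mult_left_mono[OF abs_ge_self[of "g Q"] assms(2)] by linarith
  then show "(\<lambda>Q. f Q - a Q) \<in> O[at_top](g)"
    by (intro bigoI[of _ C] eventually_mono[OF eventually_ge_at_top[of 9]]) simp
qed simp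

lemma error_term_le:
  fixes f a g :: "real \<Rightarrow> real"
  assumes "\<And>Q. Q \<ge> 9 \<Longrightarrow> f Q \<le> a Q + C * g Q" "C \<ge> 0"
  shows "\<exists>h\<in>O[at_top](g). \<forall>Q>1. f Q \<le> a Q + h Q"
proof (rule bexI[where x = "\<lambda>Q. max 0 (f Q - a Q)"])
  have "\<bar>max 0 (f Q - a Q)\<bar> \<le> C * \<bar>g Q\<bar>" if "Q \<ge> 9" for Q
    using assms(1)[OF that] mult_left_mono[OF abs_ge_self[of "g Q"] assms(2)]
      mult_nonneg_nonneg[OF assms(2) abs_ge_zero[of "g Q"]] by linarith
  then show "(\<lambda>Q. max 0 (f Q - a Q)) \<in> O[at_top](g)"
    by (intro bigoI[of _ C] eventually_mono[OF eventually_ge_at_top[of 9]]) simp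
qed auto

lemma error_term_ge:
  fixes f a g :: "real \<Rightarrow> real"
  assumes "\<And>Q. Q \<ge> 9 \<Longrightarrow> a Q \<le> f Q + C * g Q" "C \<ge> 0"
  shows "\<exists>h\<in>O[at_top](g). \<forall>Q>1. f Q \<ge> a Q + h Q"
proof (rule bexI[where x = "\<lambda>Q. min 0 (f Q - a Q)"])
  have "\<bar>min 0 (f Q - a Q)\<bar> \<le> C * \<bar>g Q\<bar>" if "Q \<ge> 9" for Q
    using assms(1)[OF that] mult_left_mono[OF abs_ge_self[of "g Q"] assms(2)]
      mult_nonneg_nonneg[OF assms(2) abs_ge_zero[of "g Q"]] by linarith
  then show "(\<lambda>Q. min 0 (f Q - a Q)) \<in> O[at_top](g)"
    by (intro bigoI[of _ C] eventually_mono[OF eventually_ge_at_top[of 9]]) simp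
qed auto

text \<open>For odd m vectors and numbers correspond bijectively. In general each number comes from
  at least one and at most 2^(2m) vectors, which gives the two one-sided estimates.\<close>

lemma Sal_sq_asymptotics:
  fixes a g :: "real \<Rightarrow> real"
  assumes fin: "\<And>Q. Q \<ge> 9 \<Longrightarrow> finite (sal_points n Q)" and C: "C \<ge> 0" and m: "m = Suc n"
    and est: "\<And>Q. Q \<ge> 9 \<Longrightarrow> \<bar>real (card (sal_points n Q)) - a Q\<bar> \<le> C * g Q"
  shows "odd m \<Longrightarrow> \<exists>h\<in>O[at_top](g). \<forall>Q>1. real (card (Sal_sq m Q)) = a Q + h Q"
    and "\<exists>h\<in>O[at_top](g). \<forall>Q>1. real (card (Sal_sq m Q)) \<le> a Q + h Q"
    and "\<exists>h\<in>O[at_top](g). \<forall>Q>1. real (card (Sal_sq m Q)) \<ge> 1 / 2 ^ (2 * m) * a Q + h Q"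
proof -
  show "\<exists>h\<in>O[at_top](g). \<forall>Q>1. real (card (Sal_sq m Q)) = a Q + h Q" if "odd m"
  proof (rule error_term_eq[OF _ C])
    fix Q :: real assume Q: "Q \<ge> 9"
    have "card (Sal_sq m Q) = card (sal_points n Q)" unfolding m using Q that m by (intro card_Sal_sq_eq) auto
    then show "\<bar>real (card (Sal_sq m Q)) - a Q\<bar> \<le> C * g Q" using est[OF Q] by simp
  qed
  show "\<exists>h\<in>O[at_top](g). \<forall>Q>1. real (card (Sal_sq m Q)) \<le> a Q + h Q"
  proof (rule error_term_le[OF _ C])
    fix Q :: real assume Q: "Q \<ge> 9"
    have "card (Sal_sq m Q) \<le> card (sal_points n Q)" unfolding m using Q by (intro card_Sal_sq_le fin) auto
    then have "real (card (Sal_sq m Q)) \<le> real (card (sal_points n Q))" by simp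
    then show "real (card (Sal_sq m Q)) \<le> a Q + C * g Q" using est[OF Q] by linarith
  qed
  show "\<exists>h\<in>O[at_top](g). \<forall>Q>1. real (card (Sal_sq m Q)) \<ge> 1 / 2 ^ (2 * m) * a Q + h Q"
  proof (rule error_term_ge[OF _ C])
    fix Q :: real assume Q: "Q \<ge> 9"
    have "card (sal_points n Q) \<le> 2 ^ (2 * m) * card (Sal_sq m Q)"
      unfolding m using Q by (intro card_Sal_sq_ge fin) auto
    then have "real (card (sal_points n Q)) \<le> real (2 ^ (2 * m) * card (Sal_sq m Q))" by (simp only: of_nat_le_iff)
    then have "a Q \<le> 2 ^ (2 * m) * real (card (Sal_sq m Q)) + C * g Q" using est[OF Q] by simp
    then have "1 / 2 ^ (2 * m) * a Q \<le> 1 / 2 ^ (2 * m) * (2 ^ (2 * m) * real (card (Sal_sq m Q)) + C * g Q)"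
      by (intro mult_left_mono) auto
    also have "\<dots> = real (card (Sal_sq m Q)) + 1 / 2 ^ (2 * m) * (C * g Q)" unfolding distrib_left by simp
    also have "1 / 2 ^ (2 * m) * (C * g Q) \<le> 1 * (C * g Q)"
    proof (rule mult_right_mono)
      show "0 \<le> C * g Q" using est[OF Q] by linarith
      show "(1::real) / 2 ^ (2 * m) \<le> 1" by (simp add: divide_le_eq_1)
    qed
    finally show "1 / 2 ^ (2 * m) * a Q \<le> real (card (Sal_sq m Q)) + C * g Q" by simp
  qed
qed

lemma Sal_sq_asymptotics_small:
  assumes m: "m = 3 \<or> m = 4"
  shows "odd m \<Longrightarrow> \<exists>h\<in>O[at_top](\<lambda>Q::real. Q powr (real m / 2)). \<forall>Q>1.
      real (card (Sal_sq m Q)) = w_const (m - 1) * (6 / pi\<^sup>2) * Q powr (real m / 2) * ln Q + h Q"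
    and "\<exists>h\<in>O[at_top](\<lambda>Q::real. Q powr (real m / 2)). \<forall>Q>1.
      real (card (Sal_sq m Q)) \<le> w_const (m - 1) * (6 / pi\<^sup>2) * Q powr (real m / 2) * ln Q + h Q"
    and "\<exists>h\<in>O[at_top](\<lambda>Q::real. Q powr (real m / 2)). \<forall>Q>1.
      real (card (Sal_sq m Q)) \<ge> 1 / 2 ^ (2 * m) * w_const (m - 1) * (6 / pi\<^sup>2) * Q powr (real m / 2) * ln Q + h Q"
proof -
  define n where "n = m - 1"
  have n: "n = 2 \<or> n = 3" and mn: "m = Suc n" using m by (auto simp: n_def)
  obtain C where C: "\<And>Q. Q \<ge> 9 \<Longrightarrow> finite (sal_points n Q)" "C \<ge> 0"
    "\<And>Q. Q \<ge> 9 \<Longrightarrow> \<bar>real (card (sal_points n Q)) - w_const n * (6 / pi\<^sup>2) * Q powr (real (Suc n) / 2) * ln Q\<bar>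
      \<le> C * Q powr (real (Suc n) / 2)"
    by (rule card_sal_points_small[OF n]) blast
  note A = Sal_sq_asymptotics[OF C(1,2) mn C(3), folded mn, unfolded n_def, folded mult.assoc]
  show "odd m \<Longrightarrow> \<exists>h\<in>O[at_top](\<lambda>Q::real. Q powr (real m / 2)). \<forall>Q>1.
      real (card (Sal_sq m Q)) = w_const (m - 1) * (6 / pi\<^sup>2) * Q powr (real m / 2) * ln Q + h Q"
    by (rule A(1))
  show "\<exists>h\<in>O[at_top](\<lambda>Q::real. Q powr (real m / 2)). \<forall>Q>1.
      real (card (Sal_sq m Q)) \<le> w_const (m - 1) * (6 / pi\<^sup>2) * Q powr (real m / 2) * ln Q + h Q"
    by (rule A(2))
  show "\<exists>h\<in>O[at_top](\<lambda>Q::real. Q powr (real m / 2)). \<forall>Q>1.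
      real (card (Sal_sq m Q)) \<ge> 1 / 2 ^ (2 * m) * w_const (m - 1) * (6 / pi\<^sup>2) * Q powr (real m / 2) * ln Q + h Q"
    by (rule A(3))
qed

text \<open>The number of coordinates with step sqrt d is (m+1)/2 for odd m and m/2 for even m; s is
  half of it.\<close>

lemma Sal_sq_asymptotics_large:
  assumes m: "m \<ge> 5" and s: "s = (if odd m then (real m + 1) / 4 else real m / 4)" and t: "t = 2 * s"
  shows "odd m \<Longrightarrow> \<exists>h\<in>O[at_top](\<lambda>Q::real. Q powr ((real m - 1) / 2) * ln Q). \<forall>Q>1.
      real (card (Sal_sq m Q)) = w_const (m - 1) * (zeta s / zeta t) * Q powr (real m / 2) + h Q"
    and "\<exists>h\<in>O[at_top](\<lambda>Q::real. Q powr ((real m - 1) / 2) * ln Q). \<forall>Q>1.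
      real (card (Sal_sq m Q)) \<le> w_const (m - 1) * (zeta s / zeta t) * Q powr (real m / 2) + h Q"
    and "\<exists>h\<in>O[at_top](\<lambda>Q::real. Q powr ((real m - 1) / 2) * ln Q). \<forall>Q>1.
      real (card (Sal_sq m Q)) \<ge> 1 / 2 ^ (2 * m) * w_const (m - 1) * (zeta s / zeta t) * Q powr (real m / 2) + h Q"
proof -
  define n where "n = m - 1"
  have n: "n \<ge> 4" and mn: "m = Suc n" using m by (auto simp: n_def)
  have rn: "real n = real m - 1" unfolding mn by simp
  have sn: "s = real (odd_codim n) / 2"
  proof (cases "even n")
    case True
    then obtain k where "n = 2 * k" by (rule evenE)
    then show ?thesis using s mn by (simp add: odd_codim_def)
  next
    case False
    then obtain k where "n = 2 * k + 1" by (rule oddE)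
    then show ?thesis using s mn by (simp add: odd_codim_def)
  qed
  obtain C where C: "\<And>Q. Q \<ge> 9 \<Longrightarrow> finite (sal_points n Q)" "C \<ge> 0"
    "\<And>Q. Q \<ge> 9 \<Longrightarrow> \<bar>real (card (sal_points n Q)) - w_const n * (zeta s / zeta (2 * s)) * Q powr (real (Suc n) / 2)\<bar>
      \<le> C * (Q powr (real n / 2) * ln Q)"
    by (rule card_sal_points_large[OF n sn]) blast
  note A = Sal_sq_asymptotics[OF C(1,2) mn C(3), folded mn t, unfolded rn, unfolded n_def, folded mult.assoc]
  show "odd m \<Longrightarrow> \<exists>h\<in>O[at_top](\<lambda>Q::real. Q powr ((real m - 1) / 2) * ln Q). \<forall>Q>1.
      real (card (Sal_sq m Q)) = w_const (m - 1) * (zeta s / zeta t) * Q powr (real m / 2) + h Q"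
    by (rule A(1))
  show "\<exists>h\<in>O[at_top](\<lambda>Q::real. Q powr ((real m - 1) / 2) * ln Q). \<forall>Q>1.
      real (card (Sal_sq m Q)) \<le> w_const (m - 1) * (zeta s / zeta t) * Q powr (real m / 2) + h Q"
    by (rule A(2))
  show "\<exists>h\<in>O[at_top](\<lambda>Q::real. Q powr ((real m - 1) / 2) * ln Q). \<forall>Q>1.
      real (card (Sal_sq m Q)) \<ge> 1 / 2 ^ (2 * m) * w_const (m - 1) * (zeta s / zeta t) * Q powr (real m / 2) + h Q"
    by (rule A(3))
qed

theorem theorem1p7:
  fixes m :: nat
  assumes "m \<ge> 3"
  shows
    "(m = 3 \<longrightarrow>
        (\<exists>h \<in> O[at_top](\<lambda>Q::real. Q powr (real m / 2)). \<forall>Q>1.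
           real (card (Sal_sq m Q)) = w_const (m - 1) * (6 / pi\<^sup>2) * Q powr (real m / 2) * ln Q + h Q))
     \<and>
     (m = 4 \<longrightarrow>
        (\<exists>h \<in> O[at_top](\<lambda>Q::real. Q powr (real m / 2)). \<forall>Q>1.
           real (card (Sal_sq m Q)) \<ge>
             1 / 2 ^ (2 * m) * w_const (m - 1) * (6 / pi\<^sup>2) * Q powr (real m / 2) * ln Q + h Q) \<and>
        (\<exists>h \<in> O[at_top](\<lambda>Q::real. Q powr (real m / 2)). \<forall>Q>1.
           real (card (Sal_sq m Q)) \<le> w_const (m - 1) * (6 / pi\<^sup>2) * Q powr (real m / 2) * ln Q + h Q))
     \<and>
     (m \<ge> 5 \<and> odd m \<longrightarrow>
        (\<exists>h \<in> O[at_top](\<lambda>Q::real. Q powr ((real m - 1) / 2) * ln Q). \<forall>Q>1.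
           real (card (Sal_sq m Q)) =
             w_const (m - 1) * (zeta ((real m + 1) / 4) / zeta ((real m + 1) / 2)) * Q powr (real m / 2) + h Q))
     \<and>
     (m \<ge> 5 \<and> even m \<longrightarrow>
        (\<exists>h \<in> O[at_top](\<lambda>Q::real. Q powr ((real m - 1) / 2) * ln Q). \<forall>Q>1.
           real (card (Sal_sq m Q)) \<ge>
             1 / 2 ^ (2 * m) * w_const (m - 1) * (zeta (real m / 4) / zeta (real m / 2)) * Q powr (real m / 2) + h Q) \<and>
        (\<exists>h \<in> O[at_top](\<lambda>Q::real. Q powr ((real m - 1) / 2) * ln Q). \<forall>Q>1.
           real (card (Sal_sq m Q)) \<le>
             w_const (m - 1) * (zeta (real m / 4) / zeta (real m / 2)) * Q powr (real m / 2) + h Q))"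
proof (intro conjI impI)
  assume m: "m = 3"
  show "\<exists>h \<in> O[at_top](\<lambda>Q::real. Q powr (real m / 2)). \<forall>Q>1.
      real (card (Sal_sq m Q)) = w_const (m - 1) * (6 / pi\<^sup>2) * Q powr (real m / 2) * ln Q + h Q"
    using m by (intro Sal_sq_asymptotics_small(1)) simp_all
next
  assume m: "m = 4"
  show "\<exists>h \<in> O[at_top](\<lambda>Q::real. Q powr (real m / 2)). \<forall>Q>1.
      real (card (Sal_sq m Q)) \<ge> 1 / 2 ^ (2 * m) * w_const (m - 1) * (6 / pi\<^sup>2) * Q powr (real m / 2) * ln Q + h Q"
    using m by (intro Sal_sq_asymptotics_small(3)) simp
next
  assume m: "m = 4"
  show "\<exists>h \<in> O[at_top](\<lambda>Q::real. Q powr (real m / 2)). \<forall>Q>1.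
      real (card (Sal_sq m Q)) \<le> w_const (m - 1) * (6 / pi\<^sup>2) * Q powr (real m / 2) * ln Q + h Q"
    using m by (intro Sal_sq_asymptotics_small(2)) simp
next
  assume m: "5 \<le> m \<and> odd m"
  show "\<exists>h \<in> O[at_top](\<lambda>Q::real. Q powr ((real m - 1) / 2) * ln Q). \<forall>Q>1.
      real (card (Sal_sq m Q)) =
        w_const (m - 1) * (zeta ((real m + 1) / 4) / zeta ((real m + 1) / 2)) * Q powr (real m / 2) + h Q"
    using m by (intro Sal_sq_asymptotics_large(1)) simp_all
next
  assume m: "5 \<le> m \<and> even m"
  show "\<exists>h \<in> O[at_top](\<lambda>Q::real. Q powr ((real m - 1) / 2) * ln Q). \<forall>Q>1.
      real (card (Sal_sq m Q)) \<ge>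
        1 / 2 ^ (2 * m) * w_const (m - 1) * (zeta (real m / 4) / zeta (real m / 2)) * Q powr (real m / 2) + h Q"
    using m by (intro Sal_sq_asymptotics_large(3)) simp_all
next
  assume m: "5 \<le> m \<and> even m"
  show "\<exists>h \<in> O[at_top](\<lambda>Q::real. Q powr ((real m - 1) / 2) * ln Q). \<forall>Q>1.
      real (card (Sal_sq m Q)) \<le>
        w_const (m - 1) * (zeta (real m / 4) / zeta (real m / 2)) * Q powr (real m / 2) + h Q"
    using m by (intro Sal_sq_asymptotics_large(2)) simp_all
qed

end
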